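(* Let $\Gamma\subset\mathbb{R}^n$ be a disjoint IFS attractor with $n-1<d=\dim_{\mathrm H}(\Gamma)<n$, and suppose that $-1<t_1<t_2<1$. Then, for some constant $c>0$ independent of $h\in(0,\mathrm{diam}(\Gamma)]$ and $\Psi_h$, $$\|\Psi_h\|_{\mathbb{H}^{t_2}(\Gamma)}\le c\,h^{t_1-t_2}\|\Psi_h\|_{\mathbb{H}^{t_1}(\Gamma)},\qquad\Psi_h\in\mathbb{Y}_h.$$ In particular, if $0<t<1$, then, for some constant $c_t>0$ independent of $h$ and $\Psi_h$, $$\|\Psi_h\|_{\mathbb{L}_2(\Gamma)}\le c_t\,h^{-t}\|\Psi_h\|_{\mathbb{H}^{-t}(\Gamma)},\qquad\Psi_h\in\mathbb{Y}_h.$$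
   Context: IFS attractors. Let $M\ge2$ and let $s_1,\dots,s_M:\mathbb{R}^n\to\mathbb{R}^n$ satisfy $|s_m(x)-s_m(y)|=\rho_m|x-y|$ with $\rho_m\in(0,1)$. The attractor is the unique non-empty compact $\Gamma$ with $\Gamma=\bigcup_ms_m(\Gamma)$; it is disjoint if the sets $s_m(\Gamma)$ are pairwise disjoint. Such a $\Gamma$ is a $d$-set, where $d=\dim_{\mathrm H}(\Gamma)$ solves $\sum_m\rho_m^d=1$; a closed set is a $d$-set if $c_1r^d\le\mathcal{H}^d(\Gamma\cap B_r(x))\le c_2r^d$ for all $x\in\Gamma$, $0<r\le1$, some $c_1,c_2>0$ ($\mathcal{H}^d$ Hausdorff measure). Function spaces. $H^s(\mathbb{R}^n)$ has norm $\|\varphi\|^2_{H^s(\mathbb{R}^n)}=\int(1+|\xi|^2)^s|\widehat\varphi(\xi)|^2\,d\xi$ (unitary Fourier transform). $\mathbb{L}_2(\Gamma)$ is the complex $L_2$ space with respect to $\mathcal{H}^d|_\Gamma$. For $s>(n-d)/2$, $t=s-(n-d)/2>0$, $\mathrm{tr}_\Gamma:H^s(\mathbb{R}^n)\to\mathbb{L}_2(\Gamma)$ is the continuous extension of $\varphi\mapsto\varphi|_\Gamma$, $\varphi\in C_0^\infty(\mathbb{R}^n)$; $\mathbb{H}^t(\Gamma):=\mathrm{tr}_\Gamma(H^s(\mathbb{R}^n))$ with norm $\|f\|_{\mathbb{H}^t(\Gamma)}=\inf\{\|\varphi\|_{H^s(\mathbb{R}^n)}:\mathrm{tr}_\Gamma\varphi=f\}$;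 $\mathbb{H}^0(\Gamma)=\mathbb{L}_2(\Gamma)$; $\mathbb{H}^{-t}(\Gamma):=(\mathbb{H}^t(\Gamma))^*$ (antilinear functionals), with $\mathbb{L}_2(\Gamma)$ embedded via $f\mapsto(f,\cdot)_{\mathbb{L}_2(\Gamma)}$. Approximation spaces. $I_{\mathbb{N}}=\bigcup_{\ell\ge1}\{1,\dots,M\}^\ell$; $\Gamma_0=\Gamma$, $\Gamma_{\boldsymbol m}=s_{m_1}\circ\cdots\circ s_{m_\ell}(\Gamma)$; $\boldsymbol m_-=(m_1,\dots,m_{\ell-1})$ if $\ell\ge2$, $\boldsymbol m_-=0$ if $\ell=1$. $\chi_{\boldsymbol m}=\mathcal{H}^d(\Gamma_{\boldsymbol m})^{-1/2}$ on $\Gamma_{\boldsymbol m}$, $0$ elsewhere. For $0<h\le\mathrm{diam}(\Gamma)$: $L_h=\{0\}$ if $h=\mathrm{diam}(\Gamma)$, otherwise $L_h=\{\boldsymbol m\in I_{\mathbb{N}}:\mathrm{diam}(\Gamma_{\boldsymbol m})\le h,\ \mathrm{diam}(\Gamma_{\boldsymbol m_-})>h\}$. $\mathbb{Y}_h=\mathrm{span}\{\chi_{\boldsymbol m}:\boldsymbol m\in L_h\}$. *)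

theory Defs
  imports "HOL-Analysis.Analysis"
begin

section \<open>Hausdorff measure and dimension\<close>

text \<open>The library \<open>diameter\<close> is unspecified on unbounded sets, so coverings use bounded sets.
  The gauge implements \<open>diam(U)^d\<close> with \<open>0^0 = 1\<close> on non-empty sets.  No normalising
  constant is included; a different normalisation only changes the
  constants in the inverse estimates.\<close>

definition hausdorff_gauge :: "real \<Rightarrow> 'a::metric_space set \<Rightarrow> ennreal" where
  "hausdorff_gauge d U =
     (if U = {} then 0 else if d = 0 then 1 else ennreal (diameter U powr d))"

definition hausdorff_content :: "real \<Rightarrow> real \<Rightarrow> 'a::metric_space set \<Rightarrow> ennreal" where
  "hausdorff_content d \<delta> A =
     (INF U\<in>{U :: nat \<Rightarrow> 'a set. A \<subseteq> (\<Union>i. U i) \<and> (\<forall>i. bounded (U i) \<and> diameter (U i) \<le> \<delta>)}.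
        \<Sum>i. hausdorff_gauge d (U i))"

definition hausdorff_outer :: "real \<Rightarrow> 'a::metric_space set \<Rightarrow> ennreal" where
  "hausdorff_outer d A = (SUP \<delta>\<in>{0<..}. hausdorff_content d \<delta> A)"

definition hausdorff_measure :: "real \<Rightarrow> 'a::metric_space measure" where
  "hausdorff_measure d = measure_of UNIV (sets borel) (hausdorff_outer d)"

text \<open>Real-valued, as it is only used for subsets of Euclidean space, where it is finite.\<close>

definition hausdorff_dim :: "'a::metric_space set \<Rightarrow> real" where
  "hausdorff_dim A = Inf {d. 0 \<le> d \<and> hausdorff_outer d A = 0}"


section \<open>Complex \<open>L\<^sub>2\<close> spaces\<close>

text \<open>Elements are represented by functions, not by classes modulo a.e. equality.\<close>

definition L2_space :: "'a measure \<Rightarrow> ('a \<Rightarrow> complex) set" where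
  "L2_space M = {f \<in> borel_measurable M. integrable M (\<lambda>x. (cmod (f x))\<^sup>2)}"

definition L2_norm :: "'a measure \<Rightarrow> ('a \<Rightarrow> complex) \<Rightarrow> real" where
  "L2_norm M f = sqrt (\<integral>x. (cmod (f x))\<^sup>2 \<partial>M)"

definition L2_inner :: "'a measure \<Rightarrow> ('a \<Rightarrow> complex) \<Rightarrow> ('a \<Rightarrow> complex) \<Rightarrow> complex" where
  "L2_inner M f g = (\<integral>x. f x * cnj (g x) \<partial>M)"

definition L2_tendsto :: "'a measure \<Rightarrow> (nat \<Rightarrow> 'a \<Rightarrow> complex) \<Rightarrow> ('a \<Rightarrow> complex) \<Rightarrow> bool" where
  "L2_tendsto M u f \<longleftrightarrow> (\<forall>k. u k \<in> L2_space M) \<and> f \<in> L2_space M \<and>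
     (\<lambda>k. L2_norm M (\<lambda>x. u k x - f x)) \<longlonglongrightarrow> 0"


section \<open>Sobolev spaces on Euclidean space\<close>

definition fourier_L1 :: "('a::euclidean_space \<Rightarrow> complex) \<Rightarrow> 'a \<Rightarrow> complex" where
  "fourier_L1 f \<xi> =
     complex_of_real ((2 * pi) powr (- real DIM('a) / 2)) * (\<integral>x. cis (- (\<xi> \<bullet> x)) * f x \<partial>lborel)"

text \<open>Continuous extension of the Fourier transform from \<open>L\<^sub>1 \<inter> L\<^sub>2\<close> to \<open>L\<^sub>2\<close>; the limit is
  determined up to a null set, which is immaterial for the Sobolev norm.\<close>

definition has_fourier_L2 ::
    "('a::euclidean_space \<Rightarrow> complex) \<Rightarrow> ('a \<Rightarrow> complex) \<Rightarrow> bool" where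
  "has_fourier_L2 f g \<longleftrightarrow> (\<exists>u. (\<forall>k. integrable lborel (u k)) \<and>
     L2_tendsto lborel u f \<and> L2_tendsto lborel (\<lambda>k. fourier_L1 (u k)) g)"

definition fourier_L2 :: "('a::euclidean_space \<Rightarrow> complex) \<Rightarrow> 'a \<Rightarrow> complex" where
  "fourier_L2 f = (SOME g. has_fourier_L2 f g)"

text \<open>The next two are for \<open>s \<ge> 0\<close>, where \<open>H\<^sup>s\<close> is a subspace of \<open>L\<^sub>2\<close>.\<close>

definition sobolev_space :: "real \<Rightarrow> ('a::euclidean_space \<Rightarrow> complex) set" where
  "sobolev_space s = {\<phi> \<in> L2_space lborel.
     integrable lborel (\<lambda>\<xi>. (1 + (norm \<xi>)\<^sup>2) powr s * (cmod (fourier_L2 \<phi> \<xi>))\<^sup>2)}"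

definition sobolev_norm :: "real \<Rightarrow> ('a::euclidean_space \<Rightarrow> complex) \<Rightarrow> real" where
  "sobolev_norm s \<phi> =
     sqrt (\<integral>\<xi>. (1 + (norm \<xi>)\<^sup>2) powr s * (cmod (fourier_L2 \<phi> \<xi>))\<^sup>2 \<partial>lborel)"

primrec C_k :: "nat \<Rightarrow> ('a::euclidean_space \<Rightarrow> complex) \<Rightarrow> bool" where
  "C_k 0 f \<longleftrightarrow> continuous_on UNIV f"
| "C_k (Suc k) f \<longleftrightarrow> f differentiable_on UNIV \<and>
     (\<forall>b\<in>Basis. C_k k (\<lambda>x. frechet_derivative f (at x) b))"

definition test_functions :: "('a::euclidean_space \<Rightarrow> complex) set" where
  "test_functions = {\<phi>. (\<forall>k. C_k k \<phi>) \<and> compact (closure {x. \<phi> x \<noteq> 0})}"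


section \<open>Traces and the spaces on \<open>\<Gamma>\<close>\<close>

text \<open>Throughout, \<open>d\<close> is the dimension of \<open>\<Gamma>\<close>; only the values of functions on \<open>\<Gamma>\<close> matter.\<close>

abbreviation hausdorff_on :: "real \<Rightarrow> 'a::metric_space set \<Rightarrow> 'a measure" where
  "hausdorff_on d \<Gamma> \<equiv> restrict_space (hausdorff_measure d) \<Gamma>"

text \<open>Graph of the continuous extension of \<open>\<phi> \<mapsto> \<phi>|\<^sub>\<Gamma>\<close> from test functions to \<open>H\<^sup>s\<close>,
  with the trace determined up to a null set.\<close>

definition has_trace ::
    "real \<Rightarrow> real \<Rightarrow> 'a::euclidean_space set \<Rightarrow> ('a \<Rightarrow> complex) \<Rightarrow> ('a \<Rightarrow> complex) \<Rightarrow> bool" where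
  "has_trace s d \<Gamma> \<phi> f \<longleftrightarrow> \<phi> \<in> sobolev_space s \<and>
     (\<exists>u. (\<forall>k. u k \<in> test_functions) \<and>
        (\<lambda>k. sobolev_norm s (\<lambda>x. u k x - \<phi> x)) \<longlonglongrightarrow> 0 \<and>
        L2_tendsto (hausdorff_on d \<Gamma>) u f)"

definition trace_order :: "real \<Rightarrow> 'a::euclidean_space set \<Rightarrow> real \<Rightarrow> real" where
  "trace_order d \<Gamma> t = t + (real DIM('a) - d) / 2"

definition trace_space ::
    "real \<Rightarrow> 'a::euclidean_space set \<Rightarrow> real \<Rightarrow> ('a \<Rightarrow> complex) set" where
  "trace_space d \<Gamma> t = {f. \<exists>\<phi>. has_trace (trace_order d \<Gamma> t) d \<Gamma> \<phi> f}"

definition trace_norm ::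
    "real \<Rightarrow> 'a::euclidean_space set \<Rightarrow> real \<Rightarrow> ('a \<Rightarrow> complex) \<Rightarrow> real" where
  "trace_norm d \<Gamma> t f =
     Inf {sobolev_norm (trace_order d \<Gamma> t) \<phi> |\<phi>. has_trace (trace_order d \<Gamma> t) d \<Gamma> \<phi> f}"

text \<open>Bounded antilinear functionals on \<open>trace_space d \<Gamma> t\<close>, and the dual norm.
  Boundedness makes them respect a.e. equality.\<close>

definition dual_space ::
    "real \<Rightarrow> 'a::euclidean_space set \<Rightarrow> real \<Rightarrow> (('a \<Rightarrow> complex) \<Rightarrow> complex) set" where
  "dual_space d \<Gamma> t = {F.
     (\<forall>f\<in>trace_space d \<Gamma> t. \<forall>g\<in>trace_space d \<Gamma> t. F (\<lambda>x. f x + g x) = F f + F g) \<and>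
     (\<forall>a. \<forall>f\<in>trace_space d \<Gamma> t. F (\<lambda>x. a * f x) = cnj a * F f) \<and>
     (\<exists>C. \<forall>f\<in>trace_space d \<Gamma> t. cmod (F f) \<le> C * trace_norm d \<Gamma> t f)}"

definition dual_norm ::
    "real \<Rightarrow> 'a::euclidean_space set \<Rightarrow> real \<Rightarrow> (('a \<Rightarrow> complex) \<Rightarrow> complex) \<Rightarrow> real" where
  "dual_norm d \<Gamma> t F = Sup {cmod (F f) |f. f \<in> trace_space d \<Gamma> t \<and> trace_norm d \<Gamma> t f \<le> 1}"

text \<open>Membership in, and norm of, \<open>\<bbbH>\<^sup>t(\<Gamma>)\<close> for \<open>L\<^sub>2\<close> functions on \<open>\<Gamma>\<close> and any real \<open>t\<close>; for
  \<open>t < 0\<close> the function is identified with the functional \<open>(f, \<cdot>)\<close> on \<open>\<bbbH>\<^sup>-\<^sup>t(\<Gamma>)\<close>.\<close>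

definition in_H :: "real \<Rightarrow> 'a::euclidean_space set \<Rightarrow> real \<Rightarrow> ('a \<Rightarrow> complex) \<Rightarrow> bool" where
  "in_H d \<Gamma> t f \<longleftrightarrow> f \<in> L2_space (hausdorff_on d \<Gamma>) \<and>
     (if t > 0 then f \<in> trace_space d \<Gamma> t
      else t < 0 \<longrightarrow> L2_inner (hausdorff_on d \<Gamma>) f \<in> dual_space d \<Gamma> (- t))"

definition norm_H :: "real \<Rightarrow> 'a::euclidean_space set \<Rightarrow> real \<Rightarrow> ('a \<Rightarrow> complex) \<Rightarrow> real" where
  "norm_H d \<Gamma> t f =
     (if t > 0 then trace_norm d \<Gamma> t f
      else if t = 0 then L2_norm (hausdorff_on d \<Gamma>) f
      else dual_norm d \<Gamma> (- t) (L2_inner (hausdorff_on d \<Gamma>) f))"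


section \<open>Attractors and approximation spaces\<close>

definition contracting_similarities ::
    "nat \<Rightarrow> (nat \<Rightarrow> 'a::metric_space \<Rightarrow> 'a) \<Rightarrow> (nat \<Rightarrow> real) \<Rightarrow> bool" where
  "contracting_similarities M s \<rho> \<longleftrightarrow>
     (\<forall>m\<in>{1..M}. 0 < \<rho> m \<and> \<rho> m < 1 \<and> (\<forall>x y. dist (s m x) (s m y) = \<rho> m * dist x y))"

definition is_attractor ::
    "nat \<Rightarrow> (nat \<Rightarrow> 'a::metric_space \<Rightarrow> 'a) \<Rightarrow> 'a set \<Rightarrow> bool" where
  "is_attractor M s \<Gamma> \<longleftrightarrow> \<Gamma> \<noteq> {} \<and> compact \<Gamma> \<and> \<Gamma> = (\<Union>m\<in>{1..M}. s m ` \<Gamma>)"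

definition disjoint_attractor ::
    "nat \<Rightarrow> (nat \<Rightarrow> 'a::metric_space \<Rightarrow> 'a) \<Rightarrow> 'a set \<Rightarrow> bool" where
  "disjoint_attractor M s \<Gamma> \<longleftrightarrow>
     is_attractor M s \<Gamma> \<and> disjoint_family_on (\<lambda>m. s m ` \<Gamma>) {1..M}"

text \<open>Multi-indices are lists; the empty list plays the role of the index \<open>0\<close>, so that
  \<open>butlast\<close> is the map \<open>m \<mapsto> m\<^sub>-\<close> in all cases.\<close>

definition words :: "nat \<Rightarrow> nat list set" where
  "words M = {w. w \<noteq> [] \<and> set w \<subseteq> {1..M}}"

definition piece :: "(nat \<Rightarrow> 'a \<Rightarrow> 'a) \<Rightarrow> 'a set \<Rightarrow> nat list \<Rightarrow> 'a set" where
  "piece s \<Gamma> w = foldr (\<lambda>m. (`) (s m)) w \<Gamma>"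

definition piece_fun ::
    "real \<Rightarrow> (nat \<Rightarrow> 'a::metric_space \<Rightarrow> 'a) \<Rightarrow> 'a set \<Rightarrow> nat list \<Rightarrow> 'a \<Rightarrow> complex" where
  "piece_fun d s \<Gamma> w x =
     (if x \<in> piece s \<Gamma> w
      then complex_of_real (measure (hausdorff_measure d) (piece s \<Gamma> w) powr (- 1 / 2)) else 0)"

definition mesh_words ::
    "nat \<Rightarrow> (nat \<Rightarrow> 'a::metric_space \<Rightarrow> 'a) \<Rightarrow> 'a set \<Rightarrow> real \<Rightarrow> nat list set" where
  "mesh_words M s \<Gamma> h =
     (if h = diameter \<Gamma> then {[]}
      else {w \<in> words M. diameter (piece s \<Gamma> w) \<le> h \<and> diameter (piece s \<Gamma> (butlast w)) > h})"

text \<open>The complex linear span of the functions \<open>piece_fun d s \<Gamma> w\<close>, \<open>w \<in> mesh_words M s \<Gamma> h\<close>.\<close>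

definition approx_space ::
    "real \<Rightarrow> nat \<Rightarrow> (nat \<Rightarrow> 'a::metric_space \<Rightarrow> 'a) \<Rightarrow> 'a set \<Rightarrow> real \<Rightarrow> ('a \<Rightarrow> complex) set" where
  "approx_space d M s \<Gamma> h =
     {\<lambda>x. \<Sum>w\<in>W. a w * piece_fun d s \<Gamma> w x |W a. finite W \<and> W \<subseteq> mesh_words M s \<Gamma> h}"

end

theory Submission
  imports Defs "HOL-Probability.Probability" "HOL-Library.Sublist" "HOL-Real_Asymp.Real_Asymp"
begin

text \<open>For \<open>t \<ge> 0\<close> the \<open>L\<^sub>2\<close> projection \<open>P\<^sub>h\<close> onto the functions that are constant on the pieces of size \<open>h\<close> has,
  up to constants, two properties.  A function constant on these pieces extends to a sum of disjointly supported bumps,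
  whose Sobolev norm is at most \<open>h powr (- t)\<close> times the \<open>L\<^sub>2\<close> norm.  Conversely the \<open>L\<^sub>2\<close> norm of \<open>f - P\<^sub>h f\<close> is at most
  \<open>h powr t\<close> times the trace norm of \<open>f\<close>: by duality this is a bound for the negative norm of
  \<open>\<psi> d\<mu>\<close>, where \<open>\<psi>\<close> has mean zero on each piece, and this norm is a dyadic sum of Gaussian means of
  its Fourier transform, that is, of Gaussian energies, which the upper Ahlfors bound controls.
  Telescoping \<open>P\<^sub>h f\<close> over the scales \<open>2^k h\<close>, \<open>P\<^sub>h\<close> maps order \<open>t2\<close> to order \<open>t1 > t2\<close> with norm at
  most a constant times \<open>h powr (t2 - t1)\<close>.  On the range of \<open>P\<^sub>h\<close> this is the inverse estimate
  for non-negative orders; since \<open>(\<Psi>, g) = (\<Psi>, P\<^sub>h g)\<close>, the one for negative orders is dual to it.\<close>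


section \<open>Complex L2 spaces\<close>

text \<open>Interpolation theory is avoided throughout. A trace order t in (0, 1) corresponds to the
  Sobolev order t + (n - d)/2, which lies between 0 and 2, so a positive norm is controlled by the
  L2 norms of a function and of its image under 1 - Laplacian, weighted by powers of the mesh size.
  The obstacle is the dual side: \<psi> d\<mu> is a singular measure, to which neither the L2
  Fourier transform nor Plancherel's theorem applies. Gaussian weights make all integrals absolutely
  convergent, and one-sided bounds suffice. The limit t < 1 enters in a dyadic sum: a mean-zero
  density gains h^2/\<tau> in the energy at scale \<tau>, and the sum of 4^(-tj) min(1, h^2 4^j) is
  of order h^(2t) for 0 < t < 1. Disjointness of the images becomes a positive \<open>gap\<close>:
  distinct pieces of one mesh are separated in proportion to their size. This separation yields the
  disjoint bumps and the localisation of small sets inside pieces, and from the latter come the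
  positivity of the Hausdorff measure at the similarity dimension and the upper Ahlfors
  bound.\<close>

lemma L2_spaceD [dest]:
  assumes "f \<in> L2_space M"
  shows "f \<in> borel_measurable M" "integrable M (\<lambda>x. (cmod (f x))\<^sup>2)"
  using assms by (auto simp: L2_space_def)

lemma L2_norm_nonneg [simp]: "0 \<le> L2_norm M f"
  by (simp add: L2_norm_def)

lemma L2_norm_power2: "(L2_norm M f)\<^sup>2 = (\<integral>x. (cmod (f x))\<^sup>2 \<partial>M)"
  by (simp add: L2_norm_def)

lemma L2_spaceI_bound:
  assumes "f \<in> borel_measurable M" "integrable M g" "AE x in M. (cmod (f x))\<^sup>2 \<le> g x"
  shows "f \<in> L2_space M"
  using assms by (auto simp: L2_space_def intro!: Bochner_Integration.integrable_bound[OF assms(2)] elim!: eventually_mono)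

lemma L2_space_zero [simp]: "(\<lambda>x. 0) \<in> L2_space M"
  by (simp add: L2_space_def)

lemma L2_space_scale [simp]:
  assumes "f \<in> L2_space M" shows "(\<lambda>x. c * f x) \<in> L2_space M"
  using L2_spaceD[OF assms] by (auto simp: L2_space_def norm_mult power_mult_distrib)

lemma L2_norm_scale: "L2_norm M (\<lambda>x. c * f x) = cmod c * L2_norm M f"
  by (simp add: L2_norm_def norm_mult power_mult_distrib real_sqrt_mult)

lemma L2_space_add [simp]:
  assumes "f \<in> L2_space M" "g \<in> L2_space M" shows "(\<lambda>x. f x + g x) \<in> L2_space M"
proof (rule L2_spaceI_bound)
  show "integrable M (\<lambda>x. 2 * (cmod (f x))\<^sup>2 + 2 * (cmod (g x))\<^sup>2)"
    using assms by (auto simp: L2_space_def)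
  show "(\<lambda>x. f x + g x) \<in> borel_measurable M"
    using assms by (auto simp: L2_space_def)
  have "(cmod (a + b))\<^sup>2 \<le> 2 * (cmod a)\<^sup>2 + 2 * (cmod b)\<^sup>2" for a b
  proof -
    have "(cmod (a + b))\<^sup>2 \<le> (cmod a + cmod b)\<^sup>2"
      by (intro power_mono norm_triangle_ineq) simp
    also have "\<dots> \<le> 2 * (cmod a)\<^sup>2 + 2 * (cmod b)\<^sup>2"
      using zero_le_power2[of "cmod a - cmod b"] unfolding power2_diff power2_sum by linarith
    finally show ?thesis .
  qed
  then show "AE x in M. (cmod (f x + g x))\<^sup>2 \<le> 2 * (cmod (f x))\<^sup>2 + 2 * (cmod (g x))\<^sup>2"
    by simp
qed

lemma L2_space_diff [simp]:
  assumes "f \<in> L2_space M" "g \<in> L2_space M" shows "(\<lambda>x. f x - g x) \<in> L2_space M"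
  using L2_space_add[OF assms(1) L2_space_scale[OF assms(2), of "-1"]] by simp

lemma L2_space_sum:
  assumes "\<And>i. i \<in> I \<Longrightarrow> f i \<in> L2_space M" shows "(\<lambda>x. \<Sum>i\<in>I. f i x) \<in> L2_space M"
  using assms by (induction I rule: infinite_finite_induct) auto

lemma borel_measurable_cnj [measurable]: "cnj \<in> borel_measurable borel"
  by (intro borel_measurable_continuous_onI continuous_intros)

lemma L2_integrable_mult:
  assumes "f \<in> L2_space M" "g \<in> L2_space M" shows "integrable M (\<lambda>x. f x * cnj (g x))"
proof (rule Bochner_Integration.integrable_bound)
  show "integrable M (\<lambda>x. (cmod (f x))\<^sup>2 + (cmod (g x))\<^sup>2)"
    using assms by (auto simp: L2_space_def)
  have [measurable]: "f \<in> borel_measurable M" "g \<in> borel_measurable M"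
    using assms by auto
  show "(\<lambda>x. f x * cnj (g x)) \<in> borel_measurable M"
    by measurable
  have "a * b \<le> a\<^sup>2 + b\<^sup>2" for a b :: real
    using zero_le_power2[of "a - b"] zero_le_power2[of a] zero_le_power2[of b]
    unfolding power2_diff by linarith
  then show "AE x in M. norm (f x * cnj (g x)) \<le> norm ((cmod (f x))\<^sup>2 + (cmod (g x))\<^sup>2)"
    by (simp add: norm_mult)
qed

lemma L2_norm_nn_integral:
  assumes "f \<in> L2_space M"
  shows "(\<integral>\<^sup>+x. (ennreal (cmod (f x)))\<^sup>2 \<partial>M) = ennreal ((L2_norm M f)\<^sup>2)"
  unfolding L2_norm_power2
  by (subst nn_integral_eq_integral[symmetric]) (use assms in \<open>auto simp: L2_space_def ennreal_power\<close>)

lemma L2_Cauchy_Schwarz_norm: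
  assumes "f \<in> L2_space M" "g \<in> L2_space M"
  shows "(\<integral>x. cmod (f x) * cmod (g x) \<partial>M) \<le> L2_norm M f * L2_norm M g"
proof -
  have m: "f \<in> borel_measurable M" "g \<in> borel_measurable M"
    using assms by auto
  have i: "integrable M (\<lambda>x. cmod (f x) * cmod (g x))"
    using integrable_norm[OF L2_integrable_mult[OF assms]] by (simp add: norm_mult)
  have "ennreal (\<integral>x. cmod (f x) * cmod (g x) \<partial>M) = (\<integral>\<^sup>+x. ennreal (cmod (f x)) * ennreal (cmod (g x)) \<partial>M)"
    by (subst nn_integral_eq_integral[symmetric]) (use i in \<open>auto simp: ennreal_mult\<close>)
  then have "ennreal ((\<integral>x. cmod (f x) * cmod (g x) \<partial>M)\<^sup>2) = (\<integral>\<^sup>+x. ennreal (cmod (f x)) * ennreal (cmod (g x)) \<partial>M)\<^sup>2"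
    by (simp add: ennreal_power[symmetric])
  also have "\<dots> \<le> (\<integral>\<^sup>+x. (ennreal (cmod (f x)))\<^sup>2 \<partial>M) * (\<integral>\<^sup>+x. (ennreal (cmod (g x)))\<^sup>2 \<partial>M)"
    by (rule Cauchy_Schwarz_nn_integral) (use m in auto)
  also have "\<dots> = ennreal ((L2_norm M f * L2_norm M g)\<^sup>2)"
    using assms by (simp add: L2_norm_nn_integral ennreal_mult[symmetric] power_mult_distrib)
  finally have "(\<integral>x. cmod (f x) * cmod (g x) \<partial>M)\<^sup>2 \<le> (L2_norm M f * L2_norm M g)\<^sup>2"
    by (subst (asm) ennreal_le_iff) auto
  then show ?thesis
    by (rule power2_le_imp_le) simp
qed

lemma L2_Cauchy_Schwarz:
  assumes "f \<in> L2_space M" "g \<in> L2_space M"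
  shows "cmod (L2_inner M f g) \<le> L2_norm M f * L2_norm M g"
proof -
  have "cmod (L2_inner M f g) \<le> (\<integral>x. cmod (f x * cnj (g x)) \<partial>M)"
    unfolding L2_inner_def by (rule integral_norm_bound)
  then show ?thesis
    using L2_Cauchy_Schwarz_norm[OF assms] by (simp add: norm_mult)
qed

lemma L2_norm_cong_AE:
  assumes "f \<in> borel_measurable M" "g \<in> borel_measurable M" "AE x in M. f x = g x"
  shows "L2_norm M f = L2_norm M g"
  unfolding L2_norm_def
  by (rule arg_cong[of _ _ sqrt], rule integral_cong_AE) (use assms in \<open>auto elim!: eventually_mono\<close>)

lemma L2_triangle:
  assumes "f \<in> L2_space M" "g \<in> L2_space M"
  shows "L2_norm M (\<lambda>x. f x + g x) \<le> L2_norm M f + L2_norm M g"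
proof -
  have i: "integrable M (\<lambda>x. cmod (f x) * cmod (g x))"
    using integrable_norm[OF L2_integrable_mult[OF assms]] by (simp add: norm_mult)
  have i2: "integrable M (\<lambda>x. (cmod (f x))\<^sup>2)" "integrable M (\<lambda>x. (cmod (g x))\<^sup>2)"
    using assms by auto
  have "(L2_norm M (\<lambda>x. f x + g x))\<^sup>2 \<le> (\<integral>x. (cmod (f x))\<^sup>2 + 2 * (cmod (f x) * cmod (g x)) + (cmod (g x))\<^sup>2 \<partial>M)"
    unfolding L2_norm_power2
  proof (rule integral_mono)
    show "integrable M (\<lambda>x. (cmod (f x + g x))\<^sup>2)"
      using L2_space_add[OF assms] by auto
    show "integrable M (\<lambda>x. (cmod (f x))\<^sup>2 + 2 * (cmod (f x) * cmod (g x)) + (cmod (g x))\<^sup>2)"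
      using i i2 by auto
    show "(cmod (f x + g x))\<^sup>2 \<le> (cmod (f x))\<^sup>2 + 2 * (cmod (f x) * cmod (g x)) + (cmod (g x))\<^sup>2" for x
      using power_mono[OF norm_triangle_ineq[of "f x" "g x"], of 2] by (simp add: power2_sum)
  qed
  also have "\<dots> = (L2_norm M f)\<^sup>2 + 2 * (\<integral>x. cmod (f x) * cmod (g x) \<partial>M) + (L2_norm M g)\<^sup>2"
    unfolding L2_norm_power2 using i i2 by simp
  also have "\<dots> \<le> (L2_norm M f + L2_norm M g)\<^sup>2"
    using L2_Cauchy_Schwarz_norm[OF assms] by (simp add: power2_sum)
  finally show ?thesis
    by (rule power2_le_imp_le) simp
qed

lemma L2_triangle_diff:
  assumes "f \<in> L2_space M" "g \<in> L2_space M"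
  shows "L2_norm M (\<lambda>x. f x - g x) \<le> L2_norm M f + L2_norm M g"
  using L2_triangle[OF assms(1) L2_space_scale[OF assms(2), of "-1"]] L2_norm_scale[of M "-1" g] by simp

lemma L2_triangle3:
  assumes "f \<in> L2_space M" "g \<in> L2_space M" "k \<in> L2_space M"
  shows "L2_norm M (\<lambda>x. f x - k x) \<le> L2_norm M (\<lambda>x. f x - g x) + L2_norm M (\<lambda>x. g x - k x)"
  using L2_triangle[of "\<lambda>x. f x - g x" M "\<lambda>x. g x - k x"] assms by simp

lemma L2_norm_sum_le:
  assumes "\<And>i. i \<in> I \<Longrightarrow> f i \<in> L2_space M"
  shows "L2_norm M (\<lambda>x. \<Sum>i\<in>I. f i x) \<le> (\<Sum>i\<in>I. L2_norm M (f i))"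
  using assms
proof (induction I rule: infinite_finite_induct)
  case (insert i I)
  then show ?case
    using L2_triangle[of "f i" M "\<lambda>x. \<Sum>i\<in>I. f i x"] L2_space_sum[of I f M] by auto
qed (auto simp: L2_norm_def)

lemma L2_norm_minus_commute: "L2_norm M (\<lambda>x. f x - g x) = L2_norm M (\<lambda>x. g x - f x)"
  by (simp add: L2_norm_def norm_minus_commute)

lemma L2_norm_eq_0_AE:
  assumes "f \<in> L2_space M" "L2_norm M f = 0" shows "AE x in M. f x = 0"
proof -
  have "(\<integral>x. (cmod (f x))\<^sup>2 \<partial>M) = 0"
    using assms(2) by (simp add: L2_norm_def)
  then have "AE x in M. (cmod (f x))\<^sup>2 = 0"
    by (subst integral_nonneg_eq_0_iff_AE[symmetric]) (use assms in auto)
  then show ?thesis by (auto elim!: eventually_mono)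
qed

lemma L2_tendsto_diff:
  assumes "L2_tendsto M u f" "L2_tendsto M v g"
  shows "L2_tendsto M (\<lambda>k x. u k x - v k x) (\<lambda>x. f x - g x)"
  unfolding L2_tendsto_def
proof (intro conjI allI)
  have m: "\<And>k. u k \<in> L2_space M" "\<And>k. v k \<in> L2_space M" "f \<in> L2_space M" "g \<in> L2_space M"
    using assms by (auto simp: L2_tendsto_def)
  show "(\<lambda>x. u k x - v k x) \<in> L2_space M" for k using m by simp
  show "(\<lambda>x. f x - g x) \<in> L2_space M" using m by simp
  show "(\<lambda>k. L2_norm M (\<lambda>x. u k x - v k x - (f x - g x))) \<longlonglongrightarrow> 0"
  proof (rule Lim_null_comparison)
    show "\<forall>\<^sub>F k in sequentially. norm (L2_norm M (\<lambda>x. u k x - v k x - (f x - g x)))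
        \<le> L2_norm M (\<lambda>x. u k x - f x) + L2_norm M (\<lambda>x. v k x - g x)"
      using L2_triangle_diff[of "\<lambda>x. u k x - f x" M "\<lambda>x. v k x - g x" for k] m
      by (intro always_eventually) (simp add: algebra_simps)
    show "(\<lambda>k. L2_norm M (\<lambda>x. u k x - f x) + L2_norm M (\<lambda>x. v k x - g x)) \<longlonglongrightarrow> 0"
      using assms by (auto simp: L2_tendsto_def intro: tendsto_add_zero)
  qed
qed

lemma L2_tendsto_norm:
  assumes "L2_tendsto M u f" shows "(\<lambda>k. L2_norm M (u k)) \<longlonglongrightarrow> L2_norm M f"
proof -
  have m: "\<And>k. u k \<in> L2_space M" "f \<in> L2_space M"
    using assms by (auto simp: L2_tendsto_def)
  have "(\<lambda>k. L2_norm M (u k) - L2_norm M f) \<longlonglongrightarrow> 0"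
  proof (rule Lim_null_comparison)
    have "norm (L2_norm M (u k) - L2_norm M f) \<le> L2_norm M (\<lambda>x. u k x - f x)" for k
      using L2_triangle[of "\<lambda>x. u k x - f x" M f] L2_triangle[of "\<lambda>x. f x - u k x" M "u k"] m
        L2_norm_minus_commute[of M "u k" f]
      by (simp add: abs_le_iff)
    then show "\<forall>\<^sub>F k in sequentially. norm (L2_norm M (u k) - L2_norm M f) \<le> L2_norm M (\<lambda>x. u k x - f x)"
      by simp
    show "(\<lambda>k. L2_norm M (\<lambda>x. u k x - f x)) \<longlonglongrightarrow> 0"
      using assms by (auto simp: L2_tendsto_def)
  qed
  then show ?thesis by (simp add: LIM_zero_iff)
qed

text \<open>The weights \<open>2^k\<close> make the almost everywhere finite sum of squares control the increments
  pointwise by a geometric sequence.\<close>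

lemma L2_rapidly_Cauchy_convergent:
  assumes u: "\<And>k. u k \<in> L2_space M"
    and cau: "\<And>k. L2_norm M (\<lambda>x. u (Suc k) x - u k x) \<le> (1/2) ^ k"
  shows "\<exists>f. L2_tendsto M u f"
proof -
  have [measurable]: "u k \<in> borel_measurable M" for k using u by auto
  have "(\<integral>\<^sup>+x. (\<Sum>k. ennreal (2 ^ k * (cmod (u (Suc k) x - u k x))\<^sup>2)) \<partial>M)
      = (\<Sum>k. \<integral>\<^sup>+x. ennreal (2 ^ k * (cmod (u (Suc k) x - u k x))\<^sup>2) \<partial>M)"
    by (rule nn_integral_suminf) simp
  also have "\<dots> \<le> (\<Sum>k. ennreal ((1/2) ^ k))"
  proof (intro suminf_le allI)
    fix k
    have "(\<integral>\<^sup>+x. ennreal (2 ^ k * (cmod (u (Suc k) x - u k x))\<^sup>2) \<partial>M)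
      = ennreal (2^k * (L2_norm M (\<lambda>x. u (Suc k) x - u k x))\<^sup>2)"
      using L2_norm_nn_integral[OF L2_space_diff[OF u[of "Suc k"] u[of k]]]
      by (simp add: ennreal_mult nn_integral_cmult ennreal_power)
    also have "\<dots> \<le> ennreal (2^k * ((1/2)^k)\<^sup>2)"
      by (intro ennreal_leI mult_left_mono power_mono cau) auto
    also have "2^k * ((1/2)^k)\<^sup>2 = (1/2::real)^k"
      by (simp add: power2_eq_square flip: power_mult_distrib)
    finally show "(\<integral>\<^sup>+x. ennreal (2 ^ k * (cmod (u (Suc k) x - u k x))\<^sup>2) \<partial>M) \<le> ennreal ((1/2) ^ k)" .
  qed auto
  also have "\<dots> = ennreal (\<Sum>k. (1/2) ^ k)"
    by (rule suminf_ennreal2) auto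
  also have "\<dots> < \<infinity>" by simp
  finally have "AE x in M. (\<Sum>k. ennreal (2 ^ k * (cmod (u (Suc k) x - u k x))\<^sup>2)) \<noteq> \<infinity>"
    by (intro nn_integral_noteq_infinite) auto
  then have conv: "AE x in M. convergent (\<lambda>k. u k x)"
  proof (rule eventually_mono)
    fix x assume "(\<Sum>k. ennreal (2 ^ k * (cmod (u (Suc k) x - u k x))\<^sup>2)) \<noteq> \<infinity>"
    then have "summable (\<lambda>k. 2 ^ k * (cmod (u (Suc k) x - u k x))\<^sup>2)"
      by (intro summable_suminf_not_top) (auto simp: top_ennreal_def)
    then have "(\<lambda>k. 2 ^ k * (cmod (u (Suc k) x - u k x))\<^sup>2) \<longlonglongrightarrow> 0"
      by (rule summable_LIMSEQ_zero)
    then have "\<forall>\<^sub>F k in sequentially. 2 ^ k * (cmod (u (Suc k) x - u k x))\<^sup>2 < 1"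
      by (rule order_tendstoD) simp
    then have ev: "\<forall>\<^sub>F k in sequentially. norm (u (Suc k) x - u k x) \<le> (1 / sqrt 2) ^ k"
    proof (rule eventually_mono)
      fix k assume "2 ^ k * (cmod (u (Suc k) x - u k x))\<^sup>2 < 1"
      then have "(cmod (u (Suc k) x - u k x))\<^sup>2 \<le> 1 / 2 ^ k"
        by (simp add: field_simps)
      also have "\<dots> = ((1 / sqrt 2)\<^sup>2) ^ k"
        by (simp add: power_divide)
      also have "\<dots> = ((1 / sqrt 2) ^ k)\<^sup>2"
        by (simp only: power_mult[symmetric] mult.commute)
      finally show "norm (u (Suc k) x - u k x) \<le> (1 / sqrt 2) ^ k"
        by (rule power2_le_imp_le) simp
    qed
    have "summable (\<lambda>k. u (Suc k) x - u k x)"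
      by (rule summable_comparison_test_ev[OF ev]) (simp add: summable_geometric)
    then have "convergent (\<lambda>n. \<Sum>k<n. u (Suc k) x - u k x)"
      by (simp add: summable_iff_convergent)
    then have "convergent (\<lambda>n. u n x - u 0 x)"
      using sum_lessThan_telescope[of "\<lambda>k. u k x"] by simp
    then have "convergent (\<lambda>n. (u n x - u 0 x) + u 0 x)"
      by (intro convergent_add convergent_const)
    then show "convergent (\<lambda>k. u k x)" by simp
  qed
  define f where "f x = lim (\<lambda>k. u k x)" for x
  have [measurable]: "f \<in> borel_measurable M"
    unfolding f_def by measurable
  have lim: "AE x in M. (\<lambda>k. u k x) \<longlonglongrightarrow> f x"
    using conv by eventually_elim (simp add: f_def convergent_LIMSEQ_iff)
  have cau': "L2_norm M (\<lambda>x. u (k + m) x - u k x) \<le> 2 * (1/2) ^ k" for k m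
  proof -
    have "L2_norm M (\<lambda>x. u (k + m) x - u k x) = L2_norm M (\<lambda>x. \<Sum>i<m. u (Suc (k + i)) x - u (k + i) x)"
      using sum_lessThan_telescope[of "\<lambda>i. u (k + i) x" m for x] by simp
    also have "\<dots> \<le> (\<Sum>i<m. L2_norm M (\<lambda>x. u (Suc (k + i)) x - u (k + i) x))"
      by (rule L2_norm_sum_le) (use u in auto)
    also have "\<dots> \<le> (\<Sum>i<m. (1/2) ^ k * (1/2) ^ i)"
      using cau by (intro sum_mono) (simp add: power_add[symmetric])
    also have "\<dots> = (1/2)^k * (\<Sum>i<m. (1/2) ^ i)"
      by (simp add: sum_distrib_left)
    also have "\<dots> \<le> (1/2)^k * 2"
      by (intro mult_left_mono) (simp_all add: sum_gp_strict)
    finally show ?thesis by simp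
  qed
  \<comment> \<open>Fatou's lemma along the tail carries the Cauchy bound \<open>cau'\<close> over
    to the limit, which gives square integrability of \<open>u k - f\<close> and the rate of
    convergence at once.\<close>
  have fatou: "(\<integral>\<^sup>+x. (ennreal (cmod (u k x - f x)))\<^sup>2 \<partial>M) \<le> ennreal ((2 * (1/2) ^ k)\<^sup>2)" for k
  proof -
    have "(\<integral>\<^sup>+x. (ennreal (cmod (u k x - f x)))\<^sup>2 \<partial>M)
        = (\<integral>\<^sup>+x. liminf (\<lambda>m. (ennreal (cmod (u (k + m) x - u k x)))\<^sup>2) \<partial>M)"
    proof (intro nn_integral_cong_AE)
      show "AE x in M. (ennreal (cmod (u k x - f x)))\<^sup>2 = liminf (\<lambda>m. (ennreal (cmod (u (k + m) x - u k x)))\<^sup>2)"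
        using lim
      proof (rule eventually_mono)
        fix x assume "(\<lambda>k. u k x) \<longlonglongrightarrow> f x"
        then have "(\<lambda>m. u (k + m) x) \<longlonglongrightarrow> f x"
          using LIMSEQ_ignore_initial_segment[of "\<lambda>k. u k x" "f x" k] by (simp add: add.commute)
        then have "(\<lambda>m. (ennreal ((cmod (u (k + m) x - u k x))\<^sup>2))) \<longlonglongrightarrow> (ennreal ((cmod (f x - u k x))\<^sup>2))"
          by (intro tendsto_intros tendsto_ennrealI)
        then have "liminf (\<lambda>m. ennreal ((cmod (u (k + m) x - u k x))\<^sup>2)) = ennreal ((cmod (u k x - f x))\<^sup>2)"
          unfolding norm_minus_commute[of "u k x"] by (rule lim_imp_Liminf[OF sequentially_bot])
        then show "(ennreal (cmod (u k x - f x)))\<^sup>2 = liminf (\<lambda>m. (ennreal (cmod (u (k + m) x - u k x)))\<^sup>2)"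
          by (simp add: ennreal_power)
      qed
    qed
    also have "\<dots> \<le> liminf (\<lambda>m. \<integral>\<^sup>+x. (ennreal (cmod (u (k + m) x - u k x)))\<^sup>2 \<partial>M)"
      by (rule nn_integral_liminf) auto
    also have "\<dots> \<le> liminf (\<lambda>m::nat. ennreal ((2 * (1/2) ^ k)\<^sup>2))"
    proof (intro Liminf_mono always_eventually allI)
      fix m
      have "(\<integral>\<^sup>+x. (ennreal (cmod (u (k + m) x - u k x)))\<^sup>2 \<partial>M) = ennreal ((L2_norm M (\<lambda>x. u (k + m) x - u k x))\<^sup>2)"
        by (rule L2_norm_nn_integral) (use u in auto)
      also have "\<dots> \<le> ennreal ((2 * (1/2) ^ k)\<^sup>2)"
        by (intro ennreal_leI power_mono cau') auto
      finally show "(\<integral>\<^sup>+x. (ennreal (cmod (u (k + m) x - u k x)))\<^sup>2 \<partial>M) \<le> ennreal ((2 * (1/2) ^ k)\<^sup>2)" .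
    qed
    also have "\<dots> = ennreal ((2 * (1/2) ^ k)\<^sup>2)"
      by (simp add: Liminf_const)
    finally show ?thesis .
  qed
  have diff: "(\<lambda>x. u k x - f x) \<in> L2_space M" for k
  proof -
    have "(\<integral>\<^sup>+x. ennreal (norm ((cmod (u k x - f x))\<^sup>2)) \<partial>M) \<le> ennreal ((2 * (1/2) ^ k)\<^sup>2)"
      using fatou[of k] by (simp add: ennreal_power)
    also have "\<dots> < \<infinity>" by simp
    finally show ?thesis
      unfolding L2_space_def by (auto intro!: integrableI_bounded)
  qed
  have "f \<in> L2_space M"
    using L2_space_diff[OF u[of 0] diff[of 0]] by simp
  moreover have bd: "L2_norm M (\<lambda>x. u k x - f x) \<le> 2 * (1/2) ^ k" for k
  proof -
    have "ennreal ((L2_norm M (\<lambda>x. u k x - f x))\<^sup>2) \<le> ennreal ((2 * (1/2) ^ k)\<^sup>2)"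
      using fatou[of k] L2_norm_nn_integral[OF diff[of k]] by simp
    then have "(L2_norm M (\<lambda>x. u k x - f x))\<^sup>2 \<le> (2 * (1/2) ^ k)\<^sup>2"
      by (subst (asm) ennreal_le_iff) auto
    then show ?thesis by (rule power2_le_imp_le) simp
  qed
  moreover have "(\<lambda>k. L2_norm M (\<lambda>x. u k x - f x)) \<longlonglongrightarrow> 0"
  proof (rule Lim_null_comparison)
    show "\<forall>\<^sub>F k in sequentially. norm (L2_norm M (\<lambda>x. u k x - f x)) \<le> 2 * (1/2) ^ k"
      by (intro always_eventually allI) (simp only: real_norm_def abs_of_nonneg[OF L2_norm_nonneg] bd)
    show "(\<lambda>k. 2 * (1/2::real) ^ k) \<longlonglongrightarrow> 0"
      by (intro tendsto_mult_right_zero LIMSEQ_power_zero) simp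
  qed
  ultimately show ?thesis
    using u unfolding L2_tendsto_def by blast
qed


section \<open>Gaussian means of Fourier transforms\<close>

lemma borel_measurable_cis [measurable]: "cis \<in> borel_measurable borel"
  by (intro borel_measurable_continuous_onI continuous_intros)

text \<open>The substitution x -> c x with c = sqrt (2 * \<tau>) turns the standard normal density
  into the Gaussian of parameter \<tau>, so the formula is the characteristic function of the
  standard normal distribution at b / c.\<close>

lemma gaussian_fourier_1d:
  fixes b \<tau> :: real
  assumes "0 < \<tau>"
  shows "integrable lborel (\<lambda>x::real. cis (b * x) * of_real (exp (- \<tau> * x\<^sup>2)))"
    and "(\<integral>x. cis (b * x) * of_real (exp (- \<tau> * x\<^sup>2)) \<partial>lborel)
       = of_real (sqrt (pi / \<tau>) * exp (- b\<^sup>2 / (4 * \<tau>)))"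
proof -
  define c where "c = sqrt (2 * \<tau>)"
  have c: "c > 0" "c\<^sup>2 = 2 * \<tau>"
    using assms by (auto simp: c_def)
  let ?g = "\<lambda>x::real. std_normal_density x *\<^sub>R iexp (b / c * x)"
  have dens: "std_normal_density (0 + c * x) = 1 / sqrt (2 * pi) * exp (- \<tau> * x\<^sup>2)" for x
    by (simp add: std_normal_density_def power_mult_distrib c)
  have g: "?g (0 + c * x) = of_real (1 / sqrt (2 * pi)) * (cis (b * x) * of_real (exp (- \<tau> * x\<^sup>2)))" for x
    using c(1) unfolding dens by (simp add: scaleR_conv_of_real cis_conv_exp)
  have int: "integrable lborel ?g"
  proof (rule Bochner_Integration.integrable_bound[OF integrable_normal_density[of 1 0]])
    show "AE x in lborel. norm (?g x) \<le> norm (std_normal_density x)"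
      by simp
  qed simp_all
  from lborel_integrable_real_affine[OF int, of c 0] c
  have "integrable lborel (\<lambda>x::real. of_real (1 / sqrt (2 * pi)) * (cis (b * x) * of_real (exp (- \<tau> * x\<^sup>2))))"
    unfolding g by auto
  then have "integrable lborel (\<lambda>x::real. of_real (sqrt (2 * pi)) *
      (of_real (1 / sqrt (2 * pi)) * (cis (b * x) * of_real (exp (- \<tau> * x\<^sup>2)))))"
    by (rule integrable_mult_right)
  then show *: "integrable lborel (\<lambda>x::real. cis (b * x) * of_real (exp (- \<tau> * x\<^sup>2)))"
    unfolding mult.assoc[symmetric] of_real_mult[symmetric] by simp
  have "of_real (exp (- (b / c)\<^sup>2 / 2)) = char std_normal_distribution (b / c)"
    by (simp add: char_std_normal_distribution)
  also have "\<dots> = (\<integral>x. ?g x \<partial>lborel)"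
    unfolding char_def by (subst integral_density) auto
  also have "\<dots> = c *\<^sub>R (\<integral>x. ?g (0 + c * x) \<partial>lborel)"
    using lborel_integral_real_affine[of c ?g 0] c by auto
  also have "\<dots> = of_real (c / sqrt (2 * pi)) * (\<integral>x. cis (b * x) * of_real (exp (- \<tau> * x\<^sup>2)) \<partial>lborel)"
    unfolding g integral_mult_right_zero by (simp add: scaleR_conv_of_real)
  finally have "(\<integral>x. cis (b * x) * of_real (exp (- \<tau> * x\<^sup>2)) \<partial>lborel) = of_real (sqrt (2 * pi) / c * exp (- (b / c)\<^sup>2 / 2))"
    using c(1) by (simp add: field_simps)
  also have "sqrt (2 * pi) / c = sqrt (pi / \<tau>)"
    using assms by (simp add: c_def flip: real_sqrt_divide)
  also have "- (b / c)\<^sup>2 / 2 = - b\<^sup>2 / (4 * \<tau>)"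
    by (simp add: power_divide c)
  finally show "(\<integral>x. cis (b * x) * of_real (exp (- \<tau> * x\<^sup>2)) \<partial>lborel)
       = of_real (sqrt (pi / \<tau>) * exp (- b\<^sup>2 / (4 * \<tau>)))" .
qed

text \<open>\<open>lborel\<close> on a Euclidean space is the image of the product of
  one-dimensional Lebesgue measures under the coordinate map, so this is Fubini for a product of
  functions of one coordinate each.\<close>

lemma lborel_integral_prod:
  fixes f :: "'a::euclidean_space \<Rightarrow> real \<Rightarrow> complex"
  assumes f: "\<And>b. b \<in> Basis \<Longrightarrow> integrable lborel (f b)"
  shows "integrable lborel (\<lambda>x::'a. \<Prod>b\<in>Basis. f b (x \<bullet> b))"
    and "(\<integral>x. (\<Prod>b\<in>Basis. f b (x \<bullet> b)) \<partial>lborel) = (\<Prod>b\<in>Basis. \<integral>x. f b x \<partial>lborel)"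
proof -
  interpret product_sigma_finite "\<lambda>_::'a. lborel :: real measure" ..
  have [measurable]: "f b \<in> borel_measurable borel" if "b \<in> Basis" for b
    using borel_measurable_integrable[OF f[OF that]] by simp
  have [measurable]: "(\<lambda>g. \<Sum>b\<in>Basis. g b *\<^sub>R b) \<in> (\<Pi>\<^sub>M b\<in>(Basis::'a set). lborel) \<rightarrow>\<^sub>M borel"
    by measurable
  have inner: "(\<Sum>c\<in>Basis. g c *\<^sub>R c) \<bullet> b = g b" if "b \<in> Basis" for g and b :: 'a
    using that by simp
  have m: "(\<lambda>x::'a. \<Prod>b\<in>Basis. f b (x \<bullet> b)) \<in> borel_measurable borel"
    by measurable
  have i: "integrable (\<Pi>\<^sub>M b\<in>(Basis::'a set). lborel) (\<lambda>g. \<Prod>b\<in>Basis. f b (g b))"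
    by (rule product_integrable_prod) (use f in auto)
  show "integrable lborel (\<lambda>x::'a. \<Prod>b\<in>Basis. f b (x \<bullet> b))"
    by (subst lborel_eq, subst integrable_distr_eq) (use m i in \<open>simp_all add: inner cong: prod.cong\<close>)
  show "(\<integral>x. (\<Prod>b\<in>Basis. f b (x \<bullet> b)) \<partial>lborel) = (\<Prod>b\<in>Basis. \<integral>x. f b x \<partial>lborel)"
  proof (subst lborel_eq, subst integral_distr)
    show "(\<integral>g. (\<Prod>b\<in>Basis. f b ((\<Sum>c\<in>Basis. g c *\<^sub>R c) \<bullet> b)) \<partial>(\<Pi>\<^sub>M b\<in>(Basis::'a set). lborel))
        = (\<Prod>b\<in>Basis. \<integral>x. f b x \<partial>lborel)"
      by (simp add: inner product_integral_prod[OF finite_Basis f] cong: prod.cong)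
  qed (use m in simp_all)
qed

lemma cis_sum: "finite A \<Longrightarrow> cis (\<Sum>a\<in>A. f a) = (\<Prod>a\<in>A. cis (f a))"
  by (induction A rule: finite_induct) (auto simp flip: cis_mult)

text \<open>Both the Gaussian of the norm and the character \<open>cis\<close> factorise over the
  coordinates, which reduces the claim to dimension one.\<close>

lemma gaussian_fourier:
  fixes v :: "'a::euclidean_space"
  assumes "0 < \<tau>"
  shows "integrable lborel (\<lambda>x::'a. cis (v \<bullet> x) * of_real (exp (- \<tau> * (norm x)\<^sup>2)))"
    and "(\<integral>x. cis (v \<bullet> x) * of_real (exp (- \<tau> * (norm x)\<^sup>2)) \<partial>lborel)
       = of_real ((pi / \<tau>) powr (DIM('a) / 2) * exp (- (norm v)\<^sup>2 / (4 * \<tau>)))"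
proof -
  have nrm: "(norm x)\<^sup>2 = (\<Sum>b\<in>Basis. (x \<bullet> b)\<^sup>2)" for x :: 'a
    unfolding power2_norm_eq_inner by (subst euclidean_inner) (simp add: power2_eq_square)
  have eq: "cis (v \<bullet> x) * of_real (exp (- \<tau> * (norm x)\<^sup>2))
    = (\<Prod>b\<in>Basis. cis ((v \<bullet> b) * (x \<bullet> b)) * of_real (exp (- \<tau> * (x \<bullet> b)\<^sup>2)))" for x :: 'a
    unfolding nrm sum_distrib_left exp_sum[OF finite_Basis] prod.distrib
    by (subst euclidean_inner) (simp add: cis_sum)
  show "integrable lborel (\<lambda>x::'a. cis (v \<bullet> x) * of_real (exp (- \<tau> * (norm x)\<^sup>2)))"
    unfolding eq by (rule lborel_integral_prod(1)[OF gaussian_fourier_1d(1)[OF assms]])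
  have "(\<integral>x. cis (v \<bullet> x) * of_real (exp (- \<tau> * (norm x)\<^sup>2)) \<partial>lborel)
      = (\<Prod>b\<in>(Basis::'a set). of_real (sqrt (pi / \<tau>) * exp (- (v \<bullet> b)\<^sup>2 / (4 * \<tau>))))"
    unfolding eq
    by (subst lborel_integral_prod(2)[OF gaussian_fourier_1d(1)[OF assms]])
       (simp only: gaussian_fourier_1d(2)[OF assms])
  also have "\<dots> = of_real ((sqrt (pi / \<tau>)) ^ DIM('a) * exp (\<Sum>b\<in>(Basis::'a set). - (v \<bullet> b)\<^sup>2 / (4 * \<tau>)))"
    by (simp add: prod.distrib exp_sum)
  also have "(sqrt (pi / \<tau>)) ^ DIM('a) = (pi / \<tau>) powr (DIM('a) / 2)"
    using assms by (simp add: powr_half_sqrt[symmetric] powr_powr powr_realpow[symmetric])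
  also have "(\<Sum>b\<in>(Basis::'a set). - (v \<bullet> b)\<^sup>2 / (4 * \<tau>)) = - (norm v)\<^sup>2 / (4 * \<tau>)"
    by (simp add: nrm sum_negf sum_divide_distrib)
  finally show "(\<integral>x. cis (v \<bullet> x) * of_real (exp (- \<tau> * (norm x)\<^sup>2)) \<partial>lborel)
       = of_real ((pi / \<tau>) powr (DIM('a) / 2) * exp (- (norm v)\<^sup>2 / (4 * \<tau>)))" .
qed

lemma gaussian_integrable:
  assumes "0 < \<tau>" shows "integrable lborel (\<lambda>x::'a::euclidean_space. exp (- \<tau> * (norm x)\<^sup>2))"
proof -
  have "norm (cis (0 \<bullet> x) * complex_of_real (exp (- \<tau> * (norm x)\<^sup>2))) = exp (- \<tau> * (norm x)\<^sup>2)" for x :: 'a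
    unfolding norm_mult norm_cis norm_of_real by simp
  then show ?thesis
    using integrable_norm[OF gaussian_fourier(1)[OF assms, of "0::'a"]] by simp
qed

lemma gaussian_nn_integral:
  fixes z :: "'a::euclidean_space"
  assumes "0 < \<tau>"
  shows "(\<integral>\<^sup>+x. ennreal (exp (- \<tau> * (norm (x - z))\<^sup>2)) \<partial>lborel) = ennreal ((pi / \<tau>) powr (DIM('a) / 2))"
proof -
  have c0: "cis (0 \<bullet> x) * complex_of_real r = complex_of_real r" for x :: 'a and r
    by simp
  have "complex_of_real (\<integral>x. exp (- \<tau> * (norm (x::'a))\<^sup>2) \<partial>lborel)
      = (\<integral>x. cis ((0::'a) \<bullet> x) * complex_of_real (exp (- \<tau> * (norm x)\<^sup>2)) \<partial>lborel)"
    unfolding c0 integral_complex_of_real ..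
  also have "\<dots> = complex_of_real ((pi / \<tau>) powr (DIM('a) / 2))"
    unfolding gaussian_fourier(2)[OF assms] by simp
  finally have "complex_of_real (\<integral>x. exp (- \<tau> * (norm (x::'a))\<^sup>2) \<partial>lborel) = complex_of_real ((pi / \<tau>) powr (DIM('a) / 2))" .
  then have *: "(\<integral>x. exp (- \<tau> * (norm (x::'a))\<^sup>2) \<partial>lborel) = (pi / \<tau>) powr (DIM('a) / 2)"
    by (simp only: of_real_eq_iff)
  have "(\<integral>\<^sup>+x. ennreal (exp (- \<tau> * (norm (x - z))\<^sup>2)) \<partial>lborel)
      = (\<integral>\<^sup>+x. ennreal (exp (- \<tau> * (norm (x - z))\<^sup>2)) \<partial>(distr lborel borel ((+) z)))"
    by (simp add: lborel_distr_plus)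
  also have "\<dots> = (\<integral>\<^sup>+x. ennreal (exp (- \<tau> * (norm (x::'a))\<^sup>2)) \<partial>lborel)"
    by (subst nn_integral_distr) auto
  also have "\<dots> = ennreal (\<integral>x. exp (- \<tau> * (norm (x::'a))\<^sup>2) \<partial>lborel)"
    by (rule nn_integral_eq_integral[OF gaussian_integrable[OF assms]]) simp
  finally show ?thesis using * by simp
qed

lemma gaussian_integral_shift:
  fixes z :: "'a::euclidean_space"
  assumes "0 < \<tau>"
  shows "integrable lborel (\<lambda>x. exp (- \<tau> * (norm (x - z))\<^sup>2))"
    and "(\<integral>x. exp (- \<tau> * (norm (x - z))\<^sup>2) \<partial>lborel) = (pi / \<tau>) powr (DIM('a) / 2)"
proof -
  show "integrable lborel (\<lambda>x. exp (- \<tau> * (norm (x - z))\<^sup>2))"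
    using gaussian_nn_integral[OF assms, of z] by (intro integrableI_nonneg) auto
  then show "(\<integral>x. exp (- \<tau> * (norm (x - z))\<^sup>2) \<partial>lborel) = (pi / \<tau>) powr (DIM('a) / 2)"
    using gaussian_nn_integral[OF assms, of z] by (subst integral_eq_nn_integral) auto
qed

lemma (in pair_sigma_finite) integrable_product:
  fixes f g :: "_ \<Rightarrow> complex"
  assumes f: "integrable M1 f" and g: "integrable M2 g"
  shows "integrable (M1 \<Otimes>\<^sub>M M2) (\<lambda>z. f (fst z) * g (snd z))"
proof (rule Fubini_integrable)
  have [measurable]: "f \<in> borel_measurable M1" "g \<in> borel_measurable M2"
    using f g by auto
  show "(\<lambda>z. f (fst z) * g (snd z)) \<in> borel_measurable (M1 \<Otimes>\<^sub>M M2)" by measurable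
  show "integrable M1 (\<lambda>x. \<integral>y. norm (f (fst (x, y)) * g (snd (x, y))) \<partial>M2)"
    using f by (simp add: norm_mult)
  show "AE x in M1. integrable M2 (\<lambda>y. f (fst (x, y)) * g (snd (x, y)))"
    using g by simp
qed

text \<open>The transform of the complex measure u dN, without the unitary factor. Allowing an
  arbitrary measure N lets one formula treat functions (N = \<open>lborel\<close>) and densities on
  \<Gamma> alike.\<close>

definition fourier_integral :: "'a::euclidean_space measure \<Rightarrow> ('a \<Rightarrow> complex) \<Rightarrow> 'a \<Rightarrow> complex" where
  "fourier_integral N u \<xi> = (\<integral>x. cis (- (\<xi> \<bullet> x)) * u x \<partial>N)"

lemma fourier_integral_measurable:
  assumes "sigma_finite_measure N" and [measurable]: "(\<lambda>x. x) \<in> borel_measurable N" "u \<in> borel_measurable N"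
  shows "fourier_integral N u \<in> borel_measurable borel"
proof -
  interpret sigma_finite_measure N by fact
  show ?thesis unfolding fourier_integral_def
    by (rule borel_measurable_lebesgue_integral) measurable
qed

lemma integrable_cis_mult:
  fixes N :: "'a::euclidean_space measure"
  assumes [measurable]: "(\<lambda>x. x) \<in> borel_measurable N" and "integrable N u"
  shows "integrable N (\<lambda>x. cis (- (\<xi> \<bullet> x)) * u x)"
proof (rule Bochner_Integration.integrable_bound[OF assms(2)])
  have [measurable]: "u \<in> borel_measurable N" using assms by auto
  have [measurable]: "(\<lambda>x. \<xi> \<bullet> x) \<in> borel_measurable N"
    by (rule borel_measurable_inner[OF borel_measurable_const assms(1)])
  show "(\<lambda>x. cis (- (\<xi> \<bullet> x)) * u x) \<in> borel_measurable N" by measurable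
qed (simp add: norm_mult)

lemma fourier_integral_bound:
  "cmod (fourier_integral N u \<xi>) \<le> (\<integral>x. cmod (u x) \<partial>N)"
  unfolding fourier_integral_def
  by (rule order_trans[OF integral_norm_bound]) (simp add: norm_mult)

text \<open>Gaussian means of products of Fourier transforms are Gaussian energies.  This replaces
  Plancherel's theorem, for functions as well as for singular measures.\<close>

lemma gaussian_fourier_product:
  fixes N1 N2 :: "'a::euclidean_space measure"
  assumes "sigma_finite_measure N1" "sigma_finite_measure N2"
    and [measurable]: "(\<lambda>x. x) \<in> borel_measurable N1" "(\<lambda>x. x) \<in> borel_measurable N2"
    and u: "integrable N1 u" and v: "integrable N2 v" and "0 < \<tau>"
  shows "(\<integral>\<xi>. of_real (exp (- \<tau> * (norm \<xi>)\<^sup>2)) * (fourier_integral N1 u \<xi> * cnj (fourier_integral N2 v \<xi>)) \<partial>lborel)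
    = of_real ((pi / \<tau>) powr (DIM('a) / 2)) *
      (\<integral>z. u (fst z) * cnj (v (snd z)) * of_real (exp (- (norm (fst z - snd z))\<^sup>2 / (4 * \<tau>))) \<partial>(N1 \<Otimes>\<^sub>M N2))"
proof -
  interpret N1: sigma_finite_measure N1 by fact
  interpret N2: sigma_finite_measure N2 by fact
  interpret P: pair_sigma_finite N1 N2 ..
  let ?P = "N1 \<Otimes>\<^sub>M N2"
  interpret PP: sigma_finite_measure ?P ..
  interpret Q: pair_sigma_finite ?P "lborel :: 'a measure" ..
  have [measurable]: "u \<in> borel_measurable N1" "v \<in> borel_measurable N2"
    using u v by auto
  let ?w = "\<lambda>z. u (fst z) * cnj (v (snd z))"
  let ?g = "\<lambda>\<xi>::'a. complex_of_real (exp (- \<tau> * (norm \<xi>)\<^sup>2))"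
  let ?c = "\<lambda>\<xi> z. cis (- (\<xi> \<bullet> (fst z - snd z)))"
  have w: "integrable ?P ?w"
    by (rule P.integrable_product[OF u, of "\<lambda>y. cnj (v y)"]) (simp add: v)
  have [measurable]: "?w \<in> borel_measurable ?P" using w by auto
  have prod: "fourier_integral N1 u \<xi> * cnj (fourier_integral N2 v \<xi>) = (\<integral>z. ?c \<xi> z * ?w z \<partial>?P)" for \<xi>
  proof -
    have i: "integrable ?P (\<lambda>z. (cis (- (\<xi> \<bullet> fst z)) * u (fst z)) * cnj (cis (- (\<xi> \<bullet> snd z)) * v (snd z)))"
      by (rule P.integrable_product[where f = "\<lambda>x. cis (- (\<xi> \<bullet> x)) * u x" and g = "\<lambda>x. cnj (cis (- (\<xi> \<bullet> x)) * v x)"])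
         (simp_all only: integrable_cnj integrable_cis_mult[OF assms(3) u] integrable_cis_mult[OF assms(4) v])
    have "(\<integral>z. ?c \<xi> z * ?w z \<partial>?P)
       = (\<integral>z. (cis (- (\<xi> \<bullet> fst z)) * u (fst z)) * cnj (cis (- (\<xi> \<bullet> snd z)) * v (snd z)) \<partial>?P)"
    proof (rule Bochner_Integration.integral_cong[OF refl])
      fix z :: "'a \<times> 'a"
      have "?c \<xi> z = cis (- (\<xi> \<bullet> fst z)) * cnj (cis (- (\<xi> \<bullet> snd z)))"
        by (simp add: cis_cnj cis_mult inner_diff_right)
      then show "?c \<xi> z * ?w z = (cis (- (\<xi> \<bullet> fst z)) * u (fst z)) * cnj (cis (- (\<xi> \<bullet> snd z)) * v (snd z))"
        by (simp add: mult_ac)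
    qed
    also have "\<dots> = (\<integral>x. (\<integral>y. (cis (- (\<xi> \<bullet> x)) * u x) * cnj (cis (- (\<xi> \<bullet> y)) * v y) \<partial>N2) \<partial>N1)"
      by (subst P.integral_fst'[symmetric, OF i]) simp
    also have "\<dots> = fourier_integral N1 u \<xi> * cnj (fourier_integral N2 v \<xi>)"
      unfolding fourier_integral_def Bochner_Integration.integral_cnj integral_mult_right_zero integral_mult_left_zero ..
    finally show ?thesis ..
  qed
  \<comment> \<open>The Gaussian in \<xi> makes the integrand absolutely integrable over all three
    variables, which permits the exchange of the frequency integral with the integral over pairs of
    points.\<close>
  have iQ: "integrable (?P \<Otimes>\<^sub>M lborel) (\<lambda>(z, \<xi>). ?g \<xi> * (?c \<xi> z * ?w z))"
  proof (rule Bochner_Integration.integrable_bound)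
    show "integrable (?P \<Otimes>\<^sub>M lborel) (\<lambda>p. ?w (fst p) * ?g (snd p))"
    proof (rule Q.integrable_product[OF w, of ?g])
      show "integrable lborel ?g"
        by (rule integrable_of_real[OF gaussian_integrable[OF \<open>0 < \<tau>\<close>]])
    qed
    show "AE p in ?P \<Otimes>\<^sub>M lborel. norm (case p of (z, \<xi>) \<Rightarrow> ?g \<xi> * (?c \<xi> z * ?w z)) \<le> norm (?w (fst p) * ?g (snd p))"
      by (intro AE_I2) (simp add: norm_mult split: prod.split)
    show "(\<lambda>(z, \<xi>). ?g \<xi> * (?c \<xi> z * ?w z)) \<in> borel_measurable (?P \<Otimes>\<^sub>M lborel)"
      by measurable
  qed
  have "(\<integral>\<xi>. ?g \<xi> * (fourier_integral N1 u \<xi> * cnj (fourier_integral N2 v \<xi>)) \<partial>lborel)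
      = (\<integral>\<xi>. (\<integral>z. ?g \<xi> * (?c \<xi> z * ?w z) \<partial>?P) \<partial>lborel)"
    unfolding prod integral_mult_right_zero ..
  also have "\<dots> = (\<integral>z. (\<integral>\<xi>. ?g \<xi> * (?c \<xi> z * ?w z) \<partial>lborel) \<partial>?P)"
    using Q.Fubini_integral[of "\<lambda>z \<xi>. ?g \<xi> * (?c \<xi> z * ?w z)"] iQ by simp
  also have "\<dots> = (\<integral>z. of_real ((pi / \<tau>) powr (DIM('a) / 2)) * (?w z * of_real (exp (- (norm (fst z - snd z))\<^sup>2 / (4 * \<tau>)))) \<partial>?P)"
  proof (rule Bochner_Integration.integral_cong[OF refl])
    fix z :: "'a \<times> 'a"
    have "(\<integral>\<xi>. ?g \<xi> * (?c \<xi> z * ?w z) \<partial>lborel) = (\<integral>\<xi>. (cis ((snd z - fst z) \<bullet> \<xi>) * ?g \<xi>) * ?w z \<partial>lborel)"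
      by (rule Bochner_Integration.integral_cong[OF refl]) (simp add: inner_commute inner_diff_left inner_diff_right)
    also have "\<dots> = (\<integral>\<xi>. cis ((snd z - fst z) \<bullet> \<xi>) * ?g \<xi> \<partial>lborel) * ?w z"
      by (rule integral_mult_left_zero)
    also have "\<dots> = of_real ((pi / \<tau>) powr (DIM('a) / 2)) * (?w z * of_real (exp (- (norm (fst z - snd z))\<^sup>2 / (4 * \<tau>))))"
      unfolding gaussian_fourier(2)[OF \<open>0 < \<tau>\<close>] by (simp add: norm_minus_commute)
    finally show "(\<integral>\<xi>. ?g \<xi> * (?c \<xi> z * ?w z) \<partial>lborel) = \<dots>" .
  qed
  also have "\<dots> = of_real ((pi / \<tau>) powr (DIM('a) / 2)) * (\<integral>z. ?w z * of_real (exp (- (norm (fst z - snd z))\<^sup>2 / (4 * \<tau>))) \<partial>?P)"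
    by (rule integral_mult_right_zero)
  finally show ?thesis .
qed

text \<open>By 2|u(x)||u(y)| <= |u(x)|^2 + |u(y)|^2 the double integral splits into two; in each the
  variable without u is integrated first, and the symmetry of K gives both the same bound A.
  Energies are thereby reduced to the mass of the kernel seen from one point.\<close>

lemma schur_test:
  fixes N :: "'a measure" and K :: "'a \<Rightarrow> 'a \<Rightarrow> real"
  assumes "sigma_finite_measure N" and u: "u \<in> L2_space N"
    and [measurable]: "(\<lambda>z. K (fst z) (snd z)) \<in> borel_measurable (N \<Otimes>\<^sub>M N)"
    and sym: "\<And>x y. K x y = K y x" and K: "\<And>x y. 0 \<le> K x y"
    and A: "\<And>x. x \<in> space N \<Longrightarrow> (\<integral>\<^sup>+y. ennreal (K x y) \<partial>N) \<le> ennreal A" and "0 \<le> A"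
  shows "(\<integral>\<^sup>+z. ennreal (cmod (u (fst z)) * cmod (u (snd z)) * K (fst z) (snd z)) \<partial>(N \<Otimes>\<^sub>M N)) \<le> ennreal (A * (L2_norm N u)\<^sup>2)"
proof -
  interpret N: sigma_finite_measure N by fact
  interpret P: pair_sigma_finite N N ..
  have [measurable]: "u \<in> borel_measurable N" using u by auto
  have K1 [measurable]: "(\<lambda>y. K x y) \<in> borel_measurable N" if "x \<in> space N" for x
    using measurable_Pair2[OF assms(3) that] by simp
  let ?q = "\<lambda>x. ennreal ((cmod (u x))\<^sup>2)"
  have half: "(\<integral>\<^sup>+x. (\<integral>\<^sup>+y. ?q x * ennreal (K x y) \<partial>N) \<partial>N) \<le> ennreal (A * (L2_norm N u)\<^sup>2)"
  proof -
    have "(\<integral>\<^sup>+x. (\<integral>\<^sup>+y. ?q x * ennreal (K x y) \<partial>N) \<partial>N) \<le> (\<integral>\<^sup>+x. ?q x * ennreal A \<partial>N)"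
      by (intro nn_integral_mono) (auto simp: nn_integral_cmult intro!: mult_left_mono A)
    also have "\<dots> = ennreal ((L2_norm N u)\<^sup>2) * ennreal A"
      using L2_norm_nn_integral[OF u] by (simp add: nn_integral_multc ennreal_power)
    finally show ?thesis using \<open>0 \<le> A\<close> by (simp add: ennreal_mult[symmetric] mult.commute)
  qed
  have "2 * (\<integral>\<^sup>+z. ennreal (cmod (u (fst z)) * cmod (u (snd z)) * K (fst z) (snd z)) \<partial>(N \<Otimes>\<^sub>M N))
      = (\<integral>\<^sup>+z. 2 * ennreal (cmod (u (fst z)) * cmod (u (snd z)) * K (fst z) (snd z)) \<partial>(N \<Otimes>\<^sub>M N))"
    by (simp add: nn_integral_cmult)
  also have "\<dots> \<le> (\<integral>\<^sup>+z. ?q (fst z) * ennreal (K (fst z) (snd z)) + ?q (snd z) * ennreal (K (fst z) (snd z)) \<partial>(N \<Otimes>\<^sub>M N))"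
  proof (rule nn_integral_mono)
    fix z :: "'a \<times> 'a"
    let ?a = "cmod (u (fst z))" and ?b = "cmod (u (snd z))" and ?k = "K (fst z) (snd z)"
    have "2 * (?a * ?b) \<le> ?a\<^sup>2 + ?b\<^sup>2"
      using zero_le_power2[of "?a - ?b"] unfolding power2_diff by linarith
    from mult_right_mono[OF this K[of "fst z" "snd z"]]
    have "ennreal (2 * (?a * ?b * ?k)) \<le> ennreal (?a\<^sup>2 * ?k + ?b\<^sup>2 * ?k)"
      by (intro ennreal_leI) (simp add: algebra_simps)
    then show "2 * ennreal (?a * ?b * ?k) \<le> ennreal (?a\<^sup>2) * ennreal ?k + ennreal (?b\<^sup>2) * ennreal ?k"
      using K by (simp add: ennreal_mult ennreal_plus)
  qed
  also have "\<dots> = (\<integral>\<^sup>+z. ?q (fst z) * ennreal (K (fst z) (snd z)) \<partial>(N \<Otimes>\<^sub>M N))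
      + (\<integral>\<^sup>+z. ?q (snd z) * ennreal (K (fst z) (snd z)) \<partial>(N \<Otimes>\<^sub>M N))"
    by (rule nn_integral_add) auto
  also have "(\<integral>\<^sup>+z. ?q (fst z) * ennreal (K (fst z) (snd z)) \<partial>(N \<Otimes>\<^sub>M N)) = (\<integral>\<^sup>+x. (\<integral>\<^sup>+y. ?q x * ennreal (K x y) \<partial>N) \<partial>N)"
    by (subst N.nn_integral_fst[symmetric]) auto
  also have "(\<integral>\<^sup>+z. ?q (snd z) * ennreal (K (fst z) (snd z)) \<partial>(N \<Otimes>\<^sub>M N)) = (\<integral>\<^sup>+y. (\<integral>\<^sup>+x. ?q y * ennreal (K y x) \<partial>N) \<partial>N)"
    by (subst P.nn_integral_snd[symmetric]) (auto simp: sym)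
  also have "(\<integral>\<^sup>+x. (\<integral>\<^sup>+y. ?q x * ennreal (K x y) \<partial>N) \<partial>N) + (\<integral>\<^sup>+y. (\<integral>\<^sup>+x. ?q y * ennreal (K y x) \<partial>N) \<partial>N)
    \<le> ennreal (A * (L2_norm N u)\<^sup>2) + ennreal (A * (L2_norm N u)\<^sup>2)"
    by (intro add_mono half)
  also have "\<dots> = 2 * ennreal (A * (L2_norm N u)\<^sup>2)" by (simp add: mult_2)
  finally show ?thesis
    using ennreal_mult_le_mult_iff[of 2] by simp
qed


section \<open>The Fourier transform on L2 and Sobolev norms\<close>

text \<open>The diagonal case of \<open>gaussian_fourier_product\<close> writes the Gaussian mean as
  an energy, to which \<open>schur_test\<close> applies.\<close>

lemma gaussian_energy_le:
  fixes N :: "'a::euclidean_space measure"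
  assumes N: "sigma_finite_measure N" and id [measurable]: "(\<lambda>x. x) \<in> borel_measurable N"
    and u: "integrable N u" "u \<in> L2_space N" and "0 < \<tau>" "0 \<le> A"
    and A: "\<And>x. x \<in> space N \<Longrightarrow> (\<integral>\<^sup>+y. ennreal (exp (- (norm (x - y))\<^sup>2 / (4 * \<tau>))) \<partial>N) \<le> ennreal A"
  shows "integrable lborel (\<lambda>\<xi>. exp (- \<tau> * (norm \<xi>)\<^sup>2) * (cmod (fourier_integral N u \<xi>))\<^sup>2)"
    and "(\<integral>\<xi>. exp (- \<tau> * (norm \<xi>)\<^sup>2) * (cmod (fourier_integral N u \<xi>))\<^sup>2 \<partial>lborel)
      \<le> (pi / \<tau>) powr (DIM('a) / 2) * (A * (L2_norm N u)\<^sup>2)"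
proof -
  let ?F = "fourier_integral N u"
  let ?K = "\<lambda>x y. exp (- (norm (x - y))\<^sup>2 / (4 * \<tau>))"
  have [measurable]: "u \<in> borel_measurable N" using u by auto
  have F [measurable]: "?F \<in> borel_measurable borel"
    by (rule fourier_integral_measurable[OF N id]) simp
  show int: "integrable lborel (\<lambda>\<xi>. exp (- \<tau> * (norm \<xi>)\<^sup>2) * (cmod (?F \<xi>))\<^sup>2)"
  proof (rule Bochner_Integration.integrable_bound)
    show "integrable lborel (\<lambda>\<xi>::'a. exp (- \<tau> * (norm \<xi>)\<^sup>2) * (\<integral>x. cmod (u x) \<partial>N)\<^sup>2)"
      by (intro integrable_mult_left gaussian_integrable \<open>0 < \<tau>\<close>)
    show "AE \<xi> in lborel. norm (exp (- \<tau> * (norm \<xi>)\<^sup>2) * (cmod (?F \<xi>))\<^sup>2)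
        \<le> norm (exp (- \<tau> * (norm \<xi>)\<^sup>2) * (\<integral>x. cmod (u x) \<partial>N)\<^sup>2)"
      by (intro AE_I2) (simp add: mult_left_mono power_mono fourier_integral_bound)
  qed simp
  let ?I = "\<integral>z. u (fst z) * cnj (u (snd z)) * of_real (?K (fst z) (snd z)) \<partial>(N \<Otimes>\<^sub>M N)"
  have "of_real (\<integral>\<xi>. exp (- \<tau> * (norm \<xi>)\<^sup>2) * (cmod (?F \<xi>))\<^sup>2 \<partial>lborel)
      = (\<integral>\<xi>. complex_of_real (exp (- \<tau> * (norm \<xi>)\<^sup>2)) * (?F \<xi> * cnj (?F \<xi>)) \<partial>lborel)"
    unfolding complex_norm_square[symmetric] of_real_mult[symmetric] of_real_power[symmetric]
    by (rule integral_complex_of_real[symmetric])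
  also have "\<dots> = of_real ((pi / \<tau>) powr (DIM('a) / 2)) * ?I"
    by (rule gaussian_fourier_product[OF N N id id u(1) u(1) \<open>0 < \<tau>\<close>])
  finally have eq: "complex_of_real (\<integral>\<xi>. exp (- \<tau> * (norm \<xi>)\<^sup>2) * (cmod (?F \<xi>))\<^sup>2 \<partial>lborel)
      = of_real ((pi / \<tau>) powr (DIM('a) / 2)) * ?I" .
  have "cmod ?I \<le> (\<integral>z. cmod (u (fst z)) * cmod (u (snd z)) * ?K (fst z) (snd z) \<partial>(N \<Otimes>\<^sub>M N))"
    by (rule order_trans[OF integral_norm_bound]) (simp add: norm_mult)
  also have "\<dots> = enn2real (\<integral>\<^sup>+z. ennreal (cmod (u (fst z)) * cmod (u (snd z)) * ?K (fst z) (snd z)) \<partial>(N \<Otimes>\<^sub>M N))"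
    by (rule integral_eq_nn_integral) auto
  also have "\<dots> \<le> A * (L2_norm N u)\<^sup>2"
  proof (rule enn2real_leI)
    show "(\<integral>\<^sup>+z. ennreal (cmod (u (fst z)) * cmod (u (snd z)) * ?K (fst z) (snd z)) \<partial>(N \<Otimes>\<^sub>M N))
        \<le> ennreal (A * (L2_norm N u)\<^sup>2)"
      by (rule schur_test[OF N u(2) _ _ _ A \<open>0 \<le> A\<close>]) (auto simp: norm_minus_commute)
  qed (use \<open>0 \<le> A\<close> in simp)
  finally have I: "cmod ?I \<le> A * (L2_norm N u)\<^sup>2" .
  have "(\<integral>\<xi>. exp (- \<tau> * (norm \<xi>)\<^sup>2) * (cmod (?F \<xi>))\<^sup>2 \<partial>lborel)
      = Re (complex_of_real (\<integral>\<xi>. exp (- \<tau> * (norm \<xi>)\<^sup>2) * (cmod (?F \<xi>))\<^sup>2 \<partial>lborel))" by simp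
  also have "\<dots> \<le> cmod (of_real ((pi / \<tau>) powr (DIM('a) / 2)) * ?I)"
    unfolding eq by (rule complex_Re_le_cmod)
  also have "\<dots> \<le> (pi / \<tau>) powr (DIM('a) / 2) * (A * (L2_norm N u)\<^sup>2)"
    unfolding norm_mult using I by (simp add: mult_left_mono)
  finally show "(\<integral>\<xi>. exp (- \<tau> * (norm \<xi>)\<^sup>2) * (cmod (?F \<xi>))\<^sup>2 \<partial>lborel)
      \<le> (pi / \<tau>) powr (DIM('a) / 2) * (A * (L2_norm N u)\<^sup>2)" .
qed

lemma id_measurable_lborel: "(\<lambda>x. x) \<in> borel_measurable lborel"
  by simp

text \<open>The inequality half of Plancherel's theorem: for Lebesgue measure the powers of \<tau>
  in the energy bound cancel, leaving (2 pi)^n, and Fatou's lemma lets \<tau> tend to 0.\<close>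

lemma fourier_integral_lborel_bessel:
  fixes u :: "'a::euclidean_space \<Rightarrow> complex"
  assumes u: "integrable lborel u" "u \<in> L2_space lborel"
  shows "(\<integral>\<^sup>+\<xi>. ennreal ((cmod (fourier_integral lborel u \<xi>))\<^sup>2) \<partial>lborel) \<le> ennreal ((2 * pi) powr DIM('a) * (L2_norm lborel u)\<^sup>2)"
proof -
  let ?F = "fourier_integral lborel u"
  define \<tau> where "\<tau> k = 1 / real (Suc k)" for k
  have \<tau>: "0 < \<tau> k" for k by (simp add: \<tau>_def)
  have [measurable]: "u \<in> borel_measurable borel" using u by auto
  have F [measurable]: "?F \<in> borel_measurable borel"
    by (rule fourier_integral_measurable[OF lborel.sigma_finite_measure_axioms id_measurable_lborel]) simp
  have step: "(\<integral>\<^sup>+\<xi>. ennreal (exp (- \<tau> k * (norm \<xi>)\<^sup>2) * (cmod (?F \<xi>))\<^sup>2) \<partial>lborel)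
      \<le> ennreal ((2 * pi) powr DIM('a) * (L2_norm lborel u)\<^sup>2)" for k
  proof -
    define A where "A = (pi * (4 * \<tau> k)) powr (DIM('a) / 2)"
    have "(\<integral>\<^sup>+y. ennreal (exp (- (norm (x - y))\<^sup>2 / (4 * \<tau> k))) \<partial>lborel) \<le> ennreal A" for x :: 'a
      using gaussian_nn_integral[of "1 / (4 * \<tau> k)" x] \<tau>[of k] by (simp add: A_def norm_minus_commute)
    note e = gaussian_energy_le[OF lborel.sigma_finite_measure_axioms id_measurable_lborel u \<tau>[of k] _ this]
    have A0: "0 \<le> A" by (simp add: A_def)
    have "(\<integral>\<^sup>+\<xi>. ennreal (exp (- \<tau> k * (norm \<xi>)\<^sup>2) * (cmod (?F \<xi>))\<^sup>2) \<partial>lborel)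
      = ennreal (\<integral>\<xi>. exp (- \<tau> k * (norm \<xi>)\<^sup>2) * (cmod (?F \<xi>))\<^sup>2 \<partial>lborel)"
      by (rule nn_integral_eq_integral[OF e(1)]) (use A0 in auto)
    also have "\<dots> \<le> ennreal ((pi / \<tau> k) powr (DIM('a) / 2) * (A * (L2_norm lborel u)\<^sup>2))"
      by (intro ennreal_leI e(2) A0)
    also have "(pi / \<tau> k) powr (DIM('a) / 2) * (A * (L2_norm lborel u)\<^sup>2)
        = (pi / \<tau> k * (pi * (4 * \<tau> k))) powr (DIM('a) / 2) * (L2_norm lborel u)\<^sup>2"
      using \<tau>[of k] by (subst powr_mult) (auto simp: A_def)
    also have "pi / \<tau> k * (pi * (4 * \<tau> k)) = (2 * pi) powr 2"
      using \<tau>[of k] by (simp add: power2_eq_square)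
    also have "((2 * pi) powr 2) powr (DIM('a) / 2) = (2 * pi) powr DIM('a)"
      by (simp only: powr_powr) simp
    finally show ?thesis .
  qed
  have "(\<integral>\<^sup>+\<xi>. ennreal ((cmod (?F \<xi>))\<^sup>2) \<partial>lborel)
      = (\<integral>\<^sup>+\<xi>. liminf (\<lambda>k. ennreal (exp (- \<tau> k * (norm \<xi>)\<^sup>2) * (cmod (?F \<xi>))\<^sup>2)) \<partial>lborel)"
  proof (rule nn_integral_cong)
    fix \<xi> :: 'a
    have "\<tau> \<longlonglongrightarrow> 0"
      unfolding \<tau>_def using LIMSEQ_inverse_real_of_nat by (simp add: inverse_eq_divide)
    then have "(\<lambda>k. ennreal (exp (- \<tau> k * (norm \<xi>)\<^sup>2) * (cmod (?F \<xi>))\<^sup>2)) \<longlonglongrightarrow> ennreal (exp (- 0 * (norm \<xi>)\<^sup>2) * (cmod (?F \<xi>))\<^sup>2)"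
      by (intro tendsto_intros tendsto_ennrealI)
    from lim_imp_Liminf[OF sequentially_bot this]
    show "ennreal ((cmod (?F \<xi>))\<^sup>2) = liminf (\<lambda>k. ennreal (exp (- \<tau> k * (norm \<xi>)\<^sup>2) * (cmod (?F \<xi>))\<^sup>2))"
      by simp
  qed
  also have "\<dots> \<le> liminf (\<lambda>k. \<integral>\<^sup>+\<xi>. ennreal (exp (- \<tau> k * (norm \<xi>)\<^sup>2) * (cmod (?F \<xi>))\<^sup>2) \<partial>lborel)"
    by (rule nn_integral_liminf) auto
  also have "\<dots> \<le> liminf (\<lambda>k::nat. ennreal ((2 * pi) powr DIM('a) * (L2_norm lborel u)\<^sup>2))"
    by (intro Liminf_mono always_eventually allI step)
  also have "\<dots> = ennreal ((2 * pi) powr DIM('a) * (L2_norm lborel u)\<^sup>2)"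
    by (simp add: Liminf_const)
  finally show ?thesis .
qed

lemma fourier_L1_eq: "fourier_L1 f \<xi> = of_real ((2 * pi) powr (- real DIM('a) / 2)) * fourier_integral lborel f (\<xi>::'a::euclidean_space)"
  by (simp add: fourier_L1_def fourier_integral_def)

lemma fourier_L1_bessel:
  fixes u :: "'a::euclidean_space \<Rightarrow> complex"
  assumes u: "integrable lborel u" "u \<in> L2_space lborel"
  shows "fourier_L1 u \<in> L2_space lborel" "L2_norm lborel (fourier_L1 u) \<le> L2_norm lborel u"
proof -
  have [measurable]: "u \<in> borel_measurable borel" using u by auto
  have F [measurable]: "fourier_integral lborel u \<in> borel_measurable borel"
    by (rule fourier_integral_measurable[OF lborel.sigma_finite_measure_axioms id_measurable_lborel]) simp
  have m [measurable]: "fourier_L1 u \<in> borel_measurable borel"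
    unfolding fourier_L1_eq[abs_def] by measurable
  let ?c = "(2 * pi) powr (- real DIM('a) / 2)"
  have "(\<integral>\<^sup>+\<xi>. ennreal ((cmod (fourier_L1 u \<xi>))\<^sup>2) \<partial>lborel) = ennreal (?c\<^sup>2) * (\<integral>\<^sup>+\<xi>. ennreal ((cmod (fourier_integral lborel u \<xi>))\<^sup>2) \<partial>lborel)"
    unfolding fourier_L1_eq norm_mult power_mult_distrib norm_of_real power2_abs
    by (subst nn_integral_cmult[symmetric]) (auto simp: ennreal_mult)
  also have "\<dots> \<le> ennreal (?c\<^sup>2) * ennreal ((2 * pi) powr DIM('a) * (L2_norm lborel u)\<^sup>2)"
    by (intro mult_left_mono fourier_integral_lborel_bessel u) simp
  also have "\<dots> = ennreal ((?c\<^sup>2 * (2 * pi) powr DIM('a)) * (L2_norm lborel u)\<^sup>2)"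
    by (simp add: ennreal_mult[symmetric] mult.assoc)
  also have "?c\<^sup>2 * (2 * pi) powr DIM('a) = 1"
    by (simp add: power2_eq_square powr_add[symmetric])
  finally have *: "(\<integral>\<^sup>+\<xi>. ennreal ((cmod (fourier_L1 u \<xi>))\<^sup>2) \<partial>lborel) \<le> ennreal ((L2_norm lborel u)\<^sup>2)"
    by simp
  show L: "fourier_L1 u \<in> L2_space lborel"
    unfolding L2_space_def using le_less_trans[OF * ennreal_less_top] by (auto intro!: integrableI_bounded)
  have "ennreal ((L2_norm lborel (fourier_L1 u))\<^sup>2) \<le> ennreal ((L2_norm lborel u)\<^sup>2)"
    using * L2_norm_nn_integral[OF L] by (simp add: ennreal_power)
  then have "(L2_norm lborel (fourier_L1 u))\<^sup>2 \<le> (L2_norm lborel u)\<^sup>2"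
    by (subst (asm) ennreal_le_iff) auto
  then show "L2_norm lborel (fourier_L1 u) \<le> L2_norm lborel u"
    by (rule power2_le_imp_le) simp
qed

lemma fourier_L1_add:
  assumes "integrable lborel f" "integrable lborel g"
  shows "fourier_L1 (\<lambda>x. f x + g x) \<xi> = fourier_L1 f \<xi> + fourier_L1 g \<xi>"
  unfolding fourier_L1_eq fourier_integral_def
  using integrable_cis_mult[OF id_measurable_lborel assms(1), of \<xi>]
    integrable_cis_mult[OF id_measurable_lborel assms(2), of \<xi>]
  by (simp add: distrib_left)

lemma fourier_L1_scale: "fourier_L1 (\<lambda>x. c * f x) \<xi> = c * fourier_L1 f \<xi>"
proof -
  have "(\<lambda>x. cis (- (\<xi> \<bullet> x)) * (c * f x)) = (\<lambda>x. c * (cis (- (\<xi> \<bullet> x)) * f x))"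
    by (simp add: mult_ac)
  then show ?thesis
    by (simp add: fourier_L1_eq fourier_integral_def)
qed

lemma fourier_L1_diff:
  assumes "integrable lborel f" "integrable lborel g"
  shows "fourier_L1 (\<lambda>x. f x - g x) \<xi> = fourier_L1 f \<xi> - fourier_L1 g \<xi>"
  using fourier_L1_add[OF assms(1) integrable_mult_right[OF assms(2), of "-1"]] fourier_L1_scale[of "-1" g] by simp

section \<open>Existence and uniqueness of the Fourier transform on L2\<close>

lemma has_fourier_L2_norm_le:
  assumes "has_fourier_L2 f g" shows "L2_norm lborel g \<le> L2_norm lborel f"
proof -
  obtain u where u: "\<And>k. integrable lborel (u k)" "L2_tendsto lborel u f" "L2_tendsto lborel (\<lambda>k. fourier_L1 (u k)) g"
    using assms by (auto simp: has_fourier_L2_def)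
  show ?thesis
  proof (rule LIMSEQ_le[OF L2_tendsto_norm[OF u(3)] L2_tendsto_norm[OF u(2)]])
    show "\<exists>N. \<forall>n\<ge>N. L2_norm lborel (fourier_L1 (u n)) \<le> L2_norm lborel (u n)"
      using u(2) by (auto intro!: fourier_L1_bessel u(1) simp: L2_tendsto_def)
  qed
qed

lemma has_fourier_L2_diff:
  assumes "has_fourier_L2 f g" "has_fourier_L2 f' g'"
  shows "has_fourier_L2 (\<lambda>x. f x - f' x) (\<lambda>x. g x - g' x)"
proof -
  obtain u v where u: "\<And>k. integrable lborel (u k)" "L2_tendsto lborel u f" "L2_tendsto lborel (\<lambda>k. fourier_L1 (u k)) g"
    and v: "\<And>k. integrable lborel (v k)" "L2_tendsto lborel v f'" "L2_tendsto lborel (\<lambda>k. fourier_L1 (v k)) g'"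
    using assms unfolding has_fourier_L2_def by blast
  have "L2_tendsto lborel (\<lambda>k. fourier_L1 (\<lambda>x. u k x - v k x)) (\<lambda>x. g x - g' x)"
    unfolding fourier_L1_diff[OF u(1) v(1), abs_def] by (rule L2_tendsto_diff[OF u(3) v(3)])
  then show ?thesis
    unfolding has_fourier_L2_def using u(1) v(1) L2_tendsto_diff[OF u(2) v(2)]
    by (intro exI[of _ "\<lambda>k x. u k x - v k x"]) auto
qed

lemma has_fourier_L2_in_L2:
  assumes "has_fourier_L2 f g" shows "f \<in> L2_space lborel" "g \<in> L2_space lborel"
  using assms by (auto simp: has_fourier_L2_def L2_tendsto_def)

text \<open>The difference of the two transforms is a transform of f - f = 0, and transforms do not
  increase the L2 norm. Hence the choice made in \<open>fourier_L2\<close> is determined almost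
  everywhere.\<close>

lemma has_fourier_L2_unique:
  assumes "has_fourier_L2 f g" "has_fourier_L2 f g'"
  shows "AE \<xi> in lborel. g \<xi> = g' \<xi>"
proof -
  note d = has_fourier_L2_diff[OF assms]
  have "L2_norm lborel (\<lambda>x. g x - g' x) \<le> 0"
    using has_fourier_L2_norm_le[OF d] by (simp add: L2_norm_def)
  then have "L2_norm lborel (\<lambda>x. g x - g' x) = 0"
    using L2_norm_nonneg[of lborel "\<lambda>x. g x - g' x"] by linarith
  from L2_norm_eq_0_AE[OF has_fourier_L2_in_L2(2)[OF d] this] show ?thesis by simp
qed

lemma L2_truncation:
  fixes f :: "'a::euclidean_space \<Rightarrow> complex"
  assumes f: "f \<in> L2_space lborel"
  defines "v \<equiv> \<lambda>k x. indicator (ball 0 (real k)) x * f x"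
  shows "integrable lborel (v k)" "v k \<in> L2_space lborel" "L2_tendsto lborel v f"
proof -
  have [measurable]: "f \<in> borel_measurable borel" and f2: "integrable lborel (\<lambda>x. (cmod (f x))\<^sup>2)"
    using f by auto
  have [measurable]: "v k \<in> borel_measurable lborel" for k
    unfolding v_def by (intro borel_measurable_times borel_measurable_indicator) simp_all
  show "integrable lborel (v k)" for k
  proof (rule Bochner_Integration.integrable_bound)
    show "integrable lborel (\<lambda>x. indicator (ball 0 (real k)) x + (cmod (f x))\<^sup>2)"
      by (intro Bochner_Integration.integrable_add f2 integrable_real_indicator) (auto simp: emeasure_ball)
    have "a \<le> 1 + a\<^sup>2" for a :: real
      using zero_le_power2[of "a - 1/2"] by (simp add: power2_eq_square algebra_simps)
    then show "AE x in lborel. norm (v k x) \<le> norm (indicator (ball 0 (real k)) x + (cmod (f x))\<^sup>2 :: real)"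
      by (intro AE_I2) (auto simp: v_def indicator_def)
    show "v k \<in> borel_measurable lborel" by measurable
  qed
  show v2: "v k \<in> L2_space lborel" for k
  proof (rule L2_spaceI_bound[OF _ f2])
    show "v k \<in> borel_measurable lborel" by measurable
    show "AE x in lborel. (cmod (v k x))\<^sup>2 \<le> (cmod (f x))\<^sup>2"
      by (intro AE_I2) (auto simp: v_def indicator_def)
  qed
  have "(\<lambda>k. \<integral>x. (cmod (v k x - f x))\<^sup>2 \<partial>lborel) \<longlonglongrightarrow> (\<integral>x. 0 \<partial>(lborel :: 'a measure))"
  proof (rule integral_dominated_convergence[OF _ _ f2])
    show "AE x in lborel. (\<lambda>k. (cmod (v k x - f x))\<^sup>2) \<longlonglongrightarrow> 0"
    proof (rule AE_I2)
      fix x :: 'a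
      obtain K :: nat where K: "norm x < real K" using reals_Archimedean2 by blast
      have "\<forall>\<^sub>F k in sequentially. (cmod (v k x - f x))\<^sup>2 = 0"
        using eventually_ge_at_top[of K]
        by eventually_elim (use K in \<open>auto simp: v_def indicator_def\<close>)
      then show "(\<lambda>k. (cmod (v k x - f x))\<^sup>2) \<longlonglongrightarrow> 0"
        by (rule tendsto_eventually)
    qed
    show "AE x in lborel. norm ((cmod (v k x - f x))\<^sup>2) \<le> (cmod (f x))\<^sup>2" for k
      by (intro AE_I2) (auto simp: v_def indicator_def)
    show "(\<lambda>x. (cmod (v k x - f x))\<^sup>2) \<in> borel_measurable lborel" for k
      by measurable
  qed simp
  then have "(\<lambda>k. L2_norm lborel (\<lambda>x. v k x - f x)) \<longlonglongrightarrow> 0"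
    unfolding L2_norm_def by (auto intro!: tendsto_eq_intros)
  then show "L2_tendsto lborel v f"
    using v2 f by (auto simp: L2_tendsto_def)
qed

text \<open>Truncations to balls are integrable and approximate f. Along a fast subsequence the
  contraction property makes their transforms rapidly Cauchy in L2.\<close>

lemma has_fourier_L2_exists:
  fixes f :: "'a::euclidean_space \<Rightarrow> complex"
  assumes f: "f \<in> L2_space lborel" shows "\<exists>g. has_fourier_L2 f g"
proof -
  define v where "v = (\<lambda>k x. indicator (ball 0 (real k)) x * f x)"
  have v: "\<And>k. integrable lborel (v k)" "\<And>k. v k \<in> L2_space lborel" "(\<lambda>k. L2_norm lborel (\<lambda>x. v k x - f x)) \<longlonglongrightarrow> 0"
    using L2_truncation[OF f] by (auto simp: v_def L2_tendsto_def)
  \<comment> \<open>The error (1/2)^k / 2 makes consecutive approximations differ by at most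
    (1/2)^k, the rate asked for by \<open>L2_rapidly_Cauchy_convergent\<close>.\<close>
  have "\<exists>n. L2_norm lborel (\<lambda>x. v n x - f x) < (1/2)^k / 2" for k :: nat
    using order_tendstoD(2)[OF v(3), of "(1/2)^k / 2"] by (auto simp: eventually_sequentially)
  then obtain n where n: "\<And>k. L2_norm lborel (\<lambda>x. v (n k) x - f x) < (1/2)^k / 2" by metis
  define u where "u k = v (n k)" for k
  have u: "\<And>k. integrable lborel (u k)" "\<And>k. u k \<in> L2_space lborel"
    using v by (auto simp: u_def)
  have "L2_norm lborel (\<lambda>x. fourier_L1 (u (Suc k)) x - fourier_L1 (u k) x) \<le> (1/2) ^ k" for k
  proof -
    have "L2_norm lborel (\<lambda>x. fourier_L1 (u (Suc k)) x - fourier_L1 (u k) x)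
      = L2_norm lborel (fourier_L1 (\<lambda>x. u (Suc k) x - u k x))"
      by (simp add: fourier_L1_diff[OF u(1) u(1), abs_def])
    also have "\<dots> \<le> L2_norm lborel (\<lambda>x. u (Suc k) x - u k x)"
      by (rule fourier_L1_bessel) (use u in auto)
    also have "\<dots> \<le> L2_norm lborel (\<lambda>x. u (Suc k) x - f x) + L2_norm lborel (\<lambda>x. f x - u k x)"
      by (rule L2_triangle3[OF u(2) f u(2)])
    also have "\<dots> \<le> (1/2)^(Suc k) / 2 + (1/2)^k / 2"
      using n[of k] n[of "Suc k"] L2_norm_minus_commute[of lborel f "u k"] unfolding u_def by linarith
    also have "\<dots> \<le> (1/2)^k" by simp
    finally show ?thesis .
  qed
  from L2_rapidly_Cauchy_convergent[OF fourier_L1_bessel(1)[OF u] this]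
  obtain g where g: "L2_tendsto lborel (\<lambda>k. fourier_L1 (u k)) g" by blast
  have "(\<lambda>k. L2_norm lborel (\<lambda>x. u k x - f x)) \<longlonglongrightarrow> 0"
  proof (rule Lim_null_comparison)
    show "\<forall>\<^sub>F k in sequentially. norm (L2_norm lborel (\<lambda>x. u k x - f x)) \<le> (1/2)^k / 2"
      using n by (intro always_eventually) (simp add: u_def less_imp_le)
    show "(\<lambda>k. (1/2::real)^k / 2) \<longlonglongrightarrow> 0"
      by (intro tendsto_divide_zero LIMSEQ_power_zero) simp
  qed
  then have "L2_tendsto lborel u f"
    using u f by (auto simp: L2_tendsto_def)
  then show ?thesis
    using g u by (auto simp: has_fourier_L2_def)
qed

lemma fourier_L2_has: "f \<in> L2_space lborel \<Longrightarrow> has_fourier_L2 f (fourier_L2 f)"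
  unfolding fourier_L2_def by (rule someI_ex[OF has_fourier_L2_exists])

text \<open>An integrable L2 function serves as its own constant approximating sequence.\<close>

lemma fourier_L2_eq_L1:
  assumes "integrable lborel f" "f \<in> L2_space lborel"
  shows "AE \<xi> in lborel. fourier_L2 f \<xi> = fourier_L1 f \<xi>"
proof (rule has_fourier_L2_unique[OF fourier_L2_has[OF assms(2)]])
  show "has_fourier_L2 f (fourier_L1 f)"
    unfolding has_fourier_L2_def L2_tendsto_def
    by (rule exI[of _ "\<lambda>_. f"]) (use assms fourier_L1_bessel(1)[OF assms] in \<open>simp add: L2_norm_def\<close>)
qed

lemma fourier_L2_diff:
  assumes "f \<in> L2_space lborel" "g \<in> L2_space lborel"
  shows "AE \<xi> in lborel. fourier_L2 (\<lambda>x. f x - g x) \<xi> = fourier_L2 f \<xi> - fourier_L2 g \<xi>"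
  by (rule has_fourier_L2_unique[OF fourier_L2_has has_fourier_L2_diff])
     (use assms in \<open>auto intro: fourier_L2_has\<close>)

text \<open>The square root of the usual weight, so that the Sobolev norm is the plain L2 norm of
  weight times transform and all L2 inequalities apply.\<close>

definition sobolev_weight :: "real \<Rightarrow> 'a::euclidean_space \<Rightarrow> real" where
  "sobolev_weight s \<xi> = (1 + (norm \<xi>)\<^sup>2) powr (s / 2)"

lemma sobolev_weight_measurable [measurable]: "sobolev_weight s \<in> borel_measurable borel"
  unfolding sobolev_weight_def by measurable

lemma sobolev_weight_power2: "(sobolev_weight s \<xi>)\<^sup>2 = (1 + (norm \<xi>)\<^sup>2) powr s"
  by (simp add: sobolev_weight_def power2_eq_square powr_add[symmetric])

lemma sobolev_weight_minus: "sobolev_weight (- s) \<xi> * sobolev_weight s \<xi> = 1"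
proof -
  have "1 + (norm \<xi>)\<^sup>2 \<noteq> 0" by (simp add: add_pos_nonneg[THEN less_imp_neq, symmetric])
  then show ?thesis by (simp add: sobolev_weight_def powr_add[symmetric])
qed

lemma weighted_power2:
  "(cmod (of_real (sobolev_weight s \<xi>) * z))\<^sup>2 = (1 + (norm \<xi>)\<^sup>2) powr s * (cmod z)\<^sup>2"
  by (simp add: norm_mult power_mult_distrib sobolev_weight_power2)

lemma sobolev_space_iff:
  "\<phi> \<in> sobolev_space s \<longleftrightarrow> \<phi> \<in> L2_space lborel \<and> (\<lambda>\<xi>. of_real (sobolev_weight s \<xi>) * fourier_L2 \<phi> \<xi>) \<in> L2_space lborel"
proof -
  have "fourier_L2 \<phi> \<in> borel_measurable borel" if "\<phi> \<in> L2_space lborel"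
    using has_fourier_L2_in_L2(2)[OF fourier_L2_has[OF that]] by auto
  then show ?thesis
    by (auto simp: sobolev_space_def L2_space_def[of lborel] weighted_power2)
qed

lemma sobolev_norm_eq: "sobolev_norm s \<phi> = L2_norm lborel (\<lambda>\<xi>. of_real (sobolev_weight s \<xi>) * fourier_L2 \<phi> \<xi>)"
  by (simp add: sobolev_norm_def L2_norm_def weighted_power2)

lemma sobolev_norm_nonneg [simp]: "0 \<le> sobolev_norm s \<phi>"
  by (simp add: sobolev_norm_eq)

lemma sobolev_norm_L1:
  assumes "integrable lborel \<phi>" "\<phi> \<in> L2_space lborel"
  shows "\<phi> \<in> sobolev_space s \<longleftrightarrow> (\<lambda>\<xi>. of_real (sobolev_weight s \<xi>) * fourier_L1 \<phi> \<xi>) \<in> L2_space lborel"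
    and "sobolev_norm s \<phi> = L2_norm lborel (\<lambda>\<xi>. of_real (sobolev_weight s \<xi>) * fourier_L1 \<phi> \<xi>)"
proof -
  have [measurable]: "fourier_L2 \<phi> \<in> borel_measurable borel" "fourier_L1 \<phi> \<in> borel_measurable borel"
    using has_fourier_L2_in_L2(2)[OF fourier_L2_has[OF assms(2)]] fourier_L1_bessel(1)[OF assms] by auto
  note ae = fourier_L2_eq_L1[OF assms]
  show "\<phi> \<in> sobolev_space s \<longleftrightarrow> (\<lambda>\<xi>. of_real (sobolev_weight s \<xi>) * fourier_L1 \<phi> \<xi>) \<in> L2_space lborel"
  proof -
    have "integrable lborel (\<lambda>\<xi>. (cmod (of_real (sobolev_weight s \<xi>) * fourier_L2 \<phi> \<xi>))\<^sup>2)
      \<longleftrightarrow> integrable lborel (\<lambda>\<xi>. (cmod (of_real (sobolev_weight s \<xi>) * fourier_L1 \<phi> \<xi>))\<^sup>2)"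
      by (rule integrable_cong_AE) (use ae in \<open>auto elim: eventually_mono\<close>)
    then show ?thesis
      unfolding sobolev_space_iff using assms(2) by (auto simp: L2_space_def)
  qed
  show "sobolev_norm s \<phi> = L2_norm lborel (\<lambda>\<xi>. of_real (sobolev_weight s \<xi>) * fourier_L1 \<phi> \<xi>)"
    unfolding sobolev_norm_eq by (rule L2_norm_cong_AE) (use ae in \<open>auto elim: eventually_mono\<close>)
qed

text \<open>\<open>fourier_L2\<close> is known to be additive only almost everywhere, so the L2
  triangle inequality is transported through \<open>L2_norm_cong_AE\<close>.\<close>

lemma sobolev_diff:
  assumes "\<phi> \<in> sobolev_space s" "\<psi> \<in> sobolev_space s"
  shows "sobolev_norm s \<phi> \<le> sobolev_norm s \<psi> + sobolev_norm s (\<lambda>x. \<phi> x - \<psi> x)"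
proof -
  let ?W = "\<lambda>f \<xi>. of_real (sobolev_weight s \<xi>) * fourier_L2 f \<xi>"
  have L: "\<phi> \<in> L2_space lborel" "?W \<phi> \<in> L2_space lborel" "\<psi> \<in> L2_space lborel" "?W \<psi> \<in> L2_space lborel"
    using assms by (auto simp: sobolev_space_iff)
  have [measurable]: "fourier_L2 (\<lambda>x. \<phi> x - \<psi> x) \<in> borel_measurable borel"
    using has_fourier_L2_in_L2(2)[OF fourier_L2_has[OF L2_space_diff[OF L(1,3)]]] by auto
  have "sobolev_norm s (\<lambda>x. \<phi> x - \<psi> x) = L2_norm lborel (\<lambda>\<xi>. ?W \<phi> \<xi> - ?W \<psi> \<xi>)"
    unfolding sobolev_norm_eq
    by (rule L2_norm_cong_AE)
       (use L2_space_diff[OF L(2,4)] fourier_L2_diff[OF L(1,3)] in \<open>auto elim!: eventually_mono simp: right_diff_distrib\<close>)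
  then show ?thesis
    using L2_triangle[OF L(4) L2_space_diff[OF L(2,4)]] unfolding sobolev_norm_eq by simp
qed


section \<open>Pairing Sobolev functions with measures\<close>

text \<open>The Gaussian kernel, of width of order sqrt \<epsilon>, is an approximate identity of
  total mass (2 pi)^n. Uniform continuity makes one \<epsilon> serve all points, so the estimate
  survives integration against an integrable density on any measure.\<close>

lemma gaussian_mean_approx:
  fixes \<phi> :: "'a::euclidean_space \<Rightarrow> complex"
  assumes uc: "uniformly_continuous_on UNIV \<phi>" and B: "\<And>x. cmod (\<phi> x) \<le> B" and "0 < \<eta>"
  shows "\<exists>\<epsilon>>0. \<forall>x. cmod (of_real ((pi / \<epsilon>) powr (DIM('a) / 2)) * (\<integral>y. \<phi> y * of_real (exp (- (norm (y - x))\<^sup>2 / (4 * \<epsilon>))) \<partial>lborel)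
      - of_real ((2 * pi) powr DIM('a)) * \<phi> x) \<le> \<eta>"
proof -
  define c1 where "c1 = (2 * pi) powr DIM('a)"
  define c2 where "c2 = (8 * pi\<^sup>2) powr (DIM('a) / 2)"
  have c: "0 < c1" "0 < c2" by (auto simp: c1_def c2_def)
  have B0: "0 \<le> B" using order_trans[OF norm_ge_zero B[of 0]] .
  have [measurable]: "\<phi> \<in> borel_measurable borel"
    by (rule borel_measurable_continuous_onI[OF uniformly_continuous_imp_continuous[OF uc]])
  obtain \<delta> where \<delta>: "0 < \<delta>" "\<And>x y. dist y x < \<delta> \<Longrightarrow> dist (\<phi> y) (\<phi> x) < \<eta> / (2 * c1)"
  proof -
    have "0 < \<eta> / (2 * c1)" using \<open>0 < \<eta>\<close> c by simp
    then show ?thesis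
      using uc that unfolding uniformly_continuous_on_def by blast
  qed
  \<comment> \<open>D * \<epsilon> is the contribution of points at distance at least \<delta>;
    \<epsilon> is then chosen to make it at most \<eta> / 2.\<close>
  define D where "D = 16 * B / \<delta>\<^sup>2 * c2"
  have D0: "0 \<le> D" using B0 c by (simp add: D_def)
  define \<epsilon> where "\<epsilon> = \<eta> / (2 * (D + 1))"
  have e: "0 < \<epsilon>" using \<open>0 < \<eta>\<close> D0 by (simp add: \<epsilon>_def)
  have De: "D * \<epsilon> \<le> \<eta> / 2"
    using D0 \<open>0 < \<eta>\<close> by (simp add: \<epsilon>_def field_simps)
  let ?k = "(pi / \<epsilon>) powr (DIM('a) / 2)"
  have k1: "?k * (pi / (1 / (4 * \<epsilon>))) powr (DIM('a) / 2) = c1"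
  proof -
    have "?k * (pi / (1 / (4 * \<epsilon>))) powr (DIM('a) / 2) = ((2 * pi) powr 2) powr (DIM('a) / 2)"
      using e by (subst powr_mult[symmetric]) (simp add: power2_eq_square mult_ac)
    also have "\<dots> = c1"
      unfolding c1_def by (simp only: powr_powr) simp
    finally show ?thesis .
  qed
  have k2: "?k * (pi / (1 / (8 * \<epsilon>))) powr (DIM('a) / 2) = c2"
    using e by (subst powr_mult[symmetric]) (simp add: power2_eq_square c2_def mult_ac)
  have "cmod (of_real ?k * (\<integral>y. \<phi> y * of_real (exp (- (norm (y - x))\<^sup>2 / (4 * \<epsilon>))) \<partial>lborel)
      - of_real c1 * \<phi> x) \<le> \<eta>" for x
  proof -
    define g where "g y = exp (- (1 / (4 * \<epsilon>)) * (norm (y - x))\<^sup>2)" for y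
    define g2 where "g2 y = exp (- (1 / (8 * \<epsilon>)) * (norm (y - x))\<^sup>2)" for y
    have [measurable]: "g \<in> borel_measurable borel" "g2 \<in> borel_measurable borel"
      unfolding g_def g2_def by measurable
    have ig: "integrable lborel g" "(\<integral>y. g y \<partial>lborel) = (pi / (1 / (4 * \<epsilon>))) powr (DIM('a) / 2)"
      unfolding g_def using e by (intro gaussian_integral_shift; simp)+
    have ig2: "integrable lborel g2" "(\<integral>y. g2 y \<partial>lborel) = (pi / (1 / (8 * \<epsilon>))) powr (DIM('a) / 2)"
      unfolding g2_def using e by (intro gaussian_integral_shift; simp)+
    have iog: "integrable lborel (\<lambda>y. complex_of_real (g y))"
      by (rule integrable_of_real[OF ig(1)])
    have ipg: "integrable lborel (\<lambda>y. \<phi> y * of_real (g y))"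
    proof (rule Bochner_Integration.integrable_bound)
      show "integrable lborel (\<lambda>y. B * g y)" using ig by simp
      show "AE y in lborel. norm (\<phi> y * of_real (g y)) \<le> norm (B * g y)"
        using B B0 by (intro AE_I2) (auto simp: norm_mult g_def intro!: mult_right_mono)
    qed simp
    \<comment> \<open>Near x the modulus of continuity is used. Far from x the Gaussian is split
      into two equal factors: one, by v exp(-v/(8 \<epsilon>)) <= 8 \<epsilon>, supplies the small
      factor \<epsilon>, the other remains as the integrable Gaussian \<open>g2\<close>.\<close>
    have pw: "cmod ((\<phi> y - \<phi> x) * of_real (g y)) \<le> \<eta> / (2 * c1) * g y + 16 * B * \<epsilon> / \<delta>\<^sup>2 * g2 y" for y
    proof (cases "dist y x < \<delta>")
      case True
      then have "cmod (\<phi> y - \<phi> x) \<le> \<eta> / (2 * c1)"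
        using \<delta>(2)[OF True] by (simp add: dist_norm)
      then have "cmod (\<phi> y - \<phi> x) * g y \<le> \<eta> / (2 * c1) * g y"
        by (intro mult_right_mono) (auto simp: g_def)
      moreover have "0 \<le> 16 * B * \<epsilon> / \<delta>\<^sup>2 * g2 y"
        using B0 e by (simp add: g2_def)
      ultimately show ?thesis by (simp add: norm_mult g_def)
    next
      case False
      define v where "v = (norm (y - x))\<^sup>2"
      have v: "\<delta>\<^sup>2 \<le> v"
        unfolding v_def using False \<delta>(1) by (intro power_mono) (auto simp: dist_norm)
      have g: "g y = exp (- (v / (8 * \<epsilon>))) * g2 y"
        using e by (simp add: g_def g2_def v_def exp_add[symmetric] field_simps)
      have "v / (8 * \<epsilon>) \<le> exp (v / (8 * \<epsilon>))"
        using exp_ge_add_one_self[of "v / (8 * \<epsilon>)"] by linarith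
      then have "v / (8 * \<epsilon>) * exp (- (v / (8 * \<epsilon>))) \<le> exp (v / (8 * \<epsilon>)) * exp (- (v / (8 * \<epsilon>)))"
        by (intro mult_right_mono) auto
      also have "\<dots> = 1" by (simp flip: exp_add)
      finally have "v / (8 * \<epsilon>) * exp (- (v / (8 * \<epsilon>))) \<le> 1" .
      then have vexp: "v * exp (- (v / (8 * \<epsilon>))) \<le> 8 * \<epsilon>"
        using e by (simp add: field_simps)
      have "cmod (\<phi> y - \<phi> x) \<le> 2 * B"
        using norm_triangle_ineq4[of "\<phi> y" "\<phi> x"] B[of x] B[of y] by linarith
      also have "\<dots> \<le> 2 * B * (v / \<delta>\<^sup>2)"
        using mult_left_mono[of 1 "v / \<delta>\<^sup>2" "2 * B"] v B0 \<delta>(1) by simp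
      finally have "cmod (\<phi> y - \<phi> x) * g y \<le> 2 * B * (v / \<delta>\<^sup>2) * g y"
        by (intro mult_right_mono) (auto simp: g_def)
      also have "\<dots> = 2 * B / \<delta>\<^sup>2 * g2 y * (v * exp (- (v / (8 * \<epsilon>))))"
        unfolding g by simp
      also have "\<dots> \<le> 2 * B / \<delta>\<^sup>2 * g2 y * (8 * \<epsilon>)"
        using vexp B0 by (intro mult_left_mono) (auto simp: g2_def)
      also have "\<dots> = 16 * B * \<epsilon> / \<delta>\<^sup>2 * g2 y" by simp
      also have "\<dots> \<le> \<eta> / (2 * c1) * g y + 16 * B * \<epsilon> / \<delta>\<^sup>2 * g2 y"
        using \<open>0 < \<eta>\<close> c by (simp add: g_def)
      finally show ?thesis by (simp add: norm_mult g_def)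
    qed
    have "(\<integral>y. (\<phi> y - \<phi> x) * of_real (g y) \<partial>lborel)
        = (\<integral>y. \<phi> y * of_real (g y) \<partial>lborel) - \<phi> x * of_real ((pi / (1 / (4 * \<epsilon>))) powr (DIM('a) / 2))"
      unfolding left_diff_distrib
      by (subst Bochner_Integration.integral_diff[OF ipg]) (use iog ig in auto)
    moreover have "A = D' + B'" if "D' = A - B'" for A B' D' :: complex
      using that by simp
    ultimately have I: "(\<integral>y. \<phi> y * of_real (g y) \<partial>lborel)
        = (\<integral>y. (\<phi> y - \<phi> x) * of_real (g y) \<partial>lborel) + \<phi> x * of_real ((pi / (1 / (4 * \<epsilon>))) powr (DIM('a) / 2))"
      by blast
    have ring: "a * (D + p * q) - (a * q) * p = a * D" for a D p q :: complex
      by (simp add: algebra_simps)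
    have "of_real ?k * (\<integral>y. \<phi> y * of_real (g y) \<partial>lborel) - of_real c1 * \<phi> x
        = of_real ?k * (\<integral>y. (\<phi> y - \<phi> x) * of_real (g y) \<partial>lborel)"
      unfolding I k1[symmetric] of_real_mult by (rule ring)
    then have "cmod (of_real ?k * (\<integral>y. \<phi> y * of_real (g y) \<partial>lborel) - of_real c1 * \<phi> x)
        = ?k * cmod (\<integral>y. (\<phi> y - \<phi> x) * of_real (g y) \<partial>lborel)"
      by (simp only: norm_mult norm_of_real) simp
    also have "\<dots> \<le> ?k * (\<integral>y. \<eta> / (2 * c1) * g y + 16 * B * \<epsilon> / \<delta>\<^sup>2 * g2 y \<partial>lborel)"
    proof (rule mult_left_mono)
      show "cmod (\<integral>y. (\<phi> y - \<phi> x) * of_real (g y) \<partial>lborel) \<le> (\<integral>y. \<eta> / (2 * c1) * g y + 16 * B * \<epsilon> / \<delta>\<^sup>2 * g2 y \<partial>lborel)"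
      proof (rule order_trans[OF integral_norm_bound], rule integral_mono)
        show "integrable lborel (\<lambda>y. norm ((\<phi> y - \<phi> x) * complex_of_real (g y)))"
          using ipg iog by (intro integrable_norm) (simp add: left_diff_distrib)
        show "integrable lborel (\<lambda>y. \<eta> / (2 * c1) * g y + 16 * B * \<epsilon> / \<delta>\<^sup>2 * g2 y)"
          using ig ig2 by simp
      qed (rule pw)
    qed simp
    also have "(\<integral>y. \<eta> / (2 * c1) * g y + 16 * B * \<epsilon> / \<delta>\<^sup>2 * g2 y \<partial>lborel)
        = \<eta> / (2 * c1) * (pi / (1 / (4 * \<epsilon>))) powr (DIM('a) / 2) + 16 * B * \<epsilon> / \<delta>\<^sup>2 * (pi / (1 / (8 * \<epsilon>))) powr (DIM('a) / 2)"
      using ig ig2 by simp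
    also have "?k * \<dots> = \<eta> / (2 * c1) * (?k * (pi / (1 / (4 * \<epsilon>))) powr (DIM('a) / 2)) + 16 * B * \<epsilon> / \<delta>\<^sup>2 * (?k * (pi / (1 / (8 * \<epsilon>))) powr (DIM('a) / 2))"
      by (simp only: distrib_left mult_ac)
    also have "\<dots> = \<eta> / 2 + D * \<epsilon>"
      unfolding k1 k2 using c by (simp add: D_def)
    also have "\<dots> \<le> \<eta>" using De by simp
    finally show ?thesis by (simp add: g_def)
  qed
  with e show ?thesis unfolding c1_def by blast
qed

text \<open>Duality between the orders s and -s for a possibly singular measure. The pairing
  regularised by a Gaussian equals a frequency integral, to which Cauchy-Schwarz applies with the
  weights s and -s; \<open>gaussian_mean_approx\<close> compares the regularised pairing with the
  true one.\<close>

lemma sobolev_pairing: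
  fixes N :: "'a::euclidean_space measure"
  assumes N: "finite_measure N" and id [measurable]: "(\<lambda>x. x) \<in> borel_measurable N"
    and uc: "uniformly_continuous_on UNIV \<phi>" and B: "\<And>x. cmod (\<phi> x) \<le> B"
    and \<phi>: "integrable lborel \<phi>" "\<phi> \<in> L2_space lborel" "\<phi> \<in> sobolev_space s"
    and \<psi>: "integrable N \<psi>"
    and neg: "(\<lambda>\<xi>. of_real (sobolev_weight (- s) \<xi>) * fourier_integral N \<psi> \<xi>) \<in> L2_space lborel"
  shows "cmod (\<integral>x. \<phi> x * cnj (\<psi> x) \<partial>N) \<le> (2 * pi) powr (- real DIM('a) / 2) *
    (sobolev_norm s \<phi> * L2_norm lborel (\<lambda>\<xi>. of_real (sobolev_weight (- s) \<xi>) * fourier_integral N \<psi> \<xi>))"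
proof -
  interpret N: finite_measure N by fact
  have sf: "sigma_finite_measure N" ..
  interpret P: pair_sigma_finite "lborel :: 'a measure" N ..
  define c1 where "c1 = (2 * pi) powr DIM('a)"
  define c where "c = (2 * pi) powr (real DIM('a) / 2)"
  have c0: "0 < c1" "0 < c" "c * c = c1"
    by (auto simp: c1_def c_def powr_add[symmetric])
  have cm: "(2 * pi) powr (- real DIM('a) / 2) = 1 / c"
    by (simp add: c_def powr_minus_divide)
  have cont: "\<phi> \<in> borel_measurable borel"
    by (rule borel_measurable_continuous_onI[OF uniformly_continuous_imp_continuous[OF uc]])
  note [measurable] = cont
  have \<phi>N [measurable]: "(\<lambda>x. \<phi> x) \<in> borel_measurable N"
    using measurable_compose[OF id cont] .
  have [measurable]: "\<psi> \<in> borel_measurable N" using \<psi> by auto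
  have F1 [measurable]: "fourier_L1 \<phi> \<in> borel_measurable borel"
    using fourier_L1_bessel(1)[OF \<phi>(1,2)] by auto
  have F [measurable]: "fourier_integral N \<psi> \<in> borel_measurable borel"
    by (rule fourier_integral_measurable[OF sf id]) simp
  let ?a = "\<lambda>\<xi>. of_real (sobolev_weight s \<xi>) * fourier_L1 \<phi> \<xi>"
  let ?b = "\<lambda>\<xi>. of_real (sobolev_weight (- s) \<xi>) * fourier_integral N \<psi> \<xi>"
  have a: "?a \<in> L2_space lborel" and an: "sobolev_norm s \<phi> = L2_norm lborel ?a"
    using sobolev_norm_L1[OF \<phi>(1,2), of s] \<phi>(3) by auto
  let ?J = "\<integral>x. \<phi> x * cnj (\<psi> x) \<partial>N"
  let ?S = "\<integral>x. cmod (\<psi> x) \<partial>N"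
  have S0: "0 \<le> ?S" by simp
  \<comment> \<open>The weights s and -s multiply to 1, and c converts the unnormalised transform of
    \<phi> into \<open>fourier_L1\<close>.\<close>
  have ab: "fourier_integral lborel \<phi> \<xi> * cnj (fourier_integral N \<psi> \<xi>) = of_real c * (?a \<xi> * cnj (?b \<xi>))" for \<xi>
  proof -
    have "?a \<xi> * cnj (?b \<xi>) = of_real (sobolev_weight (- s) \<xi> * sobolev_weight s \<xi>) * (fourier_L1 \<phi> \<xi> * cnj (fourier_integral N \<psi> \<xi>))"
      by (simp add: mult_ac)
    then show ?thesis
      using c0 unfolding sobolev_weight_minus fourier_L1_eq cm by simp
  qed
  have iab: "integrable lborel (\<lambda>\<xi>. cmod (?a \<xi>) * cmod (?b \<xi>))"
    using integrable_norm[OF L2_integrable_mult[OF a neg]] by (simp add: norm_mult)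
  have J_int: "integrable N (\<lambda>x. \<phi> x * cnj (\<psi> x))"
  proof (rule Bochner_Integration.integrable_bound)
    show "integrable N (\<lambda>x. B * cmod (\<psi> x))" using \<psi> by simp
    show "AE x in N. norm (\<phi> x * cnj (\<psi> x)) \<le> norm (B * cmod (\<psi> x))"
      using B order_trans[OF norm_ge_zero B[of 0]] by (intro AE_I2) (auto simp: norm_mult intro!: mult_right_mono)
  qed simp
  have "c1 * cmod ?J \<le> c * (L2_norm lborel ?a * L2_norm lborel ?b) + e" if "0 < e" for e
  proof -
    \<comment> \<open>The summand 1 keeps the denominator positive when \<psi> has total mass
      0.\<close>
    define \<eta> where "\<eta> = e / (?S + 1)"
    have \<eta>: "0 < \<eta>" using that S0 by (simp add: \<eta>_def add_nonneg_pos)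
    obtain \<epsilon> where \<epsilon>: "0 < \<epsilon>" and appr: "\<And>x. cmod (of_real ((pi / \<epsilon>) powr (DIM('a) / 2)) * (\<integral>y. \<phi> y * of_real (exp (- (norm (y - x))\<^sup>2 / (4 * \<epsilon>))) \<partial>lborel)
      - of_real c1 * \<phi> x) \<le> \<eta>"
      using gaussian_mean_approx[OF uc B \<eta>] unfolding c1_def by blast
    let ?k = "(pi / \<epsilon>) powr (DIM('a) / 2)"
    let ?m = "\<lambda>x. \<integral>y. \<phi> y * of_real (exp (- (norm (y - x))\<^sup>2 / (4 * \<epsilon>))) \<partial>lborel"
    let ?I = "\<integral>\<xi>. of_real (exp (- \<epsilon> * (norm \<xi>)\<^sup>2)) * (fourier_integral lborel \<phi> \<xi> * cnj (fourier_integral N \<psi> \<xi>)) \<partial>lborel"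
    have iP: "integrable (lborel \<Otimes>\<^sub>M N) (\<lambda>z. \<phi> (fst z) * cnj (\<psi> (snd z)) * of_real (exp (- (norm (fst z - snd z))\<^sup>2 / (4 * \<epsilon>))))"
    proof (rule Bochner_Integration.integrable_bound)
      show "integrable (lborel \<Otimes>\<^sub>M N) (\<lambda>z. \<phi> (fst z) * cnj (\<psi> (snd z)))"
        by (rule P.integrable_product[OF \<phi>(1), of "\<lambda>x. cnj (\<psi> x)"]) (simp add: \<psi>)
      show "AE z in lborel \<Otimes>\<^sub>M N. norm (\<phi> (fst z) * cnj (\<psi> (snd z)) * of_real (exp (- (norm (fst z - snd z))\<^sup>2 / (4 * \<epsilon>))))
          \<le> norm (\<phi> (fst z) * cnj (\<psi> (snd z)))"
        using \<epsilon> by (intro AE_I2) (auto simp: norm_mult intro!: mult_left_le mult_nonneg_nonneg)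
    qed measurable
    have "?I = of_real ?k * (\<integral>z. \<phi> (fst z) * cnj (\<psi> (snd z)) * of_real (exp (- (norm (fst z - snd z))\<^sup>2 / (4 * \<epsilon>))) \<partial>(lborel \<Otimes>\<^sub>M N))"
      by (rule gaussian_fourier_product[OF lborel.sigma_finite_measure_axioms sf id_measurable_lborel id \<phi>(1) \<psi> \<epsilon>])
    also have "(\<integral>z. \<phi> (fst z) * cnj (\<psi> (snd z)) * of_real (exp (- (norm (fst z - snd z))\<^sup>2 / (4 * \<epsilon>))) \<partial>(lborel \<Otimes>\<^sub>M N))
       = (\<integral>x. (\<integral>y. \<phi> y * cnj (\<psi> x) * of_real (exp (- (norm (y - x))\<^sup>2 / (4 * \<epsilon>))) \<partial>lborel) \<partial>N)"
      using P.integral_snd[of "\<lambda>y x. \<phi> y * cnj (\<psi> x) * of_real (exp (- (norm (y - x))\<^sup>2 / (4 * \<epsilon>)))"] iP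
      by (simp add: case_prod_unfold)
    also have "\<dots> = (\<integral>x. cnj (\<psi> x) * ?m x \<partial>N)"
    proof (rule Bochner_Integration.integral_cong[OF refl])
      fix x
      have "(\<integral>y. \<phi> y * cnj (\<psi> x) * of_real (exp (- (norm (y - x))\<^sup>2 / (4 * \<epsilon>))) \<partial>lborel)
        = (\<integral>y. cnj (\<psi> x) * (\<phi> y * of_real (exp (- (norm (y - x))\<^sup>2 / (4 * \<epsilon>)))) \<partial>lborel)"
        by (rule Bochner_Integration.integral_cong[OF refl]) (simp only: mult_ac)
      then show "(\<integral>y. \<phi> y * cnj (\<psi> x) * of_real (exp (- (norm (y - x))\<^sup>2 / (4 * \<epsilon>))) \<partial>lborel) = cnj (\<psi> x) * ?m x"
        by simp
    qed
    also have "of_real ?k * \<dots> = (\<integral>x. cnj (\<psi> x) * (of_real ?k * ?m x) \<partial>N)"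
      by (subst integral_mult_right_zero[symmetric]) (simp only: mult_ac)
    finally have I: "?I = (\<integral>x. cnj (\<psi> x) * (of_real ?k * ?m x) \<partial>N)" .
    have m_meas [measurable]: "?m \<in> borel_measurable N"
    proof -
      have "?m \<in> borel_measurable borel"
        by (rule lborel.borel_measurable_lebesgue_integral) measurable
      from measurable_compose[OF id this] show ?thesis .
    qed
    have bound: "cmod (cnj (\<psi> x) * (of_real ?k * ?m x - of_real c1 * \<phi> x)) \<le> \<eta> * cmod (\<psi> x)" for x
      using mult_left_mono[OF appr[of x], of "cmod (\<psi> x)"] by (simp add: norm_mult mult.commute)
    have idiff: "integrable N (\<lambda>x. cnj (\<psi> x) * (of_real ?k * ?m x - of_real c1 * \<phi> x))"
    proof (rule Bochner_Integration.integrable_bound)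
      show "integrable N (\<lambda>x. \<eta> * cmod (\<psi> x))" using \<psi> by simp
      show "AE x in N. norm (cnj (\<psi> x) * (of_real ?k * ?m x - of_real c1 * \<phi> x)) \<le> norm (\<eta> * cmod (\<psi> x))"
        using bound \<eta> by (intro AE_I2) simp
    qed measurable
    have "of_real c1 * ?J = (\<integral>x. cnj (\<psi> x) * (of_real ?k * ?m x) - cnj (\<psi> x) * (of_real ?k * ?m x - of_real c1 * \<phi> x) \<partial>N)"
      by (subst integral_mult_right_zero[symmetric]) (simp add: algebra_simps)
    also have "\<dots> = ?I - (\<integral>x. cnj (\<psi> x) * (of_real ?k * ?m x - of_real c1 * \<phi> x) \<partial>N)"
      unfolding I
    proof (rule Bochner_Integration.integral_diff[OF _ idiff])
      have "integrable N (\<lambda>x. cnj (\<psi> x) * (of_real ?k * ?m x - of_real c1 * \<phi> x) + of_real c1 * (\<phi> x * cnj (\<psi> x)))"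
        by (intro Bochner_Integration.integrable_add idiff integrable_mult_right J_int)
      then show "integrable N (\<lambda>x. cnj (\<psi> x) * (of_real ?k * ?m x))"
        by (simp add: algebra_simps)
    qed
    finally have "cmod (of_real c1 * ?J) \<le> cmod ?I + cmod (\<integral>x. cnj (\<psi> x) * (of_real ?k * ?m x - of_real c1 * \<phi> x) \<partial>N)"
      by (simp add: norm_triangle_ineq4)
    also have "cmod (\<integral>x. cnj (\<psi> x) * (of_real ?k * ?m x - of_real c1 * \<phi> x) \<partial>N) \<le> (\<integral>x. \<eta> * cmod (\<psi> x) \<partial>N)"
      by (rule order_trans[OF integral_norm_bound], rule integral_mono[OF integrable_norm[OF idiff] _ bound])
         (use \<psi> in simp)
    also have "\<dots> = \<eta> * ?S" by simp
    also have "\<eta> * ?S \<le> e"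
    proof -
      have "\<eta> * (?S + 1) = e"
        unfolding \<eta>_def using add_nonneg_pos[OF S0 zero_less_one] by (metis less_irrefl nonzero_eq_divide_eq)
      then show ?thesis using \<eta> by (simp add: distrib_left)
    qed
    also have "cmod ?I \<le> (\<integral>\<xi>. c * (cmod (?a \<xi>) * cmod (?b \<xi>)) \<partial>lborel)"
    proof -
      have le: "norm (complex_of_real (exp (- \<epsilon> * (norm \<xi>)\<^sup>2)) * (fourier_integral lborel \<phi> \<xi> * cnj (fourier_integral N \<psi> \<xi>)))
        \<le> c * (cmod (?a \<xi>) * cmod (?b \<xi>))" for \<xi> :: 'a
      proof -
        have "norm (complex_of_real (exp (- \<epsilon> * (norm \<xi>)\<^sup>2)) * (fourier_integral lborel \<phi> \<xi> * cnj (fourier_integral N \<psi> \<xi>)))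
          = exp (- \<epsilon> * (norm \<xi>)\<^sup>2) * (c * (cmod (?a \<xi>) * cmod (?b \<xi>)))"
          unfolding ab using c0 by (simp add: norm_mult)
        also have "\<dots> \<le> 1 * (c * (cmod (?a \<xi>) * cmod (?b \<xi>)))"
          using \<epsilon> c0 by (intro mult_right_mono) auto
        finally show ?thesis by simp
      qed
      show ?thesis
      proof (rule order_trans[OF integral_norm_bound])
        show "(\<integral>\<xi>. norm (complex_of_real (exp (- \<epsilon> * (norm \<xi>)\<^sup>2)) * (fourier_integral lborel \<phi> \<xi> * cnj (fourier_integral N \<psi> \<xi>))) \<partial>lborel)
          \<le> (\<integral>\<xi>. c * (cmod (?a \<xi>) * cmod (?b \<xi>)) \<partial>lborel)"
          by (rule integral_mono_AE') (use le iab c0 in auto)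
      qed
    qed
    also have "\<dots> \<le> c * (L2_norm lborel ?a * L2_norm lborel ?b)"
      using L2_Cauchy_Schwarz_norm[OF a neg] c0 by simp
    finally show ?thesis
      using c0 by (simp add: norm_mult)
  qed
  then have "c1 * cmod ?J \<le> c * (L2_norm lborel ?a * L2_norm lborel ?b)"
    by (rule field_le_epsilon)
  then have "c * (c * cmod ?J) \<le> c * (L2_norm lborel ?a * L2_norm lborel ?b)"
    using c0(3) by (simp add: mult.assoc[symmetric])
  then show ?thesis
    unfolding cm an using c0 by (simp add: field_simps)
qed


section \<open>Smooth functions and cutoffs\<close>

lemma C_k_SucI:
  assumes "\<And>x. (f has_derivative f' x) (at x)" "\<And>b. b \<in> Basis \<Longrightarrow> C_k k (\<lambda>x. f' x b)"
  shows "C_k (Suc k) f"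
proof -
  have "frechet_derivative f (at x) = f' x" for x
    using frechet_derivative_at[OF assms(1)] by simp
  then show ?thesis
    using assms unfolding C_k.simps by (auto simp: differentiable_on_def differentiable_def)
qed

lemma C_k_SucD:
  assumes "C_k (Suc k) f"
  shows "(f has_derivative frechet_derivative f (at x)) (at x)"
    and "b \<in> Basis \<Longrightarrow> C_k k (\<lambda>x. frechet_derivative f (at x) b)"
  using assms by (auto simp: differentiable_on_def frechet_derivative_works)

lemma C_k_less: "C_k (Suc k) f \<Longrightarrow> C_k k f"
proof (induction k arbitrary: f)
  case 0
  then show ?case by (simp add: differentiable_imp_continuous_on)
next
  case (Suc k)
  then show ?case
    using C_k_SucD[OF Suc.prems] by (intro C_k_SucI[of f "\<lambda>x. frechet_derivative f (at x)"]) auto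
qed

lemma C_k_continuous: "C_k k f \<Longrightarrow> continuous_on UNIV f"
  by (cases k) (auto simp: differentiable_imp_continuous_on)

lemma C_k_const [simp]: "C_k k (\<lambda>x. c)"
  by (induction k arbitrary: c) (simp, rule C_k_SucI[OF has_derivative_const], simp)

lemma C_k_add: "C_k k f \<Longrightarrow> C_k k g \<Longrightarrow> C_k k (\<lambda>x. f x + g x)"
proof (induction k arbitrary: f g)
  case 0
  then show ?case by (simp add: continuous_on_add)
next
  case (Suc k)
  show ?case
    by (rule C_k_SucI[OF has_derivative_add[OF C_k_SucD(1)[OF Suc.prems(1)] C_k_SucD(1)[OF Suc.prems(2)]]])
       (intro Suc.IH C_k_SucD(2) Suc.prems)
qed

lemma C_k_mult: "C_k k f \<Longrightarrow> C_k k g \<Longrightarrow> C_k k (\<lambda>x. f x * g x)"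
proof (induction k arbitrary: f g)
  case 0
  then show ?case by (simp add: continuous_on_mult)
next
  case (Suc k)
  show ?case
    by (rule C_k_SucI[OF has_derivative_mult[OF C_k_SucD(1)[OF Suc.prems(1)] C_k_SucD(1)[OF Suc.prems(2)]]])
       (intro C_k_add Suc.IH C_k_SucD(2) Suc.prems C_k_less[OF Suc.prems(1)] C_k_less[OF Suc.prems(2)])
qed

lemma C_k_sum: "(\<And>i. i \<in> I \<Longrightarrow> C_k k (f i)) \<Longrightarrow> C_k k (\<lambda>x. \<Sum>i\<in>I. f i x)"
  by (induction I rule: infinite_finite_induct) (auto intro: C_k_add)

lemma C_k_minus: "C_k k f \<Longrightarrow> C_k k (\<lambda>x. - f x)"
  using C_k_mult[OF C_k_const[of k "-1"], of f] by simp

lemma C_k_diff: "C_k k f \<Longrightarrow> C_k k g \<Longrightarrow> C_k k (\<lambda>x. f x - g x)"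
  using C_k_add[OF _ C_k_minus, of k f g] by simp

lemma C_k_inverse: "C_k k f \<Longrightarrow> (\<And>x. f x \<noteq> 0) \<Longrightarrow> C_k k (\<lambda>x. inverse (f x))"
proof (induction k arbitrary: f)
  case 0
  then show ?case by (simp add: continuous_on_inverse)
next
  case (Suc k)
  show ?case
    by (rule C_k_SucI[OF Deriv.has_derivative_inverse[OF Suc.prems(2) C_k_SucD(1)[OF Suc.prems(1)]]])
       (intro C_k_minus C_k_mult Suc.IH C_k_SucD(2) Suc.prems C_k_less[OF Suc.prems(1)])
qed

lemma C_k_inner: "C_k k (\<lambda>x. complex_of_real ((x - y) \<bullet> v))"
proof (cases k)
  case 0
  then show ?thesis by (auto intro!: continuous_intros)
next
  case (Suc l)
  show ?thesis unfolding Suc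
    by (rule C_k_SucI[where f' = "\<lambda>x h. complex_of_real (h \<bullet> v)"]) (auto intro!: derivative_eq_intros)
qed

text \<open>With a linear inner map, the partial derivatives of the composition are
  constant-coefficient combinations of partial derivatives of f composed with the same map, so the
  induction closes.\<close>

lemma C_k_affine:
  fixes L :: "'a::euclidean_space \<Rightarrow> 'a" and f :: "'a \<Rightarrow> complex"
  assumes "linear L" "C_k k f"
  shows "C_k k (\<lambda>x. f (c + L x))"
  using assms(2)
proof (induction k arbitrary: f)
  case 0
  have "continuous_on UNIV L"
    using assms(1) by (simp add: linear_continuous_on linear_conv_bounded_linear)
  then show ?case
    using 0 by (auto intro!: continuous_intros continuous_on_compose2[of UNIV f])
next
  case (Suc k)
  note D = C_k_SucD[OF Suc.prems]
  have TL: "((\<lambda>x. c + L x) has_derivative L) (at x)" for x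
    using assms(1) by (auto intro!: derivative_eq_intros linear_imp_has_derivative)
  have d: "((\<lambda>x. f (c + L x)) has_derivative (\<lambda>h. frechet_derivative f (at (c + L x)) (L h))) (at x)" for x
    using has_derivative_compose[OF TL D(1)] .
  show ?case
  proof (rule C_k_SucI[OF d])
    fix b :: 'a assume "b \<in> Basis"
    have eq: "frechet_derivative f (at (c + L x)) (L b)
        = (\<Sum>e\<in>Basis. of_real (L b \<bullet> e) * frechet_derivative f (at (c + L x)) e)" for x
    proof -
      have lin: "linear (frechet_derivative f (at (c + L x)))"
        using D(1) by (rule has_derivative_linear)
      have "frechet_derivative f (at (c + L x)) (L b) = frechet_derivative f (at (c + L x)) (\<Sum>e\<in>Basis. (L b \<bullet> e) *\<^sub>R e)"
        by (simp add: euclidean_representation)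
      then show ?thesis
        by (simp add: linear_sum[OF lin] linear_scale[OF lin] scaleR_conv_of_real)
    qed
    show "C_k k (\<lambda>x. frechet_derivative f (at (c + L x)) (L b))"
      unfolding eq by (rule C_k_sum, rule C_k_mult, rule C_k_const, rule Suc.IH[OF D(2)])
  qed
qed

text \<open>The classical flat function exp(-1/v), with a power of 1/v in front. The parameter m
  makes the family closed under differentiation up to linear combinations, as an induction on
  smoothness requires.\<close>

definition flat_exp :: "nat \<Rightarrow> real \<Rightarrow> real" where
  "flat_exp m v = (if 0 < v then (1 / v) ^ m * exp (- (1 / v)) else 0)"

lemma flat_exp_tendsto_0: "(flat_exp m \<longlongrightarrow> 0) (at_right 0)"
proof -
  have "((\<lambda>y::real. y ^ m / exp y) \<longlongrightarrow> 0) at_top"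
    by (rule tendsto_power_div_exp_0)
  then have "((\<lambda>v. inverse v ^ m / exp (inverse v)) \<longlongrightarrow> (0::real)) (at_right 0)"
    by (rule filterlim_compose[OF _ filterlim_inverse_at_top_right])
  then show ?thesis
  proof (rule Lim_transform_eventually)
    show "\<forall>\<^sub>F v in at_right 0. inverse v ^ m / exp (inverse v) = flat_exp m v"
      unfolding eventually_at_right_field
      by (intro exI[of _ 1]) (auto simp: flat_exp_def exp_minus field_simps)
  qed
qed

lemma flat_exp_deriv:
  "(flat_exp m has_real_derivative (flat_exp (m + 2) v - real m * flat_exp (m + 1) v)) (at v)"
proof -
  consider "v < 0" | "v = 0" | "0 < v" by linarith
  then show ?thesis
  proof cases
    case 1
    have "((\<lambda>v. 0) has_real_derivative 0) (at v)" by simp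
    then have "(flat_exp m has_real_derivative 0) (at v)"
    proof (rule has_field_derivative_transform_within_open[of _ _ _ "{..<0}"])
    qed (use 1 in \<open>auto simp: flat_exp_def\<close>)
    then show ?thesis using 1 by (simp add: flat_exp_def)
  next
    case 3
    have "((\<lambda>v. (1 / v) ^ m * exp (- (1 / v))) has_real_derivative
        ((1 / v) ^ (m + 2) * exp (- (1 / v)) - real m * ((1 / v) ^ (m + 1) * exp (- (1 / v))))) (at v)"
    proof -
      have dw: "((\<lambda>v. 1 / v) has_real_derivative - ((1 / v)\<^sup>2)) (at v)"
        using 3 by (auto intro!: derivative_eq_intros simp: power2_eq_square)
      show ?thesis
        by (rule DERIV_cong, (rule derivative_eq_intros dw refl)+)
           (cases m; simp add: algebra_simps power2_eq_square)
    qed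
    then have "(flat_exp m has_real_derivative
        ((1 / v) ^ (m + 2) * exp (- (1 / v)) - real m * ((1 / v) ^ (m + 1) * exp (- (1 / v))))) (at v)"
      by (rule has_field_derivative_transform_within_open[of _ _ _ "{0<..}"])
         (use 3 in \<open>auto simp: flat_exp_def\<close>)
    then show ?thesis using 3 by (simp add: flat_exp_def)
  next
    case 2
    have "((\<lambda>y. (flat_exp m y - flat_exp m 0) / (y - 0)) \<longlongrightarrow> 0) (at 0)"
      unfolding filterlim_at_split
    proof
      \<comment> \<open>To the right of 0 the difference quotient is
        \<open>flat_exp (Suc m)\<close>, so one limit for all m settles differentiability at
        0.\<close>
      show "((\<lambda>y. (flat_exp m y - flat_exp m 0) / (y - 0)) \<longlongrightarrow> 0) (at_right 0)"
        by (rule Lim_transform_eventually[OF flat_exp_tendsto_0[of "Suc m"]])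
           (auto simp: flat_exp_def eventually_at_right_field intro!: exI[of _ 1])
      show "((\<lambda>y. (flat_exp m y - flat_exp m 0) / (y - 0)) \<longlongrightarrow> 0) (at_left 0)"
        by (rule tendsto_eventually) (auto simp: flat_exp_def eventually_at_left_field intro!: exI[of _ "-1"])
    qed
    then show ?thesis
      unfolding 2 has_field_derivative_iff by (simp add: flat_exp_def)
  qed
qed

lemma flat_exp_nonneg: "0 \<le> flat_exp m v"
  by (simp add: flat_exp_def)

lemma flat_exp_pos_iff: "0 < flat_exp m v \<longleftrightarrow> 0 < v"
  by (simp add: flat_exp_def)

lemma flat_exp_eq_0_iff: "flat_exp m v = 0 \<longleftrightarrow> v \<le> 0"
  by (simp add: flat_exp_def)

lemma C_k_flat_exp:
  assumes "C_k k (\<lambda>x. complex_of_real (u x))"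
  shows "C_k k (\<lambda>x. complex_of_real (flat_exp m (u x)))"
  using assms
proof (induction k arbitrary: m)
  case 0
  have "continuous_on UNIV (\<lambda>x. Re (complex_of_real (u x)))"
    using 0 by (intro continuous_intros) simp
  moreover have "continuous_on UNIV (flat_exp m)"
    using flat_exp_deriv by (intro DERIV_continuous_on) auto
  ultimately show ?case
    by (auto intro!: continuous_intros continuous_on_compose2[of UNIV "flat_exp m" UNIV u])
next
  case (Suc k)
  note D = C_k_SucD[OF Suc.prems]
  define D' where "D' x = frechet_derivative (\<lambda>x. complex_of_real (u x)) (at x)" for x
  have D': "((\<lambda>x. complex_of_real (u x)) has_derivative D' x) (at x)"
    "b \<in> Basis \<Longrightarrow> C_k k (\<lambda>x. D' x b)" for x b
    using D by (auto simp: D'_def)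
  have u: "(u has_derivative (\<lambda>h. Re (D' x h))) (at x)" for x
    using has_derivative_Re[OF D'(1)] by simp
  have "((\<lambda>x. complex_of_real (u x)) has_derivative (\<lambda>h. complex_of_real (Re (D' x h)))) (at x)" for x
    by (rule has_derivative_of_real[OF u])
  \<comment> \<open>The derivative of a real-valued function is real. This allows the smoothness
    hypothesis, which is stated for complex values, to be used for u itself.\<close>
  from has_derivative_unique[OF this D'(1)] have re: "complex_of_real (Re (D' x h)) = D' x h" for x h
    by metis
  have "((\<lambda>x. flat_exp m (u x)) has_derivative
      (\<lambda>h. Re (D' x h) * (flat_exp (m + 2) (u x) - real m * flat_exp (m + 1) (u x)))) (at x)" for x
    using has_derivative_compose[OF u has_field_derivative_imp_has_derivative[OF flat_exp_deriv]]
    by (simp add: mult.commute)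
  then have "((\<lambda>x. complex_of_real (flat_exp m (u x))) has_derivative
      (\<lambda>h. complex_of_real (Re (D' x h) * (flat_exp (m + 2) (u x) - real m * flat_exp (m + 1) (u x))))) (at x)" for x
    by (rule has_derivative_of_real)
  then have d: "((\<lambda>x. complex_of_real (flat_exp m (u x))) has_derivative
      (\<lambda>h. D' x h * (complex_of_real (flat_exp (m + 2) (u x)) - of_real (real m) * complex_of_real (flat_exp (m + 1) (u x))))) (at x)" for x
    unfolding of_real_mult of_real_diff re .
  show ?case
    by (rule C_k_SucI[OF d]) (intro C_k_mult C_k_diff C_k_const Suc.IH C_k_less[OF Suc.prems] D'(2))
qed

text \<open>A finite sum F of bumps around a net in \<Gamma> is smooth, positive on \<Gamma> and
  zero at distance at least \<epsilon>. Its minimum c on \<Gamma> is positive, and a quotient of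
  flat functions of F and c - F levels it off to 1 wherever F >= c.\<close>

lemma smooth_cutoff:
  fixes \<Gamma> :: "'a::euclidean_space set"
  assumes \<Gamma>: "compact \<Gamma>" "\<Gamma> \<noteq> {}" and "0 < \<epsilon>"
  shows "\<exists>\<eta>. (\<forall>k. C_k k \<eta>) \<and> (\<forall>x\<in>\<Gamma>. \<eta> x = 1) \<and> (\<forall>x. infdist x \<Gamma> \<ge> \<epsilon> \<longrightarrow> \<eta> x = 0)"
proof -
  obtain Y where Y: "Y \<subseteq> \<Gamma>" "finite Y" "\<Gamma> \<subseteq> (\<Union>y\<in>Y. ball y \<epsilon>)"
    using compactE_image[OF \<Gamma>(1), of \<Gamma> "\<lambda>y. ball y \<epsilon>"] \<open>0 < \<epsilon>\<close> by (metis (no_types, lifting) UN_iff centre_in_ball open_ball subsetI)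
  define \<beta> where "\<beta> y x = flat_exp 0 (\<epsilon>\<^sup>2 - (norm (x - y))\<^sup>2)" for x y :: 'a
  define F where "F x = (\<Sum>y\<in>Y. \<beta> y x)" for x
  have nrm: "(norm (x - y))\<^sup>2 = (\<Sum>b\<in>Basis. ((x - y) \<bullet> b) * ((x - y) \<bullet> b))" for x y :: 'a
    unfolding power2_norm_eq_inner by (rule euclidean_inner)
  have "C_k k (\<lambda>x. complex_of_real (\<epsilon>\<^sup>2) - (\<Sum>b\<in>Basis. of_real ((x - y) \<bullet> b) * of_real ((x - y) \<bullet> b)))" for k and y :: 'a
    by (intro C_k_diff C_k_const C_k_sum C_k_mult C_k_inner)
  then have "C_k k (\<lambda>x. complex_of_real (\<beta> y x))" for k y
    unfolding \<beta>_def nrm by (intro C_k_flat_exp) simp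
  then have F_C: "C_k k (\<lambda>x. complex_of_real (F x))" for k
    using C_k_sum[of Y k "\<lambda>y x. complex_of_real (\<beta> y x)"] by (simp add: F_def)
  have F_cont: "continuous_on UNIV F"
  proof -
    show ?thesis
      using continuous_on_Re[OF C_k_continuous[OF F_C[of 0]]] by simp
  qed
  have \<beta>0: "0 \<le> \<beta> y x" for x y by (simp add: \<beta>_def flat_exp_nonneg)
  have F0: "0 \<le> F x" for x unfolding F_def by (intro sum_nonneg \<beta>0)
  have F_pos: "0 < F x" if "x \<in> \<Gamma>" for x
  proof -
    have "x \<in> (\<Union>y\<in>Y. ball y \<epsilon>)" by (rule subsetD[OF Y(3) that])
    then obtain y where y: "y \<in> Y" "x \<in> ball y \<epsilon>" by (rule UN_E)
    then have *: "0 < \<beta> y x"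
      using \<open>0 < \<epsilon>\<close> by (simp add: \<beta>_def flat_exp_pos_iff dist_norm norm_minus_commute power_strict_mono)
    then show ?thesis
      unfolding F_def using y Y(2) \<beta>0 by (intro sum_pos2[of Y y]) auto
  qed
  have F_zero: "F x = 0" if "\<epsilon> \<le> infdist x \<Gamma>" for x
    unfolding F_def
  proof (rule sum.neutral, intro ballI)
    fix y assume "y \<in> Y"
    then have "\<epsilon> \<le> norm (x - y)"
      using infdist_le[of y \<Gamma> x] Y(1) that by (auto simp: dist_norm)
    then show "\<beta> y x = 0"
      using \<open>0 < \<epsilon>\<close> by (simp add: \<beta>_def flat_exp_eq_0_iff power_mono)
  qed
  obtain x0 where x0: "x0 \<in> \<Gamma>" "\<And>x. x \<in> \<Gamma> \<Longrightarrow> F x0 \<le> F x"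
    using continuous_attains_inf[OF \<Gamma> continuous_on_subset[OF F_cont subset_UNIV]] by blast
  define c where "c = F x0"
  have c: "0 < c" using F_pos[OF x0(1)] by (simp add: c_def)
  define G where "G x = flat_exp 0 (F x) + flat_exp 0 (c - F x)" for x
  \<comment> \<open>Since c > 0, the numbers F x and c - F x are never both non-positive.\<close>
  have G_pos: "0 < G x" for x
    using c F0[of x] flat_exp_nonneg[of 0 "F x"] flat_exp_nonneg[of 0 "c - F x"]
      flat_exp_pos_iff[of 0 "F x"] flat_exp_pos_iff[of 0 "c - F x"]
    unfolding G_def by (cases "0 < F x") (auto intro: add_pos_nonneg add_nonneg_pos)
  define \<eta> where "\<eta> x = complex_of_real (flat_exp 0 (F x)) * inverse (complex_of_real (G x))" for x
  have "C_k k \<eta>" for k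
  proof -
    have cF: "C_k k (\<lambda>x. complex_of_real (c - F x))"
      using C_k_diff[OF C_k_const[of k "complex_of_real c"] F_C] by simp
    have "C_k k (\<lambda>x. complex_of_real (G x))"
      using C_k_add[OF C_k_flat_exp[OF F_C, of k 0] C_k_flat_exp[OF cF, of 0]] by (simp add: G_def)
    moreover have "complex_of_real (G x) \<noteq> 0" for x using G_pos[of x] by simp
    ultimately show ?thesis
      unfolding \<eta>_def by (intro C_k_mult C_k_flat_exp F_C C_k_inverse)
  qed
  moreover have "\<eta> x = 1" if "x \<in> \<Gamma>" for x
  proof -
    have "flat_exp 0 (c - F x) = 0"
      using x0(2)[OF that] by (simp add: flat_exp_eq_0_iff c_def)
    then have "flat_exp 0 (F x) = G x" by (simp add: G_def)
    then show ?thesis using G_pos[of x] by (simp add: \<eta>_def)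
  qed
  moreover have "\<eta> x = 0" if "\<epsilon> \<le> infdist x \<Gamma>" for x
    by (simp add: \<eta>_def F_zero[OF that] flat_exp_def)
  ultimately show ?thesis by blast
qed

lemma frechet_derivative_zero_on_open:
  assumes "open U" "\<And>x. x \<in> U \<Longrightarrow> f x = 0" "x \<in> U"
  shows "frechet_derivative f (at x) b = 0"
proof -
  have "(f has_derivative (\<lambda>h. 0)) (at x)"
    by (rule has_derivative_transform_within_open[OF has_derivative_const[of 0] assms(1,3)]) (simp add: assms(2))
  from frechet_derivative_at[OF this] show ?thesis by metis
qed


section \<open>Sobolev norms of functions with compact support\<close>

text \<open>The derivative is read along the step sizes 1/(k+1), because dominated convergence will
  be applied to a sequence.\<close>

lemma directional_quotient_tendsto:
  fixes f :: "'a::real_normed_vector \<Rightarrow> complex"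
  assumes "(f has_derivative f') (at x)" "b \<noteq> 0"
  shows "(\<lambda>k. (f (x + (1 / real (Suc k)) *\<^sub>R b) - f x) / of_real (1 / real (Suc k))) \<longlonglongrightarrow> f' b"
proof -
  define t where "t k = 1 / real (Suc k)" for k
  have t: "0 < t k" for k by (simp add: t_def)
  have lin: "linear f'" using assms(1) by (rule has_derivative_linear)
  have "t \<longlonglongrightarrow> 0"
    unfolding t_def using LIMSEQ_inverse_real_of_nat by (simp add: inverse_eq_divide)
  then have "(\<lambda>k. t k *\<^sub>R b) \<longlonglongrightarrow> 0" using tendsto_scaleR[OF _ tendsto_const, of t 0] by simp
  then have "filterlim (\<lambda>k. t k *\<^sub>R b) (at 0) sequentially"
    using t assms(2) by (auto simp: filterlim_at less_imp_neq[symmetric] intro!: always_eventually)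
  moreover have "((\<lambda>h. norm (f (x + h) - f x - f' h) / norm h) \<longlongrightarrow> 0) (at 0)"
    using assms(1) by (simp add: has_derivative_at)
  ultimately have "(\<lambda>k. norm (f (x + t k *\<^sub>R b) - f x - f' (t k *\<^sub>R b)) / norm (t k *\<^sub>R b)) \<longlonglongrightarrow> 0"
    by (rule filterlim_compose[rotated])
  then have "(\<lambda>k. norm (f (x + t k *\<^sub>R b) - f x - f' (t k *\<^sub>R b)) / norm (t k *\<^sub>R b) * norm b) \<longlonglongrightarrow> 0"
    by (rule tendsto_mult_left_zero)
  moreover have "norm (f (x + t k *\<^sub>R b) - f x - f' (t k *\<^sub>R b)) / norm (t k *\<^sub>R b) * norm b
      = norm ((f (x + t k *\<^sub>R b) - f x) / of_real (t k) - f' b)" for k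
  proof -
    have "(f (x + t k *\<^sub>R b) - f x) / of_real (t k) - f' b = (f (x + t k *\<^sub>R b) - f x - f' (t k *\<^sub>R b)) / of_real (t k)"
      using t[of k] by (simp add: linear_scale[OF lin] scaleR_conv_of_real diff_divide_distrib)
    then show ?thesis
      using t[of k] assms(2) by (simp add: norm_divide)
  qed
  ultimately have "(\<lambda>k. norm ((f (x + t k *\<^sub>R b) - f x) / of_real (t k) - f' b)) \<longlonglongrightarrow> 0"
    by simp
  then show ?thesis
    unfolding t_def by (subst LIM_zero_iff[symmetric], subst tendsto_norm_zero_iff[symmetric])
qed

lemma compact_support_bounded:
  fixes f :: "'a::euclidean_space \<Rightarrow> complex"
  assumes "continuous_on UNIV f" "\<And>x. x \<notin> cball 0 R \<Longrightarrow> f x = 0"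
  shows "\<exists>B\<ge>0. \<forall>x. cmod (f x) \<le> B"
proof -
  have "compact (f ` cball 0 R)"
    by (rule compact_continuous_image[OF continuous_on_subset[OF assms(1)]]) auto
  then obtain B where B: "\<And>x. x \<in> cball 0 R \<Longrightarrow> cmod (f x) \<le> B"
    by (meson bounded_iff compact_imp_bounded imageI)
  show ?thesis
    by (rule exI[of _ "max B 0"]) (use B assms(2) in \<open>metis max.cobounded2 max.coboundedI1 norm_zero\<close>)
qed

lemma compact_support_integrable:
  fixes f :: "'a::euclidean_space \<Rightarrow> complex"
  assumes "continuous_on UNIV f" "\<And>x. x \<notin> cball 0 R \<Longrightarrow> f x = 0"
  shows "integrable lborel f" "f \<in> L2_space lborel"
proof -
  have ind: "f = (\<lambda>x. indicator (cball 0 R) x *\<^sub>R f x)"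
    using assms(2) by (auto simp: indicator_def)
  show "integrable lborel f"
    by (subst ind, rule borel_integrable_compact) (auto intro: continuous_on_subset[OF assms(1)])
  have ind2: "(\<lambda>x. indicator (cball 0 R) x *\<^sub>R (cmod (f x))\<^sup>2) = (\<lambda>x. (cmod (f x))\<^sup>2)"
  proof
    show "indicator (cball 0 R) x *\<^sub>R (cmod (f x))\<^sup>2 = (cmod (f x))\<^sup>2" for x
      by (cases "x \<in> cball 0 R") (simp_all add: assms(2))
  qed
  have "integrable lborel (\<lambda>x. indicator (cball 0 R) x *\<^sub>R (cmod (f x))\<^sup>2)"
    by (rule borel_integrable_compact) (auto intro!: continuous_intros continuous_on_subset[OF assms(1)])
  then have "integrable lborel (\<lambda>x. (cmod (f x))\<^sup>2)"
    unfolding ind2 .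
  then show "f \<in> L2_space lborel"
    unfolding L2_space_def using assms(1) by (auto intro: borel_measurable_continuous_onI)
qed

lemma compact_support_uniformly_continuous:
  fixes f :: "'a::euclidean_space \<Rightarrow> complex"
  assumes "continuous_on UNIV f" "\<And>x. x \<notin> cball 0 R \<Longrightarrow> f x = 0"
  shows "uniformly_continuous_on UNIV f"
  unfolding uniformly_continuous_on_def
proof (intro allI impI)
  fix e :: real assume "0 < e"
  have "uniformly_continuous_on (cball 0 (R + 1)) f"
    by (rule compact_uniformly_continuous[OF continuous_on_subset[OF assms(1)]]) auto
  then obtain d where d: "0 < d" "\<And>x y. x \<in> cball 0 (R + 1) \<Longrightarrow> y \<in> cball 0 (R + 1) \<Longrightarrow> dist y x < d \<Longrightarrow> dist (f y) (f x) < e"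
    using \<open>0 < e\<close> unfolding uniformly_continuous_on_def by blast
  have "dist (f y) (f x) < e" if "dist y x < min d 1" for x y
  proof (cases "x \<in> cball 0 (R + 1) \<and> y \<in> cball 0 (R + 1)")
    case True
    then show ?thesis using d(2)[of x y] that by simp
  next
    case False
    have "norm x \<le> norm y + dist y x" "norm y \<le> norm x + dist y x"
      using norm_triangle_sub[of x y] norm_triangle_sub[of y x] by (auto simp: dist_norm norm_minus_commute)
    with False that have "x \<notin> cball 0 R" "y \<notin> cball 0 R"
      by auto
    then show ?thesis using assms(2) \<open>0 < e\<close> by simp
  qed
  with d(1) show "\<exists>d>0. \<forall>x\<in>UNIV. \<forall>x'\<in>UNIV. dist x' x < d \<longrightarrow> dist (f x') (f x) < e"
    by (intro exI[of _ "min d 1"]) auto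
qed

section \<open>Fourier transforms of derivatives\<close>

lemma fourier_integral_translate:
  fixes f :: "'a::euclidean_space \<Rightarrow> complex"
  assumes "f \<in> borel_measurable borel"
  shows "fourier_integral lborel (\<lambda>x. f (x + a)) \<xi> = cis (\<xi> \<bullet> a) * fourier_integral lborel f \<xi>"
proof -
  note [measurable] = assms
  have "cis (\<xi> \<bullet> a) * fourier_integral lborel f \<xi> = (\<integral>x. cis (\<xi> \<bullet> a) * (cis (- (\<xi> \<bullet> x)) * f x) \<partial>lborel)"
    by (simp add: fourier_integral_def)
  also have "\<dots> = (\<integral>x. cis (\<xi> \<bullet> a) * (cis (- (\<xi> \<bullet> x)) * f x) \<partial>(distr lborel borel ((+) a)))"
    by (simp add: lborel_distr_plus)
  also have "\<dots> = (\<integral>x. cis (\<xi> \<bullet> a) * (cis (- (\<xi> \<bullet> (a + x))) * f (a + x)) \<partial>lborel)"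
    by (rule integral_distr) auto
  also have "\<dots> = fourier_integral lborel (\<lambda>x. f (x + a)) \<xi>"
    unfolding fourier_integral_def
    by (rule Bochner_Integration.integral_cong[OF refl]) (simp add: mult.assoc[symmetric] cis_mult inner_add_right add.commute)
  finally show ?thesis ..
qed

text \<open>Difference quotients replace integration by parts: a translation multiplies the
  transform by a character, whose quotient tends to \<i> times the frequency coordinate, while
  dominated convergence yields the transform of the derivative.\<close>

lemma fourier_integral_derivative:
  fixes f :: "'a::euclidean_space \<Rightarrow> complex"
  assumes f: "C_k (Suc 0) f" "\<And>x. x \<notin> cball 0 R \<Longrightarrow> f x = 0" and b: "b \<in> Basis"
  shows "fourier_integral lborel (\<lambda>x. frechet_derivative f (at x) b) \<xi> = \<i> * of_real (\<xi> \<bullet> b) * fourier_integral lborel f \<xi>"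
proof -
  define g where "g x = frechet_derivative f (at x) b" for x
  define t where "t k = 1 / real (Suc k)" for k
  have t: "0 < t k" "t k \<le> 1" for k by (auto simp: t_def)
  have b0: "b \<noteq> 0" "norm b = 1" using b by auto
  note D = C_k_SucD(1)[OF f(1)]
  have fc: "continuous_on UNIV f" using C_k_continuous[OF f(1)] .
  have gc: "continuous_on UNIV g"
    using C_k_SucD(2)[OF f(1) b] by (simp add: g_def[abs_def])
  have [measurable]: "f \<in> borel_measurable borel" "g \<in> borel_measurable borel"
    using fc gc by (auto intro: borel_measurable_continuous_onI)
  have fi: "integrable lborel f" by (rule compact_support_integrable[OF fc f(2)])
  have g0: "g x = 0" if "x \<notin> cball 0 R" for x
    unfolding g_def
    by (rule frechet_derivative_zero_on_open[of "- cball 0 R"]) (use f(2) that in auto)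
  obtain B where B: "0 \<le> B" "\<And>x. cmod (g x) \<le> B"
    using compact_support_bounded[OF gc g0] by blast
  define q where "q k x = (f (x + t k *\<^sub>R b) - f x) / of_real (t k)" for k x
  have q_lim: "(\<lambda>k. q k x) \<longlonglongrightarrow> g x" for x
    unfolding q_def t_def g_def by (rule directional_quotient_tendsto[OF D b0(1)])
  \<comment> \<open>The mean value theorem bounds the quotients by the maximum of the derivative;
    the steps have length at most 1, so all quotients vanish outside radius R + 1.\<close>
  have q_bd: "cmod (q k x) \<le> B * indicator (cball 0 (R + 1)) x" for k x
  proof (cases "x \<in> cball 0 (R + 1)")
    case True
    have der: "((\<lambda>s. f (x + s *\<^sub>R b)) has_derivative (\<lambda>h. frechet_derivative f (at (x + s *\<^sub>R b)) (h *\<^sub>R b))) (at s)" for s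
      by (rule has_derivative_compose[OF _ D]) (auto intro!: derivative_eq_intros)
    have "\<exists>s\<in>{0<..<t k}. norm (f (x + t k *\<^sub>R b) - f (x + 0 *\<^sub>R b)) \<le> norm (frechet_derivative f (at (x + s *\<^sub>R b)) ((t k - 0) *\<^sub>R b))"
      by (rule mvt_general[OF t(1) has_derivative_continuous_on[OF has_derivative_at_withinI[OF der]] der])
    then obtain s where "norm (f (x + t k *\<^sub>R b) - f x) \<le> norm (frechet_derivative f (at (x + s *\<^sub>R b)) (t k *\<^sub>R b))"
      by auto
    also have "\<dots> = t k * norm (g (x + s *\<^sub>R b))"
      using t(1)[of k] unfolding g_def linear_scale[OF has_derivative_linear[OF D]] by simp
    also have "\<dots> \<le> t k * B" using B(2) t(1)[of k] by (intro mult_left_mono) auto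
    finally show ?thesis
      using True t(1)[of k] by (simp add: q_def norm_divide field_simps)
  next
    case False
    have "norm x \<le> norm (x + t k *\<^sub>R b) + norm (t k *\<^sub>R b)"
      using norm_triangle_sub[of x "x + t k *\<^sub>R b"] by simp
    also have "norm (t k *\<^sub>R b) \<le> 1" using t[of k] b0 by simp
    finally have "x + t k *\<^sub>R b \<notin> cball 0 R" "x \<notin> cball 0 R" using False by auto
    then show ?thesis using False f(2) by (simp add: q_def)
  qed
  have [measurable]: "q k \<in> borel_measurable borel" for k unfolding q_def by measurable
  have "(\<lambda>k. \<integral>x. cis (- (\<xi> \<bullet> x)) * q k x \<partial>lborel) \<longlonglongrightarrow> (\<integral>x. cis (- (\<xi> \<bullet> x)) * g x \<partial>lborel)"
  proof (rule integral_dominated_convergence)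
    show "integrable lborel (\<lambda>x. B * indicator (cball 0 (R + 1)) x :: real)"
      by (intro integrable_mult_right integrable_real_indicator) (auto intro!: emeasure_bounded_finite[unfolded infinity_ennreal_def])
    show "AE x in lborel. norm (cis (- (\<xi> \<bullet> x)) * q k x) \<le> B * indicator (cball 0 (R + 1)) x" for k
      using q_bd by (intro AE_I2) (simp add: norm_mult)
    show "AE x in lborel. (\<lambda>k. cis (- (\<xi> \<bullet> x)) * q k x) \<longlonglongrightarrow> cis (- (\<xi> \<bullet> x)) * g x"
      by (intro AE_I2 tendsto_intros q_lim)
  qed measurable
  then have L1: "(\<lambda>k. fourier_integral lborel (q k) \<xi>) \<longlonglongrightarrow> fourier_integral lborel g \<xi>"
    by (simp add: fourier_integral_def)
  have qF: "fourier_integral lborel (q k) \<xi> = (cis (\<xi> \<bullet> (t k *\<^sub>R b)) - 1) / of_real (t k) * fourier_integral lborel f \<xi>" for k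
  proof -
    have fi': "integrable lborel (\<lambda>x. f (x + t k *\<^sub>R b))"
    proof -
      have "integrable (distr lborel borel ((+) (t k *\<^sub>R b))) f"
        using fi by (simp add: lborel_distr_plus)
      then show ?thesis by (subst (asm) integrable_distr_eq) (auto simp: add.commute)
    qed
    have "fourier_integral lborel (q k) \<xi>
      = (\<integral>x. (cis (- (\<xi> \<bullet> x)) * f (x + t k *\<^sub>R b) - cis (- (\<xi> \<bullet> x)) * f x) / of_real (t k) \<partial>lborel)"
      unfolding fourier_integral_def q_def by (simp add: right_diff_distrib)
    also have "\<dots> = (fourier_integral lborel (\<lambda>x. f (x + t k *\<^sub>R b)) \<xi> - fourier_integral lborel f \<xi>) / of_real (t k)"
      unfolding fourier_integral_def integral_divide_zero
      by (subst Bochner_Integration.integral_diff)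
         (rule integrable_cis_mult[OF id_measurable_lborel fi'] integrable_cis_mult[OF id_measurable_lborel fi] refl)+
    finally show ?thesis
      by (simp add: fourier_integral_translate left_diff_distrib)
  qed
  have "(cis has_derivative (\<lambda>h. of_real h * (\<i> * cis 0))) (at 0)"
    by (auto intro!: derivative_eq_intros simp: scaleR_conv_of_real)
  then have "((\<lambda>s. cis (s * (\<xi> \<bullet> b))) has_derivative (\<lambda>h. of_real (h * (\<xi> \<bullet> b)) * (\<i> * cis 0))) (at 0)"
    by (intro has_derivative_compose[of "\<lambda>s. s * (\<xi> \<bullet> b)" _ 0 UNIV cis, simplified]) (auto intro!: derivative_eq_intros)
  from directional_quotient_tendsto[OF this, of 1]
  have "(\<lambda>k. (cis (\<xi> \<bullet> (t k *\<^sub>R b)) - 1) / of_real (t k)) \<longlonglongrightarrow> \<i> * of_real (\<xi> \<bullet> b)"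
    by (simp add: t_def mult.commute)
  then have L2: "(\<lambda>k. fourier_integral lborel (q k) \<xi>) \<longlonglongrightarrow> \<i> * of_real (\<xi> \<bullet> b) * fourier_integral lborel f \<xi>"
    unfolding qF by (intro tendsto_intros)
  show ?thesis
    using LIMSEQ_unique[OF L1 L2] by (simp add: g_def[abs_def])
qed

definition laplace :: "('a::euclidean_space \<Rightarrow> complex) \<Rightarrow> 'a \<Rightarrow> complex" where
  "laplace \<phi> x = (\<Sum>b\<in>Basis. frechet_derivative (\<lambda>y. frechet_derivative \<phi> (at y) b) (at x) b)"

lemma laplace_continuous: "C_k (Suc (Suc 0)) \<phi> \<Longrightarrow> continuous_on UNIV (laplace \<phi>)"
  unfolding laplace_def[abs_def] by (auto intro!: continuous_on_sum)

lemma laplace_zero_outside: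
  assumes "open U" "\<And>x. x \<in> U \<Longrightarrow> \<phi> x = 0" "x \<in> U"
  shows "laplace \<phi> x = 0"
  unfolding laplace_def
  by (rule sum.neutral, rule ballI, rule frechet_derivative_zero_on_open[OF assms(1) _ assms(3)])
     (rule frechet_derivative_zero_on_open[OF assms(1,2)])

lemma fourier_integral_laplace:
  fixes \<phi> :: "'a::euclidean_space \<Rightarrow> complex"
  assumes C2: "C_k (Suc (Suc 0)) \<phi>" and R: "\<And>x. x \<notin> cball 0 R \<Longrightarrow> \<phi> x = 0"
  shows "fourier_integral lborel (laplace \<phi>) \<xi> = - of_real ((norm \<xi>)\<^sup>2) * fourier_integral lborel \<phi> \<xi>"
proof -
  let ?d = "\<lambda>b x. frechet_derivative \<phi> (at x) b"
  have d0: "?d b x = 0" if "x \<notin> cball 0 R" for x b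
    by (rule frechet_derivative_zero_on_open[of "- cball 0 R"]) (use R that in auto)
  have dd: "continuous_on UNIV (\<lambda>x. frechet_derivative (?d b) (at x) b)" if "b \<in> Basis" for b
    using C_k_SucD(2)[OF C_k_SucD(2)[OF C2 that] that] by simp
  have i: "integrable lborel (\<lambda>x. frechet_derivative (?d b) (at x) b)" if "b \<in> Basis" for b
    by (rule compact_support_integrable[OF dd[OF that]])
       (rule frechet_derivative_zero_on_open[of "- cball 0 R"], use d0 in auto)
  have "fourier_integral lborel (laplace \<phi>) \<xi>
      = (\<Sum>b\<in>Basis. fourier_integral lborel (\<lambda>x. frechet_derivative (?d b) (at x) b) \<xi>)"
    unfolding fourier_integral_def laplace_def sum_distrib_left
    by (rule Bochner_Integration.integral_sum) (rule integrable_cis_mult[OF id_measurable_lborel i])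
  also have "\<dots> = (\<Sum>b\<in>Basis. - of_real ((\<xi> \<bullet> b) * (\<xi> \<bullet> b)) * fourier_integral lborel \<phi> \<xi>)"
  proof (rule sum.cong[OF refl])
    fix b :: 'a assume b: "b \<in> Basis"
    have "fourier_integral lborel (\<lambda>x. frechet_derivative (?d b) (at x) b) \<xi> = \<i> * of_real (\<xi> \<bullet> b) * fourier_integral lborel (?d b) \<xi>"
      by (rule fourier_integral_derivative[OF C_k_SucD(2)[OF C2 b] d0 b])
    also have "fourier_integral lborel (?d b) \<xi> = \<i> * of_real (\<xi> \<bullet> b) * fourier_integral lborel \<phi> \<xi>"
      by (rule fourier_integral_derivative[OF C_k_less[OF C2] R b])
    also have "\<i> * of_real (\<xi> \<bullet> b) * (\<i> * of_real (\<xi> \<bullet> b) * fourier_integral lborel \<phi> \<xi>)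
        = \<i> * \<i> * of_real ((\<xi> \<bullet> b) * (\<xi> \<bullet> b)) * fourier_integral lborel \<phi> \<xi>"
      by (simp only: of_real_mult mult_ac)
    finally show "fourier_integral lborel (\<lambda>x. frechet_derivative (?d b) (at x) b) \<xi> = - of_real ((\<xi> \<bullet> b) * (\<xi> \<bullet> b)) * fourier_integral lborel \<phi> \<xi>"
      unfolding i_squared by (simp only: mult_minus_left mult_1)
  qed
  also have "\<dots> = - of_real (\<Sum>b\<in>Basis. (\<xi> \<bullet> b) * (\<xi> \<bullet> b)) * fourier_integral lborel \<phi> \<xi>"
    by (simp add: sum_distrib_right sum_negf)
  also have "(\<Sum>b\<in>Basis. (\<xi> \<bullet> b) * (\<xi> \<bullet> b)) = (norm \<xi>)\<^sup>2"
    unfolding power2_norm_eq_inner by (rule euclidean_inner[symmetric])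
  finally show ?thesis .
qed

lemma powr_le_one_plus_square:
  fixes y s :: real
  assumes "0 \<le> y" "0 \<le> s" "s \<le> 2" shows "y powr s \<le> 1 + y\<^sup>2"
proof (cases "y \<le> 1")
  case True
  then have "y powr s \<le> 1" using assms by (simp add: powr_le1)
  then show ?thesis by (simp add: add_increasing2)
next
  case False
  then have "y powr s \<le> y powr 2" using assms by (intro powr_mono) auto
  then show ?thesis using False by simp
qed

text \<open>With X = 1 + |\<xi>|^2 one has X^s <= h^(-2s) (1 + h^4 X^2) for every h > 0, and X times
  the transform of \<phi> is the transform of \<phi> - \<open>laplace \<phi>\<close>. For h the size
  of the features of \<phi> both terms balance, so this takes the place of interpolation between the
  orders 0 and 2.\<close>

lemma sobolev_compact_support:
  fixes \<phi> :: "'a::euclidean_space \<Rightarrow> complex"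
  assumes C2: "C_k (Suc (Suc 0)) \<phi>" and R: "\<And>x. x \<notin> cball 0 R \<Longrightarrow> \<phi> x = 0"
    and s: "0 \<le> s" "s \<le> 2" and "0 < h"
  shows "\<phi> \<in> sobolev_space s"
    and "(sobolev_norm s \<phi>)\<^sup>2 \<le> h powr (- 2 * s) * ((L2_norm lborel \<phi>)\<^sup>2 + h ^ 4 * (L2_norm lborel (\<lambda>x. \<phi> x - laplace \<phi> x))\<^sup>2)"
proof -
  define \<psi> where "\<psi> x = \<phi> x - laplace \<phi> x" for x
  have \<phi>c: "continuous_on UNIV \<phi>" and lc: "continuous_on UNIV (laplace \<phi>)"
    using C_k_continuous[OF C2] laplace_continuous[OF C2] by auto
  have l0: "laplace \<phi> x = 0" if "x \<notin> cball 0 R" for x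
    by (rule laplace_zero_outside[of "- cball 0 R"]) (use R that in auto)
  have \<phi>i: "integrable lborel \<phi>" "\<phi> \<in> L2_space lborel"
    by (rule compact_support_integrable[OF \<phi>c R]; assumption)+
  have li: "integrable lborel (laplace \<phi>)" "laplace \<phi> \<in> L2_space lborel"
    by (rule compact_support_integrable[OF lc l0]; assumption)+
  have \<psi>i: "integrable lborel \<psi>" "\<psi> \<in> L2_space lborel"
    unfolding \<psi>_def[abs_def] using \<phi>i li by auto
  have F\<psi>: "fourier_L1 \<psi> \<xi> = of_real (1 + (norm \<xi>)\<^sup>2) * fourier_L1 \<phi> \<xi>" for \<xi>
  proof -
    have fl: "fourier_integral lborel (laplace \<phi>) \<xi> = - of_real ((norm \<xi>)\<^sup>2) * fourier_integral lborel \<phi> \<xi>"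
      by (rule fourier_integral_laplace[OF C2]) (rule R)
    have "fourier_L1 (laplace \<phi>) \<xi> = - of_real ((norm \<xi>)\<^sup>2) * fourier_L1 \<phi> \<xi>"
      unfolding fourier_L1_eq fl by (rule mult.left_commute)
    then show ?thesis
      unfolding \<psi>_def[abs_def] fourier_L1_diff[OF \<phi>i(1) li(1)] by (simp add: distrib_right)
  qed
  note b\<phi> = fourier_L1_bessel[OF \<phi>i] and b\<psi> = fourier_L1_bessel[OF \<psi>i]
  let ?W = "\<lambda>\<xi>. of_real (sobolev_weight s \<xi>) * fourier_L1 \<phi> \<xi>"
  let ?m = "\<lambda>\<xi>. h powr (- 2 * s) * ((cmod (fourier_L1 \<phi> \<xi>))\<^sup>2 + h ^ 4 * (cmod (fourier_L1 \<psi> \<xi>))\<^sup>2)"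
  have pw: "(cmod (?W \<xi>))\<^sup>2 \<le> ?m \<xi>" for \<xi>
  proof -
    let ?X = "1 + (norm \<xi>)\<^sup>2"
    have X: "0 < ?X" by (simp add: add_pos_nonneg)
    have hp: "h powr (- 2 * s) * (h\<^sup>2) powr s = 1"
      using \<open>0 < h\<close> by (simp add: powr_powr powr_add[symmetric] flip: powr_numeral)
    have "?X powr s = h powr (- 2 * s) * (h\<^sup>2) powr s * ?X powr s"
      unfolding hp by simp
    also have "\<dots> = h powr (- 2 * s) * (h\<^sup>2 * ?X) powr s"
      by (simp add: powr_mult mult.assoc)
    also have "\<dots> \<le> h powr (- 2 * s) * (1 + (h\<^sup>2 * ?X)\<^sup>2)"
      using X s by (intro mult_left_mono powr_le_one_plus_square) auto
    finally have "?X powr s \<le> h powr (- 2 * s) * (1 + h ^ 4 * ?X\<^sup>2)"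
      by (simp add: power_mult_distrib flip: power_mult)
    then have "?X powr s * (cmod (fourier_L1 \<phi> \<xi>))\<^sup>2 \<le> h powr (- 2 * s) * (1 + h ^ 4 * ?X\<^sup>2) * (cmod (fourier_L1 \<phi> \<xi>))\<^sup>2"
      by (rule mult_right_mono) simp
    also have "\<dots> = ?m \<xi>"
      unfolding F\<psi> norm_mult norm_of_real power_mult_distrib power2_abs by (simp add: algebra_simps)
    finally show ?thesis unfolding weighted_power2 .
  qed
  have mi: "integrable lborel ?m"
    by (intro integrable_mult_right Bochner_Integration.integrable_add L2_spaceD(2) b\<phi>(1) b\<psi>(1))
  have [measurable]: "fourier_L1 \<phi> \<in> borel_measurable borel" using b\<phi>(1) by auto
  have W: "?W \<in> L2_space lborel"
    by (rule L2_spaceI_bound[OF _ mi]) (use pw in auto)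
  then show "\<phi> \<in> sobolev_space s"
    by (simp add: sobolev_norm_L1[OF \<phi>i])
  have "(sobolev_norm s \<phi>)\<^sup>2 = (\<integral>\<xi>. (cmod (?W \<xi>))\<^sup>2 \<partial>lborel)"
    unfolding sobolev_norm_L1(2)[OF \<phi>i] by (rule L2_norm_power2)
  also have "\<dots> \<le> (\<integral>\<xi>. ?m \<xi> \<partial>lborel)"
    by (rule integral_mono[OF _ mi pw]) (use W in auto)
  also have "\<dots> = h powr (- 2 * s) * ((L2_norm lborel (fourier_L1 \<phi>))\<^sup>2 + h ^ 4 * (L2_norm lborel (fourier_L1 \<psi>))\<^sup>2)"
    unfolding L2_norm_power2 using b\<phi>(1) b\<psi>(1) by (subst integral_mult_right_zero, subst Bochner_Integration.integral_add) auto
  also have "\<dots> \<le> h powr (- 2 * s) * ((L2_norm lborel \<phi>)\<^sup>2 + h ^ 4 * (L2_norm lborel \<psi>)\<^sup>2)"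
    using b\<phi>(2) b\<psi>(2) \<open>0 < h\<close> by (intro mult_left_mono add_mono power_mono) auto
  finally show "(sobolev_norm s \<phi>)\<^sup>2 \<le> h powr (- 2 * s) * ((L2_norm lborel \<phi>)\<^sup>2 + h ^ 4 * (L2_norm lborel (\<lambda>x. \<phi> x - laplace \<phi> x))\<^sup>2)"
    by (simp add: \<psi>_def[abs_def])
qed


section \<open>Hausdorff measure on Borel sets\<close>

abbreviation covers :: "real \<Rightarrow> 'a::metric_space set \<Rightarrow> (nat \<Rightarrow> 'a set) set" where
  "covers \<delta> A \<equiv> {U. A \<subseteq> (\<Union>i. U i) \<and> (\<forall>i. bounded (U i) \<and> diameter (U i) \<le> \<delta>)}"

lemma hausdorff_gauge_empty [simp]: "hausdorff_gauge d {} = 0"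
  by (simp add: hausdorff_gauge_def)

lemma hausdorff_content_le:
  assumes "U \<in> covers \<delta> A" shows "hausdorff_content d \<delta> A \<le> (\<Sum>i. hausdorff_gauge d (U i))"
  unfolding hausdorff_content_def by (rule INF_lower) (use assms in simp)

lemma hausdorff_content_mono: "A \<subseteq> B \<Longrightarrow> hausdorff_content d \<delta> A \<le> hausdorff_content d \<delta> B"
  unfolding hausdorff_content_def by (rule INF_superset_mono) auto

lemma hausdorff_content_antimono: "\<delta> \<le> \<delta>' \<Longrightarrow> hausdorff_content d \<delta>' A \<le> hausdorff_content d \<delta> A"
  unfolding hausdorff_content_def by (rule INF_superset_mono) (auto intro: order_trans)

lemma hausdorff_content_empty: "0 \<le> \<delta> \<Longrightarrow> hausdorff_content d \<delta> {} = 0"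
  using hausdorff_content_le[where U = "\<lambda>_. {}" and \<delta> = \<delta> and A = "{}" and d = d] by simp

text \<open>Near-optimal covers of the A i, with errors e 2^(-i-1) that add up to e, are merged into
  one sequence by a pairing of the indices.\<close>

lemma hausdorff_content_subadditive:
  "hausdorff_content d \<delta> (\<Union>i::nat. A i) \<le> (\<Sum>i. hausdorff_content d \<delta> (A i))"
proof (cases "(\<Sum>i. hausdorff_content d \<delta> (A i)) = \<top>")
  case False
  have fin: "hausdorff_content d \<delta> (A i) \<noteq> \<top>" for i
    using False sum_le_suminf[of "\<lambda>i. hausdorff_content d \<delta> (A i)" "{i}"] by (auto simp: top_unique)
  show ?thesis
  proof (rule ennreal_le_epsilon)
    fix e :: real assume "0 < e"
    have "\<forall>i. \<exists>U. U \<in> covers \<delta> (A i) \<and> (\<Sum>j. hausdorff_gauge d (U j)) < hausdorff_content d \<delta> (A i) + ennreal (e * (1/2) ^ Suc i)"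
    proof
      fix i
      have "hausdorff_content d \<delta> (A i) < hausdorff_content d \<delta> (A i) + ennreal (e * (1/2) ^ Suc i)"
        using ennreal_add_left_cancel_less[of "hausdorff_content d \<delta> (A i)" 0 "ennreal (e * (1/2) ^ Suc i)"]
          fin[of i] \<open>0 < e\<close> by simp
      then show "\<exists>U. U \<in> covers \<delta> (A i) \<and> (\<Sum>j. hausdorff_gauge d (U j)) < hausdorff_content d \<delta> (A i) + ennreal (e * (1/2) ^ Suc i)"
        by (subst (asm) (1) hausdorff_content_def) (simp add: INF_less_iff Bex_def)
    qed
    from choice[OF this] obtain U where "\<forall>i. U i \<in> covers \<delta> (A i) \<and>
      (\<Sum>j. hausdorff_gauge d (U i j)) < hausdorff_content d \<delta> (A i) + ennreal (e * (1/2) ^ Suc i)" ..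
    then have U: "\<And>i. U i \<in> covers \<delta> (A i)"
      "\<And>i. (\<Sum>j. hausdorff_gauge d (U i j)) < hausdorff_content d \<delta> (A i) + ennreal (e * (1/2) ^ Suc i)"
      by simp_all
    define V where "V n = (case prod_decode n of (i, j) \<Rightarrow> U i j)" for n
    have "V \<in> covers \<delta> (\<Union>i. A i)"
    proof -
      have "x \<in> (\<Union>n. V n)" if x: "x \<in> A i" for x i
      proof -
        obtain j where "x \<in> U i j" using U(1)[of i] x by blast
        then have "x \<in> V (prod_encode (i, j))" by (simp add: V_def)
        then show ?thesis by blast
      qed
      moreover have "bounded (V n) \<and> diameter (V n) \<le> \<delta>" for n
        using U(1) by (auto simp: V_def split: prod.split)
      ultimately show ?thesis by blast
    qed
    then have "hausdorff_content d \<delta> (\<Union>i. A i) \<le> (\<Sum>n. hausdorff_gauge d (V n))"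
      by (rule hausdorff_content_le)
    also have "\<dots> = (\<Sum>i. \<Sum>j. hausdorff_gauge d (U i j))"
      using suminf_ennreal_2dimen[of "\<lambda>i. \<Sum>j. hausdorff_gauge d (U i j)" "\<lambda>p. hausdorff_gauge d (U (fst p) (snd p))"]
      by (simp add: V_def case_prod_unfold o_def)
    also have "\<dots> \<le> (\<Sum>i. hausdorff_content d \<delta> (A i) + ennreal (e * (1/2) ^ Suc i))"
      by (rule suminf_le, rule less_imp_le[OF U(2)]) auto
    also have "\<dots> = (\<Sum>i. hausdorff_content d \<delta> (A i)) + (\<Sum>i. ennreal (e * (1/2) ^ Suc i))"
      by (rule suminf_add[symmetric]) auto
    also have "(\<Sum>i. ennreal (e * (1/2) ^ Suc i)) = ennreal e"
    proof -
      have "(\<lambda>i. e * (1/2) ^ Suc i) sums (e * 1)"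
        by (intro sums_mult power_half_series)
      then show ?thesis
        using \<open>0 < e\<close> by (subst suminf_ennreal2) (auto simp: sums_iff)
    qed
    finally show "hausdorff_content d \<delta> (\<Union>i. A i) \<le> (\<Sum>i. hausdorff_content d \<delta> (A i)) + ennreal e" .
  qed
qed simp

section \<open>The Hausdorff outer measure and Caratheodory's criterion\<close>

lemma hausdorff_content_le_outer: "0 < \<delta> \<Longrightarrow> hausdorff_content d \<delta> A \<le> hausdorff_outer d A"
  unfolding hausdorff_outer_def by (rule SUP_upper) simp

lemma hausdorff_outer_empty: "hausdorff_outer d {} = 0"
  unfolding hausdorff_outer_def by (simp add: hausdorff_content_empty)

lemma hausdorff_outer_mono: "A \<subseteq> B \<Longrightarrow> hausdorff_outer d A \<le> hausdorff_outer d B"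
  unfolding hausdorff_outer_def by (intro SUP_mono) (auto intro: hausdorff_content_mono)

lemma hausdorff_outer_subadditive:
  "hausdorff_outer d (\<Union>i::nat. A i) \<le> (\<Sum>i. hausdorff_outer d (A i))"
  unfolding hausdorff_outer_def[of d "\<Union>i. A i"]
proof (rule SUP_least)
  fix \<delta> :: real assume "\<delta> \<in> {0<..}"
  then have "(\<Sum>i. hausdorff_content d \<delta> (A i)) \<le> (\<Sum>i. hausdorff_outer d (A i))"
    by (intro suminf_le hausdorff_content_le_outer) auto
  then show "hausdorff_content d \<delta> (\<Union>i. A i) \<le> (\<Sum>i. hausdorff_outer d (A i))"
    using hausdorff_content_subadditive order_trans by blast
qed

lemma hausdorff_outer_measure_space: "outer_measure_space (Pow UNIV) (hausdorff_outer d)"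
  unfolding outer_measure_space_def positive_def increasing_def countably_subadditive_def
  by (auto simp: hausdorff_outer_empty hausdorff_outer_subadditive intro: hausdorff_outer_mono)

lemma hausdorff_outer_Un_le: "hausdorff_outer d (A \<union> B) \<le> hausdorff_outer d A + hausdorff_outer d B"
proof -
  have "hausdorff_outer d (\<Union>i. binaryset A B i) \<le> (\<Sum>i. hausdorff_outer d (binaryset A B i))"
    by (rule hausdorff_outer_subadditive)
  then show ?thesis
    by (simp add: UN_binaryset_eq suminf_binaryset_eq hausdorff_outer_empty)
qed

text \<open>In a cover by sets of diameter below r no member meets both A and B, so the cover
  splits. Contents grow as the scale shrinks, hence the sum of the two suprema is a supremum over
  common scales.\<close>

lemma hausdorff_outer_separated:
  assumes "0 < r" and sep: "\<And>x y. x \<in> A \<Longrightarrow> y \<in> B \<Longrightarrow> r \<le> dist x y"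
  shows "hausdorff_outer d A + hausdorff_outer d B \<le> hausdorff_outer d (A \<union> B)"
proof -
  have small: "hausdorff_content d \<delta> A + hausdorff_content d \<delta> B \<le> hausdorff_outer d (A \<union> B)"
    if \<delta>: "0 < \<delta>" "\<delta> < r" for \<delta>
  proof -
    have "hausdorff_content d \<delta> A + hausdorff_content d \<delta> B \<le> (\<Sum>i. hausdorff_gauge d (U i))"
      if U: "U \<in> covers \<delta> (A \<union> B)" for U
    proof -
      define UA where "UA i = (if U i \<inter> A \<noteq> {} then U i else {})" for i
      define UB where "UB i = (if U i \<inter> B \<noteq> {} then U i else {})" for i
      have d0: "diameter ({} :: 'a set) \<le> \<delta>" using \<delta> by simp
      have "UA \<in> covers \<delta> A" "UB \<in> covers \<delta> B"
        using U d0 unfolding UA_def UB_def by (simp; blast)+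
      then have "hausdorff_content d \<delta> A + hausdorff_content d \<delta> B
        \<le> (\<Sum>i. hausdorff_gauge d (UA i)) + (\<Sum>i. hausdorff_gauge d (UB i))"
        by (intro add_mono hausdorff_content_le)
      also have "\<dots> = (\<Sum>i. hausdorff_gauge d (UA i) + hausdorff_gauge d (UB i))"
        by (rule suminf_add) auto
      also have "\<dots> \<le> (\<Sum>i. hausdorff_gauge d (U i))"
      proof (intro suminf_le)
        fix i
        have "U i \<inter> A = {} \<or> U i \<inter> B = {}"
        proof (rule ccontr)
          assume "\<not> ?thesis"
          then obtain x y where xy: "x \<in> U i" "x \<in> A" "y \<in> U i" "y \<in> B" by blast
          have "dist x y \<le> diameter (U i)"
            using U xy by (intro diameter_bounded_bound) auto
          also have "\<dots> < r" using U \<delta> by (auto intro: le_less_trans)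
          finally show False using sep[OF xy(2,4)] by simp
        qed
        then show "hausdorff_gauge d (UA i) + hausdorff_gauge d (UB i) \<le> hausdorff_gauge d (U i)"
          by (auto simp: UA_def UB_def)
      qed auto
      finally show ?thesis .
    qed
    then have "hausdorff_content d \<delta> A + hausdorff_content d \<delta> B \<le> hausdorff_content d \<delta> (A \<union> B)"
      unfolding hausdorff_content_def[of d \<delta> "A \<union> B"] by (intro INF_greatest) simp
    also have "\<dots> \<le> hausdorff_outer d (A \<union> B)"
      by (rule hausdorff_content_le_outer[OF \<delta>(1)])
    finally show ?thesis .
  qed
  have "hausdorff_outer d A + hausdorff_outer d B
      = (SUP \<delta>\<in>{0<..}. hausdorff_content d \<delta> A + hausdorff_content d \<delta> B)"
    unfolding hausdorff_outer_def
  proof (rule SUP_add_directed_ennreal[symmetric])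
    fix \<delta>1 \<delta>2 :: real assume "\<delta>1 \<in> {0<..}" "\<delta>2 \<in> {0<..}"
    then show "\<exists>k\<in>{0<..}. hausdorff_content d \<delta>1 A + hausdorff_content d \<delta>2 B \<le> hausdorff_content d k A + hausdorff_content d k B"
      by (intro bexI[of _ "min \<delta>1 \<delta>2"] add_mono hausdorff_content_antimono) auto
  qed
  also have "\<dots> \<le> hausdorff_outer d (A \<union> B)"
  proof (rule SUP_least)
    fix \<delta> :: real assume "\<delta> \<in> {0<..}"
    then have "hausdorff_content d \<delta> A + hausdorff_content d \<delta> B
      \<le> hausdorff_content d (min \<delta> (r/2)) A + hausdorff_content d (min \<delta> (r/2)) B"
      by (intro add_mono hausdorff_content_antimono) auto
    also have "\<dots> \<le> hausdorff_outer d (A \<union> B)"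
      using \<open>\<delta> \<in> {0<..}\<close> \<open>0 < r\<close> by (intro small) auto
    finally show "hausdorff_content d \<delta> A + hausdorff_content d \<delta> B \<le> hausdorff_outer d (A \<union> B)" .
  qed
  finally show ?thesis .
qed

lemma hausdorff_outer_finite_separated:
  assumes "\<And>i j. i < j \<Longrightarrow> \<exists>r>0. \<forall>x\<in>R i. \<forall>y\<in>R j. r \<le> dist x y"
  shows "(\<Sum>i<n. hausdorff_outer d (R i)) \<le> hausdorff_outer d (\<Union>i<n::nat. R i)"
proof (induction n)
  case (Suc n)
  have "\<exists>r>0. \<forall>x\<in>(\<Union>i<k. R i). \<forall>y\<in>R n. r \<le> dist x y" if "k \<le> n" for k
    using that
  proof (induction k)
    case 0
    show ?case by (auto intro: exI[of _ 1])
  next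
    case (Suc k)
    then obtain r1 where r1: "0 < r1" "\<forall>x\<in>(\<Union>i<k. R i). \<forall>y\<in>R n. r1 \<le> dist x y" by auto
    obtain r2 where r2: "0 < r2" "\<forall>x\<in>R k. \<forall>y\<in>R n. r2 \<le> dist x y" using assms[of k n] Suc.prems by auto
    show ?case
      by (rule exI[of _ "min r1 r2"]) (use r1 r2 in \<open>auto simp: less_Suc_eq min_le_iff_disj\<close>)
  qed
  from this[of n] obtain r where r: "0 < r" "\<And>x y. x \<in> (\<Union>i<n. R i) \<Longrightarrow> y \<in> R n \<Longrightarrow> r \<le> dist x y" by auto
  have "(\<Sum>i<Suc n. hausdorff_outer d (R i)) \<le> hausdorff_outer d (\<Union>i<n. R i) + hausdorff_outer d (R n)"
    using Suc.IH by (simp add: add_right_mono)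
  also have "\<dots> \<le> hausdorff_outer d ((\<Union>i<n. R i) \<union> R n)"
    by (rule hausdorff_outer_separated[OF r])
  also have "(\<Union>i<n. R i) \<union> R n = (\<Union>i<Suc n. R i)"
    by (auto simp: less_Suc_eq)
  finally show ?case .
qed (simp add: hausdorff_outer_empty)

text \<open>Caratheodory's criterion: the annuli \<open>R k\<close> around \<open>F\<close> with indices of equal parity are separated,
  which makes the sum of their outer measures finite.\<close>

lemma hausdorff_outer_closed_split:
  fixes F A :: "'a::metric_space set"
  assumes F: "closed F"
  shows "hausdorff_outer d (F \<inter> A) + hausdorff_outer d (A - F) \<le> hausdorff_outer d A"
proof (cases "F = {} \<or> hausdorff_outer d A = \<top>")
  case True
  then show ?thesis by (auto simp: hausdorff_outer_empty)
next
  case False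
  then have F0: "F \<noteq> {}" and fin: "hausdorff_outer d A \<noteq> \<top>" by auto
  let ?H = "hausdorff_outer d"
  define B where "B k = {x\<in>A. 1 / real (Suc k) \<le> infdist x F}" for k
  define R where "R k = B (Suc k) - B k" for k
  have inf_lip: "infdist x F \<le> infdist y F + dist x y" for x y
    by (rule infdist_triangle)
  have sepR: "1 / real (Suc (Suc i)) - 1 / real (Suc j) \<le> dist x y" if "x \<in> R i" "y \<in> R j" for i j x y
  proof -
    have "1 / real (Suc (Suc i)) \<le> infdist x F" "infdist y F < 1 / real (Suc j)"
      using that by (auto simp: R_def B_def)
    then show ?thesis using inf_lip[of x y] by linarith
  qed
  have sep: "\<exists>r>0. \<forall>x\<in>R i. \<forall>y\<in>R j. r \<le> dist x y" if "Suc i < j" for i j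
  proof -
    have "1 / real (Suc j) < 1 / real (Suc (Suc i))"
      using that by (intro divide_strict_left_mono) auto
    then have "0 < 1 / real (Suc (Suc i)) - 1 / real (Suc j)" by simp
    then show ?thesis using sepR by blast
  qed
  have RA: "R k \<subseteq> A" for k by (auto simp: R_def B_def)
  have evn: "(\<Sum>i<n. ?H (R (2 * i))) \<le> ?H A" for n
    by (rule order_trans[OF hausdorff_outer_finite_separated hausdorff_outer_mono])
       (rule sep, simp, rule UN_least[OF RA])
  have odd: "(\<Sum>i<n. ?H (R (2 * i + 1))) \<le> ?H A" for n
    by (rule order_trans[OF hausdorff_outer_finite_separated hausdorff_outer_mono])
       (rule sep, simp, rule UN_least[OF RA])
  have "(\<Sum>i<2 * n. ?H (R i)) = (\<Sum>i<n. ?H (R (2 * i))) + (\<Sum>i<n. ?H (R (2 * i + 1)))" for n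
    by (induction n) (auto simp: algebra_simps)
  then have ev_part: "(\<Sum>i<2 * n. ?H (R i)) \<le> 2 * ?H A" for n
    using add_mono[OF evn odd] by (simp add: mult_2)
  have "(\<Sum>i<n. ?H (R i)) \<le> 2 * ?H A" for n
    by (rule order_trans[OF sum_mono2[of "{..<2 * n}" "{..<n}"] ev_part]) auto
  then have "(\<Sum>i. ?H (R i)) \<le> 2 * ?H A"
    by (rule suminf_le_const[OF summableI])
  then have tot: "(\<Sum>i. ?H (R i)) \<noteq> \<top>"
    using fin by (auto simp: top_unique ennreal_mult_eq_top_iff)
  \<comment> \<open>A point of A - F has positive distance to the closed set F, so it lies in some B
    m, and then either in B k or in an annulus of index at least k.\<close>
  have tail: "?H (A - F) \<le> ?H (B k) + (\<Sum>i. ?H (R (i + k)))" for k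
  proof -
    have "A - F \<subseteq> B k \<union> (\<Union>i. R (i + k))"
    proof
      fix x assume x: "x \<in> A - F"
      then have "0 < infdist x F"
        using infdist_pos_not_in_closed[OF F F0] by auto
      then obtain m where "1 / real (Suc m) < infdist x F"
        using reals_Archimedean by (auto simp: inverse_eq_divide)
      then have xm: "x \<in> B m" using x by (auto simp: B_def)
      show "x \<in> B k \<union> (\<Union>i. R (i + k))"
      proof (cases "x \<in> B k")
        case False
        define l where "l = (LEAST l. x \<in> B l)"
        have l: "x \<in> B l" unfolding l_def using xm by (rule LeastI)
        have nl: "x \<notin> B j" if "j < l" for j using not_less_Least[of j "\<lambda>l. x \<in> B l"] that unfolding l_def by simp
        have mono: "B i \<subseteq> B j" if "i \<le> j" for i j
        proof -
          have "1 / real (Suc j) \<le> 1 / real (Suc i)"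
            using that by (intro divide_left_mono) auto
          then show ?thesis unfolding B_def by (auto intro: order_trans)
        qed
        have "k < l" using False l mono[of l k] by (meson not_less subsetD)
        then obtain l' where l': "l = Suc l'" "k \<le> l'" by (cases l) auto
        then have "x \<in> R l'" using l nl[of l'] by (simp add: R_def)
        then have "x \<in> R ((l' - k) + k)" using l' by simp
        then show ?thesis by blast
      qed simp
    qed
    then have "?H (A - F) \<le> ?H (B k \<union> (\<Union>i. R (i + k)))" by (rule hausdorff_outer_mono)
    also have "\<dots> \<le> ?H (B k) + ?H (\<Union>i. R (i + k))" by (rule hausdorff_outer_Un_le)
    also have "\<dots> \<le> ?H (B k) + (\<Sum>i. ?H (R (i + k)))"
      by (intro add_left_mono hausdorff_outer_subadditive)
    finally show ?thesis .
  qed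
  have main: "?H (F \<inter> A) + ?H (A - F) \<le> ?H A + (\<Sum>i. ?H (R (i + k)))" for k
  proof -
    have "?H (F \<inter> A) + ?H (B k) \<le> ?H ((F \<inter> A) \<union> B k)"
    proof (rule hausdorff_outer_separated)
      show "0 < 1 / real (Suc k)" by simp
      fix x y assume "x \<in> F \<inter> A" "y \<in> B k"
      then show "1 / real (Suc k) \<le> dist x y"
        using infdist_le[of x F y] by (auto simp: B_def dist_commute)
    qed
    also have "\<dots> \<le> ?H A" by (rule hausdorff_outer_mono) (auto simp: B_def)
    finally have le: "?H (F \<inter> A) + ?H (B k) \<le> ?H A" .
    have "?H (F \<inter> A) + ?H (A - F) \<le> ?H (F \<inter> A) + (?H (B k) + (\<Sum>i. ?H (R (i + k))))"
      by (rule add_left_mono[OF tail])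
    also have "\<dots> \<le> ?H A + (\<Sum>i. ?H (R (i + k)))"
      unfolding add.assoc[symmetric] by (rule add_right_mono[OF le])
    finally show ?thesis .
  qed
  show ?thesis
  proof (rule ennreal_le_epsilon)
    fix e :: real assume "0 < e"
    define a where "a i = enn2real (?H (R i))" for i
    have a: "?H (R i) = ennreal (a i)" "0 \<le> a i" for i
      using tot sum_le_suminf[of "\<lambda>i. ?H (R i)" "{i}"] by (auto simp: a_def less_top top_unique)
    have sa: "summable a"
      using tot a by (intro summable_suminf_not_top) auto
    obtain k where k: "norm (\<Sum>i. a (i + k)) < e"
      using suminf_exist_split[OF \<open>0 < e\<close> sa] by auto
    have "(\<Sum>i. ?H (R (i + k))) = ennreal (\<Sum>i. a (i + k))"
      unfolding a(1) using a(2) sa by (intro suminf_ennreal2) (auto simp: summable_iff_shift)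
    also have "\<dots> \<le> ennreal e" using k by (intro ennreal_leI) auto
    finally show "?H (F \<inter> A) + ?H (A - F) \<le> ?H A + ennreal e"
      using main[of k] by (meson add_left_mono order_trans)
  qed
qed

text \<open>Closed sets satisfy Caratheodory's criterion, and the sets that do so form a
  sigma-algebra, which therefore contains all Borel sets.\<close>

lemma hausdorff_measure_space:
  "measure_space (UNIV :: 'a::metric_space set) (sets borel) (hausdorff_outer d)"
proof -
  let ?L = "lambda_system (UNIV :: 'a set) (Pow UNIV) (hausdorff_outer d)"
  have ms: "measure_space UNIV ?L (hausdorff_outer d)"
    by (rule sigma_algebra.caratheodory_lemma[OF sigma_algebra_Pow hausdorff_outer_measure_space])
  then have sa: "sigma_algebra UNIV ?L" by (simp add: measure_space_def)
  have closed: "F \<in> ?L" if "closed F" for F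
  proof -
    have "hausdorff_outer d (F \<inter> A) + hausdorff_outer d ((UNIV - F) \<inter> A) = hausdorff_outer d A" for A
    proof (rule antisym)
      have "(UNIV - F) \<inter> A = A - F" by auto
      then show "hausdorff_outer d (F \<inter> A) + hausdorff_outer d ((UNIV - F) \<inter> A) \<le> hausdorff_outer d A"
        using hausdorff_outer_closed_split[OF that] by simp
      have "A = (F \<inter> A) \<union> ((UNIV - F) \<inter> A)" by auto
      then show "hausdorff_outer d A \<le> hausdorff_outer d (F \<inter> A) + hausdorff_outer d ((UNIV - F) \<inter> A)"
        using hausdorff_outer_Un_le by metis
    qed
    then show ?thesis by (simp add: lambda_system_def)
  qed
  have "sets (borel :: 'a measure) = sigma_sets UNIV (Collect closed)"
    unfolding borel_eq_closed by (simp add: sets_measure_of)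
  also have "\<dots> \<subseteq> ?L"
    using closed by (intro sigma_algebra.sigma_sets_subset[OF sa]) auto
  finally show ?thesis
    using measure_down[OF ms] sets.sigma_algebra_axioms[of borel] by simp
qed

lemma sets_hausdorff_measure [simp, measurable_cong]: "sets (hausdorff_measure d) = sets borel"
  unfolding hausdorff_measure_def using sets.sigma_sets_eq[of borel] by (simp add: sets_measure_of)

lemma space_hausdorff_measure [simp]: "space (hausdorff_measure d) = UNIV"
  unfolding hausdorff_measure_def by (simp add: space_measure_of)

lemma emeasure_hausdorff_measure:
  assumes "A \<in> sets borel" shows "emeasure (hausdorff_measure d) A = hausdorff_outer d A"
proof (rule emeasure_measure_of[OF hausdorff_measure_def])
  show "positive (sets (hausdorff_measure d)) (hausdorff_outer d)"
    "countably_additive (sets (hausdorff_measure d)) (hausdorff_outer d)"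
    using hausdorff_measure_space by (auto simp: measure_space_def)
qed (use assms in auto)


section \<open>Disjoint attractors\<close>

lemma diameter_le_scale:
  fixes f :: "'a::real_normed_vector \<Rightarrow> 'b::real_normed_vector"
  assumes "bounded A" "0 \<le> c" "\<And>x y. x \<in> A \<Longrightarrow> y \<in> A \<Longrightarrow> dist (f x) (f y) \<le> c * dist x y"
  shows "bounded (f ` A)" "diameter (f ` A) \<le> c * diameter A"
proof -
  have le: "dist (f x) (f y) \<le> c * diameter A" if "x \<in> A" "y \<in> A" for x y
    using assms(3)[OF that] mult_left_mono[OF diameter_bounded_bound[OF assms(1) that] assms(2)] by linarith
  show "bounded (f ` A)"
    using le by (auto simp: bounded_two_points)
  show "diameter (f ` A) \<le> c * diameter A"
    by (rule diameter_le) (use le assms diameter_ge_0 in \<open>auto simp: dist_norm\<close>)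
qed

lemma hausdorff_gauge_scale_le:
  fixes U :: "'a::real_normed_vector set" and V :: "'b::real_normed_vector set"
  assumes "0 < d" "0 < c" "U \<noteq> {} \<Longrightarrow> V \<noteq> {}" "diameter U \<le> c * diameter V" "bounded U" "bounded V"
  shows "hausdorff_gauge d U \<le> ennreal (c powr d) * hausdorff_gauge d V"
proof (cases "U = {}")
  case False
  have "diameter U powr d \<le> (c * diameter V) powr d"
    using assms diameter_ge_0 by (intro powr_mono2) auto
  also have "\<dots> = c powr d * diameter V powr d" by (rule powr_mult)
  finally show ?thesis
    using False assms by (auto simp: hausdorff_gauge_def ennreal_mult[symmetric] intro: ennreal_leI)
qed simp

text \<open>Covers of A at scale \<delta> / c are mapped to covers of the image at scale \<delta>.
  The Lipschitz bound is asked for on S only, because the lemma is also applied to an inverse map,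
  which is controlled on a range.\<close>

lemma hausdorff_outer_image_le:
  fixes f :: "'a::real_normed_vector \<Rightarrow> 'b::real_normed_vector"
  assumes "0 < d" "0 < c" "\<And>x y. x \<in> S \<Longrightarrow> y \<in> S \<Longrightarrow> dist (f x) (f y) \<le> c * dist x y" "A \<subseteq> S"
  shows "hausdorff_outer d (f ` A) \<le> ennreal (c powr d) * hausdorff_outer d A"
  unfolding hausdorff_outer_def[of d "f ` A"]
proof (rule SUP_least)
  fix \<delta> :: real assume "\<delta> \<in> {0<..}"
  then have \<delta>: "0 < \<delta> / c" "c * (\<delta> / c) = \<delta>" using assms(2) by auto
  have le0: "hausdorff_content d \<delta> (f ` A) \<le> ennreal (c powr d) * (\<Sum>i. hausdorff_gauge d (U i))"
    if U: "U \<in> covers (\<delta> / c) A" for U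
  proof -
    define V where "V i = f ` (U i \<inter> S)" for i
    have bd: "bounded (U i \<inter> S)" for i using U by (auto intro: bounded_subset)
    have V: "bounded (V i)" "diameter (V i) \<le> c * diameter (U i \<inter> S)" for i
      unfolding V_def
      by (rule diameter_le_scale(1)[OF bd, of c], use assms in simp_all)
         (rule diameter_le_scale(2)[OF bd, of c], use assms in simp_all)
    have dU: "diameter (U i \<inter> S) \<le> diameter (U i)" for i
      using U by (intro diameter_subset) auto
    then have V': "diameter (V i) \<le> c * diameter (U i)" for i
      using V(2)[of i] mult_left_mono[OF dU[of i], of c] assms(2) by linarith
    have "V \<in> covers \<delta> (f ` A)"
    proof -
      have "diameter (V i) \<le> \<delta>" for i
      proof -
        have "c * diameter (U i) \<le> c * (\<delta> / c)"
          using U assms(2) by (intro mult_left_mono) auto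
        then show ?thesis using V'[of i] \<delta> by linarith
      qed
      moreover have "f ` A \<subseteq> (\<Union>i. V i)"
        using U assms(4) by (fastforce simp: V_def)
      ultimately show ?thesis using V(1) by simp
    qed
    then have "hausdorff_content d \<delta> (f ` A) \<le> (\<Sum>i. hausdorff_gauge d (V i))"
      by (rule hausdorff_content_le)
    also have "\<dots> \<le> (\<Sum>i. ennreal (c powr d) * hausdorff_gauge d (U i))"
      by (intro suminf_le hausdorff_gauge_scale_le assms V' V(1)) (use U in \<open>auto simp: V_def\<close>)
    finally show ?thesis by (simp add: ennreal_suminf_cmult)
  qed
  \<comment> \<open>The factor is moved to the other side so that the infimum over covers can be
    taken of a bare sum.\<close>
  have inv: "ennreal (c powr d) * (ennreal (1 / c powr d) * X) = X" "ennreal (1 / c powr d) * (ennreal (c powr d) * X) = X" for X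
    using assms(2) by (simp_all add: mult.assoc[symmetric] ennreal_mult[symmetric])
  have le: "ennreal (1 / c powr d) * hausdorff_content d \<delta> (f ` A) \<le> (\<Sum>i. hausdorff_gauge d (U i))"
    if "U \<in> covers (\<delta> / c) A" for U
  proof -
    have "ennreal (1 / c powr d) * hausdorff_content d \<delta> (f ` A)
      \<le> ennreal (1 / c powr d) * (ennreal (c powr d) * (\<Sum>i. hausdorff_gauge d (U i)))"
      by (rule mult_left_mono[OF le0[OF that]]) simp
    then show ?thesis unfolding inv .
  qed
  have "ennreal (1 / c powr d) * hausdorff_content d \<delta> (f ` A) \<le> hausdorff_content d (\<delta> / c) A"
    unfolding hausdorff_content_def[of d "\<delta> / c"] by (rule INF_greatest) (rule le)
  also have "\<dots> \<le> hausdorff_outer d A"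
    by (rule hausdorff_content_le_outer[OF \<delta>(1)])
  finally have "ennreal (c powr d) * (ennreal (1 / c powr d) * hausdorff_content d \<delta> (f ` A)) \<le> ennreal (c powr d) * hausdorff_outer d A"
    by (rule mult_left_mono) simp
  then show "hausdorff_content d \<delta> (f ` A) \<le> ennreal (c powr d) * hausdorff_outer d A"
    unfolding inv .
qed

text \<open>The upper bound is the Lipschitz estimate for f, the lower bound the same estimate for
  \<open>inv f\<close>, which has Lipschitz constant 1 / c on the range of f.\<close>

lemma hausdorff_outer_similarity:
  fixes f :: "'a::real_normed_vector \<Rightarrow> 'a"
  assumes "0 < d" "0 < c" and f: "\<And>x y. dist (f x) (f y) = c * dist x y"
  shows "hausdorff_outer d (f ` A) = ennreal (c powr d) * hausdorff_outer d A"
proof (rule antisym)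
  show "hausdorff_outer d (f ` A) \<le> ennreal (c powr d) * hausdorff_outer d A"
    by (rule hausdorff_outer_image_le[OF assms(1,2), of UNIV]) (auto simp: f)
  have inj: "inj f"
  proof (rule injI)
    fix x y assume "f x = f y"
    then show "x = y" using f[of x y] assms(2) by simp
  qed
  have "hausdorff_outer d (inv f ` f ` A) \<le> ennreal ((1 / c) powr d) * hausdorff_outer d (f ` A)"
  proof (rule hausdorff_outer_image_le[OF assms(1), of _ "range f"])
    fix x y assume "x \<in> range f" "y \<in> range f"
    then obtain u v where "x = f u" "y = f v" by auto
    then show "dist (inv f x) (inv f y) \<le> 1 / c * dist x y"
      using f[of u v] assms(2) by (simp add: inv_f_f[OF inj])
  qed (use assms(2) in auto)
  then have "hausdorff_outer d A \<le> ennreal ((1 / c) powr d) * hausdorff_outer d (f ` A)"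
    by (simp add: image_inv_f_f[OF inj])
  then have "ennreal (c powr d) * hausdorff_outer d A \<le> ennreal (c powr d) * (ennreal ((1 / c) powr d) * hausdorff_outer d (f ` A))"
    by (rule mult_left_mono) simp
  also have "\<dots> = ennreal ((c * (1 / c)) powr d) * hausdorff_outer d (f ` A)"
    by (simp only: powr_mult ennreal_mult[OF powr_ge_zero powr_ge_zero] mult.assoc)
  finally show "ennreal (c powr d) * hausdorff_outer d A \<le> hausdorff_outer d (f ` A)"
    using assms(2) by simp
qed

section \<open>Words, pieces and their separation\<close>

locale disjoint_ifs =
  fixes \<Gamma> :: "'a::euclidean_space set" and M :: nat and s :: "nat \<Rightarrow> 'a \<Rightarrow> 'a" and \<rho> :: "nat \<Rightarrow> real"
  assumes M2: "2 \<le> M" and sim: "contracting_similarities M s \<rho>" and att: "disjoint_attractor M s \<Gamma>"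
begin

definition ratio :: "nat list \<Rightarrow> real" where "ratio w = prod_list (map \<rho> w)"

definition word_map :: "nat list \<Rightarrow> 'a \<Rightarrow> 'a" where "word_map w = foldr (\<lambda>m f. s m \<circ> f) w id"

abbreviation "P \<equiv> piece s \<Gamma>"
abbreviation "valid w \<equiv> set w \<subseteq> {1..M}"
abbreviation "R \<equiv> diameter \<Gamma>"

lemma rho_bounds: "m \<in> {1..M} \<Longrightarrow> 0 < \<rho> m" "m \<in> {1..M} \<Longrightarrow> \<rho> m < 1"
  and dist_s: "m \<in> {1..M} \<Longrightarrow> dist (s m x) (s m y) = \<rho> m * dist x y"
  using sim by (auto simp: contracting_similarities_def)

lemma attractor: "\<Gamma> \<noteq> {}" "compact \<Gamma>" "\<Gamma> = (\<Union>m\<in>{1..M}. s m ` \<Gamma>)"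
  using att by (auto simp: disjoint_attractor_def is_attractor_def)

lemma s_in_attractor: "m \<in> {1..M} \<Longrightarrow> x \<in> \<Gamma> \<Longrightarrow> s m x \<in> \<Gamma>"
  by (subst attractor(3)) blast

lemma attractor_cases: "x \<in> \<Gamma> \<Longrightarrow> \<exists>m\<in>{1..M}. x \<in> s m ` \<Gamma>"
  by (subst (asm) attractor(3)) blast

lemma images_disjoint: "m \<in> {1..M} \<Longrightarrow> m' \<in> {1..M} \<Longrightarrow> m \<noteq> m' \<Longrightarrow> s m ` \<Gamma> \<inter> s m' ` \<Gamma> = {}"
  using att by (auto simp: disjoint_attractor_def disjoint_family_on_def)

lemma ratio_simps [simp]: "ratio [] = 1" "ratio (m # w) = \<rho> m * ratio w" "ratio (v @ w) = ratio v * ratio w"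
  by (auto simp: ratio_def)

lemma piece_simps [simp]: "P [] = \<Gamma>" "P (m # w) = s m ` P w"
  by (auto simp: piece_def)

lemma word_map_simps [simp]: "word_map [] = id" "word_map (m # w) = s m \<circ> word_map w"
  by (auto simp: word_map_def)

lemma piece_append: "P (v @ w) = word_map v ` P w"
  by (induction v) (auto simp: image_comp)

lemma piece_eq: "P w = word_map w ` \<Gamma>"
  using piece_append[of w "[]"] by simp

lemma ratio_pos: "valid w \<Longrightarrow> 0 < ratio w"
  by (induction w) (auto intro!: mult_pos_pos rho_bounds)

lemma ratio_le_1: "valid w \<Longrightarrow> ratio w \<le> 1"
  by (induction w) (auto intro!: mult_le_one rho_bounds less_imp_le[OF rho_bounds(2)] less_imp_le[OF ratio_pos])

lemma dist_word_map: "valid w \<Longrightarrow> dist (word_map w x) (word_map w y) = ratio w * dist x y"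
  by (induction w) (auto simp: dist_s)

lemma piece_subset: "valid w \<Longrightarrow> P w \<subseteq> \<Gamma>"
proof (induction w)
  case (Cons m w)
  then have "s m ` P w \<subseteq> s m ` \<Gamma>" by (intro image_mono) simp
  also have "\<dots> \<subseteq> \<Gamma>" using Cons.prems s_in_attractor by auto
  finally show ?case by simp
qed simp

lemma piece_append_subset: "valid w \<Longrightarrow> P (v @ w) \<subseteq> P v"
  unfolding piece_append by (subst piece_eq[of v]) (rule image_mono[OF piece_subset])

lemma continuous_word_map: "valid w \<Longrightarrow> continuous_on UNIV (word_map w)"
proof (rule continuous_on_iff[THEN iffD2], intro ballI allI impI)
  fix x e assume w: "valid w" and "0 < (e::real)"
  then show "\<exists>d>0. \<forall>x'\<in>UNIV. dist x' x < d \<longrightarrow> dist (word_map w x') (word_map w x) < e"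
    using ratio_pos[OF w] by (intro exI[of _ "e / ratio w"]) (auto simp: dist_word_map field_simps)
qed

lemma piece_compact: "valid w \<Longrightarrow> compact (P w)"
  unfolding piece_eq
  by (rule compact_continuous_image[OF continuous_on_subset[OF continuous_word_map] attractor(2)]) auto

lemma piece_nonempty: "P w \<noteq> {}"
  unfolding piece_eq using attractor(1) by simp

lemma diameter_piece: "valid w \<Longrightarrow> diameter (P w) = ratio w * R"
proof (rule antisym)
  assume w: "valid w"
  have bd: "bounded \<Gamma>" using attractor(2) by (rule compact_imp_bounded)
  show "diameter (P w) \<le> ratio w * R"
    unfolding piece_eq using ratio_pos[OF w] by (intro diameter_le_scale[OF bd]) (auto simp: dist_word_map[OF w])
  have "ratio w * R \<le> ratio w * (diameter (P w) / ratio w)"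
  proof (rule mult_left_mono)
    show "R \<le> diameter (P w) / ratio w"
    proof (rule diameter_le)
      show "\<Gamma> \<noteq> {} \<or> 0 \<le> diameter (P w) / ratio w" using attractor(1) by simp
      fix x y assume "x \<in> \<Gamma>" "y \<in> \<Gamma>"
      then have "dist (word_map w x) (word_map w y) \<le> diameter (P w)"
        by (intro diameter_bounded_bound compact_imp_bounded piece_compact w) (auto simp: piece_eq)
      then show "norm (x - y) \<le> diameter (P w) / ratio w"
        using ratio_pos[OF w] by (simp add: dist_word_map[OF w] dist_norm[symmetric] field_simps)
    qed
  qed (use ratio_pos[OF w] in simp)
  then show "ratio w * R \<le> diameter (P w)" using ratio_pos[OF w] by simp
qed

lemma R_pos: "0 < R"
proof -
  obtain g where g: "g \<in> \<Gamma>" using attractor(1) by auto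
  have m: "1 \<in> {1..M}" "2 \<in> {1..M}" using M2 by auto
  have in\<Gamma>: "s 1 g \<in> \<Gamma>" "s 2 g \<in> \<Gamma>"
    using piece_subset[of "[1]"] piece_subset[of "[2]"] m g by auto
  moreover have "s 1 g \<noteq> s 2 g" using images_disjoint[OF m] g by force
  ultimately show ?thesis
    using diameter_bounded_bound[OF compact_imp_bounded[OF attractor(2)] in\<Gamma>] by (metis dist_pos_lt less_le_trans)
qed

definition "rmax = Max (\<rho> ` {1..M})"
definition "rmin = Min (\<rho> ` {1..M})"

lemma rmax: "0 < rmax" "rmax < 1" "m \<in> {1..M} \<Longrightarrow> \<rho> m \<le> rmax"
  and rmin: "0 < rmin" "m \<in> {1..M} \<Longrightarrow> rmin \<le> \<rho> m"
proof -
  have ne: "\<rho> ` {1..M} \<noteq> {}" "finite (\<rho> ` {1..M})" using M2 by auto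
  obtain m where "m \<in> {1..M}" "rmax = \<rho> m" using Max_in[OF ne(2,1)] by (auto simp: rmax_def)
  then show "0 < rmax" "rmax < 1" using rho_bounds by auto
  obtain m' where "m' \<in> {1..M}" "rmin = \<rho> m'" using Min_in[OF ne(2,1)] by (auto simp: rmin_def)
  then show "0 < rmin" using rho_bounds by auto
qed (auto simp: rmax_def rmin_def)

lemma ratio_le_power: "valid w \<Longrightarrow> ratio w \<le> rmax ^ length w"
  by (induction w) (auto intro!: mult_mono rmax less_imp_le[OF ratio_pos] less_imp_le[OF rmax(1)])

lemma rmax_power_small: "0 < e \<Longrightarrow> \<exists>N. rmax ^ N < e"
  using real_arch_pow_inv[of e rmax] rmax by auto

lemma finite_words: "finite {w. valid w \<and> length w = N}"
  by (rule finite_lists_length_eq) simp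

lemma cover_words: "\<Gamma> = (\<Union>w\<in>{w. valid w \<and> length w = N}. P w)"
proof (induction N)
  case (Suc N)
  have "\<Gamma> = (\<Union>m\<in>{1..M}. s m ` (\<Union>w\<in>{w. valid w \<and> length w = N}. P w))"
    unfolding Suc[symmetric] by (rule attractor(3))
  also have "\<dots> = (\<Union>w\<in>{w. valid w \<and> length w = Suc N}. P w)"
  proof (intro equalityI subsetI)
    fix x assume "x \<in> (\<Union>m\<in>{1..M}. s m ` (\<Union>w\<in>{w. valid w \<and> length w = N}. P w))"
    then obtain m w where "m \<in> {1..M}" "valid w" "length w = N" "x \<in> s m ` P w" by blast
    then show "x \<in> (\<Union>w\<in>{w. valid w \<and> length w = Suc N}. P w)"
      by (intro UN_I[of "m # w"]) auto
  next
    fix x assume "x \<in> (\<Union>w\<in>{w. valid w \<and> length w = Suc N}. P w)"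
    then obtain w where w: "valid w" "length w = Suc N" "x \<in> P w" by blast
    then obtain m w' where "w = m # w'" by (cases w) auto
    with w show "x \<in> (\<Union>m\<in>{1..M}. s m ` (\<Union>w\<in>{w. valid w \<and> length w = N}. P w))"
      by (intro UN_I[of m]) auto
  qed
  finally show ?case .
qed (simp add: conj_commute cong: conj_cong)

text \<open>Two distinct images are disjoint and compact, hence at positive distance, and there are
  finitely many pairs; inserting 1 makes the minimum run over a visibly non-empty set.\<close>

lemma gap_exists: "\<exists>\<delta>>0. \<forall>m\<in>{1..M}. \<forall>m'\<in>{1..M}. m \<noteq> m' \<longrightarrow> (\<forall>x\<in>s m ` \<Gamma>. \<forall>y\<in>s m' ` \<Gamma>. \<delta> \<le> dist x y)"
proof -
  let ?I = "{p \<in> {1..M} \<times> {1..M}. fst p \<noteq> snd p}"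
  have cp: "compact (s m ` \<Gamma>)" if "m \<in> {1..M}" for m
    using piece_compact[of "[m]"] that by simp
  have "\<exists>\<delta>>0. \<forall>x\<in>s (fst p) ` \<Gamma>. \<forall>y\<in>s (snd p) ` \<Gamma>. \<delta> \<le> dist x y" if "p \<in> ?I" for p
    using that by (intro separate_compact_closed cp compact_imp_closed images_disjoint) auto
  then have "\<forall>p\<in>?I. \<exists>\<delta>>0. \<forall>x\<in>s (fst p) ` \<Gamma>. \<forall>y\<in>s (snd p) ` \<Gamma>. \<delta> \<le> dist x y" by blast
  from bchoice[OF this] obtain f where f: "\<forall>p\<in>?I. 0 < f p \<and> (\<forall>x\<in>s (fst p) ` \<Gamma>. \<forall>y\<in>s (snd p) ` \<Gamma>. f p \<le> dist x y)" ..
  define \<delta> where "\<delta> = Min (insert 1 (f ` ?I))"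
  have fin: "finite (insert 1 (f ` ?I))" by simp
  have "0 < \<delta>" unfolding \<delta>_def using f by (subst Min_gr_iff[OF fin]) auto
  moreover have "\<delta> \<le> f p" if "p \<in> ?I" for p
    unfolding \<delta>_def using that by (intro Min_le fin) auto
  moreover have "\<delta> \<le> dist x y"
    if "m \<in> {1..M}" "m' \<in> {1..M}" "m \<noteq> m'" "x \<in> s m ` \<Gamma>" "y \<in> s m' ` \<Gamma>" for m m' x y
  proof -
    have p: "(m, m') \<in> ?I" using that by simp
    have "\<delta> \<le> f (m, m')" using p by (rule calculation(2))
    also have "f (m, m') \<le> dist x y" using f[rule_format, OF p] that by auto
    finally show ?thesis .
  qed
  ultimately show ?thesis by blast
qed

definition "gap = (SOME \<delta>. 0 < \<delta> \<and> (\<forall>m\<in>{1..M}. \<forall>m'\<in>{1..M}. m \<noteq> m' \<longrightarrow> (\<forall>x\<in>s m ` \<Gamma>. \<forall>y\<in>s m' ` \<Gamma>. \<delta> \<le> dist x y)))"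

lemma gap_pos: "0 < gap"
  and gap: "m \<in> {1..M} \<Longrightarrow> m' \<in> {1..M} \<Longrightarrow> m \<noteq> m' \<Longrightarrow> x \<in> s m ` \<Gamma> \<Longrightarrow> y \<in> s m' ` \<Gamma> \<Longrightarrow> gap \<le> dist x y"
  using someI_ex[OF gap_exists] unfolding gap_def[symmetric] by blast+

text \<open>A common first letter scales both sides by the same ratio and can be stripped. At the
  first differing letters the distance is at least \<open>gap\<close>, and the remaining ratio is at
  most 1.\<close>

lemma gap_words:
  assumes "valid w" "valid w'" "\<not> prefix w w'" "\<not> prefix w' w" "x \<in> P w" "y \<in> P w'"
  shows "gap * ratio w \<le> dist x y"
  using assms
proof (induction w arbitrary: w' x y)
  case (Cons m w)
  then obtain m' v where w': "w' = m' # v" by (cases w') auto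
  obtain x' y' where xy: "x = s m x'" "x' \<in> P w" "y = s m' y'" "y' \<in> P v"
    using Cons.prems by (auto simp: w')
  have val: "valid w" "valid v" "m \<in> {1..M}" "m' \<in> {1..M}" using Cons.prems by (auto simp: w')
  show ?case
  proof (cases "m = m'")
    case True
    then have "gap * ratio w \<le> dist x' y'"
      using Cons.prems by (intro Cons.IH[of v] val xy) (auto simp: w')
    from mult_left_mono[OF this less_imp_le[OF rho_bounds(1)[OF val(3)]]] show ?thesis
      using True xy dist_s[OF val(3)] by (simp add: mult_ac)
  next
    case False
    have "gap \<le> dist x y"
      by (rule gap[OF val(3,4) False]) (use xy piece_subset[OF val(1)] piece_subset[OF val(2)] in auto)
    moreover have "gap * ratio (m # w) \<le> gap * 1"
      using Cons.prems(1) gap_pos by (intro mult_left_mono ratio_le_1) auto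
    ultimately show ?thesis by simp
  qed
qed simp

text \<open>While diam A < gap * ratio w, all of A lies in a single child of w, so the word can be
  extended. The parameter e stops the descent, which for a one-point set would never end.\<close>

lemma localise:
  assumes A: "A \<subseteq> \<Gamma>" "A \<noteq> {}" and "0 < e"
  shows "\<exists>w. valid w \<and> A \<subseteq> P w \<and> ratio w \<le> max (diameter A / gap) e"
proof -
  have bd: "bounded A" by (rule bounded_subset[OF compact_imp_bounded[OF attractor(2)] A(1)])
  have "\<exists>w. valid w \<and> A \<subseteq> P w \<and> (gap * ratio w \<le> diameter A \<or> length w = N)" for N
  proof (induction N)
    case 0
    show ?case using A by (intro exI[of _ "[]"]) simp
  next
    case (Suc N)
    then obtain w where w: "valid w" "A \<subseteq> P w" "gap * ratio w \<le> diameter A \<or> length w = N" by blast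
    show ?case
    proof (cases "gap * ratio w \<le> diameter A")
      case True
      then show ?thesis using w by blast
    next
      case False
      then have len: "length w = N" using w by simp
      obtain a where a: "a \<in> A" using A by blast
      then obtain g where g: "g \<in> \<Gamma>" "a = word_map w g" using w(2) by (auto simp: piece_eq)
      then obtain m where m: "m \<in> {1..M}" "g \<in> s m ` \<Gamma>" using attractor_cases by blast
      have "A \<subseteq> P (w @ [m])"
      proof
        fix b assume b: "b \<in> A"
        then obtain g' where g': "g' \<in> \<Gamma>" "b = word_map w g'" using w(2) by (auto simp: piece_eq)
        then obtain m' where m': "m' \<in> {1..M}" "g' \<in> s m' ` \<Gamma>" using attractor_cases by blast
        have "ratio w * dist g g' \<le> diameter A"
          using diameter_bounded_bound[OF bd a b] dist_word_map[OF w(1)] g g' by simp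
        also have "\<dots> < ratio w * gap" using False by (simp add: mult.commute)
        finally have "dist g g' < gap" using ratio_pos[OF w(1)] by simp
        then have "m = m'" using gap[OF m(1) m'(1) _ m(2) m'(2)] by force
        then show "b \<in> P (w @ [m])" using g' m' by (auto simp: piece_append)
      qed
      then show ?thesis using w m len by (intro exI[of _ "w @ [m]"]) auto
    qed
  qed
  note ex = this
  obtain N where N: "rmax ^ N < e" using rmax_power_small[OF \<open>0 < e\<close>] by blast
  obtain w where w: "valid w" "A \<subseteq> P w" "gap * ratio w \<le> diameter A \<or> length w = N" using ex by blast
  have "ratio w \<le> max (diameter A / gap) e"
    using w(3)
  proof
    assume "gap * ratio w \<le> diameter A"
    then have "ratio w \<le> diameter A / gap" using gap_pos by (simp add: field_simps)
    then show ?thesis by simp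
  next
    assume "length w = N"
    then show ?thesis using ratio_le_power[OF w(1)] N by simp
  qed
  then show ?thesis using w by blast
qed

text \<open>The rest of \<Gamma> is the finite union of the other pieces of the same length, which
  is closed. Relative openness later provides finite subcovers by pieces.\<close>

lemma piece_relatively_open:
  assumes "valid w" shows "\<exists>U. open U \<and> U \<inter> \<Gamma> = P w"
proof -
  let ?W = "{v. valid v \<and> length v = length w} - {w}"
  have "closed (\<Union>v\<in>?W. P v)"
  proof (rule closed_UN)
    show "finite ?W" using finite_words[of "length w"] by (rule finite_Diff)
    show "\<forall>v\<in>?W. closed (P v)"
      by (intro ballI compact_imp_closed piece_compact) blast
  qed
  moreover have "- (\<Union>v\<in>?W. P v) \<inter> \<Gamma> = P w"
  proof (intro equalityI subsetI)
    fix x assume x: "x \<in> - (\<Union>v\<in>?W. P v) \<inter> \<Gamma>"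
    then obtain v where "valid v" "length v = length w" "x \<in> P v"
      using cover_words[of "length w"] by blast
    with x show "x \<in> P w" by blast
  next
    fix x assume x: "x \<in> P w"
    have "x \<notin> P v" if "v \<in> ?W" for v
    proof
      assume xv: "x \<in> P v"
      have "\<not> prefix w v" "\<not> prefix v w" using that by (auto simp: prefix_def)
      then have "gap * ratio w \<le> dist x x" using gap_words[OF assms _ _ _ x xv] that by auto
      then show False using mult_pos_pos[OF gap_pos ratio_pos[OF assms]] by simp
    qed
    then show "x \<in> - (\<Union>v\<in>?W. P v) \<inter> \<Gamma>" using x piece_subset[OF assms] by blast
  qed
  ultimately show ?thesis by blast
qed

text \<open>A combinatorial mass distribution principle. Unless the empty word occurs, the words
  starting with m, stripped of that letter, again cover \<Gamma>, because s m is injective and the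
  images are disjoint; the weights \<rho> m powr D, which sum to 1, then recombine the bounds for
  the single letters.\<close>

lemma cover_sum_ge_1:
  assumes D: "(\<Sum>m\<in>{1..M}. \<rho> m powr D) = 1" and "finite W" "\<And>w. w \<in> W \<Longrightarrow> valid w \<and> length w \<le> N" "\<Gamma> \<subseteq> (\<Union>w\<in>W. P w)"
  shows "1 \<le> (\<Sum>w\<in>W. ratio w powr D)"
  using assms(2-)
proof (induction N arbitrary: W)
  have base: "1 \<le> (\<Sum>w\<in>W. ratio w powr D)" if "[] \<in> W" "finite W" for W
    using member_le_sum[of "[]" W "\<lambda>w. ratio w powr D"] that by simp
  {
    case 0
    obtain w where "w \<in> W" using 0(3) attractor(1) by blast
    then have "[] \<in> W" using 0(2)[of w] by simp
    then show ?case using base 0 by blast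
  next
    case (Suc N)
    show ?case
    proof (cases "[] \<in> W")
      case True
      then show ?thesis using base Suc.prems by blast
    next
      case False
      define V where "V m = {w. m # w \<in> W}" for m
      have finV: "finite (V m)" for m
      proof -
        have "V m = (\<lambda>w. m # w) -` W" by (auto simp: V_def)
        then show ?thesis using finite_vimageI[OF Suc.prems(1), of "\<lambda>w. m # w"] by (simp add: inj_def)
      qed
      have "1 \<le> (\<Sum>w\<in>V m. ratio w powr D)" if m: "m \<in> {1..M}" for m
      proof (rule Suc.IH[OF finV])
        show "valid w \<and> length w \<le> N" if "w \<in> V m" for w
          using Suc.prems(2)[of "m # w"] that by (auto simp: V_def)
        show "\<Gamma> \<subseteq> (\<Union>w\<in>V m. P w)"
        proof
          fix x assume x: "x \<in> \<Gamma>"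
          then have "s m x \<in> \<Gamma>" using s_in_attractor[OF m] by blast
          then obtain w where w: "w \<in> W" "s m x \<in> P w" using Suc.prems(3) by blast
          then obtain m' w' where w': "w = m' # w'" using False by (cases w) auto
          have val: "m' \<in> {1..M}" "valid w'" using Suc.prems(2)[OF w(1)] by (auto simp: w')
          obtain y where y: "s m x = s m' y" "y \<in> P w'" using w by (auto simp: w')
          have "m' = m"
            using images_disjoint[OF m val(1)] x y piece_subset[OF val(2)] by blast
          then have "\<rho> m * dist x y = 0" using y(1) dist_s[OF m, of x y] by simp
          then have "x = y" using rho_bounds(1)[OF m] by simp
          then show "x \<in> (\<Union>w\<in>V m. P w)"
            using y w \<open>m' = m\<close> by (auto simp: V_def w')
        qed
      qed
      then have "(\<Sum>m\<in>{1..M}. \<rho> m powr D * 1) \<le> (\<Sum>m\<in>{1..M}. \<rho> m powr D * (\<Sum>w\<in>V m. ratio w powr D))"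
        by (intro sum_mono mult_left_mono) auto
      also have "\<dots> = (\<Sum>m\<in>{1..M}. \<Sum>w\<in>(\<lambda>w. m # w) ` V m. ratio w powr D)"
        by (intro sum.cong refl) (simp add: sum.reindex sum_distrib_left powr_mult inj_on_def)
      also have "\<dots> = (\<Sum>w\<in>(\<Union>m\<in>{1..M}. (\<lambda>w. m # w) ` V m). ratio w powr D)"
        by (rule sum.UNION_disjoint[symmetric]) (auto simp: finV)
      also have "\<dots> \<le> (\<Sum>w\<in>W. ratio w powr D)"
        by (rule sum_mono2[OF Suc.prems(1)]) (auto simp: V_def)
      finally show ?thesis using D by simp
    qed
  }
qed


section \<open>The Hausdorff dimension is the similarity dimension\<close>

lemma dimension_exists: "\<exists>D>0. (\<Sum>m\<in>{1..M}. \<rho> m powr D) = 1"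
proof -
  let ?f = "\<lambda>x. \<Sum>m\<in>{1..M}. \<rho> m powr x"
  have "0 < 1 / real M" using M2 by simp
  then obtain N where N: "rmax ^ N < 1 / real M" using rmax_power_small by blast
  have "?f (real N) \<le> (\<Sum>m\<in>{1..M}. rmax ^ N)"
  proof (rule sum_mono)
    fix m assume m: "m \<in> {1..M}"
    show "\<rho> m powr real N \<le> rmax ^ N"
      using rho_bounds(1)[OF m] rmax(3)[OF m] by (simp add: powr_realpow power_mono)
  qed
  also have "\<dots> = real M * rmax ^ N" by simp
  also have "\<dots> \<le> 1" using N M2 by (simp add: field_simps)
  finally have up: "?f (real N) \<le> 1" .
  have "?f 0 = (\<Sum>m\<in>{1..M}. 1)"
    using rho_bounds(1) by (intro sum.cong refl) (simp add: less_imp_neq[symmetric])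
  then have low: "1 < ?f 0" using M2 by simp
  have "\<exists>x\<ge>0. x \<le> real N \<and> ?f x = 1"
  proof (rule IVT2')
    show "continuous_on {0..real N} ?f"
      using rho_bounds(1) by (intro continuous_intros) (auto simp: less_imp_neq[symmetric])
  qed (use up low in auto)
  then obtain x where x: "0 \<le> x" "?f x = 1" by blast
  then have "x \<noteq> 0" using low by auto
  then show ?thesis using x by (intro exI[of _ x]) simp
qed

text \<open>The ratio is multiplicative, so the sum over words is the expansion of an N-th
  power.\<close>

lemma words_sum: "(\<Sum>w\<in>{w. valid w \<and> length w = N}. ratio w powr t) = (\<Sum>m\<in>{1..M}. \<rho> m powr t) ^ N"
proof (induction N)
  case (Suc N)
  let ?W = "\<lambda>N. {w. valid w \<and> length w = N}"
  have eq: "?W (Suc N) = (\<Union>m\<in>{1..M}. (\<lambda>w. m # w) ` ?W N)"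
    by (auto simp: length_Suc_conv)
  have "(\<Sum>w\<in>?W (Suc N). ratio w powr t) = (\<Sum>m\<in>{1..M}. \<Sum>w\<in>(\<lambda>w. m # w) ` ?W N. ratio w powr t)"
    unfolding eq by (rule sum.UNION_disjoint) (auto intro: finite_words[simplified])
  also have "\<dots> = (\<Sum>m\<in>{1..M}. \<rho> m powr t * (\<Sum>w\<in>?W N. ratio w powr t))"
    by (intro sum.cong refl) (simp add: sum.reindex sum_distrib_left powr_mult inj_on_def)
  also have "\<dots> = (\<Sum>m\<in>{1..M}. \<rho> m powr t) * (\<Sum>m\<in>{1..M}. \<rho> m powr t) ^ N"
    unfolding Suc.IH by (rule sum_distrib_right[symmetric])
  finally show ?case by simp
qed (simp add: conj_commute cong: conj_cong)

text \<open>The pieces of length N cover \<Gamma>, have diameter at most rmax^N R, and their gauges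
  are summed by \<open>words_sum\<close>.\<close>

lemma hausdorff_content_upper:
  assumes "0 < t" "0 < \<delta>" "rmax ^ N * R \<le> \<delta>"
  shows "hausdorff_content t \<delta> \<Gamma> \<le> ennreal (R powr t * (\<Sum>m\<in>{1..M}. \<rho> m powr t) ^ N)"
proof -
  let ?W = "{w. valid w \<and> length w = N}"
  obtain f where f: "bij_betw f {0..<card ?W} ?W"
    using ex_bij_betw_nat_finite[OF finite_words] by blast
  define U where "U i = (if i < card ?W then P (f i) else {})" for i
  have fW: "f i \<in> ?W" if "i < card ?W" for i
    using bij_betwE[OF f] that by simp
  have "U \<in> covers \<delta> \<Gamma>"
  proof -
    have "bounded (U i) \<and> diameter (U i) \<le> \<delta>" for i
    proof (cases "i < card ?W")
      case True
      then have w: "valid (f i)" "length (f i) = N" using fW by auto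
      have "diameter (P (f i)) \<le> rmax ^ N * R"
        using ratio_le_power[OF w(1)] w R_pos by (simp add: diameter_piece mult_right_mono)
      then show ?thesis using True assms(3) compact_imp_bounded[OF piece_compact[OF w(1)]] by (simp add: U_def)
    qed (use assms in \<open>simp add: U_def\<close>)
    moreover have "\<Gamma> \<subseteq> (\<Union>i. U i)"
    proof
      fix x assume "x \<in> \<Gamma>"
      then obtain w where w: "w \<in> ?W" "x \<in> P w" using cover_words[of N] by blast
      then have "w \<in> f ` {0..<card ?W}" using bij_betw_imp_surj_on[OF f] by blast
      then obtain i where "i < card ?W" "w = f i" by (auto simp del: atLeastAtMost_iff)
      then show "x \<in> (\<Union>i. U i)" using w by (intro UN_I[of i]) (auto simp: U_def)
    qed
    ultimately show ?thesis by simp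
  qed
  then have "hausdorff_content t \<delta> \<Gamma> \<le> (\<Sum>i. hausdorff_gauge t (U i))"
    by (rule hausdorff_content_le)
  also have "\<dots> = (\<Sum>i<card ?W. hausdorff_gauge t (U i))"
    by (rule suminf_finite) (auto simp: U_def)
  also have "\<dots> = (\<Sum>i\<in>{0..<card ?W}. ennreal ((ratio (f i) * R) powr t))"
  proof (rule sum.cong)
    fix i assume "i \<in> {0..<card ?W}"
    then show "hausdorff_gauge t (U i) = ennreal ((ratio (f i) * R) powr t)"
      using fW[of i] piece_nonempty assms(1) by (auto simp: U_def hausdorff_gauge_def diameter_piece)
  qed auto
  also have "\<dots> = (\<Sum>w\<in>?W. ennreal ((ratio w * R) powr t))"
    by (rule sum.reindex_bij_betw[OF f])
  also have "\<dots> = ennreal (\<Sum>w\<in>?W. ratio w powr t * R powr t)"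
    by (simp add: sum_ennreal powr_mult)
  also have "(\<Sum>w\<in>?W. ratio w powr t * R powr t) = R powr t * (\<Sum>m\<in>{1..M}. \<rho> m powr t) ^ N"
    unfolding words_sum[symmetric] by (simp add: sum_distrib_left mult.commute)
  finally show ?thesis .
qed

text \<open>Each covering set is enlarged by \<open>localise\<close> to a piece of comparable size;
  pieces are relatively open, so finitely many of them suffice, and \<open>cover_sum_ge_1\<close>
  bounds their total weight from below. Positivity of the measure at the similarity dimension rests
  on this.\<close>

lemma hausdorff_cover_lower:
  assumes D: "(\<Sum>m\<in>{1..M}. \<rho> m powr D) = 1" "0 < D" and U: "U \<in> covers \<delta> \<Gamma>"
  shows "ennreal (gap powr D) \<le> (\<Sum>i. hausdorff_gauge D (U i))"
proof (cases "(\<Sum>i. hausdorff_gauge D (U i)) = \<top>")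
  case False
  define g where "g i = (if U i = {} then 0 else diameter (U i) powr D)" for i
  have gg: "hausdorff_gauge D (U i) = ennreal (g i)" "0 \<le> g i" for i
    using D(2) by (auto simp: hausdorff_gauge_def g_def)
  have sg: "summable g"
    using False gg by (intro summable_suminf_not_top) auto
  have main: "gap powr D * (1 - e) \<le> suminf g" if e: "0 < e" for e
  proof -
    \<comment> \<open>The slack handles sets of diameter 0, for which no piece has size comparable
      to the diameter. Its D-th powers e 2^(-i-1) add up to at most e.\<close>
    define ee where "ee i = (e * (1/2) ^ Suc i) powr (1 / D)" for i
    have ee: "0 < ee i" "ee i powr D = e * (1/2) ^ Suc i" for i
      using e D(2) by (auto simp: ee_def powr_powr)
    have "\<forall>i. \<exists>w. valid w \<and> U i \<inter> \<Gamma> \<subseteq> P w \<and> (U i \<inter> \<Gamma> \<noteq> {} \<longrightarrow> ratio w powr D \<le> g i / gap powr D + e * (1/2) ^ Suc i)"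
    proof
      fix i
      show "\<exists>w. valid w \<and> U i \<inter> \<Gamma> \<subseteq> P w \<and> (U i \<inter> \<Gamma> \<noteq> {} \<longrightarrow> ratio w powr D \<le> g i / gap powr D + e * (1/2) ^ Suc i)"
      proof (cases "U i \<inter> \<Gamma> = {}")
        case True
        then show ?thesis by (intro exI[of _ "[]"]) simp
      next
        case False
        obtain w where w: "valid w" "U i \<inter> \<Gamma> \<subseteq> P w" "ratio w \<le> max (diameter (U i \<inter> \<Gamma>) / gap) (ee i)"
          using localise[OF _ False ee(1)] by blast
        have "diameter (U i \<inter> \<Gamma>) \<le> diameter (U i)"
          using U by (intro diameter_subset) auto
        then have "diameter (U i \<inter> \<Gamma>) / gap \<le> diameter (U i) / gap"
          using gap_pos by (simp add: divide_right_mono)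
        then have le: "ratio w \<le> max (diameter (U i) / gap) (ee i)" using w(3) by linarith
        have "ratio w powr D \<le> (diameter (U i) / gap) powr D + ee i powr D"
        proof (cases "ratio w \<le> diameter (U i) / gap")
          case True
          then have "ratio w powr D \<le> (diameter (U i) / gap) powr D"
            using ratio_pos[OF w(1)] D(2) by (intro powr_mono2) auto
          then show ?thesis by (simp add: add_increasing2)
        next
          case False
          then have "ratio w powr D \<le> ee i powr D"
            using le ratio_pos[OF w(1)] D(2) by (intro powr_mono2) auto
          then show ?thesis by (simp add: add_increasing)
        qed
        then have "ratio w powr D \<le> g i / gap powr D + e * (1/2) ^ Suc i"
          unfolding ee(2) powr_divide using False by (auto simp: g_def)
        then show ?thesis using w by blast
      qed
    qed
    from choice[OF this] obtain v where v: "\<And>i. valid (v i)" "\<And>i. U i \<inter> \<Gamma> \<subseteq> P (v i)"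
      "\<And>i. U i \<inter> \<Gamma> \<noteq> {} \<Longrightarrow> ratio (v i) powr D \<le> g i / gap powr D + e * (1/2) ^ Suc i" by blast
    have "\<forall>i. \<exists>V. open V \<and> V \<inter> \<Gamma> = P (v i)" using piece_relatively_open[OF v(1)] by blast
    from choice[OF this] obtain V where V: "\<And>i. open (V i)" "\<And>i. V i \<inter> \<Gamma> = P (v i)" by blast
    let ?J = "{i. U i \<inter> \<Gamma> \<noteq> {}}"
    have "\<Gamma> \<subseteq> (\<Union>i\<in>?J. V i)"
    proof
      fix x assume x: "x \<in> \<Gamma>"
      then obtain i where i: "x \<in> U i" using U by blast
      then have "x \<in> V i" using v(2)[of i] V(2)[of i] x by blast
      then show "x \<in> (\<Union>i\<in>?J. V i)" using i x by blast
    qed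
    then obtain I where I: "I \<subseteq> ?J" "finite I" "\<Gamma> \<subseteq> (\<Union>i\<in>I. V i)"
      using compactE_image[OF attractor(2), of ?J V] V(1) by blast
    have "1 \<le> (\<Sum>w\<in>v ` I. ratio w powr D)"
    proof (rule cover_sum_ge_1[OF D(1)])
      show "finite (v ` I)" using I(2) by simp
      show "valid w \<and> length w \<le> Max (length ` v ` I)" if "w \<in> v ` I" for w
        using that v(1) I(2) by auto
      show "\<Gamma> \<subseteq> (\<Union>w\<in>v ` I. P w)"
      proof
        fix x assume x: "x \<in> \<Gamma>"
        then obtain i where "i \<in> I" "x \<in> V i" using I(3) by blast
        then show "x \<in> (\<Union>w\<in>v ` I. P w)" using V(2)[of i] x by blast
      qed
    qed
    also have "\<dots> \<le> (\<Sum>i\<in>I. ratio (v i) powr D)"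
      using sum_image_le[OF I(2), of "\<lambda>w. ratio w powr D" v] by (simp add: o_def)
    also have "\<dots> \<le> (\<Sum>i\<in>I. g i / gap powr D + e * (1/2) ^ Suc i)"
      using I(1) by (intro sum_mono v(3)) auto
    also have "\<dots> = (\<Sum>i\<in>I. g i) / gap powr D + (\<Sum>i\<in>I. e * (1/2) ^ Suc i)"
      by (simp add: sum.distrib sum_divide_distrib)
    also have "\<dots> \<le> suminf g / gap powr D + e"
    proof (rule add_mono)
      show "(\<Sum>i\<in>I. g i) / gap powr D \<le> suminf g / gap powr D"
        by (intro divide_right_mono sum_le_suminf sg I(2)) (auto simp: gg)
      have "(\<lambda>i. e * (1/2) ^ Suc i) sums (e * 1)"
        by (intro sums_mult power_half_series)
      then show "(\<Sum>i\<in>I. e * (1/2) ^ Suc i) \<le> e"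
        using sum_le_suminf[of "\<lambda>i. e * (1/2) ^ Suc i" I] I(2) e by (simp add: sums_iff)
    qed
    finally have "1 - e \<le> suminf g / gap powr D" by simp
    then show ?thesis using gap_pos by (simp add: field_simps)
  qed
  have "gap powr D \<le> suminf g"
  proof (rule field_le_epsilon)
    fix e :: real assume "0 < e"
    then have "gap powr D * (1 - e / gap powr D) \<le> suminf g" using gap_pos by (intro main) simp
    then show "gap powr D \<le> suminf g + e" using gap_pos by (simp add: right_diff_distrib)
  qed
  then show ?thesis
    unfolding gg(1) using gg(2) sg by (subst suminf_ennreal2) (auto intro: ennreal_leI)
qed simp

text \<open>Covers by long words give finite measure at D, and measure zero above D, where the sum
  of the powers of the ratios is below 1 and its own powers tend to 0. The lower bound for covers
  gives positivity at D and excludes smaller exponents.\<close>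

lemma hausdorff_dim_eq:
  assumes D: "(\<Sum>m\<in>{1..M}. \<rho> m powr D) = 1" "0 < D"
  shows "hausdorff_dim \<Gamma> = D" "0 < hausdorff_outer D \<Gamma>" "hausdorff_outer D \<Gamma> < \<top>"
proof -
  have low: "ennreal (gap powr D) \<le> hausdorff_content D 1 \<Gamma>"
    unfolding hausdorff_content_def using hausdorff_cover_lower[OF D] by (intro INF_greatest) blast
  also have "\<dots> \<le> hausdorff_outer D \<Gamma>" by (rule hausdorff_content_le_outer) simp
  finally show pos: "0 < hausdorff_outer D \<Gamma>"
    using gap_pos by (metis ennreal_less_zero_iff less_le_trans powr_gt_zero less_irrefl)
  have small: "\<exists>N0. \<forall>N\<ge>N0. rmax ^ N * R \<le> \<delta>" if \<delta>: "0 < \<delta>" for \<delta>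
  proof -
    obtain N0 where N0: "rmax ^ N0 < \<delta> / R" using rmax_power_small[of "\<delta> / R"] \<delta> R_pos by auto
    have "rmax ^ N * R \<le> \<delta>" if "N0 \<le> N" for N
    proof -
      have "rmax ^ N \<le> rmax ^ N0" using that rmax by (intro power_decreasing) auto
      then have "rmax ^ N \<le> \<delta> / R" using N0 by linarith
      then show ?thesis using R_pos by (simp add: field_simps)
    qed
    then show ?thesis by blast
  qed
  have "hausdorff_outer D \<Gamma> \<le> ennreal (R powr D)"
    unfolding hausdorff_outer_def
  proof (rule SUP_least)
    fix \<delta> :: real assume "\<delta> \<in> {0<..}"
    then have \<delta>: "0 < \<delta>" by simp
    obtain N0 where "\<forall>N\<ge>N0. rmax ^ N * R \<le> \<delta>" using small[OF \<delta>] by blast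
    then have "rmax ^ N0 * R \<le> \<delta>" by blast
    from hausdorff_content_upper[OF D(2) \<delta> this]
    show "hausdorff_content D \<delta> \<Gamma> \<le> ennreal (R powr D)" unfolding D(1) by simp
  qed
  then show "hausdorff_outer D \<Gamma> < \<top>"
    using ennreal_less_top le_less_trans by blast
  have zero: "hausdorff_outer t \<Gamma> = 0" if "D < t" for t
  proof -
    let ?q = "\<Sum>m\<in>{1..M}. \<rho> m powr t"
    have "?q < (\<Sum>m\<in>{1..M}. \<rho> m powr D)"
      using M2 that rho_bounds by (intro sum_strict_mono) (auto intro!: powr_less_mono')
    then have q: "0 \<le> ?q" "?q < 1" using D(1) by (auto intro: sum_nonneg)
    have "hausdorff_content t \<delta> \<Gamma> \<le> 0" if \<delta>: "0 < \<delta>" for \<delta>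
    proof (rule ennreal_le_epsilon)
      fix e :: real assume "0 < e"
      obtain N0 where N0: "\<forall>N\<ge>N0. rmax ^ N * R \<le> \<delta>" using small[OF \<delta>] by blast
      have "(\<lambda>N. R powr t * ?q ^ N) \<longlonglongrightarrow> 0"
        using q by (intro tendsto_mult_right_zero LIMSEQ_power_zero) simp
      then have "\<forall>\<^sub>F N in sequentially. R powr t * ?q ^ N < e"
        using \<open>0 < e\<close> by (rule order_tendstoD(2))
      then obtain N1 where "\<forall>N\<ge>N1. R powr t * ?q ^ N < e" by (auto simp: eventually_sequentially)
      then have N1: "R powr t * ?q ^ (max N0 N1) < e" by simp
      have "hausdorff_content t \<delta> \<Gamma> \<le> ennreal (R powr t * ?q ^ (max N0 N1))"
        using N0 D(2) \<open>D < t\<close> by (intro hausdorff_content_upper \<delta>) auto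
      also have "\<dots> \<le> ennreal e" using N1 by (intro ennreal_leI) simp
      finally show "hausdorff_content t \<delta> \<Gamma> \<le> 0 + ennreal e" by simp
    qed
    then have "hausdorff_outer t \<Gamma> \<le> 0"
      unfolding hausdorff_outer_def by (intro SUP_least) auto
    then show ?thesis by simp
  qed
  \<comment> \<open>For sets of diameter at most 1 the gauge decreases in the exponent, so the
    content at scale 1 for t < D dominates the positive content for D. The exponent 0 is treated
    apart because its gauge is 1 on all non-empty sets.\<close>
  have ge: "D \<le> t" if "0 \<le> t" "hausdorff_outer t \<Gamma> = 0" for t
  proof (rule ccontr)
    assume "\<not> D \<le> t"
    then have tD: "t < D" by simp
    have "hausdorff_content D 1 \<Gamma> \<le> hausdorff_content t 1 \<Gamma>"
      unfolding hausdorff_content_def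
    proof (rule INF_mono)
      fix U :: "nat \<Rightarrow> 'a set" assume U: "U \<in> covers 1 \<Gamma>"
      have "hausdorff_gauge D (U i) \<le> hausdorff_gauge t (U i)" for i
      proof (cases "U i = {}")
        case False
        have dU: "0 \<le> diameter (U i)" "diameter (U i) \<le> 1" using U diameter_ge_0 by auto
        show ?thesis
        proof (cases "t = 0")
          case True
          then show ?thesis
            using False D(2) dU by (auto simp: hausdorff_gauge_def powr_le1)
        next
          case t0: False
          have "diameter (U i) powr D \<le> diameter (U i) powr t"
            using dU tD by (cases "diameter (U i) = 0") (auto intro!: powr_mono')
          then show ?thesis
            using False t0 D(2) by (auto simp: hausdorff_gauge_def intro: ennreal_leI)
        qed
      qed simp
      then show "\<exists>V\<in>covers 1 \<Gamma>. (\<Sum>i. hausdorff_gauge D (V i)) \<le> (\<Sum>i. hausdorff_gauge t (U i))"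
        by (intro bexI[OF _ U] suminf_le) auto
    qed
    also have "\<dots> \<le> hausdorff_outer t \<Gamma>" by (rule hausdorff_content_le_outer) simp
    finally have "ennreal (gap powr D) \<le> 0" using low that(2) by (simp add: order_trans)
    then show False using gap_pos by simp
  qed
  show "hausdorff_dim \<Gamma> = D"
    unfolding hausdorff_dim_def
  proof (rule antisym)
    have ne: "D + 1 \<in> {d. 0 \<le> d \<and> hausdorff_outer d \<Gamma> = 0}" using zero[of "D + 1"] D(2) by simp
    show "D \<le> Inf {d. 0 \<le> d \<and> hausdorff_outer d \<Gamma> = 0}"
      using ne ge by (intro cInf_greatest) auto
    show "Inf {d. 0 \<le> d \<and> hausdorff_outer d \<Gamma> = 0} \<le> D"
    proof (rule field_le_epsilon)
      fix e :: real assume "0 < e"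
      then show "Inf {d. 0 \<le> d \<and> hausdorff_outer d \<Gamma> = 0} \<le> D + e"
        using zero[of "D + e"] D(2) by (intro cInf_lower bdd_belowI[of _ 0]) auto
    qed
  qed
qed

section \<open>Hausdorff measure on the attractor and the growth of balls\<close>

definition "dm = hausdorff_dim \<Gamma>"

lemma dm: "(\<Sum>m\<in>{1..M}. \<rho> m powr dm) = 1" "0 < dm"
  using dimension_exists hausdorff_dim_eq(1) unfolding dm_def by metis+

definition "\<mu> = hausdorff_on dm \<Gamma>"
definition "H = measure \<mu> \<Gamma>"

lemma \<Gamma>_borel [measurable]: "\<Gamma> \<in> sets borel"
  using attractor(2) by (simp add: borel_compact)

lemma space_\<mu> [simp]: "space \<mu> = \<Gamma>"
  by (simp add: \<mu>_def space_restrict_space)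

lemma id_\<mu>: "(\<lambda>x. x) \<in> borel_measurable \<mu>"
  unfolding \<mu>_def by (rule measurable_restrict_space1) (simp add: measurable_def)

lemma sets_\<mu>: "A \<in> sets borel \<Longrightarrow> A \<subseteq> \<Gamma> \<Longrightarrow> A \<in> sets \<mu>"
  unfolding \<mu>_def by (subst sets_restrict_space_iff) auto

lemma emeasure_\<mu>: "A \<in> sets borel \<Longrightarrow> A \<subseteq> \<Gamma> \<Longrightarrow> emeasure \<mu> A = hausdorff_outer dm A"
  unfolding \<mu>_def by (subst emeasure_restrict_space) (auto simp: emeasure_hausdorff_measure)

lemma finite_measure_\<mu>: "finite_measure \<mu>"
  by (rule finite_measureI) (use hausdorff_dim_eq(3)[OF dm] in \<open>simp add: emeasure_\<mu>\<close>)

sublocale \<mu>: finite_measure \<mu> by (rule finite_measure_\<mu>)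

lemma H: "0 < H" "hausdorff_outer dm \<Gamma> = ennreal H"
proof -
  show e: "hausdorff_outer dm \<Gamma> = ennreal H"
    using emeasure_\<mu>[of \<Gamma>] \<mu>.emeasure_eq_measure[of \<Gamma>] by (simp add: H_def)
  show "0 < H" using hausdorff_dim_eq(2)[OF dm] unfolding e by simp
qed

lemma piece_borel: "valid w \<Longrightarrow> P w \<in> sets borel"
  using piece_compact by (simp add: borel_compact)

lemma piece_sets: "valid w \<Longrightarrow> P w \<in> sets \<mu>"
  by (intro sets_\<mu> piece_borel piece_subset)

lemma hausdorff_outer_piece: "valid w \<Longrightarrow> hausdorff_outer dm (P w) = ennreal (ratio w powr dm * H)"
  unfolding piece_eq
  by (subst hausdorff_outer_similarity[OF dm(2) ratio_pos dist_word_map]) (auto simp: H(2) ennreal_mult less_imp_le[OF H(1)])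

lemma measure_piece: "valid w \<Longrightarrow> measure \<mu> (P w) = ratio w powr dm * H"
  using H(1) by (simp add: measure_def emeasure_\<mu> piece_borel piece_subset hausdorff_outer_piece)

text \<open>A ball of radius r meets \<Gamma> in a set of diameter at most 2r, which
  \<open>localise\<close> with e = r places in one piece of ratio at most max (2 / gap) 1 *
  r.\<close>

lemma ahlfors_upper: "\<exists>C>0. \<forall>x r. 0 < r \<longrightarrow> measure \<mu> (\<Gamma> \<inter> ball x r) \<le> C * r powr dm"
proof -
  define C where "C = (max (2 / gap) 1) powr dm * H"
  have "measure \<mu> (\<Gamma> \<inter> ball x r) \<le> C * r powr dm" if r: "0 < r" for x r
  proof (cases "\<Gamma> \<inter> ball x r = {}")
    case True
    then show ?thesis using H(1) by (simp add: C_def)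
  next
    case False
    obtain w where w: "valid w" "\<Gamma> \<inter> ball x r \<subseteq> P w" "ratio w \<le> max (diameter (\<Gamma> \<inter> ball x r) / gap) r"
      using localise[OF _ False r] by blast
    have "diameter (\<Gamma> \<inter> ball x r) \<le> 2 * r"
    proof (rule diameter_le)
      show "\<Gamma> \<inter> ball x r \<noteq> {} \<or> 0 \<le> 2 * r" using r by simp
      fix y z assume "y \<in> \<Gamma> \<inter> ball x r" "z \<in> \<Gamma> \<inter> ball x r"
      then show "norm (y - z) \<le> 2 * r"
        using dist_triangle[of y z x] by (simp add: dist_norm[symmetric] dist_commute)
    qed
    then have "diameter (\<Gamma> \<inter> ball x r) / gap \<le> 2 / gap * r"
      using gap_pos by (simp add: divide_right_mono)
    also have "\<dots> \<le> max (2 / gap) 1 * r" using r by (intro mult_right_mono) auto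
    finally have "ratio w \<le> max (2 / gap) 1 * r"
      using w(3) mult_right_mono[of 1 "max (2 / gap) 1" r] r by linarith
    then have "ratio w powr dm \<le> (max (2 / gap) 1 * r) powr dm"
      using ratio_pos[OF w(1)] dm(2) by (intro powr_mono2) auto
    then have "ratio w powr dm * H \<le> C * r powr dm"
      using H(1) mult_right_mono[of "ratio w powr dm" _ H] by (simp add: C_def powr_mult mult_ac)
    moreover have "measure \<mu> (\<Gamma> \<inter> ball x r) \<le> measure \<mu> (P w)"
      by (rule \<mu>.finite_measure_mono[OF w(2) piece_sets[OF w(1)]])
    ultimately show ?thesis using measure_piece[OF w(1)] by simp
  qed
  moreover have "0 < C" using H(1) gap_pos by (simp add: C_def)
  ultimately show ?thesis by blast
qed

text \<open>For \<open>h \<ge> R\<close> this is \<open>{[]}\<close>, so that meshes are available at all scales.\<close>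

definition mesh :: "real \<Rightarrow> nat list set" where
  "mesh h = {w. valid w \<and> ratio w * R \<le> h \<and> (w = [] \<or> h < ratio (butlast w) * R)}"

text \<open>At h = R the convention of a single index 0 agrees with the rule extended to the empty
  word, because no word has a parent of diameter larger than R.\<close>

lemma mesh_eq_mesh_words:
  assumes "0 < h" "h \<le> R" shows "mesh_words M s \<Gamma> h = mesh h"
proof (cases "h = R")
  case True
  have "w = []" if "w \<in> mesh h" for w
  proof (rule ccontr)
    assume "w \<noteq> []"
    then have "R < ratio (butlast w) * R" "valid (butlast w)"
      using that True by (auto simp: mesh_def dest: in_set_butlastD)
    then show False using ratio_le_1[of "butlast w"] R_pos mult_right_mono[of "ratio (butlast w)" 1 R] by linarith
  qed
  moreover have "[] \<in> mesh h" using True by (simp add: mesh_def)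
  ultimately show ?thesis using True by (auto simp: mesh_words_def)
next
  case False
  have "w \<in> mesh_words M s \<Gamma> h \<longleftrightarrow> w \<in> mesh h" for w
  proof (cases "valid w")
    case True
    then have "valid (butlast w)" by (auto dest: in_set_butlastD)
    then show ?thesis
      using False True assms by (auto simp: mesh_words_def mesh_def words_def diameter_piece)
  next
    case inv: False
    then show ?thesis using False by (auto simp: mesh_words_def mesh_def words_def)
  qed
  then show ?thesis by blast
qed

text \<open>Removing last letters as long as the diameter stays at most h ends at a word whose
  parent is too large, or at the empty word.\<close>

lemma mesh_prefix_exists:
  assumes "valid w" "ratio w * R \<le> h"
  shows "\<exists>v\<in>mesh h. prefix v w"
  using assms
proof (induction w rule: rev_induct)
  case Nil
  then show ?case by (intro bexI[of _ "[]"]) (auto simp: mesh_def)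
next
  case (snoc m w)
  show ?case
  proof (cases "ratio w * R \<le> h")
    case True
    then obtain v where "v \<in> mesh h" "prefix v w" using snoc by auto
    then show ?thesis by (meson prefix_order.trans prefixI)
  next
    case False
    then show ?thesis using snoc.prems by (intro bexI[of _ "w @ [m]"]) (auto simp: mesh_def)
  qed
qed

lemma mesh_cover:
  assumes "0 < h" "x \<in> \<Gamma>" shows "\<exists>w\<in>mesh h. x \<in> P w"
proof -
  obtain N where N: "rmax ^ N < h / R" using rmax_power_small[of "h / R"] assms(1) R_pos by auto
  obtain w where w: "valid w" "length w = N" "x \<in> P w" using cover_words[of N] assms(2) by blast
  have "ratio w \<le> h / R" using ratio_le_power[OF w(1)] N w(2) by simp
  then have "ratio w * R \<le> h" using R_pos by (simp add: field_simps)
  from mesh_prefix_exists[OF w(1) this] obtain v where v: "v \<in> mesh h" "prefix v w" by blast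
  then obtain u where u: "w = v @ u" by (auto simp: prefix_def)
  then have "x \<in> P v" using w piece_append_subset[of u v] by auto
  then show ?thesis using v by blast
qed

text \<open>A proper prefix of w' is also a prefix of \<open>butlast w'\<close>, hence at least as
  large as the parent of w', whose diameter exceeds h.\<close>

lemma mesh_not_prefix:
  assumes "w \<in> mesh h" "w' \<in> mesh h" "w \<noteq> w'" shows "\<not> prefix w w'"
proof
  assume "prefix w w'"
  then obtain u where u: "w' = w @ u" "u \<noteq> []" using assms(3) by (auto simp: prefix_def)
  then have b: "butlast w' = w @ butlast u" by (simp add: butlast_append)
  have "valid (butlast u)" using assms(2) u by (auto simp: mesh_def dest: in_set_butlastD)
  then have "ratio (butlast w') \<le> ratio w"
    using mult_left_mono[OF ratio_le_1, of "butlast u" "ratio w"] ratio_pos[of w] assms(1) by (simp add: b mesh_def)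
  then have "ratio (butlast w') * R \<le> ratio w * R" using R_pos by (simp add: mult_right_mono)
  then show False using assms u by (auto simp: mesh_def)
qed

lemma mesh_gap:
  assumes "w \<in> mesh h" "w' \<in> mesh h" "w \<noteq> w'" "x \<in> P w" "y \<in> P w'"
  shows "gap * ratio w \<le> dist x y"
  using assms by (intro gap_words[of w w'] mesh_not_prefix) (auto simp: mesh_def)

lemma mesh_disjoint:
  assumes "w \<in> mesh h" "w' \<in> mesh h" "x \<in> P w" "x \<in> P w'" shows "w = w'"
proof (rule ccontr)
  assume "w \<noteq> w'"
  from mesh_gap[OF assms(1,2) this assms(3,4)] have "gap * ratio w \<le> 0" by simp
  moreover have "0 < gap * ratio w"
    using assms(1) by (intro mult_pos_pos gap_pos ratio_pos) (simp add: mesh_def)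
  ultimately show False by simp
qed

lemma mesh_finite: assumes "0 < h" shows "finite (mesh h)"
proof -
  obtain N where N: "rmax ^ N < h / R" using rmax_power_small[of "h / R"] assms(1) R_pos by auto
  have "mesh h \<subseteq> {w. set w \<subseteq> {1..M} \<and> length w \<le> N}"
  proof
    fix w assume w: "w \<in> mesh h"
    have "length w \<le> N"
    proof (rule ccontr)
      assume "\<not> length w \<le> N"
      then have ne: "w \<noteq> []" "N \<le> length (butlast w)" by auto
      have val: "valid (butlast w)" using w by (auto simp: mesh_def dest: in_set_butlastD)
      have "h < ratio (butlast w) * R" using w ne by (auto simp: mesh_def)
      also have "\<dots> \<le> rmax ^ N * R"
        using order_trans[OF ratio_le_power[OF val] power_decreasing[OF ne(2)]] rmax(1,2) R_pos
        by (intro mult_right_mono) auto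
      also have "\<dots> < h" using N R_pos by (simp add: field_simps)
      finally show False .
    qed
    then show "w \<in> {w. set w \<subseteq> {1..M} \<and> length w \<le> N}" using w by (simp add: mesh_def)
  qed
  then show ?thesis by (rule finite_subset) (rule finite_lists_length_le, simp)
qed

lemma mesh_refine:
  assumes "w \<in> mesh h" "h \<le> h'" shows "\<exists>v\<in>mesh h'. P w \<subseteq> P v"
proof -
  have w: "valid w" "ratio w * R \<le> h'" using assms by (auto simp: mesh_def)
  from mesh_prefix_exists[OF w] obtain v where v: "v \<in> mesh h'" "prefix v w" by blast
  then obtain u where u: "w = v @ u" by (auto simp: prefix_def)
  then have "P w \<subseteq> P v" using w piece_append_subset[of u v] by simp
  then show ?thesis using v by blast
qed

text \<open>\<open>rmin\<close> compares a non-empty mesh word with its parent, whose diameter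
  exceeds h. The value 1/2 takes care of the empty word, whose piece has diameter R while h may
  reach 2 * R, as happens at the last scale of the telescoping.\<close>

definition "mesh_const = min rmin (1/2)"

lemma mesh_const_pos: "0 < mesh_const"
  using rmin by (simp add: mesh_const_def)

lemma mesh_ratio_ge:
  assumes "w \<in> mesh h" "0 < h" "h \<le> 2 * R" shows "mesh_const * h \<le> ratio w * R"
proof (cases "w = []")
  case True
  have "mesh_const * h \<le> 1/2 * h" using assms(2) by (intro mult_right_mono) (auto simp: mesh_const_def)
  then show ?thesis using True assms(3) by simp
next
  case False
  then obtain v m where vm: "w = v @ [m]" by (metis append_butlast_last_id)
  then have val: "valid v" "m \<in> {1..M}" "h < ratio v * R" using assms(1) by (auto simp: mesh_def)
  have "mesh_const * h \<le> rmin * h" using assms(2) by (intro mult_right_mono) (auto simp: mesh_const_def)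
  also have "\<dots> \<le> \<rho> m * (ratio v * R)"
    using val rmin(2)[OF val(2)] rmin(1) assms(2) by (intro mult_mono) auto
  finally show ?thesis by (simp add: vm mult_ac)
qed

end


section \<open>Negative norms on Ahlfors regular measures\<close>

text \<open>By the mean value theorem the factor is a slope c exp(-c^2/2) at an intermediate point c
  with a <= c + 1. Halving the exponent to a^2/4 leaves room to absorb both the factor c and this
  shift.\<close>

lemma gaussian_difference_bound:
  fixes a b :: real
  assumes "0 \<le> a" "0 \<le> b" "\<bar>a - b\<bar> \<le> 1"
  shows "\<bar>exp (- a\<^sup>2 / 2) - exp (- b\<^sup>2 / 2)\<bar> \<le> exp (5/2) * \<bar>a - b\<bar> * exp (- a\<^sup>2 / 4)"
proof -
  let ?f = "\<lambda>c::real. exp (- c\<^sup>2 / 2)"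
  have der: "(?f has_real_derivative (- c * exp (- c\<^sup>2 / 2))) (at c)" for c
    by (auto intro!: derivative_eq_intros)
  have slope: "c * exp (- c\<^sup>2 / 2) \<le> exp (5/2) * exp (- a\<^sup>2 / 4)" if "0 \<le> c" "a \<le> c + 1" for c
  proof -
    have "a\<^sup>2 \<le> (c + 1)\<^sup>2" using assms that by (intro power_mono) auto
    \<comment> \<open>With a <= c + 1 the two sides of the next inequality differ by at least (c -
      3)^2 / 4; the constant 5/2 comes from completing this square.\<close>
    moreover have "0 \<le> (c - 3)\<^sup>2" by simp
    ultimately have "c + - c\<^sup>2 / 2 \<le> 5/2 + - a\<^sup>2 / 4"
      unfolding power2_sum power2_diff by simp
    then have "exp c * exp (- c\<^sup>2 / 2) \<le> exp (5/2) * exp (- a\<^sup>2 / 4)"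
      unfolding exp_add[symmetric] by simp
    moreover have "c \<le> exp c" using exp_ge_add_one_self[of c] by linarith
    then have "c * exp (- c\<^sup>2 / 2) \<le> exp c * exp (- c\<^sup>2 / 2)" by (intro mult_right_mono) auto
    ultimately show ?thesis by linarith
  qed
  have main: "\<bar>?f y - ?f x\<bar> \<le> exp (5/2) * exp (- a\<^sup>2 / 4) * \<bar>y - x\<bar>" if xy: "x < y" "0 \<le> x" "a \<le> x + 1" for x y
  proof -
    obtain c where c: "x < c" "c < y" "?f y - ?f x = (y - x) * (- c * exp (- c\<^sup>2 / 2))"
      using MVT2[OF xy(1), of ?f "\<lambda>c. - c * exp (- c\<^sup>2 / 2)"] der by blast
    have "\<bar>?f y - ?f x\<bar> = \<bar>y - x\<bar> * (c * exp (- c\<^sup>2 / 2))"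
      unfolding c(3) using c xy by (simp add: abs_mult)
    also have "\<dots> \<le> \<bar>y - x\<bar> * (exp (5/2) * exp (- a\<^sup>2 / 4))"
      using c xy by (intro mult_left_mono slope) auto
    finally show ?thesis by (simp add: mult_ac)
  qed
  consider "a < b" | "a = b" | "b < a" by linarith
  then show ?thesis
  proof cases
    case 1
    then show ?thesis using main[of a b] assms by (simp add: abs_minus_commute mult_ac)
  next
    case 3
    then show ?thesis using main[of b a] assms by (simp add: abs_minus_commute mult_ac)
  qed simp
qed

text \<open>Up to the first J with h^2 4^J >= 1 the terms grow geometrically, with ratio 4^(1-t) >
  1; beyond it they decay with ratio 4^(-t). At the crossover they are of order h^(2t), and the
  constant collects the two geometric series.\<close>

lemma dyadic_min_sum:
  assumes t: "0 < t" "t < (1::real)" and "0 < h"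
  shows "(\<Sum>j<N. (1/4 powr t) ^ j * min 1 (h\<^sup>2 * 4 ^ j)) \<le> (1 / (1 - 1/4 powr t) + 1 / (1 - 1/4 powr (1 - t))) * h powr (2 * t)"
proof -
  define q where "q = 1 / 4 powr t"
  define r where "r = 1 / 4 powr (1 - t)"
  have one: "1 < 4 powr u" if "0 < u" for u :: real
    using that by simp
  have q: "0 < q" "q < 1" using one[OF t(1)] by (auto simp: q_def)
  have r: "0 < r" "r < 1" using one[of "1 - t"] t(2) by (auto simp: r_def)
  define a where "a j = h\<^sup>2 * 4 ^ j" for j :: nat
  have a: "0 < a j" for j using \<open>0 < h\<close> by (simp add: a_def)
  \<comment> \<open>Expressing 4^(-tj) through a j = h^2 4^j extracts the common factor h^(2t) from
    every term.\<close>
  have qj: "q ^ j = a j powr (- t) * h powr (2 * t)" for j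
  proof -
    have "q ^ j = (4 powr (- t)) ^ j" by (simp add: q_def powr_minus_divide)
    also have "\<dots> = (4 ^ j) powr (- t)"
      by (simp add: powr_realpow[symmetric] powr_powr mult.commute)
    also have "\<dots> = (h\<^sup>2) powr (- t) * (4 ^ j) powr (- t) * (h\<^sup>2) powr t"
      using \<open>0 < h\<close> by (simp add: powr_minus field_simps)
    also have "(h\<^sup>2) powr t = h powr (2 * t)"
      using \<open>0 < h\<close> by (simp add: powr_powr flip: powr_numeral)
    also have "(h\<^sup>2) powr (- t) * (4 ^ j) powr (- t) = a j powr (- t)"
      unfolding a_def by (rule powr_mult[symmetric])
    finally show ?thesis .
  qed
  have geo: "(\<Sum>i<n. x ^ i) \<le> 1 / (1 - x)" if "0 < x" "x < 1" for x :: real and n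
    using that by (simp add: sum_gp_strict field_simps)
  obtain J0 :: nat where "1 / h\<^sup>2 < 4 ^ J0"
    using real_arch_pow[of 4 "1 / h\<^sup>2"] by auto
  then have J0: "1 \<le> a J0" using \<open>0 < h\<close> by (simp add: a_def field_simps)
  define J where "J = (LEAST j. 1 \<le> a j)"
  have J: "1 \<le> a J" unfolding J_def using J0 by (rule LeastI)
  have nJ: "a j < 1" if "j < J" for j
    using not_less_Least[of j "\<lambda>j. 1 \<le> a j"] that by (simp add: J_def)
  have big: "q ^ (J + i) * min 1 (a (J + i)) \<le> h powr (2 * t) * q ^ i" for i
  proof -
    have "4 ^ i \<le> a (J + i)" using J by (simp add: a_def power_add mult.assoc[symmetric])
    then have "a (J + i) powr (- t) \<le> (4 ^ i) powr (- t)"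
      using t by (intro powr_mono2') auto
    also have "\<dots> = q ^ i" by (simp add: q_def powr_realpow[symmetric] powr_powr mult.commute powr_minus_divide power_divide)
    finally have "a (J + i) powr (- t) * h powr (2 * t) \<le> q ^ i * h powr (2 * t)" by (rule mult_right_mono) simp
    moreover have "q ^ (J + i) * min 1 (a (J + i)) \<le> q ^ (J + i) * 1" using q by (intro mult_left_mono) auto
    ultimately show ?thesis unfolding qj[of "J + i"] by (simp add: mult.commute)
  qed
  \<comment> \<open>The index counts downwards from J - 1, so that the geometric decay away from the
    crossover appears as r^i.\<close>
  have small: "q ^ (J - Suc i) * min 1 (a (J - Suc i)) \<le> h powr (2 * t) * r ^ i" if "i < J" for i
  proof -
    let ?j = "J - Suc i"
    have "a ?j * 4 ^ i = a (J - 1)" using that by (simp add: a_def power_add[symmetric])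
    also have "\<dots> \<le> 1" using nJ[of "J - 1"] that by simp
    finally have le: "a ?j \<le> 1 / 4 ^ i" by (simp add: field_simps)
    have "q ^ ?j * min 1 (a ?j) \<le> a ?j powr (- t) * h powr (2 * t) * a ?j"
      unfolding qj using a[of ?j] by (intro mult_left_mono) auto
    also have "\<dots> = h powr (2 * t) * a ?j powr (1 - t)"
      using a[of ?j] by (simp add: powr_diff powr_minus field_simps)
    also have "\<dots> \<le> h powr (2 * t) * (1 / 4 ^ i) powr (1 - t)"
      using a[of ?j] le t by (intro mult_left_mono powr_mono2) auto
    also have "(1 / 4 ^ i) powr (1 - t) = r ^ i"
      by (simp add: r_def powr_realpow[symmetric] powr_powr mult.commute powr_divide power_divide)
    finally show ?thesis .
  qed
  have nonneg: "0 \<le> q ^ j * min 1 (a j)" for j using q a[of j] by simp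
  have "(\<Sum>j<N. q ^ j * min 1 (a j)) \<le> (\<Sum>j<J + N. q ^ j * min 1 (a j))"
    by (rule sum_mono2) (use nonneg in auto)
  also have "\<dots> = (\<Sum>j<J. q ^ j * min 1 (a j)) + (\<Sum>i<N. q ^ (J + i) * min 1 (a (J + i)))"
    by (induction N) (simp_all add: add.assoc)
  also have "(\<Sum>j<J. q ^ j * min 1 (a j)) = (\<Sum>i<J. q ^ (J - Suc i) * min 1 (a (J - Suc i)))"
    by (rule sum.nat_diff_reindex[symmetric])
  also have "\<dots> \<le> (\<Sum>i<J. h powr (2 * t) * r ^ i)" by (intro sum_mono small) simp
  also have "\<dots> \<le> h powr (2 * t) * (1 / (1 - r))"
    unfolding sum_distrib_left[symmetric] by (intro mult_left_mono geo r) simp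
  also have "(\<Sum>i<N. q ^ (J + i) * min 1 (a (J + i))) \<le> (\<Sum>i<N. h powr (2 * t) * q ^ i)" by (intro sum_mono big)
  also have "\<dots> \<le> h powr (2 * t) * (1 / (1 - q))"
    unfolding sum_distrib_left[symmetric] by (intro mult_left_mono geo q) simp
  finally show ?thesis by (simp add: q_def r_def a_def algebra_simps)
qed

text \<open>With 4^j <= 1 + |\<xi>|^2 < 4^(j+1) the weight is at most 4^(-js), and 4^(-j) |\<xi>|^2
  <= 4, so the Gaussian of parameter 4^(-j) is at least exp (- 4). Sobolev weights are thus
  dominated by dyadic Gaussians.\<close>

lemma sobolev_weight_dyadic:
  fixes \<xi> :: "'a::euclidean_space"
  assumes "0 \<le> s"
  shows "\<exists>j. (1 + (norm \<xi>)\<^sup>2) powr (- s) \<le> exp 4 * ((1/4 powr s) ^ j * exp (- ((1/4) ^ j) * (norm \<xi>)\<^sup>2))"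
proof -
  let ?X = "1 + (norm \<xi>)\<^sup>2"
  have X: "1 \<le> ?X" by simp
  define j where "j = (GREATEST j. 4 ^ j \<le> ?X)"
  obtain K :: nat where K: "?X < 4 ^ K" using real_arch_pow[of 4 ?X] by auto
  have bound: "i \<le> K" if "4 ^ i \<le> ?X" for i
  proof (rule ccontr)
    assume "\<not> i \<le> K"
    then have "(4::real) ^ K \<le> 4 ^ i" by (intro power_increasing) auto
    then show False using that K by linarith
  qed
  have j1: "4 ^ j \<le> ?X"
    unfolding j_def by (rule GreatestI_nat[of _ 0 K]) (use X bound in auto)
  have j2: "?X < 4 ^ Suc j"
  proof (rule ccontr)
    assume "\<not> ?X < 4 ^ Suc j"
    then have "Suc j \<le> j" unfolding j_def by (intro Greatest_le_nat[of _ _ K]) (use bound in auto)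
    then show False by simp
  qed
  have "?X powr (- s) \<le> (4 ^ j) powr (- s)" using j1 assms by (intro powr_mono2') auto
  also have "\<dots> = (1/4 powr s) ^ j"
    by (simp add: powr_realpow[symmetric] powr_powr mult.commute powr_minus_divide power_divide)
  finally have 1: "?X powr (- s) \<le> (1/4 powr s) ^ j" .
  have "(1/4) ^ j * (norm \<xi>)\<^sup>2 \<le> 4" using j2 by (simp add: power_divide field_simps)
  then have 2: "1 \<le> exp 4 * exp (- ((1/4) ^ j) * (norm \<xi>)\<^sup>2)" by (simp flip: exp_add)
  have "?X powr (- s) * 1 \<le> (1/4 powr s) ^ j * (exp 4 * exp (- ((1/4) ^ j) * (norm \<xi>)\<^sup>2))"
    using 1 2 by (intro mult_mono) auto
  then show ?thesis by (intro exI[of _ j]) (simp add: mult_ac)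
qed

text \<open>The Gaussian kernel has a convolution square root: by the parallelogram identity the
  product of narrower Gaussians centred at x and y integrates in z to a multiple of the kernel at x
  - y. The energy becomes a squared L2 norm of F, and F can be estimated pointwise, which makes
  cancellation usable.\<close>

lemma gaussian_convolution_energy:
  fixes N :: "'a::euclidean_space measure"
  assumes "sigma_finite_measure N" and [measurable]: "(\<lambda>x. x) \<in> borel_measurable N"
    and u: "integrable N u" and "0 < \<tau>"
  defines "F \<equiv> \<lambda>z. \<integral>x. u x * of_real (exp (- (norm (x - z))\<^sup>2 / (2 * \<tau>))) \<partial>N"
  shows "F \<in> borel_measurable borel" "integrable lborel (\<lambda>z. F z * cnj (F z))"
    and "(\<integral>z. F z * cnj (F z) \<partial>lborel) = of_real ((pi * \<tau>) powr (DIM('a) / 2)) *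
      (\<integral>p. u (fst p) * cnj (u (snd p)) * of_real (exp (- (norm (fst p - snd p))\<^sup>2 / (4 * \<tau>))) \<partial>(N \<Otimes>\<^sub>M N))"
proof -
  interpret N: sigma_finite_measure N by fact
  interpret PN: pair_sigma_finite N N ..
  let ?P = "N \<Otimes>\<^sub>M N"
  interpret Q: pair_sigma_finite ?P "lborel :: 'a measure" ..
  have [measurable]: "u \<in> borel_measurable N" using u by auto
  let ?w = "\<lambda>p. u (fst p) * cnj (u (snd p))"
  let ?g = "\<lambda>x z :: 'a. exp (- (norm (x - z))\<^sup>2 / (2 * \<tau>))"
  show F_meas [measurable]: "F \<in> borel_measurable borel"
    unfolding F_def by (rule N.borel_measurable_lebesgue_integral) measurable
  have w: "integrable ?P ?w"
    by (rule PN.integrable_product[OF u, of "\<lambda>y. cnj (u y)"]) (simp add: u)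
  have para: "?g x z * ?g y z = exp (- (norm (x - y))\<^sup>2 / (4 * \<tau>)) * exp (- (1 / \<tau>) * (norm (z - (1/2) *\<^sub>R (x + y)))\<^sup>2)" for x y z :: 'a
  proof -
    have "(norm (x - z))\<^sup>2 + (norm (y - z))\<^sup>2 = (norm (x - y))\<^sup>2 / 2 + 2 * (norm (z - (1/2) *\<^sub>R (x + y)))\<^sup>2"
      unfolding power2_norm_eq_inner by (simp add: inner_diff_left inner_diff_right inner_add_left inner_add_right inner_commute field_simps)
    moreover have "- A / (2 * \<tau>) + - B / (2 * \<tau>) = - C / (4 * \<tau>) + - (1 / \<tau>) * D" if "A + B = C / 2 + 2 * D" for A B C D
    proof -
      have "- A / (2 * \<tau>) + - B / (2 * \<tau>) = - (A + B) / (2 * \<tau>)"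
        by (simp add: add_divide_distrib diff_divide_distrib)
      then show ?thesis unfolding that using \<open>0 < \<tau>\<close> by (simp add: field_simps)
    qed
    ultimately have "- (norm (x - z))\<^sup>2 / (2 * \<tau>) + - (norm (y - z))\<^sup>2 / (2 * \<tau>)
        = - (norm (x - y))\<^sup>2 / (4 * \<tau>) + - (1 / \<tau>) * (norm (z - (1/2) *\<^sub>R (x + y)))\<^sup>2"
      by blast
    then show ?thesis by (simp only: exp_add[symmetric])
  qed
  have gi: "integrable N (\<lambda>x. u x * of_real (?g x z))" for z
  proof (rule Bochner_Integration.integrable_bound[OF u])
    show "AE x in N. norm (u x * of_real (?g x z)) \<le> norm (u x)"
      using \<open>0 < \<tau>\<close> by (intro AE_I2) (simp add: norm_mult mult_left_le)
  qed measurable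
  have FF: "F z * cnj (F z) = (\<integral>p. ?w p * of_real (?g (fst p) z * ?g (snd p) z) \<partial>?P)" for z
  proof -
    have i: "integrable ?P (\<lambda>p. (u (fst p) * of_real (?g (fst p) z)) * cnj (u (snd p) * of_real (?g (snd p) z)))"
      by (rule PN.integrable_product[OF gi[of z], of "\<lambda>x. cnj (u x * of_real (?g x z))"])
         (simp only: integrable_cnj gi)
    have "(\<integral>p. ?w p * of_real (?g (fst p) z * ?g (snd p) z) \<partial>?P)
      = (\<integral>p. (u (fst p) * of_real (?g (fst p) z)) * cnj (u (snd p) * of_real (?g (snd p) z)) \<partial>?P)"
      by (rule Bochner_Integration.integral_cong[OF refl]) (simp add: mult_ac)
    also have "\<dots> = (\<integral>x. (\<integral>y. (u x * of_real (?g x z)) * cnj (u y * of_real (?g y z)) \<partial>N) \<partial>N)"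
      by (subst PN.integral_fst'[symmetric, OF i]) simp
    also have "\<dots> = F z * cnj (F z)"
      unfolding F_def Bochner_Integration.integral_cnj integral_mult_right_zero integral_mult_left_zero ..
    finally show ?thesis ..
  qed
  have gz: "integrable lborel (\<lambda>z. ?g x z * ?g y z)"
    "(\<integral>z. ?g x z * ?g y z \<partial>lborel) = exp (- (norm (x - y))\<^sup>2 / (4 * \<tau>)) * (pi * \<tau>) powr (DIM('a) / 2)" for x y :: 'a
    unfolding para using gaussian_integral_shift[of "1 / \<tau>" "(1/2) *\<^sub>R (x + y)"] \<open>0 < \<tau>\<close> by simp_all
  have iQ: "integrable (?P \<Otimes>\<^sub>M lborel) (\<lambda>(p, z). ?w p * of_real (?g (fst p) z * ?g (snd p) z))"
  proof (rule Q.Fubini_integrable)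
    show "(\<lambda>(p, z). ?w p * of_real (?g (fst p) z * ?g (snd p) z)) \<in> borel_measurable (?P \<Otimes>\<^sub>M lborel)"
      by measurable
    show "AE p in ?P. integrable lborel (\<lambda>z. case (p, z) of (p, z) \<Rightarrow> ?w p * of_real (?g (fst p) z * ?g (snd p) z))"
      by (intro AE_I2) (simp only: prod.case integrable_mult_right integrable_of_real gz)
    have "(\<integral>z. norm (case (p, z) of (p, z) \<Rightarrow> ?w p * of_real (?g (fst p) z * ?g (snd p) z)) \<partial>lborel)
        = norm (?w p) * (exp (- (norm (fst p - snd p))\<^sup>2 / (4 * \<tau>)) * (pi * \<tau>) powr (DIM('a) / 2))" for p
    proof -
      have "(\<integral>z. norm (case (p, z) of (p, z) \<Rightarrow> ?w p * of_real (?g (fst p) z * ?g (snd p) z)) \<partial>lborel)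
        = (\<integral>z. norm (?w p) * (?g (fst p) z * ?g (snd p) z) \<partial>lborel)"
        by (rule Bochner_Integration.integral_cong[OF refl]) (simp add: norm_mult abs_mult)
      then show ?thesis unfolding integral_mult_right_zero gz(2) .
    qed
    moreover have "integrable ?P (\<lambda>p. norm (?w p) * (exp (- (norm (fst p - snd p))\<^sup>2 / (4 * \<tau>)) * (pi * \<tau>) powr (DIM('a) / 2)))"
    proof (rule Bochner_Integration.integrable_bound)
      show "integrable ?P (\<lambda>p. norm (?w p) * (pi * \<tau>) powr (DIM('a) / 2))"
        using w by (intro integrable_mult_left integrable_norm)
      show "AE p in ?P. norm (norm (?w p) * (exp (- (norm (fst p - snd p))\<^sup>2 / (4 * \<tau>)) * (pi * \<tau>) powr (DIM('a) / 2)))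
        \<le> norm (norm (?w p) * (pi * \<tau>) powr (DIM('a) / 2))"
        using \<open>0 < \<tau>\<close> by (intro AE_I2) (simp add: abs_mult mult_left_mono mult_left_le_one_le)
    qed measurable
    ultimately show "integrable ?P (\<lambda>p. \<integral>z. norm (case (p, z) of (p, z) \<Rightarrow> ?w p * of_real (?g (fst p) z * ?g (snd p) z)) \<partial>lborel)"
      by simp
  qed
  show "integrable lborel (\<lambda>z. F z * cnj (F z))"
    unfolding FF using Q.integrable_snd[OF iQ] by simp
  have "(\<integral>z. F z * cnj (F z) \<partial>lborel) = (\<integral>p. (\<integral>z. ?w p * of_real (?g (fst p) z * ?g (snd p) z) \<partial>lborel) \<partial>?P)"
    unfolding FF by (rule Q.Fubini_integral[OF iQ])
  also have "\<dots> = (\<integral>p. of_real ((pi * \<tau>) powr (DIM('a) / 2)) * (?w p * of_real (exp (- (norm (fst p - snd p))\<^sup>2 / (4 * \<tau>)))) \<partial>?P)"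
  proof (rule Bochner_Integration.integral_cong[OF refl])
    show "(\<integral>z. ?w p * of_real (?g (fst p) z * ?g (snd p) z) \<partial>lborel)
      = of_real ((pi * \<tau>) powr (DIM('a) / 2)) * (?w p * of_real (exp (- (norm (fst p - snd p))\<^sup>2 / (4 * \<tau>))))" for p
      unfolding integral_mult_right_zero integral_complex_of_real gz(2) by (simp only: of_real_mult mult_ac)
  qed
  also have "\<dots> = of_real ((pi * \<tau>) powr (DIM('a) / 2)) * (\<integral>p. ?w p * of_real (exp (- (norm (fst p - snd p))\<^sup>2 / (4 * \<tau>))) \<partial>?P)"
    by (rule integral_mult_right_zero)
  finally show "(\<integral>z. F z * cnj (F z) \<partial>lborel) = of_real ((pi * \<tau>) powr (DIM('a) / 2)) *
      (\<integral>p. u (fst p) * cnj (u (snd p)) * of_real (exp (- (norm (fst p - snd p))\<^sup>2 / (4 * \<tau>))) \<partial>(N \<Otimes>\<^sub>M N))" .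
qed

text \<open>The estimates of this part rest on finiteness and the growth of balls rather than on
  self-similarity; they are instantiated later with the Hausdorff measure on \<Gamma>.\<close>

locale ahlfors_measure = finite_measure \<mu> for \<mu> :: "'a::euclidean_space measure" +
  fixes d :: real and C :: real
  assumes id_meas [measurable]: "(\<lambda>x. x) \<in> borel_measurable \<mu>"
    and d_pos: "0 < d" and C_pos: "0 < C"
    and upper: "\<And>x r. 0 < r \<Longrightarrow> measure \<mu> (space \<mu> \<inter> ball x r) \<le> C * r powr d"
begin

lemma sigma_finite_mu: "sigma_finite_measure \<mu>" ..

lemma ball_sets: "space \<mu> \<inter> ball x r \<in> sets \<mu>"
  using measurable_sets[OF id_meas, of "ball x r"] by (simp add: Int_commute vimage_def Collect_conj_eq inf_commute)

text \<open>Gaussian mass counted by shells: between k and k + 1 widths sqrt \<tau> from the centre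
  the Gaussian is at most exp(-k^2/4), and the enclosing ball has mass at most C (k + 1)^d in units
  of the width.\<close>

definition "gauss_const = C * (\<Sum>k. exp (- (real k)\<^sup>2 / 4) * (real k + 1) powr d)"

lemma gauss_summable: "summable (\<lambda>k::nat. exp (- (real k)\<^sup>2 / 4) * (real k + 1) powr d)"
proof (rule summable_comparison_test_bigo)
  show "summable (\<lambda>k. norm (1 / real k ^ 2))"
    using inverse_power_summable[of 2, where 'a = real] by (simp add: field_simps)
  show "(\<lambda>k::nat. exp (- (real k)\<^sup>2 / 4) * (real k + 1) powr d) \<in> O(\<lambda>k. 1 / real k ^ 2)"
    by real_asymp
qed

lemma gauss_const_nonneg: "0 \<le> gauss_const"
  unfolding gauss_const_def using C_pos by (intro mult_nonneg_nonneg suminf_nonneg gauss_summable) auto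

lemma gaussian_mass:
  assumes "0 < \<tau>"
  shows "(\<integral>\<^sup>+y. ennreal (exp (- (norm (x - y))\<^sup>2 / (4 * \<tau>))) \<partial>\<mu>) \<le> ennreal (gauss_const * \<tau> powr (d / 2))"
proof -
  define \<sigma> where "\<sigma> = sqrt \<tau>"
  have \<sigma>: "0 < \<sigma>" "\<sigma>\<^sup>2 = \<tau>" using assms by (auto simp: \<sigma>_def)
  let ?B = "\<lambda>k::nat. space \<mu> \<inter> ball x ((real k + 1) * \<sigma>)"
  let ?e = "\<lambda>k::nat. exp (- (real k)\<^sup>2 / 4)"
  have pw: "ennreal (exp (- (norm (x - y))\<^sup>2 / (4 * \<tau>))) \<le> (\<Sum>k. ennreal (?e k) * indicator (?B k) y)" if y: "y \<in> space \<mu>" for y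
  proof -
    define k where "k = nat \<lfloor>norm (x - y) / \<sigma>\<rfloor>"
    have "0 \<le> norm (x - y) / \<sigma>" using \<sigma> by simp
    then have k: "real k \<le> norm (x - y) / \<sigma>" "norm (x - y) / \<sigma> < real k + 1"
      unfolding k_def by linarith+
    have "(real k)\<^sup>2 \<le> (norm (x - y) / \<sigma>)\<^sup>2" using k by (intro power_mono) auto
    then have "(real k)\<^sup>2 \<le> (norm (x - y))\<^sup>2 / \<tau>" by (simp add: power_divide \<sigma>)
    then have "exp (- (norm (x - y))\<^sup>2 / (4 * \<tau>)) \<le> ?e k" using assms by (simp add: field_simps)
    moreover have "y \<in> ?B k" using k(2) \<sigma> y by (simp add: dist_norm field_simps)
    ultimately have "ennreal (exp (- (norm (x - y))\<^sup>2 / (4 * \<tau>))) \<le> ennreal (?e k) * indicator (?B k) y"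
      by (simp add: ennreal_leI)
    also have "\<dots> \<le> (\<Sum>k. ennreal (?e k) * indicator (?B k) y)"
    proof -
      have sing: "(\<Sum>i\<in>{k}. X i) = X k" for X :: "nat \<Rightarrow> ennreal" by simp
      have "(\<Sum>i\<in>{k}. ennreal (?e i) * indicator (?B i) y) \<le> (\<Sum>i. ennreal (?e i) * indicator (?B i) y)"
        by (rule sum_le_suminf) auto
      then show ?thesis unfolding sing .
    qed
    finally show ?thesis .
  qed
  have "(\<integral>\<^sup>+y. ennreal (exp (- (norm (x - y))\<^sup>2 / (4 * \<tau>))) \<partial>\<mu>) \<le> (\<integral>\<^sup>+y. (\<Sum>k. ennreal (?e k) * indicator (?B k) y) \<partial>\<mu>)"
    by (rule nn_integral_mono) (rule pw)
  also have "\<dots> = (\<Sum>k. \<integral>\<^sup>+y. ennreal (?e k) * indicator (?B k) y \<partial>\<mu>)"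
    by (rule nn_integral_suminf) (use ball_sets in auto)
  also have "\<dots> = (\<Sum>k. ennreal (?e k) * emeasure \<mu> (?B k))"
    by (intro suminf_cong nn_integral_cmult_indicator ball_sets)
  also have "\<dots> \<le> (\<Sum>k. ennreal (C * \<tau> powr (d / 2) * (?e k * (real k + 1) powr d)))"
  proof (intro suminf_le)
    fix k :: nat
    have "emeasure \<mu> (?B k) \<le> ennreal (C * ((real k + 1) * \<sigma>) powr d)"
      unfolding emeasure_eq_measure using \<sigma> by (intro ennreal_leI upper) simp
    also have "\<sigma> powr d = \<tau> powr (d / 2)"
      using assms by (simp add: \<sigma>_def powr_half_sqrt[symmetric] powr_powr)
    then have "C * ((real k + 1) * \<sigma>) powr d = C * \<tau> powr (d / 2) * (real k + 1) powr d" by (simp add: powr_mult)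
    finally have "ennreal (?e k) * emeasure \<mu> (?B k) \<le> ennreal (?e k) * ennreal (C * \<tau> powr (d / 2) * (real k + 1) powr d)"
      by (intro mult_left_mono) auto
    then show "ennreal (?e k) * emeasure \<mu> (?B k) \<le> ennreal (C * \<tau> powr (d / 2) * (?e k * (real k + 1) powr d))"
      using C_pos by (simp add: ennreal_mult[symmetric] mult_ac)
  qed auto
  also have "\<dots> = ennreal (\<Sum>k. C * \<tau> powr (d / 2) * (?e k * (real k + 1) powr d))"
    using C_pos by (intro suminf_ennreal2 summable_mult gauss_summable) auto
  also have "(\<Sum>k. C * \<tau> powr (d / 2) * (?e k * (real k + 1) powr d)) = gauss_const * \<tau> powr (d / 2)"
    unfolding gauss_const_def by (subst suminf_mult[OF gauss_summable]) (simp add: mult_ac)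
  finally show ?thesis .
qed

lemma L2_integrable: "\<psi> \<in> L2_space \<mu> \<Longrightarrow> integrable \<mu> \<psi>"
  using L2_integrable_mult[of \<psi> \<mu> "\<lambda>_. 1"] by (simp add: L2_space_def)

definition "plain_const = pi powr (DIM('a) / 2) * gauss_const"

text \<open>The Gaussian mass of \<mu> is of order \<tau>^(d/2), against \<tau>^(n/2) for Lebesgue
  measure. The resulting factor \<tau>^((d-n)/2) is the price of codimension n - d, equivalent to
  (n-d)/2 derivatives.\<close>

lemma gaussian_mean_plain:
  assumes \<psi>: "\<psi> \<in> L2_space \<mu>" and "0 < \<tau>"
  shows "integrable lborel (\<lambda>\<xi>. exp (- \<tau> * (norm \<xi>)\<^sup>2) * (cmod (fourier_integral \<mu> \<psi> \<xi>))\<^sup>2)"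
    and "(\<integral>\<xi>. exp (- \<tau> * (norm \<xi>)\<^sup>2) * (cmod (fourier_integral \<mu> \<psi> \<xi>))\<^sup>2 \<partial>lborel)
      \<le> plain_const * \<tau> powr ((d - DIM('a)) / 2) * (L2_norm \<mu> \<psi>)\<^sup>2"
proof -
  have A0: "0 \<le> gauss_const * \<tau> powr (d / 2)" using gauss_const_nonneg by simp
  note e = gaussian_energy_le[OF sigma_finite_mu id_meas L2_integrable[OF \<psi>] \<psi> \<open>0 < \<tau>\<close> A0 gaussian_mass[OF \<open>0 < \<tau>\<close>]]
  show "integrable lborel (\<lambda>\<xi>. exp (- \<tau> * (norm \<xi>)\<^sup>2) * (cmod (fourier_integral \<mu> \<psi> \<xi>))\<^sup>2)" by (rule e(1))
  note e(2)
  also have "(pi / \<tau>) powr (DIM('a) / 2) * (gauss_const * \<tau> powr (d / 2) * (L2_norm \<mu> \<psi>)\<^sup>2)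
      = plain_const * \<tau> powr ((d - DIM('a)) / 2) * (L2_norm \<mu> \<psi>)\<^sup>2"
    using \<open>0 < \<tau>\<close> by (simp add: plain_const_def powr_divide powr_diff diff_divide_distrib)
  finally show "(\<integral>\<xi>. exp (- \<tau> * (norm \<xi>)\<^sup>2) * (cmod (fourier_integral \<mu> \<psi> \<xi>))\<^sup>2 \<partial>lborel)
      \<le> plain_const * \<tau> powr ((d - DIM('a)) / 2) * (L2_norm \<mu> \<psi>)\<^sup>2" .
qed

text \<open>\<open>p\<close> selects a point of each piece of a partition into sets of diameter at most \<open>h\<close>, and \<open>\<psi>\<close> has mean zero
  on each piece.\<close>

definition "cancels h \<psi> \<longleftrightarrow> (\<exists>p. p \<in> borel_measurable \<mu> \<and> (\<forall>x\<in>space \<mu>. dist x (p x) \<le> h) \<and>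
  (\<forall>G\<in>borel_measurable borel. (\<forall>x. \<bar>G x\<bar> \<le> 1) \<longrightarrow> (\<integral>x. \<psi> x * of_real (G (p x)) \<partial>\<mu>) = 0))"

text \<open>exp 5 is the square of the factor in \<open>gaussian_difference_bound\<close>; the
  powers of 2 arise because the dominating Gaussian has parameter 2 * \<tau>, both in its
  normalisation and in its mass under \<mu>.\<close>

definition "cancel_const = exp 5 * (2 * pi) powr (DIM('a) / 2) * 2 powr (d / 2) * gauss_const"

text \<open>A cancelling function only sees differences of the Gaussian over distances at most \<open>h\<close>,
  each of which gains a factor \<open>h / sqrt \<tau>\<close>.\<close>

lemma gaussian_mean_cancel:
  assumes \<psi>: "\<psi> \<in> L2_space \<mu>" and "0 < \<tau>" and can: "cancels h \<psi>" and h: "0 < h" "h\<^sup>2 \<le> \<tau>"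
  shows "(\<integral>\<xi>. exp (- \<tau> * (norm \<xi>)\<^sup>2) * (cmod (fourier_integral \<mu> \<psi> \<xi>))\<^sup>2 \<partial>lborel)
      \<le> cancel_const * (h\<^sup>2 / \<tau>) * \<tau> powr ((d - DIM('a)) / 2) * (L2_norm \<mu> \<psi>)\<^sup>2"
proof -
  let ?n2 = "real DIM('a) / 2"
  note i\<psi> = L2_integrable[OF \<psi>]
  have [measurable]: "\<psi> \<in> borel_measurable \<mu>" using \<psi> by auto
  obtain p where p [measurable]: "p \<in> borel_measurable \<mu>" and ph: "\<And>x. x \<in> space \<mu> \<Longrightarrow> dist x (p x) \<le> h"
    and p0: "\<And>G. G \<in> borel_measurable borel \<Longrightarrow> (\<And>x. \<bar>G x\<bar> \<le> 1) \<Longrightarrow> (\<integral>x. \<psi> x * of_real (G (p x)) \<partial>\<mu>) = 0"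
    using can unfolding cancels_def by blast
  define \<sigma> where "\<sigma> = sqrt \<tau>"
  have \<sigma>: "0 < \<sigma>" "\<sigma>\<^sup>2 = \<tau>" using \<open>0 < \<tau>\<close> by (auto simp: \<sigma>_def)
  have h\<sigma>: "h \<le> \<sigma>" unfolding \<sigma>_def using h by (intro real_le_rsqrt)
  define F where "F z = (\<integral>x. \<psi> x * of_real (exp (- (norm (x - z))\<^sup>2 / (2 * \<tau>))) \<partial>\<mu>)" for z
  \<comment> \<open>After cancellation only |\<psi>| matters. Its Gaussian mean E at the doubled
    parameter 2 * \<tau> is the envelope that \<open>gaussian_difference_bound\<close>
    provides.\<close>
  define u where "u x = complex_of_real (cmod (\<psi> x))" for x
  have iu: "integrable \<mu> u" unfolding u_def using i\<psi> by simp
  have u2: "u \<in> L2_space \<mu>" "L2_norm \<mu> u = L2_norm \<mu> \<psi>"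
    using \<psi> borel_measurable_integrable[OF iu] by (auto simp: L2_space_def L2_norm_def) (auto simp: u_def)
  define E where "E z = (\<integral>x. u x * of_real (exp (- (norm (x - z))\<^sup>2 / (2 * (2 * \<tau>)))) \<partial>\<mu>)" for z
  have \<tau>2: "0 < 2 * \<tau>" using \<open>0 < \<tau>\<close> by simp
  note eF = gaussian_convolution_energy[OF sigma_finite_mu id_meas i\<psi> \<open>0 < \<tau>\<close>, folded F_def]
  note eE = gaussian_convolution_energy[OF sigma_finite_mu id_meas iu \<tau>2, folded E_def]
  let ?EN = "\<lambda>u \<tau>. \<integral>p. u (fst p) * cnj (u (snd p)) * of_real (exp (- (norm (fst p - snd p))\<^sup>2 / (4 * \<tau>))) \<partial>(\<mu> \<Otimes>\<^sub>M \<mu>)"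
  have FE: "cmod (F z) \<le> exp (5/2) * (h / \<sigma>) * cmod (E z)" for z
  proof -
    define G where "G x = exp (- (norm (x - z))\<^sup>2 / (2 * \<tau>))" for x
    define k where "k x = exp (- (norm (x - z))\<^sup>2 / (2 * (2 * \<tau>)))" for x
    have [measurable]: "G \<in> borel_measurable borel" "k \<in> borel_measurable borel" unfolding G_def k_def by measurable
    have G1: "\<bar>G x\<bar> \<le> 1" "\<bar>k x\<bar> \<le> 1" for x using \<open>0 < \<tau>\<close> by (auto simp: G_def k_def)
    have i1: "integrable \<mu> (\<lambda>x. \<psi> x * of_real (G x))"
      by (rule Bochner_Integration.integrable_bound[OF i\<psi>])
         (use G1 in \<open>auto simp: norm_mult intro!: AE_I2 mult_left_le\<close>)
    have i2: "integrable \<mu> (\<lambda>x. \<psi> x * of_real (G (p x)))"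
      by (rule Bochner_Integration.integrable_bound[OF i\<psi>])
         (use G1 in \<open>auto simp: norm_mult intro!: AE_I2 mult_left_le\<close>)
    have i3: "integrable \<mu> (\<lambda>x. cmod (\<psi> x) * k x)"
      by (rule Bochner_Integration.integrable_bound[OF i\<psi>])
         (use G1 in \<open>auto simp: abs_mult intro!: AE_I2 mult_left_le\<close>)
    have Gk: "\<bar>G x - G (p x)\<bar> \<le> exp (5/2) * (h / \<sigma>) * k x" if x: "x \<in> space \<mu>" for x
    proof -
      let ?a = "norm (x - z) / \<sigma>" and ?b = "norm (p x - z) / \<sigma>"
      have "\<bar>norm (x - z) - norm (p x - z)\<bar> \<le> h"
        using norm_triangle_ineq3[of "x - z" "p x - z"] ph[OF x] by (simp add: dist_norm)
      then have ab: "\<bar>?a - ?b\<bar> \<le> h / \<sigma>"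
        using \<sigma>(1) by (simp add: diff_divide_distrib[symmetric] abs_divide divide_right_mono)
      have "h / \<sigma> \<le> 1" using h\<sigma> \<sigma>(1) by simp
      then have ab1: "\<bar>?a - ?b\<bar> \<le> 1" using ab by linarith
      have "\<bar>exp (- ?a\<^sup>2 / 2) - exp (- ?b\<^sup>2 / 2)\<bar> \<le> exp (5/2) * \<bar>?a - ?b\<bar> * exp (- ?a\<^sup>2 / 4)"
        using \<sigma>(1) by (intro gaussian_difference_bound ab1) auto
      also have "\<dots> \<le> exp (5/2) * (h / \<sigma>) * exp (- ?a\<^sup>2 / 4)"
        using ab by (intro mult_right_mono mult_left_mono) auto
      finally show ?thesis
        by (simp add: G_def k_def power_divide \<sigma>(2) mult.commute)
    qed
    \<comment> \<open>The subtracted integral is zero by \<open>cancels\<close>: G composed with p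
      depends only on the selected point.\<close>
    have "F z = (\<integral>x. \<psi> x * of_real (G x) \<partial>\<mu>) - (\<integral>x. \<psi> x * of_real (G (p x)) \<partial>\<mu>)"
      using p0[of G] G1 by (simp add: F_def G_def)
    also have "\<dots> = (\<integral>x. \<psi> x * of_real (G x) - \<psi> x * of_real (G (p x)) \<partial>\<mu>)"
      by (rule Bochner_Integration.integral_diff[OF i1 i2, symmetric])
    finally have "cmod (F z) \<le> (\<integral>x. cmod (\<psi> x * of_real (G x) - \<psi> x * of_real (G (p x))) \<partial>\<mu>)"
      by (simp only: integral_norm_bound)
    also have "\<dots> \<le> (\<integral>x. exp (5/2) * (h / \<sigma>) * (cmod (\<psi> x) * k x) \<partial>\<mu>)"
    proof (rule integral_mono)
      show "integrable \<mu> (\<lambda>x. cmod (\<psi> x * of_real (G x) - \<psi> x * of_real (G (p x))))"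
        using i1 i2 by (intro integrable_norm Bochner_Integration.integrable_diff)
      show "integrable \<mu> (\<lambda>x. exp (5/2) * (h / \<sigma>) * (cmod (\<psi> x) * k x))" using i3 by simp
      fix x assume x: "x \<in> space \<mu>"
      have "cmod (\<psi> x * of_real (G x) - \<psi> x * of_real (G (p x))) = cmod (\<psi> x) * \<bar>G x - G (p x)\<bar>"
        unfolding right_diff_distrib[symmetric] of_real_diff[symmetric] norm_mult norm_of_real ..
      also have "\<dots> \<le> cmod (\<psi> x) * (exp (5/2) * (h / \<sigma>) * k x)"
        by (intro mult_left_mono Gk x) simp
      finally show "cmod (\<psi> x * of_real (G x) - \<psi> x * of_real (G (p x))) \<le> exp (5/2) * (h / \<sigma>) * (cmod (\<psi> x) * k x)"
        by (simp add: mult_ac)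
    qed
    also have "\<dots> = exp (5/2) * (h / \<sigma>) * (\<integral>x. cmod (\<psi> x) * k x \<partial>\<mu>)" by simp
    also have "\<dots> \<le> exp (5/2) * (h / \<sigma>) * cmod (E z)"
    proof (rule mult_left_mono)
      have "E z = of_real (\<integral>x. cmod (\<psi> x) * k x \<partial>\<mu>)"
        unfolding E_def u_def k_def[symmetric] of_real_mult[symmetric] by (rule integral_complex_of_real)
      then show "(\<integral>x. cmod (\<psi> x) * k x \<partial>\<mu>) \<le> cmod (E z)" by simp
    qed (use h \<sigma> in simp)
    finally show ?thesis .
  qed
  have sqF: "F z * cnj (F z) = of_real ((cmod (F z))\<^sup>2)" "E z * cnj (E z) = of_real ((cmod (E z))\<^sup>2)" for z
    by (simp_all only: complex_norm_square)
  have iF: "integrable lborel (\<lambda>z. (cmod (F z))\<^sup>2)" and iE: "integrable lborel (\<lambda>z. (cmod (E z))\<^sup>2)"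
    using integrable_norm[OF eF(2)] integrable_norm[OF eE(2)] unfolding sqF norm_of_real by simp_all
  have rF: "of_real (\<integral>z. (cmod (F z))\<^sup>2 \<partial>lborel) = of_real ((pi * \<tau>) powr ?n2) * ?EN \<psi> \<tau>"
    using eF(3) unfolding sqF integral_complex_of_real .
  have rE: "of_real (\<integral>z. (cmod (E z))\<^sup>2 \<partial>lborel) = of_real ((pi * (2 * \<tau>)) powr ?n2) * ?EN u (2 * \<tau>)"
    using eE(3) unfolding sqF integral_complex_of_real .
  have EN_u: "cmod (?EN u (2 * \<tau>)) \<le> gauss_const * (2 * \<tau>) powr (d / 2) * (L2_norm \<mu> \<psi>)\<^sup>2"
  proof -
    let ?K = "\<lambda>x y. exp (- (norm (x - y))\<^sup>2 / (4 * (2 * \<tau>)))"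
    have [measurable]: "u \<in> borel_measurable \<mu>" using iu by auto
    have "cmod (?EN u (2 * \<tau>)) \<le> (\<integral>z. cmod (u (fst z)) * cmod (u (snd z)) * ?K (fst z) (snd z) \<partial>(\<mu> \<Otimes>\<^sub>M \<mu>))"
      by (rule order_trans[OF integral_norm_bound]) (simp add: norm_mult)
    also have "\<dots> = enn2real (\<integral>\<^sup>+z. ennreal (cmod (u (fst z)) * cmod (u (snd z)) * ?K (fst z) (snd z)) \<partial>(\<mu> \<Otimes>\<^sub>M \<mu>))"
      by (rule integral_eq_nn_integral) auto
    also have "\<dots> \<le> gauss_const * (2 * \<tau>) powr (d / 2) * (L2_norm \<mu> u)\<^sup>2"
    proof (rule enn2real_leI)
      show "(\<integral>\<^sup>+z. ennreal (cmod (u (fst z)) * cmod (u (snd z)) * ?K (fst z) (snd z)) \<partial>(\<mu> \<Otimes>\<^sub>M \<mu>))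
        \<le> ennreal (gauss_const * (2 * \<tau>) powr (d / 2) * (L2_norm \<mu> u)\<^sup>2)"
        by (rule schur_test[OF sigma_finite_mu u2(1) _ _ _ gaussian_mass[OF \<tau>2]]) (auto simp: norm_minus_commute gauss_const_nonneg)
    qed (use gauss_const_nonneg in simp)
    finally show ?thesis unfolding u2(2) .
  qed
  have intE: "(\<integral>z. (cmod (E z))\<^sup>2 \<partial>lborel) \<le> (pi * (2 * \<tau>)) powr ?n2 * (gauss_const * (2 * \<tau>) powr (d / 2) * (L2_norm \<mu> \<psi>)\<^sup>2)"
  proof -
    have "(\<integral>z. (cmod (E z))\<^sup>2 \<partial>lborel) = Re (of_real (\<integral>z. (cmod (E z))\<^sup>2 \<partial>lborel))" by simp
    also have "\<dots> \<le> cmod (of_real ((pi * (2 * \<tau>)) powr ?n2) * ?EN u (2 * \<tau>))"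
      unfolding rE by (rule complex_Re_le_cmod)
    also have "\<dots> \<le> (pi * (2 * \<tau>)) powr ?n2 * (gauss_const * (2 * \<tau>) powr (d / 2) * (L2_norm \<mu> \<psi>)\<^sup>2)"
      unfolding norm_mult using EN_u by (simp add: mult_left_mono)
    finally show ?thesis .
  qed
  have intF: "(\<integral>z. (cmod (F z))\<^sup>2 \<partial>lborel) \<le> exp 5 * (h\<^sup>2 / \<tau>) * (\<integral>z. (cmod (E z))\<^sup>2 \<partial>lborel)"
  proof -
    have "(cmod (F z))\<^sup>2 \<le> exp 5 * (h\<^sup>2 / \<tau>) * (cmod (E z))\<^sup>2" for z
    proof -
      have "(cmod (F z))\<^sup>2 \<le> (exp (5/2) * (h / \<sigma>) * cmod (E z))\<^sup>2" by (intro power_mono FE) simp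
      also have "\<dots> = exp 5 * (h\<^sup>2 / \<tau>) * (cmod (E z))\<^sup>2"
        by (simp add: power_mult_distrib power_divide \<sigma>(2) exp_double[symmetric])
      finally show ?thesis .
    qed
    then have "(\<integral>z. (cmod (F z))\<^sup>2 \<partial>lborel) \<le> (\<integral>z. exp 5 * (h\<^sup>2 / \<tau>) * (cmod (E z))\<^sup>2 \<partial>lborel)"
      using iF iE by (intro integral_mono) auto
    then show ?thesis by simp
  qed
  let ?I = "\<integral>\<xi>. exp (- \<tau> * (norm \<xi>)\<^sup>2) * (cmod (fourier_integral \<mu> \<psi> \<xi>))\<^sup>2 \<partial>lborel"
  have "of_real ?I = (\<integral>\<xi>. complex_of_real (exp (- \<tau> * (norm \<xi>)\<^sup>2)) * (fourier_integral \<mu> \<psi> \<xi> * cnj (fourier_integral \<mu> \<psi> \<xi>)) \<partial>lborel)"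
    unfolding complex_norm_square[symmetric] of_real_mult[symmetric] of_real_power[symmetric]
    by (rule integral_complex_of_real[symmetric])
  also have "\<dots> = of_real ((pi / \<tau>) powr ?n2) * ?EN \<psi> \<tau>"
    by (rule gaussian_fourier_product[OF sigma_finite_mu sigma_finite_mu id_meas id_meas i\<psi> i\<psi> \<open>0 < \<tau>\<close>])
  \<comment> \<open>The energy of \<psi> occurs in two identities, on the frequency side and as the
    squared L2 norm of F; eliminating it transfers the bound for F to the Gaussian mean.\<close>
  also have "?EN \<psi> \<tau> = of_real ((\<integral>z. (cmod (F z))\<^sup>2 \<partial>lborel) / (pi * \<tau>) powr ?n2)"
    using rF \<open>0 < \<tau>\<close> by (simp add: field_simps)
  finally have "complex_of_real ?I = of_real ((pi / \<tau>) powr ?n2 * ((\<integral>z. (cmod (F z))\<^sup>2 \<partial>lborel) / (pi * \<tau>) powr ?n2))"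
    by (simp only: of_real_mult)
  then have "?I = (pi / \<tau>) powr ?n2 / (pi * \<tau>) powr ?n2 * (\<integral>z. (cmod (F z))\<^sup>2 \<partial>lborel)"
    by (simp only: of_real_eq_iff) simp
  also have "\<dots> \<le> (pi / \<tau>) powr ?n2 / (pi * \<tau>) powr ?n2 * (exp 5 * (h\<^sup>2 / \<tau>) *
      ((pi * (2 * \<tau>)) powr ?n2 * (gauss_const * (2 * \<tau>) powr (d / 2) * (L2_norm \<mu> \<psi>)\<^sup>2)))"
    using intF mult_left_mono[OF intE, of "exp 5 * (h\<^sup>2 / \<tau>)"] \<open>0 < \<tau>\<close> by (intro mult_left_mono) auto
  also have "\<dots> = cancel_const * (h\<^sup>2 / \<tau>) * \<tau> powr ((d - DIM('a)) / 2) * (L2_norm \<mu> \<psi>)\<^sup>2"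
  proof -
    have "(pi / \<tau>) powr ?n2 / (pi * \<tau>) powr ?n2 * (pi * (2 * \<tau>)) powr ?n2 = (2 * pi) powr ?n2 / \<tau> powr ?n2"
      using \<open>0 < \<tau>\<close> by (simp add: powr_mult powr_divide field_simps)
    moreover have "\<tau> powr ((d - DIM('a)) / 2) = \<tau> powr (d / 2) / \<tau> powr ?n2"
      using \<open>0 < \<tau>\<close> by (simp add: powr_diff diff_divide_distrib)
    moreover have "A / B * (c1 * ((pi * (2 * \<tau>)) powr ?n2 * (g * (t2 * t1) * L))) = c1 * g * t2 * L * (t1 * (A / B * (pi * (2 * \<tau>)) powr ?n2))"
      for A B c1 g t2 t1 L :: real by (simp add: mult_ac)
    ultimately show ?thesis
      unfolding cancel_const_def powr_mult[of 2 \<tau>] by (simp add: mult_ac)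
  qed
  finally show ?thesis .
qed

text \<open>Summation of dyadic Gaussians over \<tau> = 4^(-j): the weight 4^(-js) times the factor
  \<tau>^((d-n)/2) leaves 4^(-jt), since s - (n-d)/2 = t. The number m j is the relative gain at
  scale j, so one lemma serves the bounds with and without cancellation.\<close>

lemma negative_norm_from_gaussian_means:
  assumes \<psi>: "\<psi> \<in> L2_space \<mu>" and t: "0 < t" "d \<le> DIM('a)" and S: "\<And>N. (\<Sum>j<N. (1/4 powr t) ^ j * m j) \<le> S"
    and m: "\<And>j. 0 \<le> m j" and K: "0 \<le> K"
    and mean: "\<And>j::nat. (\<integral>\<xi>. exp (- ((1/4) ^ j) * (norm \<xi>)\<^sup>2) * (cmod (fourier_integral \<mu> \<psi> \<xi>))\<^sup>2 \<partial>lborel)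
      \<le> K * m j * ((1/4) ^ j) powr ((d - DIM('a)) / 2) * (L2_norm \<mu> \<psi>)\<^sup>2"
  defines "W \<equiv> \<lambda>\<xi>. of_real (sobolev_weight (- (t + (DIM('a) - d) / 2)) \<xi>) * fourier_integral \<mu> \<psi> \<xi>"
  shows "W \<in> L2_space lborel" "(L2_norm lborel W)\<^sup>2 \<le> exp 4 * K * S * (L2_norm \<mu> \<psi>)\<^sup>2"
proof -
  define s where "s = t + (DIM('a) - d) / 2"
  have s: "0 \<le> s" using t by (simp add: s_def)
  let ?F = "fourier_integral \<mu> \<psi>"
  have [measurable]: "\<psi> \<in> borel_measurable \<mu>" using \<psi> by auto
  have F [measurable]: "?F \<in> borel_measurable borel"
    by (rule fourier_integral_measurable[OF sigma_finite_mu id_meas]) simp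
  have Wm [measurable]: "W \<in> borel_measurable borel" unfolding W_def by measurable
  define f where "f j \<xi> = exp 4 * ((1/4 powr s) ^ j * (exp (- ((1/4) ^ j) * (norm \<xi>)\<^sup>2) * (cmod (?F \<xi>))\<^sup>2))" for j :: nat and \<xi> :: 'a
  have f0: "0 \<le> f j \<xi>" for j \<xi> by (simp add: f_def)
  have fm [measurable]: "f j \<in> borel_measurable borel" for j unfolding f_def by measurable
  \<comment> \<open>One dyadic term already dominates, but its index depends on \<xi>; the sum over
    all j removes that dependence.\<close>
  have pw: "ennreal ((cmod (W \<xi>))\<^sup>2) \<le> (\<Sum>j. ennreal (f j \<xi>))" for \<xi>
  proof -
    obtain j where "(1 + (norm \<xi>)\<^sup>2) powr (- s) \<le> exp 4 * ((1/4 powr s) ^ j * exp (- ((1/4) ^ j) * (norm \<xi>)\<^sup>2))"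
      using sobolev_weight_dyadic[OF s] by blast
    then have "(1 + (norm \<xi>)\<^sup>2) powr (- s) * (cmod (?F \<xi>))\<^sup>2
      \<le> exp 4 * ((1/4 powr s) ^ j * exp (- ((1/4) ^ j) * (norm \<xi>)\<^sup>2)) * (cmod (?F \<xi>))\<^sup>2"
      by (rule mult_right_mono) simp
    also have "\<dots> = f j \<xi>" by (simp only: f_def mult.assoc)
    finally have "(1 + (norm \<xi>)\<^sup>2) powr (- s) * (cmod (?F \<xi>))\<^sup>2 \<le> f j \<xi>" .
    then have "ennreal ((cmod (W \<xi>))\<^sup>2) \<le> ennreal (f j \<xi>)"
      unfolding W_def weighted_power2 s_def by (rule ennreal_leI)
    also have "\<dots> \<le> (\<Sum>j. ennreal (f j \<xi>))"
      using sum_le_suminf[of "\<lambda>j. ennreal (f j \<xi>)" "{j}"] by simp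
    finally show ?thesis .
  qed
  have fint: "(\<integral>\<^sup>+\<xi>. ennreal (f j \<xi>) \<partial>lborel) \<le> ennreal (exp 4 * K * (L2_norm \<mu> \<psi>)\<^sup>2 * ((1/4 powr t) ^ j * m j))" for j
  proof -
    let ?\<tau> = "(1/4::real) ^ j"
    have int: "integrable lborel (\<lambda>\<xi>. exp (- ?\<tau> * (norm \<xi>)\<^sup>2) * (cmod (?F \<xi>))\<^sup>2)"
      by (rule gaussian_mean_plain(1)[OF \<psi>]) simp
    have "(\<integral>\<^sup>+\<xi>. ennreal (f j \<xi>) \<partial>lborel) = ennreal (\<integral>\<xi>. f j \<xi> \<partial>lborel)"
      by (rule nn_integral_eq_integral) (use int f0 in \<open>auto simp: f_def\<close>)
    also have "(\<integral>\<xi>. f j \<xi> \<partial>lborel) = exp 4 * ((1/4 powr s) ^ j * (\<integral>\<xi>. exp (- ?\<tau> * (norm \<xi>)\<^sup>2) * (cmod (?F \<xi>))\<^sup>2 \<partial>lborel))"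
      unfolding f_def integral_mult_right_zero ..
    also have "\<dots> \<le> exp 4 * ((1/4 powr s) ^ j * (K * m j * ?\<tau> powr ((d - DIM('a)) / 2) * (L2_norm \<mu> \<psi>)\<^sup>2))"
      by (intro mult_left_mono mean) auto
    also have "\<dots> = exp 4 * K * (L2_norm \<mu> \<psi>)\<^sup>2 * (((1/4 powr s) ^ j * ?\<tau> powr ((d - DIM('a)) / 2)) * m j)"
      by (simp only: mult_ac)
    also have "(1/4 powr s) ^ j * ?\<tau> powr ((d - DIM('a)) / 2) = (1/4 powr t) ^ j"
    proof -
      have e: "(1/4 powr u) ^ j = ?\<tau> powr u" for u :: real
        by (simp add: powr_realpow[symmetric] powr_powr mult.commute powr_divide power_divide)
      have "s + (d - DIM('a)) / 2 = t" by (simp add: s_def field_simps)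
      then show ?thesis unfolding e by (simp add: powr_add[symmetric])
    qed
    finally show ?thesis by (simp add: ennreal_leI)
  qed
  have "(\<integral>\<^sup>+\<xi>. ennreal ((cmod (W \<xi>))\<^sup>2) \<partial>lborel) \<le> (\<integral>\<^sup>+\<xi>. (\<Sum>j. ennreal (f j \<xi>)) \<partial>lborel)"
    by (intro nn_integral_mono pw)
  also have "\<dots> = (\<Sum>j. \<integral>\<^sup>+\<xi>. ennreal (f j \<xi>) \<partial>lborel)"
    by (rule nn_integral_suminf) simp
  also have "\<dots> \<le> ennreal (exp 4 * K * (L2_norm \<mu> \<psi>)\<^sup>2 * S)"
  proof (rule suminf_le_const[OF summableI])
    fix N
    have "(\<Sum>j<N. \<integral>\<^sup>+\<xi>. ennreal (f j \<xi>) \<partial>lborel) \<le> (\<Sum>j<N. ennreal (exp 4 * K * (L2_norm \<mu> \<psi>)\<^sup>2 * ((1/4 powr t) ^ j * m j)))"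
      by (intro sum_mono fint)
    also have "\<dots> = ennreal (exp 4 * K * (L2_norm \<mu> \<psi>)\<^sup>2 * (\<Sum>j<N. (1/4 powr t) ^ j * m j))"
      using m K by (subst sum_ennreal) (auto simp: sum_distrib_left)
    also have "\<dots> \<le> ennreal (exp 4 * K * (L2_norm \<mu> \<psi>)\<^sup>2 * S)"
      using K by (intro ennreal_leI mult_left_mono S) auto
    finally show "(\<Sum>j<N. \<integral>\<^sup>+\<xi>. ennreal (f j \<xi>) \<partial>lborel) \<le> ennreal (exp 4 * K * (L2_norm \<mu> \<psi>)\<^sup>2 * S)" .
  qed
  finally have *: "(\<integral>\<^sup>+\<xi>. ennreal ((cmod (W \<xi>))\<^sup>2) \<partial>lborel) \<le> ennreal (exp 4 * K * S * (L2_norm \<mu> \<psi>)\<^sup>2)"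
    by (simp add: mult_ac)
  show L: "W \<in> L2_space lborel"
    unfolding L2_space_def using le_less_trans[OF * ennreal_less_top] by (auto intro!: integrableI_bounded)
  have S0: "0 \<le> S" using S[of 0] by simp
  have "ennreal ((L2_norm lborel W)\<^sup>2) \<le> ennreal (exp 4 * K * S * (L2_norm \<mu> \<psi>)\<^sup>2)"
    using * L2_norm_nn_integral[OF L] by (simp add: ennreal_power)
  then show "(L2_norm lborel W)\<^sup>2 \<le> exp 4 * K * S * (L2_norm \<mu> \<psi>)\<^sup>2"
    by (subst (asm) ennreal_le_iff) (use K S0 in auto)
qed

text \<open>The case m j = 1, a geometric series of ratio 4^(-t). It is the dual form of the trace
  theorem.\<close>

lemma negative_norm_le:
  assumes t: "0 < t" "d \<le> DIM('a)"
  shows "\<exists>K>0. \<forall>\<psi>\<in>L2_space \<mu>. (\<lambda>\<xi>. of_real (sobolev_weight (- (t + (DIM('a) - d) / 2)) \<xi>) * fourier_integral \<mu> \<psi> \<xi>) \<in> L2_space lborel \<and>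
    L2_norm lborel (\<lambda>\<xi>. of_real (sobolev_weight (- (t + (DIM('a) - d) / 2)) \<xi>) * fourier_integral \<mu> \<psi> \<xi>) \<le> K * L2_norm \<mu> \<psi>"
proof -
  define q where "q = 1 / 4 powr t"
  have q: "0 < q" "q < 1" using t by (auto simp: q_def)
  define B where "B = exp 4 * plain_const * (1 / (1 - q))"
  have pc: "0 \<le> plain_const" using gauss_const_nonneg by (simp add: plain_const_def)
  have B: "0 \<le> B" using pc q by (simp add: B_def)
  let ?W = "\<lambda>\<psi> \<xi>. of_real (sobolev_weight (- (t + (DIM('a) - d) / 2)) \<xi>) * fourier_integral \<mu> \<psi> \<xi>"
  have "?W \<psi> \<in> L2_space lborel \<and> L2_norm lborel (?W \<psi>) \<le> (sqrt B + 1) * L2_norm \<mu> \<psi>" if \<psi>: "\<psi> \<in> L2_space \<mu>" for \<psi>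
  proof -
    have S: "(\<Sum>j<N. (1/4 powr t) ^ j * 1) \<le> 1 / (1 - q)" for N
      unfolding q_def[symmetric] using q by (simp add: sum_gp_strict field_simps)
    have mean: "(\<integral>\<xi>. exp (- ((1/4) ^ j) * (norm \<xi>)\<^sup>2) * (cmod (fourier_integral \<mu> \<psi> \<xi>))\<^sup>2 \<partial>lborel)
      \<le> plain_const * 1 * ((1/4) ^ j) powr ((d - DIM('a)) / 2) * (L2_norm \<mu> \<psi>)\<^sup>2" for j :: nat
      using gaussian_mean_plain(2)[OF \<psi>, of "(1/4) ^ j"] by simp
    note n = negative_norm_from_gaussian_means[OF \<psi> t S _ pc mean]
    have "(L2_norm lborel (?W \<psi>))\<^sup>2 \<le> B * (L2_norm \<mu> \<psi>)\<^sup>2"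
      unfolding B_def by (rule n(2)) simp
    also have "\<dots> = (sqrt B * L2_norm \<mu> \<psi>)\<^sup>2" using B by (simp add: power_mult_distrib)
    finally have "L2_norm lborel (?W \<psi>) \<le> sqrt B * L2_norm \<mu> \<psi>"
      by (rule power2_le_imp_le) (simp add: B)
    then show ?thesis using n(1) by (simp add: distrib_right add_increasing2)
  qed
  then show ?thesis by (intro exI[of _ "sqrt B + 1"]) (simp add: B add_nonneg_pos)
qed

text \<open>Scales \<tau> >= h^2 profit from the cancellation gain h^2 / \<tau> = h^2 4^j, and at
  finer scales the plain bound is used. This yields m j = min 1 (h^2 4^j), which
  \<open>dyadic_min_sum\<close> sums to order h^(2t).\<close>

lemma negative_norm_cancel_le:
  assumes t: "0 < t" "t < 1" "d \<le> DIM('a)"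
  shows "\<exists>K>0. \<forall>\<psi>\<in>L2_space \<mu>. \<forall>h>0. cancels h \<psi> \<longrightarrow>
    L2_norm lborel (\<lambda>\<xi>. of_real (sobolev_weight (- (t + (DIM('a) - d) / 2)) \<xi>) * fourier_integral \<mu> \<psi> \<xi>) \<le> K * h powr t * L2_norm \<mu> \<psi>"
proof -
  define Q where "Q = 1 / (1 - 1/4 powr t) + 1 / (1 - 1/4 powr (1 - t))"
  have Q: "0 \<le> Q"
  proof -
    have "1 < 4 powr t" "1 < 4 powr (1 - t)" using t by auto
    then show ?thesis by (simp add: Q_def)
  qed
  define K where "K = plain_const + cancel_const"
  have pc: "0 \<le> plain_const" "0 \<le> cancel_const"
    using gauss_const_nonneg by (simp_all add: plain_const_def cancel_const_def)
  then have K: "0 \<le> K" by (simp add: K_def)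
  define B where "B = exp 4 * K * Q"
  have B: "0 \<le> B" using K Q by (simp add: B_def)
  let ?W = "\<lambda>\<psi> \<xi>. of_real (sobolev_weight (- (t + (DIM('a) - d) / 2)) \<xi>) * fourier_integral \<mu> \<psi> \<xi>"
  have "L2_norm lborel (?W \<psi>) \<le> (sqrt B + 1) * h powr t * L2_norm \<mu> \<psi>"
    if \<psi>: "\<psi> \<in> L2_space \<mu>" and h: "0 < h" and can: "cancels h \<psi>" for \<psi> h
  proof -
    define m where "m j = min 1 (h\<^sup>2 * 4 ^ j)" for j :: nat
    have m0: "0 \<le> m j" for j by (simp add: m_def)
    have S: "(\<Sum>j<N. (1/4 powr t) ^ j * m j) \<le> Q * h powr (2 * t)" for N
      unfolding m_def Q_def by (rule dyadic_min_sum[OF t(1,2) h])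
    have mean: "(\<integral>\<xi>. exp (- ((1/4) ^ j) * (norm \<xi>)\<^sup>2) * (cmod (fourier_integral \<mu> \<psi> \<xi>))\<^sup>2 \<partial>lborel)
      \<le> K * m j * ((1/4) ^ j) powr ((d - DIM('a)) / 2) * (L2_norm \<mu> \<psi>)\<^sup>2" (is "?I \<le> _") for j :: nat
    proof -
      let ?\<tau> = "(1/4::real) ^ j"
      have \<tau>: "0 < ?\<tau>" by simp
      have ht: "h\<^sup>2 / ?\<tau> = h\<^sup>2 * 4 ^ j" by (simp add: power_divide)
      show ?thesis
      proof (cases "h\<^sup>2 \<le> ?\<tau>")
        case True
        then have "m j = h\<^sup>2 / ?\<tau>" unfolding ht m_def by (simp add: power_divide field_simps)
        then have "?I \<le> cancel_const * m j * ?\<tau> powr ((d - DIM('a)) / 2) * (L2_norm \<mu> \<psi>)\<^sup>2"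
          using gaussian_mean_cancel[OF \<psi> \<tau> can h True] by simp
        also have "\<dots> \<le> K * m j * ?\<tau> powr ((d - DIM('a)) / 2) * (L2_norm \<mu> \<psi>)\<^sup>2"
          using pc m0 by (intro mult_right_mono) (auto simp: K_def)
        finally show ?thesis .
      next
        case False
        then have "m j = 1" unfolding m_def by (simp add: power_divide field_simps)
        then have "?I \<le> plain_const * m j * ?\<tau> powr ((d - DIM('a)) / 2) * (L2_norm \<mu> \<psi>)\<^sup>2"
          using gaussian_mean_plain(2)[OF \<psi> \<tau>] by simp
        also have "\<dots> \<le> K * m j * ?\<tau> powr ((d - DIM('a)) / 2) * (L2_norm \<mu> \<psi>)\<^sup>2"
          using pc m0 by (intro mult_right_mono) (auto simp: K_def)
        finally show ?thesis .
      qed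
    qed
    note n = negative_norm_from_gaussian_means[OF \<psi> t(1,3) S m0 K mean]
    have "(L2_norm lborel (?W \<psi>))\<^sup>2 \<le> exp 4 * K * (Q * h powr (2 * t)) * (L2_norm \<mu> \<psi>)\<^sup>2"
      by (rule n(2))
    also have "\<dots> = (sqrt B * h powr t * L2_norm \<mu> \<psi>)\<^sup>2"
    proof -
      have "h powr (2 * t) = (h powr t)\<^sup>2" by (simp add: power2_eq_square powr_add[symmetric])
      then show ?thesis using B by (simp add: power_mult_distrib B_def mult_ac)
    qed
    finally have "L2_norm lborel (?W \<psi>) \<le> sqrt B * h powr t * L2_norm \<mu> \<psi>"
      by (rule power2_le_imp_le) (simp add: B)
    also have "\<dots> \<le> (sqrt B + 1) * h powr t * L2_norm \<mu> \<psi>"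
      by (intro mult_right_mono) auto
    finally show ?thesis .
  qed
  then show ?thesis by (intro exI[of _ "sqrt B + 1"]) (simp add: B add_nonneg_pos)
qed

end


section \<open>Smooth extensions of step functions\<close>

lemma frechet_derivative_affine_has:
  fixes f :: "'a::euclidean_space \<Rightarrow> complex" and L :: "'a \<Rightarrow> 'a"
  assumes "linear L" "C_k (Suc 0) f"
  shows "((\<lambda>x. f (c + L x)) has_derivative (\<lambda>h. \<Sum>e\<in>Basis. of_real (L h \<bullet> e) * frechet_derivative f (at (c + L x)) e)) (at x)"
proof -
  note D = C_k_SucD(1)[OF assms(2)]
  have TL: "((\<lambda>x. c + L x) has_derivative L) (at x)"
    using has_derivative_add[OF has_derivative_const linear_imp_has_derivative[OF assms(1)], of c] by simp
  have lin: "linear (frechet_derivative f (at (c + L x)))" using D by (rule has_derivative_linear)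
  have "frechet_derivative f (at (c + L x)) (L h) = (\<Sum>e\<in>Basis. of_real (L h \<bullet> e) * frechet_derivative f (at (c + L x)) e)" for h
  proof -
    have "frechet_derivative f (at (c + L x)) (L h) = frechet_derivative f (at (c + L x)) (\<Sum>e\<in>Basis. (L h \<bullet> e) *\<^sub>R e)"
      by (simp add: euclidean_representation)
    then show ?thesis by (simp add: linear_sum[OF lin] linear_scale[OF lin] scaleR_conv_of_real)
  qed
  then show ?thesis using has_derivative_compose[OF TL D] by simp
qed

lemma frechet_derivative_affine:
  fixes f :: "'a::euclidean_space \<Rightarrow> complex" and L :: "'a \<Rightarrow> 'a"
  assumes "linear L" "C_k (Suc 0) f"
  shows "frechet_derivative (\<lambda>x. f (c + L x)) (at x) b = (\<Sum>e\<in>Basis. of_real (L b \<bullet> e) * frechet_derivative f (at (c + L x)) e)"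
  unfolding frechet_derivative_at[OF frechet_derivative_affine_has[OF assms], symmetric] ..

lemma frechet_derivative_weighted_sum:
  fixes g :: "'i \<Rightarrow> 'a::euclidean_space \<Rightarrow> complex"
  assumes "\<And>i. i \<in> I \<Longrightarrow> C_k (Suc 0) (g i)"
  shows "frechet_derivative (\<lambda>x. \<Sum>i\<in>I. k i * g i x) (at x) b = (\<Sum>i\<in>I. k i * frechet_derivative (g i) (at x) b)"
proof -
  have "((\<lambda>x. \<Sum>i\<in>I. k i * g i x) has_derivative (\<lambda>h. \<Sum>i\<in>I. k i * frechet_derivative (g i) (at x) h)) (at x)"
    by (rule has_derivative_sum, rule has_derivative_mult_right, rule C_k_SucD(1), rule assms)
  from frechet_derivative_at[OF this, symmetric] show ?thesis by (rule fun_cong)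
qed

text \<open>The chain rule twice, in coordinates. Each derivative brings one factor of L, so a map
  that expands by 1 / ratio produces a Laplacian of order ratio^(-2).\<close>

lemma laplace_affine:
  fixes f :: "'a::euclidean_space \<Rightarrow> complex" and L :: "'a \<Rightarrow> 'a"
  assumes L: "linear L" and f: "C_k (Suc (Suc 0)) f"
  shows "laplace (\<lambda>x. f (c + L x)) x = (\<Sum>b\<in>Basis. \<Sum>e\<in>Basis. of_real (L b \<bullet> e) *
    (\<Sum>e'\<in>Basis. of_real (L b \<bullet> e') * frechet_derivative (\<lambda>y. frechet_derivative f (at y) e) (at (c + L x)) e'))"
  unfolding laplace_def
proof (rule sum.cong[OF refl])
  fix b :: 'a assume "b \<in> Basis"
  let ?g = "\<lambda>e y. frechet_derivative f (at y) e"
  have g: "C_k (Suc 0) (?g e)" if "e \<in> Basis" for e using C_k_SucD(2)[OF f that] .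
  have "frechet_derivative (\<lambda>y. frechet_derivative (\<lambda>x. f (c + L x)) (at y) b) (at x) b
    = frechet_derivative (\<lambda>y. \<Sum>e\<in>Basis. of_real (L b \<bullet> e) * ?g e (c + L y)) (at x) b"
    unfolding frechet_derivative_affine[OF L C_k_less[OF f]] ..
  also have "\<dots> = (\<Sum>e\<in>Basis. of_real (L b \<bullet> e) * frechet_derivative (\<lambda>y. ?g e (c + L y)) (at x) b)"
    by (rule frechet_derivative_weighted_sum) (rule C_k_affine[OF L g])
  also have "\<dots> = (\<Sum>e\<in>Basis. of_real (L b \<bullet> e) * (\<Sum>e'\<in>Basis. of_real (L b \<bullet> e') * frechet_derivative (?g e) (at (c + L x)) e'))"
    by (rule sum.cong[OF refl]) (simp only: frechet_derivative_affine[OF L g])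
  finally show "frechet_derivative (\<lambda>y. frechet_derivative (\<lambda>x. f (c + L x)) (at y) b) (at x) b = \<dots>" .
qed

lemma laplace_weighted_sum:
  fixes g :: "'i \<Rightarrow> 'a::euclidean_space \<Rightarrow> complex"
  assumes g: "\<And>i. i \<in> I \<Longrightarrow> C_k (Suc (Suc 0)) (g i)"
  shows "laplace (\<lambda>x. \<Sum>i\<in>I. k i * g i x) x = (\<Sum>i\<in>I. k i * laplace (g i) x)"
proof -
  have 1: "frechet_derivative (\<lambda>x. \<Sum>i\<in>I. k i * g i x) (at y) b = (\<Sum>i\<in>I. k i * frechet_derivative (g i) (at y) b)" for y b
    by (rule frechet_derivative_weighted_sum) (rule C_k_less[OF g])
  have 2: "frechet_derivative (\<lambda>y. \<Sum>i\<in>I. k i * frechet_derivative (g i) (at y) b) (at x) b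
    = (\<Sum>i\<in>I. k i * frechet_derivative (\<lambda>y. frechet_derivative (g i) (at y) b) (at x) b)" if "b \<in> Basis" for b
    by (rule frechet_derivative_weighted_sum) (rule C_k_SucD(2)[OF g that])
  have "laplace (\<lambda>x. \<Sum>i\<in>I. k i * g i x) x = (\<Sum>b\<in>Basis. \<Sum>i\<in>I. k i * frechet_derivative (\<lambda>y. frechet_derivative (g i) (at y) b) (at x) b)"
    unfolding laplace_def 1 by (rule sum.cong[OF refl 2])
  also have "\<dots> = (\<Sum>i\<in>I. k i * laplace (g i) x)"
    unfolding laplace_def sum_distrib_left by (rule sum.swap)
  finally show ?thesis .
qed

text \<open>At each point at most one summand survives, so the square of the sum is bounded
  termwise. Carriers S w in place of supports let the same sets serve the bumps and the bumps minus
  their Laplacians.\<close>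

lemma L2_norm_disjoint_sum_le:
  fixes g :: "'i \<Rightarrow> 'a::euclidean_space \<Rightarrow> complex"
  assumes fin: "finite W"
    and bd: "\<And>w x. w \<in> W \<Longrightarrow> cmod (g w x) \<le> B w"
    and S: "\<And>w x. w \<in> W \<Longrightarrow> g w x \<noteq> 0 \<Longrightarrow> x \<in> S w" and ball: "\<And>w. w \<in> W \<Longrightarrow> S w \<subseteq> ball (y w) (r w)"
    and disj: "\<And>v w x. v \<in> W \<Longrightarrow> w \<in> W \<Longrightarrow> x \<in> S v \<Longrightarrow> x \<in> S w \<Longrightarrow> v = w" and r: "\<And>w. w \<in> W \<Longrightarrow> 0 \<le> r w"
  shows "(L2_norm lborel (\<lambda>x. \<Sum>w\<in>W. b w * g w x))\<^sup>2 \<le> (\<Sum>w\<in>W. (cmod (b w))\<^sup>2 * (B w)\<^sup>2 * (unit_ball_vol DIM('a) * r w ^ DIM('a)))"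
proof -
  let ?u = "\<lambda>x. \<Sum>w\<in>W. (cmod (b w))\<^sup>2 * (B w)\<^sup>2 * indicator (ball (y w) (r w)) x :: real"
  have iu: "integrable lborel (\<lambda>x. (cmod (b w))\<^sup>2 * (B w)\<^sup>2 * indicator (ball (y w) (r w)) x :: real)" for w
    by (intro integrable_mult_right integrable_real_indicator) (auto intro!: emeasure_bounded_finite[unfolded infinity_ennreal_def])
  have "(cmod (\<Sum>w\<in>W. b w * g w x))\<^sup>2 \<le> ?u x" for x
  proof (cases "\<exists>v\<in>W. x \<in> S v")
    case True
    then obtain v where v: "v \<in> W" "x \<in> S v" by blast
    have "(\<Sum>w\<in>W. b w * g w x) = b v * g v x + (\<Sum>w\<in>W - {v}. b w * g w x)"
      by (rule sum.remove[OF fin v(1)])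
    also have "(\<Sum>w\<in>W - {v}. b w * g w x) = 0"
      by (rule sum.neutral) (use S disj v in force)
    finally have "(cmod (\<Sum>w\<in>W. b w * g w x))\<^sup>2 = (cmod (b v))\<^sup>2 * (cmod (g v x))\<^sup>2"
      by (simp add: norm_mult power_mult_distrib)
    also have "\<dots> \<le> (cmod (b v))\<^sup>2 * (B v)\<^sup>2 * indicator (ball (y v) (r v)) x"
    proof -
      have "x \<in> ball (y v) (r v)" using ball[OF v(1)] v(2) by (rule subsetD)
      moreover have "(cmod (g v x))\<^sup>2 \<le> (B v)\<^sup>2" by (intro power_mono bd v(1)) simp
      ultimately show ?thesis by (simp add: mult_left_mono)
    qed
    also have "\<dots> \<le> ?u x"
      using v(1) fin by (intro member_le_sum) auto
    finally show ?thesis .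
  next
    case False
    then have "(\<Sum>w\<in>W. b w * g w x) = 0" using S by (intro sum.neutral) force
    then show ?thesis by (simp add: sum_nonneg)
  qed
  then have "(L2_norm lborel (\<lambda>x. \<Sum>w\<in>W. b w * g w x))\<^sup>2 \<le> (\<integral>x. ?u x \<partial>lborel)"
    unfolding L2_norm_power2 using iu by (intro integral_mono_AE') (auto intro!: sum_nonneg)
  also have "\<dots> = (\<Sum>w\<in>W. (cmod (b w))\<^sup>2 * (B w)\<^sup>2 * measure lborel (ball (y w) (r w)))"
    using iu by (subst Bochner_Integration.integral_sum) auto
  also have "\<dots> = (\<Sum>w\<in>W. (cmod (b w))\<^sup>2 * (B w)\<^sup>2 * (unit_ball_vol DIM('a) * r w ^ DIM('a)))"
    by (rule sum.cong[OF refl]) (simp add: measure_def emeasure_ball r unit_ball_vol_nonneg)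
  finally show ?thesis .
qed

context disjoint_ifs
begin

text \<open>A similarity is affine: normalised to fix 0 and to have ratio 1 it is an isometry, hence
  orthogonal. The inverse is given in the form c + L x that the chain rules for \<open>C_k\<close>
  and \<open>laplace\<close> require.\<close>

lemma word_map_inverse:
  assumes w: "valid w"
  shows "\<exists>c L. linear L \<and> (\<forall>x. norm (L x) = norm x / ratio w) \<and> (\<forall>x. c + L (word_map w x) = x) \<and> (\<forall>x. word_map w (c + L x) = x)"
proof -
  let ?f = "word_map w" and ?r = "ratio w"
  have r: "0 < ?r" by (rule ratio_pos[OF w])
  define g where "g x = (1 / ?r) *\<^sub>R (?f x - ?f 0)" for x
  have "orthogonal_transformation g"
    unfolding orthogonal_transformation_isometry
  proof (intro conjI allI)
    show "g 0 = 0" by (simp add: g_def)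
    fix x y
    have "dist (g x) (g y) = norm ((1 / ?r) *\<^sub>R (?f x - ?f y))"
      by (simp add: dist_norm g_def flip: scaleR_diff_right)
    also have "\<dots> = dist (?f x) (?f y) / ?r" using r by (simp add: dist_norm)
    also have "\<dots> = dist x y" using r by (simp add: dist_word_map[OF w])
    finally show "dist (g x) (g y) = dist x y" .
  qed
  then have og: "orthogonal_transformation (inv g)" and bij: "bij g"
    by (auto intro: orthogonal_transformation_inv orthogonal_transformation_bij)
  have lin: "linear (inv g)" using og by (rule orthogonal_transformation_linear)
  have f: "?f x = ?f 0 + ?r *\<^sub>R g x" for x using r by (simp add: g_def)
  define L where "L x = (1 / ?r) *\<^sub>R inv g x" for x
  define c where "c = - L (?f 0)"
  have "linear L" unfolding L_def[abs_def] by (rule linear_compose_scale_right[OF lin])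
  moreover have "norm (L x) = norm x / ?r" for x
    using r orthogonal_transformation_norm[OF og] by (simp add: L_def)
  moreover have "c + L (?f x) = x" for x
  proof -
    have "c + L (?f x) = L (?f x - ?f 0)"
      using \<open>linear L\<close> by (simp add: c_def linear_diff)
    also have "\<dots> = inv g (g x)"
      unfolding L_def using r by (simp add: f[of x] linear_scale[OF lin])
    also have "\<dots> = x" using bij by (simp add: bij_is_inj)
    finally show ?thesis .
  qed
  moreover have "?f (c + L x) = x" for x
  proof -
    have "c + L x = inv g ((1 / ?r) *\<^sub>R (x - ?f 0))"
      by (simp add: c_def L_def linear_scale[OF lin] linear_diff[OF lin] scaleR_diff_right)
    then have "g (c + L x) = (1 / ?r) *\<^sub>R (x - ?f 0)" using bij by (simp add: bij_is_surj surj_f_inv_f)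
    then show ?thesis using r by (simp add: f[of "c + L x"])
  qed
  ultimately show ?thesis by blast
qed

text \<open>One cutoff for \<Gamma>, composed with the inverse of \<open>word_map w\<close>, gives
  the bump of every piece, with constants independent of w; only the Laplacian scales. The width gap
  / 4 keeps the carrier within gap / 2 * ratio w of the piece.\<close>

lemma bumps_exist:
  "\<exists>C1 C2 \<beta> S. 0 \<le> C1 \<and> 0 \<le> C2 \<and> (\<forall>w. valid w \<longrightarrow>
     (\<forall>k. C_k k (\<beta> w)) \<and> (\<forall>x\<in>P w. \<beta> w x = 1) \<and>
     (\<forall>x. \<beta> w x \<noteq> 0 \<or> laplace (\<beta> w) x \<noteq> 0 \<longrightarrow> x \<in> S w) \<and>
     (\<forall>x. cmod (\<beta> w x) \<le> C1) \<and> (\<forall>x. cmod (laplace (\<beta> w) x) \<le> C2 / (ratio w)\<^sup>2) \<and>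
     (\<forall>x\<in>S w. \<exists>y\<in>P w. dist x y < gap / 2 * ratio w))"
proof -
  obtain \<eta> where \<eta>: "\<And>k. C_k k \<eta>" "\<And>x. x \<in> \<Gamma> \<Longrightarrow> \<eta> x = 1" "\<And>x. gap / 4 \<le> infdist x \<Gamma> \<Longrightarrow> \<eta> x = 0"
    using smooth_cutoff[OF attractor(2,1), of "gap / 4"] gap_pos by auto
  define D2 where "D2 e e' y = frechet_derivative (\<lambda>y. frechet_derivative \<eta> (at y) e) (at y) e'" for e e' y
  \<comment> \<open>The cutoff vanishes from distance gap / 4 on, and its derivatives vanish on the
    open set strictly beyond; therefore the carrier S w below uses a non-strict inequality.\<close>
  let ?U = "{x. gap / 4 < infdist x \<Gamma>}"
  have openU: "open ?U"
    by (intro open_Collect_less continuous_intros)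
  have D2_0: "D2 e e' y = 0" if "y \<in> ?U" for e e' y
    unfolding D2_def
  proof (rule frechet_derivative_zero_on_open[OF openU _ that])
    show "frechet_derivative \<eta> (at z) e = 0" if "z \<in> ?U" for z
      by (rule frechet_derivative_zero_on_open[OF openU _ that]) (simp add: \<eta>(3))
  qed
  obtain Q where Q: "\<And>x. x \<in> \<Gamma> \<Longrightarrow> norm x \<le> Q"
    using compact_imp_bounded[OF attractor(2)] by (auto simp: bounded_iff)
  have outside: "x \<in> ?U" if x: "x \<notin> cball 0 (Q + gap)" for x
  proof -
    obtain y where y: "y \<in> \<Gamma>" "infdist x \<Gamma> = dist x y"
      using infdist_attains_inf[OF compact_imp_closed[OF attractor(2)] attractor(1)] by blast
    have "norm x \<le> norm y + dist x y" using norm_triangle_sub[of x y] by (simp add: dist_norm)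
    then have "gap < dist x y" using x Q[OF y(1)] by simp
    then show ?thesis using y(2) gap_pos by simp
  qed
  have "\<exists>B\<ge>0. \<forall>x. cmod (\<eta> x) \<le> B"
    by (rule compact_support_bounded[OF C_k_continuous[OF \<eta>(1)], where R = "Q + gap"]) (use outside \<eta>(3) in force)
  then obtain C1 where C1: "0 \<le> C1" "\<And>x. cmod (\<eta> x) \<le> C1" by blast
  have "\<exists>B\<ge>0. \<forall>x. cmod (D2 e e' x) \<le> B" if "e \<in> Basis" "e' \<in> Basis" for e e'
  proof (rule compact_support_bounded)
    show "continuous_on UNIV (D2 e e')"
      using C_k_SucD(2)[OF C_k_SucD(2)[OF \<eta>(1)[of "Suc (Suc 0)"] that(1)] that(2)] by (simp add: D2_def[abs_def])
    show "D2 e e' x = 0" if "x \<notin> cball 0 (Q + gap)" for x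
      by (rule D2_0[OF outside[OF that]])
  qed
  then have "\<forall>p\<in>Basis \<times> Basis. \<exists>B\<ge>0. \<forall>x. cmod (D2 (fst p) (snd p) x) \<le> B" by auto
  from bchoice[OF this] obtain B where B: "\<forall>p\<in>Basis \<times> Basis. 0 \<le> B p \<and> (\<forall>x. cmod (D2 (fst p) (snd p) x) \<le> B p)" ..
  define C2 where "C2 = (\<Sum>b\<in>(Basis::'a set). \<Sum>e\<in>Basis. \<Sum>e'\<in>Basis. B (e, e'))"
  have C2: "0 \<le> C2" unfolding C2_def using B by (intro sum_nonneg) auto
  have "\<forall>w. \<exists>cL. valid w \<longrightarrow> linear (snd cL) \<and> (\<forall>x. norm (snd cL x) = norm x / ratio w) \<and>
      (\<forall>x. fst cL + snd cL (word_map w x) = x) \<and> (\<forall>x. word_map w (fst cL + snd cL x) = x)"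
    using word_map_inverse by (metis fst_conv snd_conv)
  from choice[OF this] obtain cL where cL: "\<forall>w. valid w \<longrightarrow> linear (snd (cL w)) \<and> (\<forall>x. norm (snd (cL w) x) = norm x / ratio w) \<and>
      (\<forall>x. fst (cL w) + snd (cL w) (word_map w x) = x) \<and> (\<forall>x. word_map w (fst (cL w) + snd (cL w) x) = x)" ..
  define T where "T w x = fst (cL w) + snd (cL w) x" for w x
  define \<beta> where "\<beta> w x = \<eta> (T w x)" for w x
  define S where "S w = {x. infdist (T w x) \<Gamma> \<le> gap / 4}" for w
  have main: "(\<forall>k. C_k k (\<beta> w)) \<and> (\<forall>x\<in>P w. \<beta> w x = 1) \<and>
     (\<forall>x. \<beta> w x \<noteq> 0 \<or> laplace (\<beta> w) x \<noteq> 0 \<longrightarrow> x \<in> S w) \<and>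
     (\<forall>x. cmod (\<beta> w x) \<le> C1) \<and> (\<forall>x. cmod (laplace (\<beta> w) x) \<le> C2 / (ratio w)\<^sup>2) \<and>
     (\<forall>x\<in>S w. \<exists>y\<in>P w. dist x y < gap / 2 * ratio w)" if w: "valid w" for w
  proof -
    let ?c = "fst (cL w)" and ?L = "snd (cL w)" and ?r = "ratio w"
    have L: "linear ?L" "\<And>x. norm (?L x) = norm x / ?r" "\<And>x. T w (word_map w x) = x" "\<And>x. word_map w (T w x) = x"
      using cL w by (auto simp: T_def)
    have r: "0 < ?r" by (rule ratio_pos[OF w])
    have lap: "laplace (\<beta> w) x = (\<Sum>b\<in>Basis. \<Sum>e\<in>Basis. of_real (?L b \<bullet> e) * (\<Sum>e'\<in>Basis. of_real (?L b \<bullet> e') * D2 e e' (T w x)))" for x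
      unfolding \<beta>_def[abs_def] T_def D2_def by (rule laplace_affine[OF L(1) \<eta>(1)])
    have 1: "C_k k (\<beta> w)" for k
      unfolding \<beta>_def[abs_def] T_def by (rule C_k_affine[OF L(1) \<eta>(1)])
    have 2: "\<beta> w x = 1" if "x \<in> P w" for x
      using that by (auto simp: piece_eq \<beta>_def L(3) \<eta>(2))
    have 3: "x \<in> S w" if "\<beta> w x \<noteq> 0 \<or> laplace (\<beta> w) x \<noteq> 0" for x
    proof (rule ccontr)
      assume "x \<notin> S w"
      then have U: "T w x \<in> ?U" by (simp add: S_def)
      then have "\<beta> w x = 0" using \<eta>(3) by (simp add: \<beta>_def)
      moreover have "laplace (\<beta> w) x = 0" unfolding lap D2_0[OF U] by simp
      ultimately show False using that by blast
    qed
    have 4: "cmod (laplace (\<beta> w) x) \<le> C2 / ?r\<^sup>2" for x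
    proof -
      have Lb: "\<bar>?L b \<bullet> e\<bar> \<le> 1 / ?r" if "b \<in> Basis" "e \<in> Basis" for b e
        using Basis_le_norm[OF that(2), of "?L b"] that(1) by (simp add: L(2))
      have "cmod (laplace (\<beta> w) x) \<le> (\<Sum>b\<in>(Basis::'a set). \<Sum>e\<in>Basis. \<Sum>e'\<in>Basis. (1 / ?r * (1 / ?r)) * B (e, e'))"
        unfolding lap
      proof (intro order_trans[OF norm_sum] sum_mono)
        fix b e :: 'a assume b: "b \<in> Basis" and e: "e \<in> Basis"
        have "cmod (of_real (?L b \<bullet> e) * (\<Sum>e'\<in>Basis. of_real (?L b \<bullet> e') * D2 e e' (T w x)))
          \<le> 1 / ?r * (\<Sum>e'\<in>Basis. 1 / ?r * B (e, e'))"
          unfolding norm_mult norm_of_real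
        proof (intro mult_mono order_trans[OF norm_sum] sum_mono Lb[OF b e])
          fix e' :: 'a assume e': "e' \<in> Basis"
          show "cmod (of_real (?L b \<bullet> e') * D2 e e' (T w x)) \<le> 1 / ?r * B (e, e')"
            unfolding norm_mult norm_of_real using Lb[OF b e'] B e e' r by (intro mult_mono) auto
        qed (use r in auto)
        then show "cmod (of_real (?L b \<bullet> e) * (\<Sum>e'\<in>Basis. of_real (?L b \<bullet> e') * D2 e e' (T w x)))
          \<le> (\<Sum>e'\<in>Basis. (1 / ?r * (1 / ?r)) * B (e, e'))"
          by (simp only: sum_distrib_left mult.assoc)
      qed
      also have "\<dots> = C2 / ?r\<^sup>2"
        unfolding sum_distrib_left[symmetric] C2_def by (simp add: power2_eq_square)
      finally show ?thesis .
    qed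
    have 5: "\<exists>y\<in>P w. dist x y < gap / 2 * ?r" if x: "x \<in> S w" for x
    proof -
      obtain y where y: "y \<in> \<Gamma>" "infdist (T w x) \<Gamma> = dist (T w x) y"
        using infdist_attains_inf[OF compact_imp_closed[OF attractor(2)] attractor(1)] by blast
      have "dist x (word_map w y) = ?r * dist (T w x) y"
        using dist_word_map[OF w, of "T w x" y] by (simp add: L(4))
      also have "\<dots> \<le> ?r * (gap / 4)" using x y r by (intro mult_left_mono) (auto simp: S_def)
      also have "\<dots> < gap / 2 * ?r" using gap_pos r by simp
      finally show ?thesis using y(1) by (auto simp: piece_eq)
    qed
    show ?thesis using 1 2 3 4 5 C1(2) by (auto simp: \<beta>_def)
  qed
  show ?thesis
    by (rule exI[of _ C1], rule exI[of _ C2], rule exI[of _ \<beta>], rule exI[of _ S],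
        rule conjI[OF C1(1) conjI[OF C2]], rule allI, rule impI, rule main)
qed

text \<open>Coefficients refer to indicators rather than to the normalised \<open>piece_fun\<close>,
  so that the coefficient is the value on the piece.\<close>

definition step :: "real \<Rightarrow> (nat list \<Rightarrow> complex) \<Rightarrow> 'a \<Rightarrow> complex" where
  "step h b x = (\<Sum>w\<in>mesh h. b w * indicator (P w) x)"

lemma mesh_valid: "w \<in> mesh h \<Longrightarrow> valid w"
  by (simp add: mesh_def)

lemma step_eq:
  assumes "0 < h" "w \<in> mesh h" "x \<in> P w" shows "step h b x = b w"
proof -
  have "step h b x = b w * indicator (P w) x + (\<Sum>v\<in>mesh h - {w}. b v * indicator (P v) x)"
    unfolding step_def by (rule sum.remove[OF mesh_finite[OF assms(1)] assms(2)])
  also have "(\<Sum>v\<in>mesh h - {w}. b v * indicator (P v) x) = 0"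
    by (rule sum.neutral) (use mesh_disjoint[OF _ assms(2) _ assms(3)] in \<open>auto simp: indicator_def\<close>)
  finally show ?thesis using assms(3) by simp
qed

lemma indicator_piece_L2: "valid w \<Longrightarrow> (\<lambda>x. indicator (P w) x) \<in> L2_space \<mu>"
  using piece_sets[of w] by (auto simp: L2_space_def indicator_def if_distrib[of cmod] if_distrib[of "\<lambda>x. x ^ 2"]
    intro!: \<mu>.integrable_const_bound[of _ 1] cong: if_cong)

lemma step_L2: "step h b \<in> L2_space \<mu>"
  unfolding step_def[abs_def]
  by (intro L2_space_sum L2_space_scale indicator_piece_L2 mesh_valid)

lemma step_norm:
  assumes "0 < h"
  shows "(L2_norm \<mu> (step h b))\<^sup>2 = (\<Sum>w\<in>mesh h. (cmod (b w))\<^sup>2 * (ratio w powr dm * H))"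
proof -
  have "(cmod (step h b x))\<^sup>2 = (\<Sum>w\<in>mesh h. (cmod (b w))\<^sup>2 * indicator (P w) x)" if x: "x \<in> \<Gamma>" for x
  proof -
    obtain v where v: "v \<in> mesh h" "x \<in> P v" using mesh_cover[OF assms x] by blast
    have "(\<Sum>w\<in>mesh h. (cmod (b w))\<^sup>2 * indicator (P w) x) = (cmod (b v))\<^sup>2 * indicator (P v) x + (\<Sum>w\<in>mesh h - {v}. (cmod (b w))\<^sup>2 * indicator (P w) x)"
      by (rule sum.remove[OF mesh_finite[OF assms] v(1)])
    also have "(\<Sum>w\<in>mesh h - {v}. (cmod (b w))\<^sup>2 * indicator (P w) x) = 0"
      by (rule sum.neutral) (use mesh_disjoint[OF _ v(1) _ v(2)] in \<open>auto simp: indicator_def\<close>)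
    finally show ?thesis using v step_eq[OF assms v] by simp
  qed
  then have "(L2_norm \<mu> (step h b))\<^sup>2 = (\<integral>x. (\<Sum>w\<in>mesh h. (cmod (b w))\<^sup>2 * indicator (P w) x) \<partial>\<mu>)"
    unfolding L2_norm_power2 by (intro Bochner_Integration.integral_cong) auto
  also have "\<dots> = (\<Sum>w\<in>mesh h. (cmod (b w))\<^sup>2 * measure \<mu> (P w))"
  proof (subst Bochner_Integration.integral_sum)
    show "integrable \<mu> (\<lambda>x. (cmod (b w))\<^sup>2 * indicator (P w) x)" if "w \<in> mesh h" for w
      using piece_sets[OF mesh_valid[OF that]] by (intro integrable_mult_right integrable_real_indicator) (auto simp: less_top[symmetric])
    show "(\<Sum>w\<in>mesh h. \<integral>x. (cmod (b w))\<^sup>2 * indicator (P w) x \<partial>\<mu>) = (\<Sum>w\<in>mesh h. (cmod (b w))\<^sup>2 * measure \<mu> (P w))"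
      using piece_sets[OF mesh_valid] by (intro sum.cong refl) (simp add: Int_absorb2 piece_subset[OF mesh_valid])
  qed
  also have "\<dots> = (\<Sum>w\<in>mesh h. (cmod (b w))\<^sup>2 * (ratio w powr dm * H))"
    by (intro sum.cong refl) (simp add: measure_piece[OF mesh_valid])
  finally show ?thesis .
qed

text \<open>The extension is the sum of b w times the bump of w. Its L2 norm gains h^((n-d)/2) over
  that on \<Gamma>, because a piece of measure of order ratio^d carries a bump of volume of order
  ratio^n; with h^(-s) from \<open>sobolev_compact_support\<close> this leaves h^(-t). The range up
  to 2 * R includes the last scale of the telescoping.\<close>

lemma step_extension:
  assumes s: "0 \<le> t + (DIM('a) - dm) / 2" "t + (DIM('a) - dm) / 2 \<le> 2" and dn: "dm \<le> DIM('a)"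
  shows "\<exists>K>0. \<forall>h b. 0 < h \<and> h \<le> 2 * R \<longrightarrow> (\<exists>\<phi>\<in>test_functions. (\<forall>x\<in>\<Gamma>. \<phi> x = step h b x) \<and>
    sobolev_norm (trace_order dm \<Gamma> t) \<phi> \<le> K * h powr (- t) * L2_norm \<mu> (step h b))"
proof -
  define \<s> where "\<s> = t + (DIM('a) - dm) / 2"
  let ?n = "DIM('a)"
  obtain C1 C2 \<beta> S where C: "0 \<le> C1" "0 \<le> C2" and \<beta>S: "\<forall>w. valid w \<longrightarrow>
     (\<forall>k. C_k k (\<beta> w)) \<and> (\<forall>x\<in>P w. \<beta> w x = 1) \<and>
     (\<forall>x. \<beta> w x \<noteq> 0 \<or> laplace (\<beta> w) x \<noteq> 0 \<longrightarrow> x \<in> S w) \<and>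
     (\<forall>x. cmod (\<beta> w x) \<le> C1) \<and> (\<forall>x. cmod (laplace (\<beta> w) x) \<le> C2 / (ratio w)\<^sup>2) \<and>
     (\<forall>x\<in>S w. \<exists>y\<in>P w. dist x y < gap / 2 * ratio w)"
    using bumps_exist by blast
  have \<beta>: "C_k k (\<beta> w)" "x \<in> P w \<Longrightarrow> \<beta> w x = 1" "\<beta> w x \<noteq> 0 \<Longrightarrow> x \<in> S w" "laplace (\<beta> w) x \<noteq> 0 \<Longrightarrow> x \<in> S w"
    "cmod (\<beta> w x) \<le> C1" "cmod (laplace (\<beta> w) x) \<le> C2 / (ratio w)\<^sup>2" "x \<in> S w \<Longrightarrow> \<exists>y\<in>P w. dist x y < gap / 2 * ratio w"
    if "valid w" for w k x
    using \<beta>S that by blast+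
  define \<kappa> where "\<kappa> = mesh_const / R"
  have \<kappa>: "0 < \<kappa>" using mesh_const_pos R_pos by (simp add: \<kappa>_def)
  \<comment> \<open>A bound for h^2 (C1 + C2 / ratio^2), from h <= 2 * R in the first term and ratio
    >= \<kappa> * h in the second.\<close>
  define C3 where "C3 = 4 * R\<^sup>2 * C1 + C2 / \<kappa>\<^sup>2"
  have C3: "0 \<le> C3" using C by (simp add: C3_def)
  define V where "V = unit_ball_vol ?n * (R + gap) ^ ?n"
  have V: "0 \<le> V" using R_pos gap_pos by (simp add: V_def unit_ball_vol_nonneg)
  define C4 where "C4 = (C1\<^sup>2 + C3\<^sup>2) * V / H / R powr (?n - dm)"
  have C4: "0 \<le> C4" using V H(1) by (simp add: C4_def)
  have main: "\<exists>\<phi>\<in>test_functions. (\<forall>x\<in>\<Gamma>. \<phi> x = step h b x) \<and>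
    sobolev_norm (trace_order dm \<Gamma> t) \<phi> \<le> (sqrt C4 + 1) * h powr (- t) * L2_norm \<mu> (step h b)"
    if h: "0 < h" "h \<le> 2 * R" for h b
  proof -
    let ?W = "mesh h"
    note fin = mesh_finite[OF h(1)]
    have val: "valid w" if "w \<in> ?W" for w using that by (rule mesh_valid)
    have rpos: "0 < ratio w" if "w \<in> ?W" for w by (rule ratio_pos[OF val[OF that]])
    have rup: "ratio w \<le> h / R" if "w \<in> ?W" for w using that R_pos by (simp add: mesh_def field_simps)
    have rlow: "\<kappa> * h \<le> ratio w" if "w \<in> ?W" for w
      using mesh_ratio_ge[OF that h] R_pos by (simp add: \<kappa>_def field_simps)
    define \<phi> where "\<phi> x = (\<Sum>w\<in>?W. b w * \<beta> w x)" for x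
    \<comment> \<open>A common point would bring the pieces closer than gap / 2 * (ratio v + ratio
      w), whereas \<open>mesh_gap\<close> bounds both gap * ratio v and gap * ratio w by their
      distance.\<close>
    have disj: "v = w" if vw: "v \<in> ?W" "w \<in> ?W" "x \<in> S v" "x \<in> S w" for v w x
    proof (rule ccontr)
      assume ne: "v \<noteq> w"
      obtain y z where yz: "y \<in> P v" "dist x y < gap / 2 * ratio v" "z \<in> P w" "dist x z < gap / 2 * ratio w"
        using \<beta>(7)[OF val[OF vw(1)] vw(3)] \<beta>(7)[OF val[OF vw(2)] vw(4)] by blast
      have "gap * ratio v \<le> dist y z" "gap * ratio w \<le> dist y z"
        using mesh_gap[OF vw(1,2) ne yz(1,3)] mesh_gap[OF vw(2,1) ne[symmetric] yz(3,1)] by (auto simp: dist_commute)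
      moreover have "dist y z \<le> dist x y + dist x z" using dist_triangle[of y z x] by (simp add: dist_commute)
      ultimately show False using yz by argo
    qed
    define y0 where "y0 w = (SOME y. y \<in> P w)" for w
    have y0: "y0 w \<in> P w" for w unfolding y0_def using piece_nonempty by (rule some_in_eq[THEN iffD2])
    have ball: "S w \<subseteq> ball (y0 w) ((R + gap) * ratio w)" if w: "w \<in> ?W" for w
    proof
      fix x assume "x \<in> S w"
      then obtain y where y: "y \<in> P w" "dist x y < gap / 2 * ratio w" using \<beta>(7)[OF val[OF w]] by blast
      have "dist (y0 w) y \<le> ratio w * R"
        using diameter_bounded_bound[OF compact_imp_bounded[OF piece_compact[OF val[OF w]]] y0 y(1)]
        by (simp add: diameter_piece[OF val[OF w]])
      then have "dist (y0 w) x < ratio w * R + gap / 2 * ratio w"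
        using dist_triangle[of "y0 w" x y] y(2) by (simp add: dist_commute)
      also have "\<dots> \<le> (R + gap) * ratio w" using gap_pos rpos[OF w] by (simp add: algebra_simps)
      finally show "x \<in> ball (y0 w) ((R + gap) * ratio w)" by simp
    qed
    have \<phi>C: "C_k k \<phi>" for k
      unfolding \<phi>_def[abs_def] by (intro C_k_sum C_k_mult C_k_const \<beta>(1) val)
    have "bounded (\<Union>w\<in>?W. S w)"
      using fin ball by (intro bounded_UN) (auto intro: bounded_subset[OF bounded_ball])
    then obtain Q where Q: "\<And>x w. w \<in> ?W \<Longrightarrow> x \<in> S w \<Longrightarrow> norm x \<le> Q"
      by (auto simp: bounded_iff)
    have \<phi>0: "\<phi> x = 0" if "x \<notin> cball 0 Q" for x
      unfolding \<phi>_def using that Q \<beta>(3)[OF val] by (intro sum.neutral) force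
    have test: "\<phi> \<in> test_functions"
    proof -
      have "{x. \<phi> x \<noteq> 0} \<subseteq> cball 0 Q" using \<phi>0 by blast
      then have "compact (closure {x. \<phi> x \<noteq> 0})"
        using bounded_subset[OF bounded_cball] by (simp add: compact_closure)
      then show ?thesis using \<phi>C by (simp add: test_functions_def)
    qed
    have on\<Gamma>: "\<phi> x = step h b x" if x: "x \<in> \<Gamma>" for x
    proof -
      obtain v where v: "v \<in> ?W" "x \<in> P v" using mesh_cover[OF h(1) x] by blast
      have xS: "x \<in> S v" using \<beta>(2,3)[OF val[OF v(1)]] v(2) by force
      have "\<phi> x = b v * \<beta> v x + (\<Sum>w\<in>?W - {v}. b w * \<beta> w x)"
        unfolding \<phi>_def by (rule sum.remove[OF fin v(1)])
      also have "(\<Sum>w\<in>?W - {v}. b w * \<beta> w x) = 0"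
        by (rule sum.neutral) (use disj[OF _ v(1) _ xS] \<beta>(3)[OF val] in force)
      finally show ?thesis using step_eq[OF h(1) v] \<beta>(2)[OF val[OF v(1)] v(2)] by simp
    qed
    have lapl: "\<phi> x - laplace \<phi> x = (\<Sum>w\<in>?W. b w * (\<beta> w x - laplace (\<beta> w) x))" for x
    proof -
      have "laplace \<phi> x = (\<Sum>w\<in>?W. b w * laplace (\<beta> w) x)"
        unfolding \<phi>_def[abs_def] by (rule laplace_weighted_sum) (rule \<beta>(1)[OF val])
      then show ?thesis by (simp add: \<phi>_def right_diff_distrib sum_subtractf)
    qed
    have vol: "unit_ball_vol ?n * ((R + gap) * ratio w) ^ ?n = V * ratio w ^ ?n" for w
      by (simp add: V_def power_mult_distrib)
    have n1: "(L2_norm lborel \<phi>)\<^sup>2 \<le> (\<Sum>w\<in>?W. (cmod (b w))\<^sup>2 * C1\<^sup>2 * (V * ratio w ^ ?n))"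
      unfolding \<phi>_def[abs_def] vol[symmetric]
      by (rule L2_norm_disjoint_sum_le[OF fin _ _ ball disj])
         (use \<beta>(3,5)[OF val] rpos R_pos gap_pos in \<open>auto intro: less_imp_le\<close>)
    have n2: "(L2_norm lborel (\<lambda>x. \<phi> x - laplace \<phi> x))\<^sup>2 \<le> (\<Sum>w\<in>?W. (cmod (b w))\<^sup>2 * (C1 + C2 / (ratio w)\<^sup>2)\<^sup>2 * (V * ratio w ^ ?n))"
      unfolding lapl vol[symmetric]
    proof (rule L2_norm_disjoint_sum_le[OF fin _ _ ball disj])
      fix w x assume w: "w \<in> ?W"
      show "cmod (\<beta> w x - laplace (\<beta> w) x) \<le> C1 + C2 / (ratio w)\<^sup>2"
        by (rule order_trans[OF norm_triangle_ineq4 add_mono[OF \<beta>(5,6)[OF val[OF w]]]])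
      show "x \<in> S w" if "\<beta> w x - laplace (\<beta> w) x \<noteq> 0"
        using that \<beta>(3,4)[OF val[OF w], of x] by force
      show "0 \<le> (R + gap) * ratio w" using rpos[OF w] R_pos gap_pos by simp
    qed
    have C3_le: "h ^ 4 * (C1 + C2 / (ratio w)\<^sup>2)\<^sup>2 \<le> C3\<^sup>2" if w: "w \<in> ?W" for w
    proof -
      have "h\<^sup>2 * C1 \<le> (2 * R)\<^sup>2 * C1" using h C by (intro mult_right_mono power_mono) auto
      moreover have "h\<^sup>2 * (C2 / (ratio w)\<^sup>2) \<le> C2 / \<kappa>\<^sup>2"
      proof -
        have "C2 / (ratio w)\<^sup>2 \<le> C2 / (\<kappa> * h)\<^sup>2"
          using C rlow[OF w] \<kappa> h rpos[OF w] by (intro divide_left_mono power_mono) auto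
        then have "h\<^sup>2 * (C2 / (ratio w)\<^sup>2) \<le> h\<^sup>2 * (C2 / (\<kappa> * h)\<^sup>2)" by (rule mult_left_mono) simp
        then show ?thesis using h by (simp add: power_mult_distrib)
      qed
      ultimately have "h\<^sup>2 * (C1 + C2 / (ratio w)\<^sup>2) \<le> C3"
        by (simp add: C3_def distrib_left power_mult_distrib)
      then have "(h\<^sup>2 * (C1 + C2 / (ratio w)\<^sup>2))\<^sup>2 \<le> C3\<^sup>2"
        using C by (intro power_mono) auto
      then show ?thesis by (simp add: power_mult_distrib flip: power_mult)
    qed
    \<comment> \<open>In n = d + (n - d) the first power reproduces the measure of the piece and the
      second supplies the gain h^(n-d).\<close>
    have rn: "ratio w ^ ?n \<le> ratio w powr dm * (h powr (?n - dm) / R powr (?n - dm))" if w: "w \<in> ?W" for w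
    proof -
      have "ratio w ^ ?n = ratio w powr dm * ratio w powr (?n - dm)"
        using rpos[OF w] by (simp add: powr_add[symmetric] powr_realpow)
      also have "\<dots> \<le> ratio w powr dm * (h / R) powr (?n - dm)"
        using rpos[OF w] rup[OF w] dn by (intro mult_left_mono powr_mono2) auto
      finally show ?thesis by (simp add: powr_divide)
    qed
    have "(L2_norm lborel \<phi>)\<^sup>2 + h ^ 4 * (L2_norm lborel (\<lambda>x. \<phi> x - laplace \<phi> x))\<^sup>2
      \<le> (\<Sum>w\<in>?W. (cmod (b w))\<^sup>2 * C1\<^sup>2 * (V * ratio w ^ ?n)) + h ^ 4 * (\<Sum>w\<in>?W. (cmod (b w))\<^sup>2 * (C1 + C2 / (ratio w)\<^sup>2)\<^sup>2 * (V * ratio w ^ ?n))"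
      by (rule add_mono[OF n1 mult_left_mono[OF n2]]) (use h in simp)
    also have "\<dots> = (\<Sum>w\<in>?W. ((cmod (b w))\<^sup>2 * (V * ratio w ^ ?n)) * (C1\<^sup>2 + h ^ 4 * (C1 + C2 / (ratio w)\<^sup>2)\<^sup>2))"
      unfolding sum_distrib_left sum.distrib[symmetric] by (intro sum.cong refl) (simp only: distrib_left mult_ac)
    also have "\<dots> \<le> (\<Sum>w\<in>?W. (cmod (b w))\<^sup>2 * (V * (ratio w powr dm * (h powr (?n - dm) / R powr (?n - dm)))) * (C1\<^sup>2 + C3\<^sup>2))"
    proof (rule sum_mono)
      fix w assume w: "w \<in> ?W"
      show "((cmod (b w))\<^sup>2 * (V * ratio w ^ ?n)) * (C1\<^sup>2 + h ^ 4 * (C1 + C2 / (ratio w)\<^sup>2)\<^sup>2)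
        \<le> (cmod (b w))\<^sup>2 * (V * (ratio w powr dm * (h powr (?n - dm) / R powr (?n - dm)))) * (C1\<^sup>2 + C3\<^sup>2)"
        using V rn[OF w] C3_le[OF w] h by (intro mult_mono mult_left_mono add_left_mono) auto
    qed
    also have "\<dots> = (\<Sum>w\<in>?W. (C4 * h powr (?n - dm)) * ((cmod (b w))\<^sup>2 * (ratio w powr dm * H)))"
    proof (rule sum.cong[OF refl])
      have ring: "X * (V * (q * (y / z))) * K = (K * V / H / z * y) * (X * (q * H))" for X q y z K :: real
        using H(1) by (cases "z = 0") (simp_all add: field_simps)
      show "(cmod (b w))\<^sup>2 * (V * (ratio w powr dm * (h powr (?n - dm) / R powr (?n - dm)))) * (C1\<^sup>2 + C3\<^sup>2)
        = (C4 * h powr (?n - dm)) * ((cmod (b w))\<^sup>2 * (ratio w powr dm * H))" for w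
        unfolding C4_def by (rule ring)
    qed
    also have "\<dots> = C4 * h powr (?n - dm) * (L2_norm \<mu> (step h b))\<^sup>2"
      unfolding step_norm[OF h(1)] sum_distrib_left ..
    finally have tot: "(L2_norm lborel \<phi>)\<^sup>2 + h ^ 4 * (L2_norm lborel (\<lambda>x. \<phi> x - laplace \<phi> x))\<^sup>2
      \<le> C4 * h powr (?n - dm) * (L2_norm \<mu> (step h b))\<^sup>2" .
    have "(sobolev_norm \<s> \<phi>)\<^sup>2 \<le> h powr (- 2 * \<s>) * ((L2_norm lborel \<phi>)\<^sup>2 + h ^ 4 * (L2_norm lborel (\<lambda>x. \<phi> x - laplace \<phi> x))\<^sup>2)"
      by (rule sobolev_compact_support(2)[OF \<phi>C]) (use \<phi>0 s h in \<open>auto simp: \<s>_def\<close>)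
    also have "\<dots> \<le> h powr (- 2 * \<s>) * (C4 * h powr (?n - dm) * (L2_norm \<mu> (step h b))\<^sup>2)"
      by (rule mult_left_mono[OF tot]) simp
    also have "\<dots> = C4 * (h powr (- 2 * \<s>) * h powr (?n - dm)) * (L2_norm \<mu> (step h b))\<^sup>2"
      by (simp only: mult_ac)
    also have "h powr (- 2 * \<s>) * h powr (?n - dm) = (h powr (- t))\<^sup>2"
    proof -
      have "- 2 * \<s> + (?n - dm) = - t + - t" by (simp add: \<s>_def field_simps)
      then show ?thesis unfolding power2_eq_square powr_add[symmetric] by simp
    qed
    also have "C4 * (h powr (- t))\<^sup>2 * (L2_norm \<mu> (step h b))\<^sup>2 = (sqrt C4 * h powr (- t) * L2_norm \<mu> (step h b))\<^sup>2"
      using C4 by (simp add: power_mult_distrib)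
    finally have "sobolev_norm \<s> \<phi> \<le> sqrt C4 * h powr (- t) * L2_norm \<mu> (step h b)"
      by (rule power2_le_imp_le) (simp add: C4)
    also have "\<dots> \<le> (sqrt C4 + 1) * h powr (- t) * L2_norm \<mu> (step h b)"
      by (intro mult_right_mono) auto
    finally have "sobolev_norm (trace_order dm \<Gamma> t) \<phi> \<le> (sqrt C4 + 1) * h powr (- t) * L2_norm \<mu> (step h b)"
      by (simp add: trace_order_def \<s>_def)
    then show ?thesis using test on\<Gamma> by blast
  qed
  show ?thesis
    using main C4 by (intro exI[of _ "sqrt C4 + 1"]) (simp add: add_nonneg_pos)
qed

end


section \<open>Traces and the Jackson estimate\<close>

lemma test_function_support:
  fixes \<phi> :: "'a::euclidean_space \<Rightarrow> complex"
  assumes "\<phi> \<in> test_functions" shows "\<exists>Q. \<forall>x. x \<notin> cball 0 Q \<longrightarrow> \<phi> x = 0"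
proof -
  have "bounded (closure {x. \<phi> x \<noteq> 0})"
    using assms by (intro compact_imp_bounded) (simp add: test_functions_def)
  then obtain Q where "\<forall>x\<in>closure {x. \<phi> x \<noteq> 0}. norm x \<le> Q" by (auto simp: bounded_iff)
  moreover have "{x. \<phi> x \<noteq> 0} \<subseteq> closure {x. \<phi> x \<noteq> 0}" by (rule closure_subset)
  ultimately show ?thesis by (intro exI[of _ Q]) auto
qed

lemma test_function_props:
  fixes \<phi> :: "'a::euclidean_space \<Rightarrow> complex"
  assumes \<phi>: "\<phi> \<in> test_functions"
  shows "continuous_on UNIV \<phi>" "uniformly_continuous_on UNIV \<phi>" "\<exists>B\<ge>0. \<forall>x. cmod (\<phi> x) \<le> B"
    "integrable lborel \<phi>" "\<phi> \<in> L2_space lborel" "0 \<le> s \<Longrightarrow> s \<le> 2 \<Longrightarrow> \<phi> \<in> sobolev_space s"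
proof -
  obtain Q where Q: "\<And>x. x \<notin> cball 0 Q \<Longrightarrow> \<phi> x = 0" using test_function_support[OF \<phi>] by blast
  have C: "C_k k \<phi>" for k using \<phi> by (simp add: test_functions_def)
  show c: "continuous_on UNIV \<phi>" by (rule C_k_continuous[OF C])
  show "uniformly_continuous_on UNIV \<phi>" by (rule compact_support_uniformly_continuous[OF c Q])
  show "\<exists>B\<ge>0. \<forall>x. cmod (\<phi> x) \<le> B" by (rule compact_support_bounded[OF c Q])
  show "integrable lborel \<phi>" by (rule compact_support_integrable(1)[OF c Q])
  show "\<phi> \<in> L2_space lborel" by (rule compact_support_integrable(2)[OF c Q])
  show "\<phi> \<in> sobolev_space s" if "0 \<le> s" "s \<le> 2"
    by (rule sobolev_compact_support(1)[OF C Q that zero_less_one])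
qed

lemma test_functions_combine:
  assumes "\<phi> \<in> test_functions" "\<psi> \<in> test_functions" shows "(\<lambda>x. c * \<phi> x + \<psi> x) \<in> test_functions"
proof -
  obtain Q1 Q2 where Q: "\<And>x. x \<notin> cball 0 Q1 \<Longrightarrow> \<phi> x = 0" "\<And>x. x \<notin> cball 0 Q2 \<Longrightarrow> \<psi> x = 0"
    using test_function_support[OF assms(1)] test_function_support[OF assms(2)] by blast
  have "{x. c * \<phi> x + \<psi> x \<noteq> 0} \<subseteq> cball 0 (max Q1 Q2)"
  proof
    fix x assume "x \<in> {x. c * \<phi> x + \<psi> x \<noteq> 0}"
    then have "\<phi> x \<noteq> 0 \<or> \<psi> x \<noteq> 0" by auto
    then have "x \<in> cball 0 Q1 \<or> x \<in> cball 0 Q2" using Q(1)[of x] Q(2)[of x] by blast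
    then show "x \<in> cball 0 (max Q1 Q2)" by auto
  qed
  then have "compact (closure {x. c * \<phi> x + \<psi> x \<noteq> 0})"
    using bounded_subset[OF bounded_cball] by (simp add: compact_closure)
  moreover have "C_k k (\<lambda>x. c * \<phi> x + \<psi> x)" for k
    using assms by (intro C_k_add C_k_mult C_k_const) (auto simp: test_functions_def)
  ultimately show ?thesis by (simp add: test_functions_def)
qed

lemma test_functions_zero: "(\<lambda>x. 0) \<in> test_functions"
  by (simp add: test_functions_def)

lemma sobolev_norm_combine:
  assumes "\<phi> \<in> test_functions" "\<psi> \<in> test_functions" "0 \<le> s" "s \<le> 2"
  shows "sobolev_norm s (\<lambda>x. c * \<phi> x + \<psi> x) \<le> cmod c * sobolev_norm s \<phi> + sobolev_norm s \<psi>"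
proof -
  note p = test_function_props[OF assms(1)] and q = test_function_props[OF assms(2)]
  let ?W = "\<lambda>f \<xi>. of_real (sobolev_weight s \<xi>) * fourier_L1 f \<xi>"
  have L: "?W \<phi> \<in> L2_space lborel" "?W \<psi> \<in> L2_space lborel"
    by (rule sobolev_norm_L1(1)[OF p(4,5), THEN iffD1, OF p(6)[OF assms(3,4)]],
        rule sobolev_norm_L1(1)[OF q(4,5), THEN iffD1, OF q(6)[OF assms(3,4)]])
  have "?W (\<lambda>x. c * \<phi> x + \<psi> x) = (\<lambda>\<xi>. c * ?W \<phi> \<xi> + ?W \<psi> \<xi>)"
    by (rule ext) (simp only: fourier_L1_add[OF integrable_mult_right[OF p(4)] q(4)] fourier_L1_scale distrib_left mult.left_commute)
  then have "sobolev_norm s (\<lambda>x. c * \<phi> x + \<psi> x) = L2_norm lborel (\<lambda>\<xi>. c * ?W \<phi> \<xi> + ?W \<psi> \<xi>)"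
    using sobolev_norm_L1(2)[of "\<lambda>x. c * \<phi> x + \<psi> x" s] p(4,5) q(4,5) by simp
  also have "\<dots> \<le> L2_norm lborel (\<lambda>\<xi>. c * ?W \<phi> \<xi>) + L2_norm lborel (?W \<psi>)"
    by (rule L2_triangle[OF L2_space_scale[OF L(1)] L(2)])
  also have "\<dots> = cmod c * sobolev_norm s \<phi> + sobolev_norm s \<psi>"
    using sobolev_norm_L1(2)[OF p(4,5)] sobolev_norm_L1(2)[OF q(4,5)] by (simp only: L2_norm_scale)
  finally show ?thesis .
qed

lemma sobolev_norm_zero: "sobolev_norm s (\<lambda>x. 0) = 0"
  by (subst sobolev_norm_L1(2)) (simp_all add: fourier_L1_def L2_norm_def)

locale thin_ifs = disjoint_ifs +
  assumes dim_gt: "real DIM('a) - 1 < dm" and dim_lt: "dm < real DIM('a)"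
begin

abbreviation "sord \<equiv> trace_order dm \<Gamma>"

lemma sord_bounds: "0 < t \<Longrightarrow> t < 1 \<Longrightarrow> 0 \<le> sord t \<and> sord t \<le> 2"
  using dim_gt dim_lt by (simp add: trace_order_def field_simps)

definition "ahlfors_const = (SOME C. 0 < C \<and> (\<forall>x r. 0 < r \<longrightarrow> measure \<mu> (\<Gamma> \<inter> ball x r) \<le> C * r powr dm))"

lemma ahlfors_const: "0 < ahlfors_const" "0 < r \<Longrightarrow> measure \<mu> (\<Gamma> \<inter> ball x r) \<le> ahlfors_const * r powr dm"
  using someI_ex[OF ahlfors_upper] unfolding ahlfors_const_def[symmetric] by blast+

sublocale E: ahlfors_measure \<mu> dm ahlfors_const
  by unfold_locales (use id_\<mu> dm(2) ahlfors_const in auto)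

lemma mu_eq: "hausdorff_on dm \<Gamma> = \<mu>"
  by (simp add: \<mu>_def)

lemma test_L2: assumes "\<phi> \<in> test_functions" shows "\<phi> \<in> L2_space \<mu>"
proof -
  obtain B where B: "\<And>x. cmod (\<phi> x) \<le> B" "0 \<le> B" using test_function_props(3)[OF assms] by blast
  have m: "\<phi> \<in> borel_measurable \<mu>"
    using measurable_compose[OF id_\<mu> borel_measurable_continuous_onI[OF test_function_props(1)[OF assms]]] .
  show ?thesis
    by (rule L2_spaceI_bound[OF m \<mu>.integrable_const[of "B\<^sup>2"]]) (intro AE_I2 power_mono B, simp)
qed

lemma L2_eqI:
  assumes "f \<in> L2_space \<mu>" "\<And>x. x \<in> \<Gamma> \<Longrightarrow> g x = f x"
  shows "g \<in> L2_space \<mu>" "L2_norm \<mu> g = L2_norm \<mu> f"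
proof -
  have "g \<in> borel_measurable \<mu> \<longleftrightarrow> f \<in> borel_measurable \<mu>"
    by (rule measurable_cong) (simp add: assms(2))
  moreover have "integrable \<mu> (\<lambda>x. (cmod (g x))\<^sup>2) \<longleftrightarrow> integrable \<mu> (\<lambda>x. (cmod (f x))\<^sup>2)"
    by (rule Bochner_Integration.integrable_cong) (simp_all add: assms(2))
  ultimately show "g \<in> L2_space \<mu>" using assms(1) by (simp add: L2_space_def)
  show "L2_norm \<mu> g = L2_norm \<mu> f"
    unfolding L2_norm_def by (intro arg_cong[of _ _ sqrt] Bochner_Integration.integral_cong) (simp_all add: assms(2))
qed

lemma has_trace_test:
  assumes t: "0 < t" "t < 1" and \<phi>: "\<phi> \<in> test_functions" and f: "f \<in> L2_space \<mu>" "\<And>x. x \<in> \<Gamma> \<Longrightarrow> \<phi> x = f x"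
  shows "has_trace (sord t) dm \<Gamma> \<phi> f"
  unfolding has_trace_def mu_eq L2_tendsto_def
proof (intro conjI exI[of _ "\<lambda>_::nat. \<phi>"] allI)
  show "\<phi> \<in> sobolev_space (sord t)" using test_function_props(6)[OF \<phi>] sord_bounds[OF t] by blast
  have "L2_norm \<mu> (\<lambda>x. \<phi> x - f x) = L2_norm \<mu> (\<lambda>x. 0)" by (rule L2_eqI) (simp_all add: f)
  then show "(\<lambda>k. L2_norm \<mu> (\<lambda>x. \<phi> x - f x)) \<longlonglongrightarrow> 0" by (simp add: L2_norm_def)
qed (use \<phi> f test_L2 in \<open>simp_all add: sobolev_norm_zero\<close>)

lemma trace_norm_le: "has_trace (sord t) dm \<Gamma> \<phi> f \<Longrightarrow> trace_norm dm \<Gamma> t f \<le> sobolev_norm (sord t) \<phi>"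
  unfolding trace_norm_def by (rule cInf_lower) (auto intro: bdd_belowI[of _ 0])

lemma trace_norm_ge:
  assumes "f \<in> trace_space dm \<Gamma> t" "\<And>\<phi>. has_trace (sord t) dm \<Gamma> \<phi> f \<Longrightarrow> c \<le> sobolev_norm (sord t) \<phi>"
  shows "c \<le> trace_norm dm \<Gamma> t f"
  unfolding trace_norm_def by (rule cInf_greatest) (use assms in \<open>auto simp: trace_space_def\<close>)

lemma trace_space_L2: "f \<in> trace_space dm \<Gamma> t \<Longrightarrow> f \<in> L2_space \<mu>"
  by (auto simp: trace_space_def has_trace_def mu_eq L2_tendsto_def)

text \<open>Estimates are proved for test functions first; a quantity N that is Lipschitz in the L2
  norm passes to the limit in the definition of the trace. It is used with the L2 norm and with the
  norm of the projection residual.\<close>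

lemma trace_limit:
  assumes t: "0 < t" "t < 1" and tr: "has_trace (sord t) dm \<Gamma> \<phi> f" and "0 \<le> K"
    and N: "\<And>f g. f \<in> L2_space \<mu> \<Longrightarrow> g \<in> L2_space \<mu> \<Longrightarrow> N f \<le> N g + L2_norm \<mu> (\<lambda>x. f x - g x)"
    and test: "\<And>u. u \<in> test_functions \<Longrightarrow> N u \<le> K * sobolev_norm (sord t) u"
  shows "N f \<le> K * sobolev_norm (sord t) \<phi>"
proof -
  obtain u where u: "\<And>k. u k \<in> test_functions" "(\<lambda>k. sobolev_norm (sord t) (\<lambda>x. u k x - \<phi> x)) \<longlonglongrightarrow> 0"
      "L2_tendsto \<mu> u f" and \<phi>: "\<phi> \<in> sobolev_space (sord t)"
    using tr unfolding has_trace_def mu_eq by blast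
  have L: "\<And>k. u k \<in> L2_space \<mu>" "f \<in> L2_space \<mu>" "(\<lambda>k. L2_norm \<mu> (\<lambda>x. u k x - f x)) \<longlonglongrightarrow> 0"
    using u(3) by (auto simp: L2_tendsto_def)
  have "N f \<le> K * (sobolev_norm (sord t) \<phi> + sobolev_norm (sord t) (\<lambda>x. u k x - \<phi> x)) + L2_norm \<mu> (\<lambda>x. u k x - f x)" for k
  proof -
    have "u k \<in> sobolev_space (sord t)" using test_function_props(6)[OF u(1)] sord_bounds[OF t] by blast
    then have "sobolev_norm (sord t) (u k) \<le> sobolev_norm (sord t) \<phi> + sobolev_norm (sord t) (\<lambda>x. u k x - \<phi> x)"
      by (rule sobolev_diff) (rule \<phi>)
    then have "K * sobolev_norm (sord t) (u k) \<le> K * (sobolev_norm (sord t) \<phi> + sobolev_norm (sord t) (\<lambda>x. u k x - \<phi> x))"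
      using \<open>0 \<le> K\<close> by (rule mult_left_mono)
    then show ?thesis
      using N[OF L(2) L(1)[of k]] test[OF u(1)[of k]] L2_norm_minus_commute[of \<mu> f "u k"] by linarith
  qed
  moreover have "(\<lambda>k. K * (sobolev_norm (sord t) \<phi> + sobolev_norm (sord t) (\<lambda>x. u k x - \<phi> x)) + L2_norm \<mu> (\<lambda>x. u k x - f x))
      \<longlonglongrightarrow> K * (sobolev_norm (sord t) \<phi> + 0) + 0"
    by (intro tendsto_intros u(2) L(3))
  ultimately show ?thesis by (intro LIMSEQ_le_const[where a = "N f"]) auto
qed

text \<open>Up to a power of 2 pi, the Sobolev norm of order - \<open>sord t\<close> of the measure
  \<psi> d\<mu>.\<close>

definition "neg_norm t \<psi> = L2_norm lborel (\<lambda>\<xi>. of_real (sobolev_weight (- sord t) \<xi>) * fourier_integral \<mu> \<psi> \<xi>)"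

lemma pairing_le:
  assumes t: "0 < t" "t < 1" and \<phi>: "\<phi> \<in> test_functions" and \<psi>: "\<psi> \<in> L2_space \<mu>"
  shows "cmod (L2_inner \<mu> \<phi> \<psi>) \<le> (2 * pi) powr (- real DIM('a) / 2) * (sobolev_norm (sord t) \<phi> * neg_norm t \<psi>)"
proof -
  obtain B where B: "\<And>x. cmod (\<phi> x) \<le> B" using test_function_props(3)[OF \<phi>] by blast
  have s: "\<phi> \<in> sobolev_space (sord t)" using test_function_props(6)[OF \<phi>] sord_bounds[OF t] by blast
  have neg: "(\<lambda>\<xi>. of_real (sobolev_weight (- sord t) \<xi>) * fourier_integral \<mu> \<psi> \<xi>) \<in> L2_space lborel"
    using E.negative_norm_le[OF t(1) less_imp_le[OF dim_lt]] \<psi> unfolding trace_order_def by blast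
  show ?thesis
    unfolding L2_inner_def neg_norm_def
    by (rule sobolev_pairing[OF finite_measure_\<mu> id_\<mu> test_function_props(2)[OF \<phi>] B
        test_function_props(4,5)[OF \<phi>] s E.L2_integrable[OF \<psi>] neg])
qed

lemma L2_inner_self: "L2_inner \<mu> v v = of_real ((L2_norm \<mu> v)\<^sup>2)"
  unfolding L2_inner_def L2_norm_power2 complex_norm_square[symmetric] of_real_power[symmetric]
  by (rule integral_complex_of_real)

text \<open>Duality with u paired against itself: (u, u) is at most the Sobolev norm of u times the
  negative norm of u d\<mu>, and the latter is at most a constant times the L2 norm of u, which is
  then divided out.\<close>

lemma trace_inequality:
  assumes t: "0 < t" "t < 1"
  shows "\<exists>K>0. \<forall>f\<in>trace_space dm \<Gamma> t. L2_norm \<mu> f \<le> K * trace_norm dm \<Gamma> t f"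
proof -
  obtain K where K: "0 < K" "\<And>\<psi>. \<psi> \<in> L2_space \<mu> \<Longrightarrow> neg_norm t \<psi> \<le> K * L2_norm \<mu> \<psi>"
    using E.negative_norm_le[OF t(1) less_imp_le[OF dim_lt]] unfolding neg_norm_def trace_order_def by blast
  define c where "c = (2 * pi) powr (- real DIM('a) / 2)"
  have c: "0 < c" by (simp add: c_def)
  have test: "L2_norm \<mu> u \<le> c * K * sobolev_norm (sord t) u" if u: "u \<in> test_functions" for u
  proof (cases "L2_norm \<mu> u = 0")
    case False
    note L = test_L2[OF u]
    have "(L2_norm \<mu> u)\<^sup>2 = cmod (L2_inner \<mu> u u)" unfolding L2_inner_self norm_of_real by simp
    also have "\<dots> \<le> c * (sobolev_norm (sord t) u * neg_norm t u)"
      unfolding c_def by (rule pairing_le[OF t u L])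
    also have "\<dots> \<le> c * (sobolev_norm (sord t) u * (K * L2_norm \<mu> u))"
      using c by (intro mult_left_mono K(2) L) auto
    finally have "L2_norm \<mu> u * L2_norm \<mu> u \<le> L2_norm \<mu> u * (c * K * sobolev_norm (sord t) u)"
      by (simp add: power2_eq_square mult_ac)
    then show ?thesis using False L2_norm_nonneg[of \<mu> u] by (simp add: mult_le_cancel_left)
  qed (use c K(1) in simp)
  have "L2_norm \<mu> f \<le> c * K * trace_norm dm \<Gamma> t f" if f: "f \<in> trace_space dm \<Gamma> t" for f
  proof -
    have "L2_norm \<mu> f / (c * K) \<le> trace_norm dm \<Gamma> t f"
    proof (rule trace_norm_ge[OF f])
      fix \<phi> assume "has_trace (sord t) dm \<Gamma> \<phi> f"
      then have "L2_norm \<mu> f \<le> c * K * sobolev_norm (sord t) \<phi>"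
      proof (rule trace_limit[OF t _ _ _ test])
        show "L2_norm \<mu> f \<le> L2_norm \<mu> g + L2_norm \<mu> (\<lambda>x. f x - g x)" if "f \<in> L2_space \<mu>" "g \<in> L2_space \<mu>" for f g
          using L2_triangle[OF that(2) L2_space_diff[OF that]] by simp
      qed (use c K in auto)
      then show "L2_norm \<mu> f / (c * K) \<le> sobolev_norm (sord t) \<phi>"
        using c K by (simp add: field_simps)
    qed
    then show ?thesis using c K by (simp add: field_simps)
  qed
  then show ?thesis using c K by (intro exI[of _ "c * K"]) simp
qed

section \<open>The L2 projection onto step functions\<close>

definition avg :: "('a \<Rightarrow> complex) \<Rightarrow> nat list \<Rightarrow> complex" where
  "avg f w = (\<integral>x. indicator (P w) x * f x \<partial>\<mu>) / of_real (measure \<mu> (P w))"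

definition proj :: "real \<Rightarrow> ('a \<Rightarrow> complex) \<Rightarrow> 'a \<Rightarrow> complex" where
  "proj h f = step h (avg f)"

lemma cnj_indicator [simp]: "cnj (indicator A x) = indicator A x"
  by (cases "x \<in> A") simp_all

lemma indicator_mult_integrable:
  assumes "valid w" "f \<in> L2_space \<mu>" shows "integrable \<mu> (\<lambda>x. indicator (P w) x * f x)"
proof -
  have "integrable \<mu> (\<lambda>x. f x * cnj (indicator (P w) x))"
    by (rule L2_integrable_mult[OF assms(2) indicator_piece_L2[OF assms(1)]])
  then show ?thesis by (simp add: mult.commute)
qed

lemma proj_L2: "proj h f \<in> L2_space \<mu>"
  unfolding proj_def by (rule step_L2)

lemma proj_diff:
  assumes "f \<in> L2_space \<mu>" "g \<in> L2_space \<mu>"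
  shows "proj h (\<lambda>x. f x - g x) x = proj h f x - proj h g x"
proof -
  have "avg (\<lambda>x. f x - g x) w = avg f w - avg g w" if "w \<in> mesh h" for w
    using indicator_mult_integrable[OF mesh_valid[OF that] assms(1)] indicator_mult_integrable[OF mesh_valid[OF that] assms(2)]
    by (simp add: avg_def right_diff_distrib diff_divide_distrib)
  then show ?thesis
    by (simp add: proj_def step_def left_diff_distrib sum_subtractf[symmetric])
qed

lemma proj_orthogonal:
  assumes "0 < h" "w \<in> mesh h" "f \<in> L2_space \<mu>"
  shows "(\<integral>x. indicator (P w) x * (f x - proj h f x) \<partial>\<mu>) = 0"
proof -
  note val = mesh_valid[OF assms(2)]
  have m: "0 < measure \<mu> (P w)" using ratio_pos[OF val] H(1) by (simp add: measure_piece[OF val])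
  have eq: "indicator (P w) x * proj h f x = avg f w * indicator (P w) x" for x
    using step_eq[OF assms(1,2)] by (simp add: proj_def indicator_def)
  have ind: "integrable \<mu> (\<lambda>x. complex_of_real (indicator (P w) x))" "(\<integral>x. complex_of_real (indicator (P w) x) \<partial>\<mu>) = of_real (measure \<mu> (P w))"
    using piece_sets[OF val] by (simp_all add: Int_absorb2 piece_subset[OF val] less_top[symmetric])
  have ind': "complex_of_real (indicator (P w) x) = indicator (P w) x" for x by (simp add: indicator_def)
  have "(\<integral>x. indicator (P w) x * (f x - proj h f x) \<partial>\<mu>) = (\<integral>x. indicator (P w) x * f x - avg f w * indicator (P w) x \<partial>\<mu>)"
    by (simp only: right_diff_distrib eq)
  also have "\<dots> = (\<integral>x. indicator (P w) x * f x \<partial>\<mu>) - (\<integral>x. avg f w * indicator (P w) x \<partial>\<mu>)"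
    using indicator_mult_integrable[OF val assms(3)] ind(1) unfolding ind' by (intro Bochner_Integration.integral_diff integrable_mult_right)
  also have "(\<integral>x. avg f w * indicator (P w) x \<partial>\<mu>) = avg f w * of_real (measure \<mu> (P w))"
    unfolding integral_mult_right_zero ind(2)[unfolded ind'] ..
  finally show ?thesis using m by (simp add: avg_def)
qed

text \<open>Stated without conjugation, to match the bilinear form in \<open>cancels\<close>; the
  version for the inner product follows because the conjugate of a step function is a step
  function.\<close>

lemma step_mult_orthogonal:
  assumes "0 < h" "f \<in> L2_space \<mu>"
  shows "(\<integral>x. (f x - proj h f x) * step h b x \<partial>\<mu>) = 0"
proof -
  note L = L2_space_diff[OF assms(2) proj_L2[of h f]]
  have "(\<integral>x. (f x - proj h f x) * step h b x \<partial>\<mu>) = (\<integral>x. (\<Sum>w\<in>mesh h. b w * (indicator (P w) x * (f x - proj h f x))) \<partial>\<mu>)"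
    by (rule Bochner_Integration.integral_cong[OF refl]) (simp add: step_def sum_distrib_left sum_distrib_right mult_ac)
  also have "\<dots> = (\<Sum>w\<in>mesh h. \<integral>x. b w * (indicator (P w) x * (f x - proj h f x)) \<partial>\<mu>)"
    by (rule Bochner_Integration.integral_sum) (intro integrable_mult_right indicator_mult_integrable mesh_valid L)
  also have "\<dots> = (\<Sum>w\<in>mesh h. 0)"
    by (rule sum.cong[OF refl]) (simp only: integral_mult_right_zero proj_orthogonal[OF assms(1) _ assms(2)] mult_zero_right)
  finally show ?thesis by simp
qed

lemma cnj_step: "cnj (step h b x) = step h (\<lambda>w. cnj (b w)) x"
  by (simp add: step_def)

lemma step_inner_orthogonal:
  assumes "0 < h" "f \<in> L2_space \<mu>"
  shows "L2_inner \<mu> (step h b) (\<lambda>x. f x - proj h f x) = 0"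
proof -
  have "L2_inner \<mu> (step h b) (\<lambda>x. f x - proj h f x) = (\<integral>x. cnj ((f x - proj h f x) * step h (\<lambda>w. cnj (b w)) x) \<partial>\<mu>)"
    unfolding L2_inner_def complex_cnj_mult cnj_step by (simp add: mult.commute)
  also have "\<dots> = 0"
    unfolding Bochner_Integration.integral_cnj step_mult_orthogonal[OF assms] by simp
  finally show ?thesis .
qed

lemma L2_inner_diff_left:
  assumes "f \<in> L2_space \<mu>" "g \<in> L2_space \<mu>" "v \<in> L2_space \<mu>"
  shows "L2_inner \<mu> (\<lambda>x. f x - g x) v = L2_inner \<mu> f v - L2_inner \<mu> g v"
  unfolding L2_inner_def left_diff_distrib
  by (rule Bochner_Integration.integral_diff) (intro L2_integrable_mult assms)+

lemma L2_inner_diff_right: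
  assumes "f \<in> L2_space \<mu>" "g \<in> L2_space \<mu>" "v \<in> L2_space \<mu>"
  shows "L2_inner \<mu> v (\<lambda>x. f x - g x) = L2_inner \<mu> v f - L2_inner \<mu> v g"
  unfolding L2_inner_def complex_cnj_diff right_diff_distrib
  by (rule Bochner_Integration.integral_diff) (intro L2_integrable_mult assms)+

text \<open>Orthogonality removes \<open>proj h f\<close> from the first entry of (f - P f, f - P
  f). In the remaining form (f, f - P f) the first entry can be a smooth function, as the duality
  pairing requires.\<close>

lemma proj_residual:
  assumes "0 < h" "f \<in> L2_space \<mu>"
  shows "(L2_norm \<mu> (\<lambda>x. f x - proj h f x))\<^sup>2 = cmod (L2_inner \<mu> f (\<lambda>x. f x - proj h f x))"
    and "L2_norm \<mu> (\<lambda>x. f x - proj h f x) \<le> L2_norm \<mu> f"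
proof -
  let ?v = "\<lambda>x. f x - proj h f x"
  have v: "?v \<in> L2_space \<mu>" by (rule L2_space_diff[OF assms(2) proj_L2])
  have "L2_inner \<mu> ?v ?v = L2_inner \<mu> f ?v - L2_inner \<mu> (proj h f) ?v"
    by (rule L2_inner_diff_left[OF assms(2) proj_L2 v])
  also have "L2_inner \<mu> (proj h f) ?v = 0"
    using step_inner_orthogonal[OF assms, of "avg f"] by (simp add: proj_def)
  finally have "complex_of_real ((L2_norm \<mu> ?v)\<^sup>2) = L2_inner \<mu> f ?v" unfolding L2_inner_self by simp
  then show sq: "(L2_norm \<mu> ?v)\<^sup>2 = cmod (L2_inner \<mu> f ?v)" by (metis norm_of_real abs_power2)
  also have "\<dots> \<le> L2_norm \<mu> f * L2_norm \<mu> ?v" by (rule L2_Cauchy_Schwarz[OF assms(2) v])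
  finally have le: "L2_norm \<mu> ?v * L2_norm \<mu> ?v \<le> L2_norm \<mu> f * L2_norm \<mu> ?v" by (simp add: power2_eq_square)
  show "L2_norm \<mu> ?v \<le> L2_norm \<mu> f"
  proof (cases "L2_norm \<mu> ?v = 0")
    case False
    then have "0 < L2_norm \<mu> ?v" using L2_norm_nonneg[of \<mu> ?v] by linarith
    then show ?thesis using le by simp
  qed simp
qed

text \<open>Selecting one point per piece makes G composed with p a step function for every G, and
  residuals are orthogonal to step functions. Points move by at most the diameter of a piece, hence
  by at most h.\<close>

lemma residual_cancels:
  assumes "0 < h" "f \<in> L2_space \<mu>"
  shows "E.cancels h (\<lambda>x. f x - proj h f x)"
proof -
  define y where "y w = (SOME y. y \<in> P w)" for w
  have y: "y w \<in> P w" for w unfolding y_def using piece_nonempty by (rule some_in_eq[THEN iffD2])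
  define p where "p x = (\<Sum>w\<in>mesh h. indicator (P w) x *\<^sub>R y w)" for x
  have p_eq: "p x = y v" if v: "v \<in> mesh h" "x \<in> P v" for x v
  proof -
    have "p x = indicator (P v) x *\<^sub>R y v + (\<Sum>w\<in>mesh h - {v}. indicator (P w) x *\<^sub>R y w)"
      unfolding p_def by (rule sum.remove[OF mesh_finite[OF assms(1)] v(1)])
    also have "(\<Sum>w\<in>mesh h - {v}. indicator (P w) x *\<^sub>R y w) = 0"
      by (rule sum.neutral) (use mesh_disjoint[OF _ v(1) _ v(2)] in \<open>auto simp: indicator_def\<close>)
    finally show ?thesis using v(2) by simp
  qed
  have "p \<in> borel_measurable \<mu>"
    unfolding p_def using piece_sets[OF mesh_valid]
    by (intro borel_measurable_sum borel_measurable_scaleR borel_measurable_indicator borel_measurable_const)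
  moreover have "dist x (p x) \<le> h" if x: "x \<in> space \<mu>" for x
  proof -
    obtain v where v: "v \<in> mesh h" "x \<in> P v" using mesh_cover[OF assms(1), of x] x by auto
    have "dist x (y v) \<le> diameter (P v)"
      by (rule diameter_bounded_bound[OF compact_imp_bounded[OF piece_compact[OF mesh_valid[OF v(1)]]] v(2) y])
    also have "\<dots> \<le> h" using v(1) by (simp add: diameter_piece[OF mesh_valid[OF v(1)]] mesh_def)
    finally show ?thesis using p_eq[OF v] by simp
  qed
  moreover have "(\<integral>x. (f x - proj h f x) * of_real (G (p x)) \<partial>\<mu>) = 0" for G :: "'a \<Rightarrow> real"
  proof -
    have "(\<integral>x. (f x - proj h f x) * of_real (G (p x)) \<partial>\<mu>) = (\<integral>x. (f x - proj h f x) * step h (\<lambda>w. of_real (G (y w))) x \<partial>\<mu>)"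
    proof (rule Bochner_Integration.integral_cong[OF refl])
      fix x assume "x \<in> space \<mu>"
      then obtain v where v: "v \<in> mesh h" "x \<in> P v" using mesh_cover[OF assms(1), of x] by auto
      then show "(f x - proj h f x) * of_real (G (p x)) = (f x - proj h f x) * step h (\<lambda>w. of_real (G (y w))) x"
        using p_eq[OF v] step_eq[OF assms(1) v] by simp
    qed
    then show ?thesis using step_mult_orthogonal[OF assms] by simp
  qed
  ultimately show ?thesis unfolding E.cancels_def by blast
qed

text \<open>The argument of \<open>trace_inequality\<close> with the residual as second entry: it
  has mean zero on every piece, so its negative norm carries the extra factor h^t.\<close>

lemma jackson:
  assumes t: "0 < t" "t < 1"
  shows "\<exists>K>0. \<forall>f\<in>trace_space dm \<Gamma> t. \<forall>h>0. L2_norm \<mu> (\<lambda>x. f x - proj h f x) \<le> K * h powr t * trace_norm dm \<Gamma> t f"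
proof -
  obtain K where K: "0 < K" "\<And>\<psi> h. \<psi> \<in> L2_space \<mu> \<Longrightarrow> 0 < h \<Longrightarrow> E.cancels h \<psi> \<Longrightarrow> neg_norm t \<psi> \<le> K * h powr t * L2_norm \<mu> \<psi>"
    using E.negative_norm_cancel_le[OF t less_imp_le[OF dim_lt]] unfolding neg_norm_def trace_order_def by blast
  define c where "c = (2 * pi) powr (- real DIM('a) / 2)"
  have c: "0 < c" by (simp add: c_def)
  have test: "L2_norm \<mu> (\<lambda>x. u x - proj h u x) \<le> c * K * h powr t * sobolev_norm (sord t) u"
    if u: "u \<in> test_functions" and h: "0 < h" for u h
  proof -
    let ?v = "\<lambda>x. u x - proj h u x"
    note L = test_L2[OF u]
    have v: "?v \<in> L2_space \<mu>" by (rule L2_space_diff[OF L proj_L2])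
    show ?thesis
    proof (cases "L2_norm \<mu> ?v = 0")
      case False
      have "(L2_norm \<mu> ?v)\<^sup>2 = cmod (L2_inner \<mu> u ?v)" by (rule proj_residual[OF h L])
      also have "\<dots> \<le> c * (sobolev_norm (sord t) u * neg_norm t ?v)"
        unfolding c_def by (rule pairing_le[OF t u v])
      also have "\<dots> \<le> c * (sobolev_norm (sord t) u * (K * h powr t * L2_norm \<mu> ?v))"
        using c by (intro mult_left_mono K(2)[OF v h residual_cancels[OF h L]]) auto
      finally have "L2_norm \<mu> ?v * L2_norm \<mu> ?v \<le> L2_norm \<mu> ?v * (c * K * h powr t * sobolev_norm (sord t) u)"
        by (simp add: power2_eq_square mult_ac)
      then show ?thesis using False L2_norm_nonneg[of \<mu> ?v] by (simp only: mult_le_cancel_left)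
    qed (use c K(1) in simp)
  qed
  have "L2_norm \<mu> (\<lambda>x. f x - proj h f x) \<le> c * K * h powr t * trace_norm dm \<Gamma> t f"
    if f: "f \<in> trace_space dm \<Gamma> t" and h: "0 < h" for f h
  proof -
    have pos: "0 < c * K * h powr t" using c K h by simp
    have "L2_norm \<mu> (\<lambda>x. f x - proj h f x) / (c * K * h powr t) \<le> trace_norm dm \<Gamma> t f"
    proof (rule trace_norm_ge[OF f])
      fix \<phi> assume tr: "has_trace (sord t) dm \<Gamma> \<phi> f"
      have "L2_norm \<mu> (\<lambda>x. f x - proj h f x) \<le> c * K * h powr t * sobolev_norm (sord t) \<phi>"
      proof (rule trace_limit[where N = "\<lambda>f. L2_norm \<mu> (\<lambda>x. f x - proj h f x)", OF t tr less_imp_le[OF pos] _ test[OF _ h]])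
        \<comment> \<open>Taking residuals is linear and does not increase the L2 norm, which is the
          Lipschitz property needed for the limit.\<close>
        fix f g assume fg: "f \<in> L2_space \<mu>" "g \<in> L2_space \<mu>"
        let ?d = "\<lambda>x. f x - g x"
        have d: "?d \<in> L2_space \<mu>" by (rule L2_space_diff[OF fg])
        have "L2_norm \<mu> (\<lambda>x. f x - proj h f x) = L2_norm \<mu> (\<lambda>x. (g x - proj h g x) + (?d x - proj h ?d x))"
          by (simp add: proj_diff[OF fg])
        also have "\<dots> \<le> L2_norm \<mu> (\<lambda>x. g x - proj h g x) + L2_norm \<mu> (\<lambda>x. ?d x - proj h ?d x)"
          by (rule L2_triangle) (intro L2_space_diff fg d proj_L2)+
        also have "\<dots> \<le> L2_norm \<mu> (\<lambda>x. g x - proj h g x) + L2_norm \<mu> ?d"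
          by (rule add_left_mono[OF proj_residual(2)[OF h d]])
        finally show "L2_norm \<mu> (\<lambda>x. f x - proj h f x) \<le> L2_norm \<mu> (\<lambda>x. g x - proj h g x) + L2_norm \<mu> (\<lambda>x. f x - g x)" .
      qed
      then show "L2_norm \<mu> (\<lambda>x. f x - proj h f x) / (c * K * h powr t) \<le> sobolev_norm (sord t) \<phi>"
        using pos by (simp add: pos_divide_le_eq mult.commute)
    qed
    then show ?thesis using pos by (simp add: pos_divide_le_eq mult.commute)
  qed
  then show ?thesis using c K by (intro exI[of _ "c * K"]) simp
qed

end


section \<open>The inverse estimate\<close>

context thin_ifs
begin

text \<open>The normalising powers of the measures are absorbed into the coefficients, and mesh
  words outside W receive the coefficient 0.\<close>

lemma approx_space_step:
  assumes h: "0 < h" "h \<le> R" and \<Psi>: "\<Psi> \<in> approx_space dm M s \<Gamma> h"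
  shows "\<exists>b. \<Psi> = step h b"
proof -
  obtain W a where W: "finite W" "W \<subseteq> mesh h" and \<Psi>_eq: "\<Psi> = (\<lambda>x. \<Sum>w\<in>W. a w * piece_fun dm s \<Gamma> w x)"
    using \<Psi> unfolding approx_space_def mesh_eq_mesh_words[OF h] by blast
  define b where "b w = (if w \<in> W then a w * of_real (measure (hausdorff_measure dm) (P w) powr (- 1 / 2)) else 0)" for w
  have "\<Psi> x = step h b x" for x
  proof -
    have "step h b x = (\<Sum>w\<in>W. b w * indicator (P w) x)"
      unfolding step_def by (rule sum.mono_neutral_right[OF mesh_finite[OF h(1)] W(2)]) (simp add: b_def)
    also have "\<dots> = \<Psi> x"
      unfolding \<Psi>_eq by (rule sum.cong[OF refl]) (simp add: b_def piece_fun_def)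
    finally show ?thesis ..
  qed
  then show ?thesis by blast
qed

text \<open>Every piece of the finer mesh lies in a piece of the coarser one, so a coarse step
  function is also a fine one.\<close>

lemma step_diff:
  assumes "0 < h" "h \<le> h'"
  shows "\<exists>c. \<forall>x\<in>\<Gamma>. step h a x - step h' b x = step h c x"
proof -
  have "\<forall>w\<in>mesh h. \<exists>v. v \<in> mesh h' \<and> P w \<subseteq> P v" using mesh_refine[OF _ assms(2)] by blast
  from bchoice[OF this] obtain v where v: "\<forall>w\<in>mesh h. v w \<in> mesh h' \<and> P w \<subseteq> P (v w)" ..
  have "step h a x - step h' b x = step h (\<lambda>w. a w - b (v w)) x" if x: "x \<in> \<Gamma>" for x
  proof -
    obtain w where w: "w \<in> mesh h" "x \<in> P w" using mesh_cover[OF assms(1) x] by blast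
    have "v w \<in> mesh h'" "x \<in> P (v w)" using v w by auto
    then show ?thesis using step_eq[OF assms(1) w] step_eq[of h' "v w" x b] assms by simp
  qed
  then show ?thesis by blast
qed

lemma proj_step: assumes "0 < h" "x \<in> \<Gamma>" shows "proj h (step h b) x = step h b x"
proof -
  obtain w where w: "w \<in> mesh h" "x \<in> P w" using mesh_cover[OF assms] by blast
  note val = mesh_valid[OF w(1)]
  have m: "0 < measure \<mu> (P w)" using ratio_pos[OF val] H(1) by (simp add: measure_piece[OF val])
  have eq: "indicator (P w) y * step h b y = b w * of_real (indicator (P w) y)" for y
    using step_eq[OF assms(1) w(1)] by (simp add: indicator_def)
  have "avg (step h b) w = b w"
    unfolding avg_def eq integral_mult_right_zero
    using m by (simp add: Int_absorb2 piece_subset[OF val])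
  then show ?thesis
    unfolding proj_def step_eq[OF assms(1) w] .
qed

lemma smooth_extension:
  assumes t: "0 < t" "t < 1"
  obtains K where "0 < K" "\<And>h b. 0 < h \<Longrightarrow> h \<le> 2 * R \<Longrightarrow> \<exists>\<phi>\<in>test_functions. (\<forall>x\<in>\<Gamma>. \<phi> x = step h b x) \<and>
    sobolev_norm (sord t) \<phi> \<le> K * h powr (- t) * L2_norm \<mu> (step h b)"
proof -
  have so: "0 \<le> t + (DIM('a) - dm) / 2" "t + (DIM('a) - dm) / 2 \<le> 2" "dm \<le> DIM('a)"
    using sord_bounds[OF t] dim_lt by (simp_all add: trace_order_def)
  show ?thesis using step_extension[OF so] that by blast
qed

text \<open>Telescoping over the scales \<open>2^k h\<close>: the increments are constant on the pieces of size \<open>2^k h\<close>,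
  and \<open>t2 < t1\<close> makes the norms of their extensions a geometric sequence.\<close>

lemma smooth_extension_of_projection:
  assumes t: "0 \<le> t2" "t2 < t1" "t1 < 1"
  obtains K where "0 < K" "\<And>h f V. 0 < h \<Longrightarrow> h \<le> R \<Longrightarrow> f \<in> L2_space \<mu> \<Longrightarrow> L2_norm \<mu> f \<le> V \<Longrightarrow>
    (\<And>h'. 0 < h' \<Longrightarrow> L2_norm \<mu> (\<lambda>x. f x - proj h' f x) \<le> h' powr t2 * V) \<Longrightarrow>
    \<exists>\<phi>\<in>test_functions. (\<forall>x\<in>\<Gamma>. \<phi> x = proj h f x) \<and> sobolev_norm (sord t1) \<phi> \<le> K * h powr (t2 - t1) * V"
proof -
  have t1: "0 < t1" using t by simp
  have so: "0 \<le> sord t1" "sord t1 \<le> 2" using sord_bounds[OF t1 t(3)] by auto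
  obtain Ke where Ke: "0 < Ke" and ext: "\<And>h b. 0 < h \<Longrightarrow> h \<le> 2 * R \<Longrightarrow> \<exists>\<phi>\<in>test_functions. (\<forall>x\<in>\<Gamma>. \<phi> x = step h b x) \<and>
    sobolev_norm (sord t1) \<phi> \<le> Ke * h powr (- t1) * L2_norm \<mu> (step h b)"
    by (fact smooth_extension[OF t1 t(3)])
  \<comment> \<open>The ratio of the geometric series over the scales, below 1 because t2 <
    t1.\<close>
  define q where "q = 2 powr (t2 - t1)"
  have q: "0 < q" "q < 1" using t by (auto simp: q_def powr_less_one)
  \<comment> \<open>The first summand collects the increments; its 3 is 2 + 1, from the residual
    bounds at the scales 2^(k+1) h and 2^k h with 2 powr t2 <= 2. The second belongs to the
    projection at the last scale, which is comparable to R.\<close>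
  define K where "K = 3 * Ke / (1 - q) + 2 * Ke * R powr (- t2)"
  have K: "0 < K" unfolding K_def using Ke q R_pos by (intro add_pos_pos) auto
  \<comment> \<open>V stands for the norm of f in the order t2: a multiple of the trace norm for t2
    > 0, and the L2 norm for t2 = 0, where the residual bound is the contraction property.\<close>
  have main: "\<exists>\<phi>\<in>test_functions. (\<forall>x\<in>\<Gamma>. \<phi> x = proj h f x) \<and> sobolev_norm (sord t1) \<phi> \<le> K * h powr (t2 - t1) * V"
    if h: "0 < h" "h \<le> R" and f: "f \<in> L2_space \<mu>" "L2_norm \<mu> f \<le> V"
      and jack: "\<And>h'. 0 < h' \<Longrightarrow> L2_norm \<mu> (\<lambda>x. f x - proj h' f x) \<le> h' powr t2 * V" for h f V
  proof -
    have V: "0 \<le> V" using f(2) L2_norm_nonneg[of \<mu> f] by linarith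
    define hk where "hk k = 2 ^ k * h" for k :: nat
    have hk: "0 < hk k" "hk k \<le> hk (Suc k)" "hk (Suc k) = 2 * hk k" for k using h by (auto simp: hk_def)
    obtain N0 :: nat where "R / h < 2 ^ N0" using real_arch_pow[of 2 "R / h"] by auto
    then have N0: "R \<le> hk N0" using h by (simp add: hk_def field_simps)
    \<comment> \<open>The first scale that reaches R. Its predecessor is below R, so it is at most 2
      * R and \<open>ext\<close> still applies; there the projection is estimated by the L2 norm of
      f alone.\<close>
    define N where "N = (LEAST N. R \<le> hk N)"
    have N: "R \<le> hk N" unfolding N_def using N0 by (rule LeastI)
    have small: "hk k < R" if "k < N" for k
      using not_less_Least[of k "\<lambda>N. R \<le> hk N"] that by (simp add: N_def)
    have le2R: "hk k \<le> 2 * R" if "k \<le> N" for k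
    proof (cases k)
      case 0
      then show ?thesis using h R_pos by (simp add: hk_def)
    next
      case (Suc j)
      then show ?thesis using small[of j] that by (simp add: hk(3))
    qed
    define c where "c = 3 * Ke * V * h powr (t2 - t1)"
    have c: "0 \<le> c" using Ke V by (simp add: c_def)
    have piece: "\<exists>\<phi>\<in>test_functions. (\<forall>x\<in>\<Gamma>. \<phi> x = proj (hk k) f x - proj (hk (Suc k)) f x) \<and> sobolev_norm (sord t1) \<phi> \<le> c * q ^ k"
      if k: "k < N" for k
    proof -
      obtain b where b: "\<And>x. x \<in> \<Gamma> \<Longrightarrow> proj (hk k) f x - proj (hk (Suc k)) f x = step (hk k) b x"
        using step_diff[OF hk(1,2)] unfolding proj_def by blast
      obtain \<phi> where \<phi>: "\<phi> \<in> test_functions" "\<And>x. x \<in> \<Gamma> \<Longrightarrow> \<phi> x = step (hk k) b x"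
        "sobolev_norm (sord t1) \<phi> \<le> Ke * hk k powr (- t1) * L2_norm \<mu> (step (hk k) b)"
        using ext[OF hk(1) le2R, of k b] k by auto
      have "L2_norm \<mu> (step (hk k) b) = L2_norm \<mu> (\<lambda>x. (f x - proj (hk (Suc k)) f x) - (f x - proj (hk k) f x))"
        by (rule L2_eqI(2)) (simp_all add: b[symmetric] f(1) proj_L2)
      also have "\<dots> \<le> L2_norm \<mu> (\<lambda>x. f x - proj (hk (Suc k)) f x) + L2_norm \<mu> (\<lambda>x. f x - proj (hk k) f x)"
        by (rule L2_triangle_diff) (intro L2_space_diff f(1) proj_L2)+
      also have "\<dots> \<le> hk (Suc k) powr t2 * V + hk k powr t2 * V"
        by (intro add_mono jack hk(1))
      finally have le: "L2_norm \<mu> (step (hk k) b) \<le> hk (Suc k) powr t2 * V + hk k powr t2 * V" .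
      have "hk (Suc k) powr t2 \<le> 2 * hk k powr t2"
      proof -
        have "(2::real) powr t2 \<le> 2 powr 1" using t by (intro powr_mono) auto
        then show ?thesis unfolding hk(3) powr_mult by (simp add: mult_right_mono)
      qed
      from mult_right_mono[OF this V] have "hk (Suc k) powr t2 * V \<le> 2 * (hk k powr t2 * V)" by (simp only: mult.assoc)
      then have "L2_norm \<mu> (step (hk k) b) \<le> 3 * (hk k powr t2 * V)" using le by linarith
      then have "Ke * hk k powr (- t1) * L2_norm \<mu> (step (hk k) b) \<le> Ke * hk k powr (- t1) * (3 * (hk k powr t2 * V))"
        using Ke by (intro mult_left_mono) auto
      also have "\<dots> = 3 * Ke * V * (hk k powr t2 * hk k powr (- t1))" by (simp only: mult_ac)
      also have "hk k powr t2 * hk k powr (- t1) = h powr (t2 - t1) * q ^ k"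
      proof -
        have "hk k powr t2 * hk k powr (- t1) = hk k powr (t2 - t1)" by (simp add: powr_add[symmetric])
        also have "\<dots> = (2 ^ k) powr (t2 - t1) * h powr (t2 - t1)" unfolding hk_def by (rule powr_mult)
        also have "(2 ^ k) powr (t2 - t1) = q ^ k"
          by (simp add: q_def powr_realpow[symmetric] powr_powr mult.commute)
        finally show ?thesis by simp
      qed
      also have "3 * Ke * V * (h powr (t2 - t1) * q ^ k) = c * q ^ k" by (simp add: c_def)
      finally have "sobolev_norm (sord t1) \<phi> \<le> c * q ^ k" using \<phi>(3) by linarith
      then show ?thesis using \<phi>(1,2) b by auto
    qed
    have tele: "\<exists>\<phi>\<in>test_functions. (\<forall>x\<in>\<Gamma>. \<phi> x = proj h f x - proj (hk m) f x) \<and> sobolev_norm (sord t1) \<phi> \<le> c * (\<Sum>k<m. q ^ k)"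
      if "m \<le> N" for m
      using that
    proof (induction m)
      case 0
      show ?case
        by (rule bexI[OF _ test_functions_zero]) (simp add: hk_def sobolev_norm_zero)
    next
      case (Suc m)
      then obtain \<phi> where \<phi>: "\<phi> \<in> test_functions" "\<forall>x\<in>\<Gamma>. \<phi> x = proj h f x - proj (hk m) f x"
        "sobolev_norm (sord t1) \<phi> \<le> c * (\<Sum>k<m. q ^ k)" by auto
      obtain \<psi> where \<psi>: "\<psi> \<in> test_functions" "\<forall>x\<in>\<Gamma>. \<psi> x = proj (hk m) f x - proj (hk (Suc m)) f x"
        "sobolev_norm (sord t1) \<psi> \<le> c * q ^ m" using piece[of m] Suc.prems by auto
      have "sobolev_norm (sord t1) (\<lambda>x. 1 * \<phi> x + \<psi> x) \<le> cmod 1 * sobolev_norm (sord t1) \<phi> + sobolev_norm (sord t1) \<psi>"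
        by (rule sobolev_norm_combine[OF \<phi>(1) \<psi>(1) so])
      also have "\<dots> \<le> c * (\<Sum>k<Suc m. q ^ k)" using \<phi>(3) \<psi>(3) by (simp add: distrib_left)
      finally show ?case
        using \<phi>(2) \<psi>(2) by (intro bexI[OF _ test_functions_combine[OF \<phi>(1) \<psi>(1), of 1]]) auto
    qed
    obtain \<phi> where \<phi>: "\<phi> \<in> test_functions" "\<And>x. x \<in> \<Gamma> \<Longrightarrow> \<phi> x = proj h f x - proj (hk N) f x"
      "sobolev_norm (sord t1) \<phi> \<le> c * (\<Sum>k<N. q ^ k)" using tele[OF order_refl] by auto
    obtain \<psi> where \<psi>: "\<psi> \<in> test_functions" "\<And>x. x \<in> \<Gamma> \<Longrightarrow> \<psi> x = proj (hk N) f x"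
      "sobolev_norm (sord t1) \<psi> \<le> Ke * hk N powr (- t1) * L2_norm \<mu> (proj (hk N) f)"
      using ext[OF hk(1) le2R[OF order_refl], of "avg f"] unfolding proj_def by auto
    have "(\<Sum>k<N. q ^ k) \<le> 1 / (1 - q)"
      using q by (simp add: sum_gp_strict field_simps)
    then have "c * (\<Sum>k<N. q ^ k) \<le> c * (1 / (1 - q))" by (rule mult_left_mono[OF _ c])
    then have b1: "sobolev_norm (sord t1) \<phi> \<le> 3 * Ke / (1 - q) * h powr (t2 - t1) * V"
      using \<phi>(3) by (simp add: c_def mult_ac)
    have "L2_norm \<mu> (proj (hk N) f) = L2_norm \<mu> (\<lambda>x. f x - (f x - proj (hk N) f x))" by simp
    also have "\<dots> \<le> L2_norm \<mu> f + L2_norm \<mu> (\<lambda>x. f x - proj (hk N) f x)"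
      by (rule L2_triangle_diff[OF f(1) L2_space_diff[OF f(1) proj_L2]])
    also have "\<dots> \<le> 2 * V" using proj_residual(2)[OF hk(1) f(1), of N] f(2) by simp
    finally have pN: "L2_norm \<mu> (proj (hk N) f) \<le> 2 * V" .
    have "hk N powr (- t1) \<le> R powr (- t1)" using N R_pos t1 by (intro powr_mono2') auto
    also have "R powr (- t1) = R powr (- t2) * R powr (t2 - t1)" by (simp add: powr_add[symmetric])
    also have "\<dots> \<le> R powr (- t2) * h powr (t2 - t1)"
      using h t by (intro mult_left_mono powr_mono2') auto
    finally have hN: "hk N powr (- t1) \<le> R powr (- t2) * h powr (t2 - t1)" .
    have "Ke * hk N powr (- t1) * L2_norm \<mu> (proj (hk N) f) \<le> Ke * (R powr (- t2) * h powr (t2 - t1)) * (2 * V)"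
      using Ke V by (intro mult_mono hN pN order_refl) auto
    then have b2: "sobolev_norm (sord t1) \<psi> \<le> 2 * Ke * R powr (- t2) * h powr (t2 - t1) * V"
      using \<psi>(3) by (simp add: mult_ac)
    have "sobolev_norm (sord t1) (\<lambda>x. 1 * \<phi> x + \<psi> x) \<le> cmod 1 * sobolev_norm (sord t1) \<phi> + sobolev_norm (sord t1) \<psi>"
      by (rule sobolev_norm_combine[OF \<phi>(1) \<psi>(1) so])
    also have "\<dots> \<le> 3 * Ke / (1 - q) * h powr (t2 - t1) * V + 2 * Ke * R powr (- t2) * h powr (t2 - t1) * V"
      using b1 b2 by simp
    also have "\<dots> = K * h powr (t2 - t1) * V" unfolding K_def by (simp only: distrib_right)
    finally show ?thesis
      using \<phi>(2) \<psi>(2) by (intro bexI[OF _ test_functions_combine[OF \<phi>(1) \<psi>(1), of 1]]) auto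
  qed
  show ?thesis by (rule that[OF K main])
qed

section \<open>Trace spaces and their duals\<close>

lemma trace_norm_nonneg: "f \<in> trace_space dm \<Gamma> t \<Longrightarrow> 0 \<le> trace_norm dm \<Gamma> t f"
  by (rule trace_norm_ge) simp_all

lemma trace_space_test:
  assumes "0 < t" "t < 1" "\<phi> \<in> test_functions" "f \<in> L2_space \<mu>" "\<And>x. x \<in> \<Gamma> \<Longrightarrow> \<phi> x = f x"
  shows "f \<in> trace_space dm \<Gamma> t" "trace_norm dm \<Gamma> t f \<le> sobolev_norm (sord t) \<phi>"
  using has_trace_test[OF assms] trace_norm_le by (auto simp: trace_space_def)

text \<open>Boundedness is Cauchy-Schwarz followed by the trace inequality; it is also what makes
  the supremum in \<open>dual_norm\<close> meaningful.\<close>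

lemma L2_inner_dual:
  assumes t: "0 < t" "t < 1" and \<Psi>: "\<Psi> \<in> L2_space \<mu>"
  shows "L2_inner \<mu> \<Psi> \<in> dual_space dm \<Gamma> t"
  unfolding dual_space_def
proof (intro CollectI conjI ballI allI)
  fix f g assume "f \<in> trace_space dm \<Gamma> t" "g \<in> trace_space dm \<Gamma> t"
  then have L: "f \<in> L2_space \<mu>" "g \<in> L2_space \<mu>" by (simp_all add: trace_space_L2)
  show "L2_inner \<mu> \<Psi> (\<lambda>x. f x + g x) = L2_inner \<mu> \<Psi> f + L2_inner \<mu> \<Psi> g"
    unfolding L2_inner_def complex_cnj_add distrib_left
    by (rule Bochner_Integration.integral_add) (intro L2_integrable_mult \<Psi> L)+
next
  fix a f
  have "(\<lambda>x. \<Psi> x * cnj (a * f x)) = (\<lambda>x. cnj a * (\<Psi> x * cnj (f x)))" by (simp add: mult_ac)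
  then show "L2_inner \<mu> \<Psi> (\<lambda>x. a * f x) = cnj a * L2_inner \<mu> \<Psi> f"
    unfolding L2_inner_def by simp
next
  obtain K where K: "0 < K" "\<And>f. f \<in> trace_space dm \<Gamma> t \<Longrightarrow> L2_norm \<mu> f \<le> K * trace_norm dm \<Gamma> t f"
    using trace_inequality[OF t] by blast
  have "cmod (L2_inner \<mu> \<Psi> f) \<le> L2_norm \<mu> \<Psi> * K * trace_norm dm \<Gamma> t f" if f: "f \<in> trace_space dm \<Gamma> t" for f
  proof -
    have "cmod (L2_inner \<mu> \<Psi> f) \<le> L2_norm \<mu> \<Psi> * L2_norm \<mu> f"
      by (rule L2_Cauchy_Schwarz[OF \<Psi> trace_space_L2[OF f]])
    also have "\<dots> \<le> L2_norm \<mu> \<Psi> * (K * trace_norm dm \<Gamma> t f)" by (intro mult_left_mono K(2) f) simp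
    finally show ?thesis by (simp add: mult.assoc)
  qed
  then show "\<exists>C. \<forall>f\<in>trace_space dm \<Gamma> t. cmod (L2_inner \<mu> \<Psi> f) \<le> C * trace_norm dm \<Gamma> t f" by blast
qed

lemma dual_norm_upper:
  assumes F: "F \<in> dual_space dm \<Gamma> t" and g: "g \<in> trace_space dm \<Gamma> t" "trace_norm dm \<Gamma> t g \<le> 1"
  shows "cmod (F g) \<le> dual_norm dm \<Gamma> t F"
  unfolding dual_norm_def
proof (rule cSup_upper)
  obtain C where C: "\<And>f. f \<in> trace_space dm \<Gamma> t \<Longrightarrow> cmod (F f) \<le> C * trace_norm dm \<Gamma> t f"
    using F unfolding dual_space_def by blast
  show "bdd_above {cmod (F f) |f. f \<in> trace_space dm \<Gamma> t \<and> trace_norm dm \<Gamma> t f \<le> 1}"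
  proof (rule bdd_aboveI[of _ "\<bar>C\<bar>"])
    fix y assume "y \<in> {cmod (F f) |f. f \<in> trace_space dm \<Gamma> t \<and> trace_norm dm \<Gamma> t f \<le> 1}"
    then obtain f where f: "y = cmod (F f)" "f \<in> trace_space dm \<Gamma> t" "trace_norm dm \<Gamma> t f \<le> 1" by blast
    have "y \<le> C * trace_norm dm \<Gamma> t f" using C[OF f(2)] f(1) by simp
    also have "\<dots> \<le> \<bar>C\<bar> * 1"
      using f(3) trace_norm_nonneg[OF f(2)] by (intro mult_mono) auto
    finally show "y \<le> \<bar>C\<bar>" by simp
  qed
  show "cmod (F g) \<in> {cmod (F f) |f. f \<in> trace_space dm \<Gamma> t \<and> trace_norm dm \<Gamma> t f \<le> 1}" using g by blast
qed

text \<open>Rescaling of f to the unit ball. Any positive bound a for the Sobolev norm of an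
  extension may be used, so there is no division by a norm that could be zero.\<close>

lemma dual_norm_test:
  assumes t: "0 < t" "t < 1" and F: "F \<in> dual_space dm \<Gamma> t" and \<phi>: "\<phi> \<in> test_functions"
    and f: "f \<in> L2_space \<mu>" "\<And>x. x \<in> \<Gamma> \<Longrightarrow> \<phi> x = f x" and a: "sobolev_norm (sord t) \<phi> \<le> a" "0 < a"
  shows "cmod (F f) \<le> a * dual_norm dm \<Gamma> t F"
proof -
  define k where "k = complex_of_real (1 / a)"
  define g where "g x = k * f x" for x
  have \<psi>: "(\<lambda>x. k * \<phi> x + 0) \<in> test_functions" by (rule test_functions_combine[OF \<phi> test_functions_zero])
  have gL: "g \<in> L2_space \<mu>" unfolding g_def[abs_def] by (rule L2_space_scale[OF f(1)])
  have so: "0 \<le> sord t" "sord t \<le> 2" using sord_bounds[OF t] by auto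
  note g = trace_space_test[OF t \<psi> gL]
  have gt: "g \<in> trace_space dm \<Gamma> t" by (rule g(1)) (simp add: g_def f(2))
  have "trace_norm dm \<Gamma> t g \<le> sobolev_norm (sord t) (\<lambda>x. k * \<phi> x + 0)" by (rule g(2)) (simp add: g_def f(2))
  also have "\<dots> \<le> cmod k * sobolev_norm (sord t) \<phi> + sobolev_norm (sord t) (\<lambda>x::'a. 0)"
    by (rule sobolev_norm_combine[OF \<phi> test_functions_zero so])
  also have "\<dots> = sobolev_norm (sord t) \<phi> / a" using a(2) by (simp add: k_def norm_divide sobolev_norm_zero)
  also have "\<dots> \<le> 1" using a by simp
  finally have g1: "trace_norm dm \<Gamma> t g \<le> 1" .
  have fg: "f = (\<lambda>x. complex_of_real a * g x)" using a(2) by (simp add: g_def k_def)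
  have "F (\<lambda>x. complex_of_real a * g x) = cnj (complex_of_real a) * F g"
    using F gt unfolding dual_space_def by blast
  then have "cmod (F f) = a * cmod (F g)" using a(2) unfolding fg[symmetric] by (simp add: norm_mult)
  also have "\<dots> \<le> a * dual_norm dm \<Gamma> t F" using a(2) by (intro mult_left_mono dual_norm_upper[OF F gt g1]) simp
  finally show ?thesis .
qed

lemma dual_norm_nonneg:
  assumes t: "0 < t" "t < 1" and F: "F \<in> dual_space dm \<Gamma> t" shows "0 \<le> dual_norm dm \<Gamma> t F"
proof -
  note z = trace_space_test[OF t test_functions_zero L2_space_zero]
  have "cmod (F (\<lambda>x. 0)) \<le> dual_norm dm \<Gamma> t F"
    by (rule dual_norm_upper[OF F]) (use z in \<open>simp_all add: sobolev_norm_zero\<close>)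
  then show ?thesis using norm_ge_zero order_trans by blast
qed

text \<open>Both bounds with one constant, so that V = K times the trace norm meets the hypotheses
  of \<open>smooth_extension_of_projection\<close>.\<close>

lemma jackson_data:
  assumes t: "0 < t" "t < 1"
  shows "\<exists>K>0. \<forall>f\<in>trace_space dm \<Gamma> t. L2_norm \<mu> f \<le> K * trace_norm dm \<Gamma> t f \<and>
    (\<forall>h>0. L2_norm \<mu> (\<lambda>x. f x - proj h f x) \<le> h powr t * (K * trace_norm dm \<Gamma> t f))"
proof -
  obtain K1 where K1: "0 < K1" "\<And>f. f \<in> trace_space dm \<Gamma> t \<Longrightarrow> L2_norm \<mu> f \<le> K1 * trace_norm dm \<Gamma> t f"
    using trace_inequality[OF t] by blast
  obtain K2 where K2: "0 < K2" "\<And>f h. f \<in> trace_space dm \<Gamma> t \<Longrightarrow> 0 < h \<Longrightarrow>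
    L2_norm \<mu> (\<lambda>x. f x - proj h f x) \<le> K2 * h powr t * trace_norm dm \<Gamma> t f"
    using jackson[OF t] by blast
  have "L2_norm \<mu> f \<le> (K1 + K2) * trace_norm dm \<Gamma> t f \<and>
    (\<forall>h>0. L2_norm \<mu> (\<lambda>x. f x - proj h f x) \<le> h powr t * ((K1 + K2) * trace_norm dm \<Gamma> t f))"
    if f: "f \<in> trace_space dm \<Gamma> t" for f
  proof (intro conjI allI impI)
    note n = trace_norm_nonneg[OF f]
    have "K1 * trace_norm dm \<Gamma> t f \<le> (K1 + K2) * trace_norm dm \<Gamma> t f" using n K2(1) by (intro mult_right_mono) auto
    then show "L2_norm \<mu> f \<le> (K1 + K2) * trace_norm dm \<Gamma> t f" using K1(2)[OF f] by linarith
    fix h :: real assume h: "0 < h"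
    have "K2 * trace_norm dm \<Gamma> t f \<le> (K1 + K2) * trace_norm dm \<Gamma> t f" using n K1(1) by (intro mult_right_mono) auto
    then have "h powr t * (K2 * trace_norm dm \<Gamma> t f) \<le> h powr t * ((K1 + K2) * trace_norm dm \<Gamma> t f)" by (rule mult_left_mono) simp
    then show "L2_norm \<mu> (\<lambda>x. f x - proj h f x) \<le> h powr t * ((K1 + K2) * trace_norm dm \<Gamma> t f)"
      using K2(2)[OF f h] by (simp add: mult_ac)
  qed
  then show ?thesis using K1(1) K2(1) by (intro exI[of _ "K1 + K2"]) auto
qed

lemma in_H_step:
  assumes "- 1 < t" "t < 1" "0 < h" "h \<le> R" shows "in_H dm \<Gamma> t (step h b)"
proof -
  consider "0 < t" | "t = 0" | "t < 0" by linarith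
  then show ?thesis
  proof cases
    case 1
    have h2: "h \<le> 2 * R" using assms(4) R_pos by simp
    obtain K where "0 < K" and ext: "\<And>h b. 0 < h \<Longrightarrow> h \<le> 2 * R \<Longrightarrow> \<exists>\<phi>\<in>test_functions. (\<forall>x\<in>\<Gamma>. \<phi> x = step h b x) \<and>
      sobolev_norm (sord t) \<phi> \<le> K * h powr (- t) * L2_norm \<mu> (step h b)"
      by (fact smooth_extension[OF 1 assms(2)])
    obtain \<phi> where "\<phi> \<in> test_functions" "\<forall>x\<in>\<Gamma>. \<phi> x = step h b x"
      using ext[OF assms(3) h2] by blast
    then have "step h b \<in> trace_space dm \<Gamma> t"
      using trace_space_test(1)[OF 1 assms(2) _ step_L2] by blast
    then show ?thesis using 1 by (simp add: in_H_def mu_eq step_L2)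
  next
    case 2
    then show ?thesis by (simp add: in_H_def mu_eq step_L2)
  next
    case 3
    then show ?thesis using L2_inner_dual[of "- t" "step h b"] assms(1) by (simp add: in_H_def mu_eq step_L2)
  qed
qed

text \<open>A step function is its own projection, so the smooth extension of the projection bounds
  its norm of order t2. The cases t1 = 0 and t1 > 0 differ only in the source of the residual bound:
  contraction or the Jackson estimate.\<close>

lemma inverse_nonneg:
  assumes t: "0 \<le> t1" "t1 < t2" "t2 < 1"
  shows "\<exists>c>0. \<forall>h b. 0 < h \<longrightarrow> h \<le> R \<longrightarrow> norm_H dm \<Gamma> t2 (step h b) \<le> c * h powr (t1 - t2) * norm_H dm \<Gamma> t1 (step h b)"
proof -
  have t2: "0 < t2" using t by simp
  obtain K where K: "0 < K" and ext: "\<And>h f V. 0 < h \<Longrightarrow> h \<le> R \<Longrightarrow> f \<in> L2_space \<mu> \<Longrightarrow> L2_norm \<mu> f \<le> V \<Longrightarrow>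
    (\<And>h'. 0 < h' \<Longrightarrow> L2_norm \<mu> (\<lambda>x. f x - proj h' f x) \<le> h' powr t1 * V) \<Longrightarrow>
    \<exists>\<phi>\<in>test_functions. (\<forall>x\<in>\<Gamma>. \<phi> x = proj h f x) \<and> sobolev_norm (sord t2) \<phi> \<le> K * h powr (t1 - t2) * V"
    by (fact smooth_extension_of_projection[OF t])
  obtain K' where K': "0 < K'" and data: "\<And>h b. 0 < h \<Longrightarrow> h \<le> R \<Longrightarrow> L2_norm \<mu> (step h b) \<le> K' * norm_H dm \<Gamma> t1 (step h b) \<and>
    (\<forall>h'>0. L2_norm \<mu> (\<lambda>x. step h b x - proj h' (step h b) x) \<le> h' powr t1 * (K' * norm_H dm \<Gamma> t1 (step h b)))"
  proof (cases "t1 = 0")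
    case True
    show ?thesis
      by (rule that[of 1]) (use True proj_residual(2)[OF _ step_L2] in \<open>auto simp: norm_H_def mu_eq\<close>)
  next
    case False
    then have t1: "0 < t1" "t1 < 1" using t by auto
    obtain K' where K': "0 < K'" "\<forall>f\<in>trace_space dm \<Gamma> t1. L2_norm \<mu> f \<le> K' * trace_norm dm \<Gamma> t1 f \<and>
      (\<forall>h>0. L2_norm \<mu> (\<lambda>x. f x - proj h f x) \<le> h powr t1 * (K' * trace_norm dm \<Gamma> t1 f))"
      using jackson_data[OF t1] by blast
    show ?thesis
    proof (rule that[OF K'(1)])
      fix h b assume "0 < h" "h \<le> R"
      then have "step h b \<in> trace_space dm \<Gamma> t1" using in_H_step[of t1 h b] t1 by (simp add: in_H_def)
      then show "L2_norm \<mu> (step h b) \<le> K' * norm_H dm \<Gamma> t1 (step h b) \<and>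
        (\<forall>h'>0. L2_norm \<mu> (\<lambda>x. step h b x - proj h' (step h b) x) \<le> h' powr t1 * (K' * norm_H dm \<Gamma> t1 (step h b)))"
        using K'(2) t1 by (simp add: norm_H_def)
    qed
  qed
  have "norm_H dm \<Gamma> t2 (step h b) \<le> K * K' * h powr (t1 - t2) * norm_H dm \<Gamma> t1 (step h b)" if h: "0 < h" "h \<le> R" for h b
  proof -
    obtain \<phi> where \<phi>: "\<phi> \<in> test_functions" "\<forall>x\<in>\<Gamma>. \<phi> x = proj h (step h b) x"
      "sobolev_norm (sord t2) \<phi> \<le> K * h powr (t1 - t2) * (K' * norm_H dm \<Gamma> t1 (step h b))"
      using ext[OF h step_L2[of h b], of "K' * norm_H dm \<Gamma> t1 (step h b)"] data[OF h, of b] by blast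
    have "trace_norm dm \<Gamma> t2 (step h b) \<le> sobolev_norm (sord t2) \<phi>"
      by (rule trace_space_test(2)[OF t2 t(3) \<phi>(1) step_L2]) (simp add: \<phi>(2) proj_step[OF h(1)])
    then show ?thesis using \<phi>(3) t2 by (simp add: norm_H_def mult_ac)
  qed
  then show ?thesis using K K' by (intro exI[of _ "K * K'"]) auto
qed

text \<open>The functional is tested on \<Psi> itself, whose extension costs h^(-t) times its L2
  norm; one L2 norm is then divided out of the square.\<close>

lemma inverse_to_L2:
  assumes t: "0 < t" "t < 1"
  shows "\<exists>c>0. \<forall>h b. 0 < h \<longrightarrow> h \<le> R \<longrightarrow> L2_norm \<mu> (step h b) \<le> c * h powr (- t) * dual_norm dm \<Gamma> t (L2_inner \<mu> (step h b))"
proof -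
  obtain K where K: "0 < K" and ext: "\<And>h b. 0 < h \<Longrightarrow> h \<le> 2 * R \<Longrightarrow> \<exists>\<phi>\<in>test_functions. (\<forall>x\<in>\<Gamma>. \<phi> x = step h b x) \<and>
    sobolev_norm (sord t) \<phi> \<le> K * h powr (- t) * L2_norm \<mu> (step h b)"
    by (fact smooth_extension[OF t])
  have "L2_norm \<mu> (step h b) \<le> K * h powr (- t) * dual_norm dm \<Gamma> t (L2_inner \<mu> (step h b))" if h: "0 < h" "h \<le> R" for h b
  proof -
    let ?\<Psi> = "step h b"
    note F = L2_inner_dual[OF t step_L2[of h b]]
    show ?thesis
    proof (cases "L2_norm \<mu> ?\<Psi> = 0")
      case True
      then show ?thesis using dual_norm_nonneg[OF t F] K by simp
    next
      case False
      then have pos: "0 < L2_norm \<mu> ?\<Psi>" using L2_norm_nonneg[of \<mu> ?\<Psi>] by linarith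
      define a where "a = K * h powr (- t) * L2_norm \<mu> ?\<Psi>"
      have a: "0 < a" using K h pos by (simp add: a_def)
      obtain \<phi> where \<phi>: "\<phi> \<in> test_functions" "\<And>x. x \<in> \<Gamma> \<Longrightarrow> \<phi> x = ?\<Psi> x" "sobolev_norm (sord t) \<phi> \<le> a"
        using ext[of h b] h R_pos unfolding a_def by auto
      have "(L2_norm \<mu> ?\<Psi>)\<^sup>2 = cmod (L2_inner \<mu> ?\<Psi> ?\<Psi>)" unfolding L2_inner_self norm_of_real by simp
      also have "\<dots> \<le> a * dual_norm dm \<Gamma> t (L2_inner \<mu> ?\<Psi>)"
        by (rule dual_norm_test[OF t F \<phi>(1) step_L2 \<phi>(2,3) a])
      finally have "L2_norm \<mu> ?\<Psi> * L2_norm \<mu> ?\<Psi> \<le> L2_norm \<mu> ?\<Psi> * (K * h powr (- t) * dual_norm dm \<Gamma> t (L2_inner \<mu> ?\<Psi>))"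
        by (simp add: power2_eq_square a_def mult_ac)
      then show ?thesis by (rule mult_left_le_imp_le[OF _ pos])
    qed
  qed
  then show ?thesis using K by blast
qed

text \<open>Here t1 and t2 are the absolute values of the negative orders. A test element g of order
  t2 may be replaced by its projection, which has the same pairing with a step function and whose
  norm of the higher order t1 is controlled.\<close>

lemma inverse_negative:
  assumes t: "0 < t2" "t2 < t1" "t1 < 1"
  shows "\<exists>c>0. \<forall>h b. 0 < h \<longrightarrow> h \<le> R \<longrightarrow> dual_norm dm \<Gamma> t2 (L2_inner \<mu> (step h b)) \<le> c * h powr (t2 - t1) * dual_norm dm \<Gamma> t1 (L2_inner \<mu> (step h b))"
proof -
  have t2: "t2 < 1" and t1: "0 < t1" using t by auto
  obtain K where K: "0 < K" and ext: "\<And>h f V. 0 < h \<Longrightarrow> h \<le> R \<Longrightarrow> f \<in> L2_space \<mu> \<Longrightarrow> L2_norm \<mu> f \<le> V \<Longrightarrow>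
    (\<And>h'. 0 < h' \<Longrightarrow> L2_norm \<mu> (\<lambda>x. f x - proj h' f x) \<le> h' powr t2 * V) \<Longrightarrow>
    \<exists>\<phi>\<in>test_functions. (\<forall>x\<in>\<Gamma>. \<phi> x = proj h f x) \<and> sobolev_norm (sord t1) \<phi> \<le> K * h powr (t2 - t1) * V"
    by (fact smooth_extension_of_projection[OF less_imp_le[OF t(1)] t(2,3)])
  obtain K' where K': "0 < K'" "\<forall>f\<in>trace_space dm \<Gamma> t2. L2_norm \<mu> f \<le> K' * trace_norm dm \<Gamma> t2 f \<and>
    (\<forall>h>0. L2_norm \<mu> (\<lambda>x. f x - proj h f x) \<le> h powr t2 * (K' * trace_norm dm \<Gamma> t2 f))"
    using jackson_data[OF t(1) t2] by blast
  have "dual_norm dm \<Gamma> t2 (L2_inner \<mu> (step h b)) \<le> K * K' * h powr (t2 - t1) * dual_norm dm \<Gamma> t1 (L2_inner \<mu> (step h b))"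
    if h: "0 < h" "h \<le> R" for h b
    unfolding dual_norm_def[of _ _ t2]
  proof (rule cSup_least)
    let ?\<Psi> = "step h b"
    have "(\<lambda>x. 0) \<in> trace_space dm \<Gamma> t2" "trace_norm dm \<Gamma> t2 (\<lambda>x. 0) \<le> 1"
      using trace_space_test[OF t(1) t2 test_functions_zero L2_space_zero] by (simp_all add: sobolev_norm_zero)
    then show "{cmod (L2_inner \<mu> ?\<Psi> f) |f. f \<in> trace_space dm \<Gamma> t2 \<and> trace_norm dm \<Gamma> t2 f \<le> 1} \<noteq> {}" by blast
    fix y assume "y \<in> {cmod (L2_inner \<mu> ?\<Psi> f) |f. f \<in> trace_space dm \<Gamma> t2 \<and> trace_norm dm \<Gamma> t2 f \<le> 1}"
    then obtain g where g: "y = cmod (L2_inner \<mu> ?\<Psi> g)" "g \<in> trace_space dm \<Gamma> t2" "trace_norm dm \<Gamma> t2 g \<le> 1" by blast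
    note gL = trace_space_L2[OF g(2)]
    have V: "K' * trace_norm dm \<Gamma> t2 g \<le> K'" using K'(1) g(3) by simp
    have "L2_norm \<mu> g \<le> K'" using K'(2) g(2) V by (meson order_trans)
    moreover have "L2_norm \<mu> (\<lambda>x. g x - proj h' g x) \<le> h' powr t2 * K'" if "0 < h'" for h'
    proof -
      have "L2_norm \<mu> (\<lambda>x. g x - proj h' g x) \<le> h' powr t2 * (K' * trace_norm dm \<Gamma> t2 g)" using K'(2) g(2) that by blast
      also have "\<dots> \<le> h' powr t2 * K'" by (rule mult_left_mono[OF V]) simp
      finally show ?thesis .
    qed
    ultimately obtain \<phi> where \<phi>: "\<phi> \<in> test_functions" "\<forall>x\<in>\<Gamma>. \<phi> x = proj h g x" "sobolev_norm (sord t1) \<phi> \<le> K * h powr (t2 - t1) * K'"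
      using ext[OF h gL] by blast
    have "L2_inner \<mu> ?\<Psi> g - L2_inner \<mu> ?\<Psi> (proj h g) = 0"
      using L2_inner_diff_right[OF gL proj_L2[of h g] step_L2[of h b]] step_inner_orthogonal[OF h(1) gL, of b] by simp
    then have "y = cmod (L2_inner \<mu> ?\<Psi> (proj h g))" using g(1) by simp
    also have "\<dots> \<le> (K * h powr (t2 - t1) * K') * dual_norm dm \<Gamma> t1 (L2_inner \<mu> ?\<Psi>)"
      by (rule dual_norm_test[OF t1 t(3) L2_inner_dual[OF t1 t(3) step_L2] \<phi>(1) proj_L2 _ \<phi>(3)]) (use \<phi>(2) K K' h in auto)
    finally show "y \<le> K * K' * h powr (t2 - t1) * dual_norm dm \<Gamma> t1 (L2_inner \<mu> ?\<Psi>)" by (simp add: mult_ac)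
  qed
  then show ?thesis using K K'(1) by (intro exI[of _ "K * K'"]) auto
qed

lemma inverse_from_negative:
  assumes t: "0 < t" "t < 1"
  shows "\<exists>c>0. \<forall>h b. 0 < h \<longrightarrow> h \<le> R \<longrightarrow> L2_norm \<mu> (step h b) \<le> c * h powr (- t) * norm_H dm \<Gamma> (- t) (step h b)"
  using inverse_to_L2[OF t] t by (simp add: norm_H_def mu_eq)

text \<open>Non-negative orders are covered directly and negative ones by duality; for orders of
  opposite sign the estimate passes through L2, where the powers of h multiply.\<close>

lemma inverse_estimate:
  assumes t: "- 1 < t1" "t1 < t2" "t2 < 1"
  shows "\<exists>c>0. \<forall>h b. 0 < h \<longrightarrow> h \<le> R \<longrightarrow> norm_H dm \<Gamma> t2 (step h b) \<le> c * h powr (t1 - t2) * norm_H dm \<Gamma> t1 (step h b)"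
proof -
  consider "0 \<le> t1" | "t1 < 0" "t2 = 0" | "t1 < 0" "0 < t2" | "t2 < 0" using t by linarith
  then show ?thesis
  proof cases
    case 1
    then show ?thesis using inverse_nonneg t(2,3) by blast
  next
    case 2
    then show ?thesis using inverse_from_negative[of "- t1"] t by (simp add: norm_H_def[of _ _ 0] mu_eq)
  next
    case 3
    obtain c1 where c1: "0 < c1" "\<And>h b. 0 < h \<Longrightarrow> h \<le> R \<Longrightarrow> norm_H dm \<Gamma> t2 (step h b) \<le> c1 * h powr (0 - t2) * norm_H dm \<Gamma> 0 (step h b)"
      using inverse_nonneg[OF order_refl 3(2) t(3)] by blast
    obtain c2 where c2: "0 < c2" "\<And>h b. 0 < h \<Longrightarrow> h \<le> R \<Longrightarrow> L2_norm \<mu> (step h b) \<le> c2 * h powr t1 * norm_H dm \<Gamma> t1 (step h b)"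
      using inverse_from_negative[of "- t1"] 3 t by auto
    have "norm_H dm \<Gamma> t2 (step h b) \<le> c1 * c2 * h powr (t1 - t2) * norm_H dm \<Gamma> t1 (step h b)" if h: "0 < h" "h \<le> R" for h b
    proof -
      have "norm_H dm \<Gamma> t2 (step h b) \<le> c1 * h powr (- t2) * L2_norm \<mu> (step h b)"
        using c1(2)[OF h, of b] by (simp add: norm_H_def[of _ _ 0] mu_eq)
      also have "\<dots> \<le> c1 * h powr (- t2) * (c2 * h powr t1 * norm_H dm \<Gamma> t1 (step h b))"
        using c1(1) by (intro mult_left_mono c2(2) h) auto
      also have "\<dots> = c1 * c2 * (h powr t1 * h powr (- t2)) * norm_H dm \<Gamma> t1 (step h b)" by (simp only: mult_ac)
      also have "h powr t1 * h powr (- t2) = h powr (t1 - t2)" by (simp add: powr_add[symmetric])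
      finally show ?thesis .
    qed
    then show ?thesis using c1(1) c2(1) by (intro exI[of _ "c1 * c2"]) auto
  next
    case 4
    then show ?thesis using inverse_negative[of "- t2" "- t1"] t by (simp add: norm_H_def mu_eq)
  qed
qed

end

theorem theorem5p10:
  fixes \<Gamma> :: "(real ^ 'n) set"
    and M :: nat
    and s :: "nat \<Rightarrow> real ^ 'n \<Rightarrow> real ^ 'n"
    and \<rho> :: "nat \<Rightarrow> real"
    and d :: real
  assumes "M \<ge> 2"
    and "contracting_similarities M s \<rho>"
    and "disjoint_attractor M s \<Gamma>"
    and "d = hausdorff_dim \<Gamma>"
    and "real CARD('n) - 1 < d"
    and "d < real CARD('n)"
  shows
    "(\<forall>t1 t2. - 1 < t1 \<and> t1 < t2 \<and> t2 < 1 \<longrightarrow>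
        (\<exists>c>0. \<forall>h. 0 < h \<and> h \<le> diameter \<Gamma> \<longrightarrow> (\<forall>\<Psi>\<in>approx_space d M s \<Gamma> h.
           in_H d \<Gamma> t1 \<Psi> \<and> in_H d \<Gamma> t2 \<Psi> \<and>
           norm_H d \<Gamma> t2 \<Psi> \<le> c * h powr (t1 - t2) * norm_H d \<Gamma> t1 \<Psi>)))
   \<and> (\<forall>t. 0 < t \<and> t < 1 \<longrightarrow>
        (\<exists>c>0. \<forall>h. 0 < h \<and> h \<le> diameter \<Gamma> \<longrightarrow> (\<forall>\<Psi>\<in>approx_space d M s \<Gamma> h.
           \<Psi> \<in> L2_space (hausdorff_on d \<Gamma>) \<and> in_H d \<Gamma> (- t) \<Psi> \<and>
           L2_norm (hausdorff_on d \<Gamma>) \<Psi> \<le> c * h powr (- t) * norm_H d \<Gamma> (- t) \<Psi>)))"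
proof -
  interpret I: disjoint_ifs \<Gamma> M s \<rho>
    using assms(1-3) by unfold_locales
  have d: "d = I.dm" using assms(4) unfolding I.dm_def .
  interpret T: thin_ifs \<Gamma> M s \<rho>
    using assms(5,6) by unfold_locales (simp_all add: d)
  show ?thesis
    unfolding d
  proof (intro conjI allI impI)
    fix t1 t2 :: real assume t: "- 1 < t1 \<and> t1 < t2 \<and> t2 < 1"
    then obtain c where c: "0 < c" "\<And>h b. 0 < h \<Longrightarrow> h \<le> diameter \<Gamma> \<Longrightarrow>
      norm_H I.dm \<Gamma> t2 (I.step h b) \<le> c * h powr (t1 - t2) * norm_H I.dm \<Gamma> t1 (I.step h b)"
      using T.inverse_estimate[of t1 t2] by blast
    show "\<exists>c>0. \<forall>h. 0 < h \<and> h \<le> diameter \<Gamma> \<longrightarrow> (\<forall>\<Psi>\<in>approx_space I.dm M s \<Gamma> h.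
           in_H I.dm \<Gamma> t1 \<Psi> \<and> in_H I.dm \<Gamma> t2 \<Psi> \<and>
           norm_H I.dm \<Gamma> t2 \<Psi> \<le> c * h powr (t1 - t2) * norm_H I.dm \<Gamma> t1 \<Psi>)"
    proof (intro exI[of _ c] conjI allI impI ballI c(1))
      fix h \<Psi> assume h: "0 < h \<and> h \<le> diameter \<Gamma>" and "\<Psi> \<in> approx_space I.dm M s \<Gamma> h"
      then obtain b where b: "\<Psi> = I.step h b" using T.approx_space_step by blast
      show "in_H I.dm \<Gamma> t1 \<Psi>" "in_H I.dm \<Gamma> t2 \<Psi>"
        unfolding b using t h by (auto intro: T.in_H_step)
      show "norm_H I.dm \<Gamma> t2 \<Psi> \<le> c * h powr (t1 - t2) * norm_H I.dm \<Gamma> t1 \<Psi>"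
        unfolding b using c(2) h by blast
    qed
  next
    fix t :: real assume t: "0 < t \<and> t < 1"
    then obtain c where c: "0 < c" "\<And>h b. 0 < h \<Longrightarrow> h \<le> diameter \<Gamma> \<Longrightarrow>
      L2_norm (hausdorff_on I.dm \<Gamma>) (I.step h b) \<le> c * h powr (- t) * norm_H I.dm \<Gamma> (- t) (I.step h b)"
      using T.inverse_from_negative[of t] unfolding T.mu_eq by blast
    show "\<exists>c>0. \<forall>h. 0 < h \<and> h \<le> diameter \<Gamma> \<longrightarrow> (\<forall>\<Psi>\<in>approx_space I.dm M s \<Gamma> h.
           \<Psi> \<in> L2_space (hausdorff_on I.dm \<Gamma>) \<and> in_H I.dm \<Gamma> (- t) \<Psi> \<and>
           L2_norm (hausdorff_on I.dm \<Gamma>) \<Psi> \<le> c * h powr (- t) * norm_H I.dm \<Gamma> (- t) \<Psi>)"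
    proof (intro exI[of _ c] conjI allI impI ballI c(1))
      fix h \<Psi> assume h: "0 < h \<and> h \<le> diameter \<Gamma>" and "\<Psi> \<in> approx_space I.dm M s \<Gamma> h"
      then obtain b where b: "\<Psi> = I.step h b" using T.approx_space_step by blast
      show "\<Psi> \<in> L2_space (hausdorff_on I.dm \<Gamma>)" unfolding b T.mu_eq by (rule I.step_L2)
      show "in_H I.dm \<Gamma> (- t) \<Psi>"
        unfolding b using t h by (auto intro: T.in_H_step)
      show "L2_norm (hausdorff_on I.dm \<Gamma>) \<Psi> \<le> c * h powr (- t) * norm_H I.dm \<Gamma> (- t) \<Psi>"
        unfolding b using c(2) h by blast
    qed
  qed
qed

end
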